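(* Let $\Omega=(x_i,x_f)\subseteq\mathbb R$ be an open interval (bounded or unbounded) and let $f,h$ be probability density functions, both with support $\overline\Omega$, with $f(x)>0$ and $h(x)>0$ for all $x\in\Omega$. Let $p\in\mathbb R$, let $p^*$ be its Hölder conjugate, let $\lambda\in\mathbb R\setminus\{1\}$, and put $\xi(\lambda,\alpha)=1+\alpha(\lambda-1)$. Then the following two inequalities hold. (i) (Moment-entropy-like inequality.) If $p^*\ge0$, $\alpha>0$ and $\lambda>\frac1{1+p^*}$, then $$e^{D_{\xi(\lambda,\alpha)}[f\|h]}\,\sigma_{p^*,\alpha}[f\|h]\ \ge\ \big(K^{(0)}_{p,\lambda}\big)^{1/\alpha}.$$ (ii) (Stam-like inequality.) If $p\ge1$, $\alpha>0$ and $\beta\in\mathbb R$ satisfies $$\operatorname{sign}(p^*\beta+\lambda-1)=\operatorname{sign}(\beta+1-\lambda)\neq 0,$$ then $$\Big[e^{-D_{\xi(\lambda,\alpha)}[f\|h]}\,\phi_{p,\beta\alpha}[f\|h]\Big]^{1+\beta-\lambda}\ \ge\ \alpha^{\frac{\lambda-\beta-1}{\alpha\beta}}\,\big(K^{(1)}_{p,\beta,\lambda}\big)^{1/\alpha},$$ provided that the relative differential-escort density $\mathfrak R^{[h]}_\alpha[f]$ is absolutely continuous. (iii) (Sharpness.) Write $\frac1{\alpha^*}=\frac{\alpha-1}\alpha$. The inequality in (i) is sharp whenever $N_{1/\alpha^*}[g_{p,\lambda}]<\infty$, and the inequality in (ii) is sharp whenever $N_{1/\alpha^*}[g_{p,\beta,\lambda}]<\infty$.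 More precisely, the minimizers of the inequality in (i) are given by $$f_{\min}(x)=\mathfrak R^{-1,[h]}_\alpha[g_{p,\lambda}](x),\quad x\in\Omega,$$ while the minimizers of the inequality in (ii) are given by $$f_{\min}(x)=\mathfrak R^{-1,[h]}_\alpha[g_{p,\beta,\lambda}](x),\quad x\in\Omega.$$
   Context: Relative differential-escort transformation: for $\alpha\in\mathbb R$ and $f,h$ as in the claim, $$\mathfrak R_\alpha^{[h]}[f](y)=\Big(\frac{f(x(y))}{h(x(y))}\Big)^\alpha,\qquad y'(x)=f(x)^{1-\alpha}h(x)^\alpha ,$$ where $x(y)$ is the inverse function of $y(x)$. It is a probability density in the variable $y$, defined up to a translation (an integration constant in $y(x)$); the canonical choice is $y(x)=\int_{x_i}^x f^{1-\alpha}h^\alpha\,dt$. Absolute continuity in (ii) is understood as in the Stam inequality from which (ii) is derived: on $\mathbb R$ (the density being $0$ outside its support) if $1+\beta-\lambda>0$, and on the open support interval if $1+\beta-\lambda<0$. Rényi divergence: $D_\xi[f\|h]=\frac1{\xi-1}\log\int_\Omega f^\xi h^{1-\xi}\,dx$ for $\xi>0$, $\xi\ne1$; since $f,h>0$ on $\Omega$, the same formula is used for other real $\xi$ when the integral is finite. Relative cumulative moment: for $q>0$ and $\alpha\in\mathbb R$, $\mu_{q,\alpha}[f\|h]$ is the $q$-th absolute moment $\int|y|^q\,\mathfrak R_\alpha^{[h]}[f](y)\,dy$ of the transformed density, explicitly $$\mu_{q,\alpha}[f\|h]=\int_\Omega\Big|\int_{x_i}^xf(s)^{1-\alpha}h(s)^\alpha\,ds\Big|^qf(x)\,dx,\qquad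 \sigma_{q,\alpha}[f\|h]=\mu_{q,\alpha}[f\|h]^{1/(q\alpha)}.$$ Relative Fisher divergence: for $f,h$ differentiable on $\Omega$, $p>1$ and $\lambda\neq0$, $$F_{p,\lambda}[f\|h]=\int_\Omega f^{1+p(\lambda-1)}h^{-\lambda p}\Big|\frac{d}{dx}\log\frac fh\Big|^p dx,\qquad \phi_{p,\lambda}[f\|h]=F_{p,\lambda}[f\|h]^{1/(p\lambda)}.$$ Classical functionals of a density $g$: $\sigma_q[g]=(\int|x|^qg\,dx)^{1/q}$ for $q>0$ (and $\sigma_0[g]=\exp\int g\log|x|\,dx$); Rényi entropy power $N_\lambda[g]=(\int g^\lambda dx)^{1/(1-\lambda)}$ for $\lambda\ne1$, the integral being over the support of $g$, and $N_1[g]=\exp(-\int g\log g\,dx)$; $(p,\lambda)$-Fisher information $\phi_{p,\lambda}[g]=\big(\int |g^{\lambda-2}g'|^p g\,dx\big)^{1/(p\lambda)}$. Stretched Gaussians: $g_{p,\lambda}(x)=a_{p,\lambda}\,(1+(1-\lambda)|x|^{p^*})_+^{1/(\lambda-1)}$ if $\lambda\neq1$, and $g_{p,1}(x)=a_{p,1}e^{-|x|^{p^*}}$, where $a_{p,\lambda}$ is the normalization constant; these are the minimizers of the classical moment-entropy inequality, i.e. of $\sigma_{p^*}[\cdot]/N_\lambda[\cdot]$. Densities $g_{p,\beta,\lambda}$: the known minimizing densities of the triparametric Stam inequality, i.e. of the functional $(\phi_{p,\beta}[\cdot]\,N_\lambda[\cdot])^{1+\beta-\lambda}$. Explicitly,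 with $\theta=1+\beta-\lambda$, $g_{p,\beta,\lambda}=\mathfrak E_{1/\theta}[g_{p,\beta/\theta}]$, where $\mathfrak E_\gamma[g](y)=g(x(y))^\gamma$, $y'(x)=g(x)^{1-\gamma}$ (differential-escort transformation). Constants: $K^{(0)}_{p,\lambda}=\sigma_{p^*}[g_{p,\lambda}]/N_\lambda[g_{p,\lambda}]$ and $K^{(1)}_{p,\beta,\lambda}=\big(\phi_{p,\beta}[g_{p,\beta,\lambda}]\,N_\lambda[g_{p,\beta,\lambda}]\big)^{1+\beta-\lambda}$. Inverse transformation: for a density $g$ with $r:=N_{1/\alpha^*}[g]<\infty$ (for $\alpha=1$: $g$ compactly supported and $r$ the length of its support), $$\mathfrak R_\alpha^{-1,[h]}[g](x)=\big[r g(r y(x))\big]^{1/\alpha}h(x),\qquad y'(x)=\big[r g(r y(x))\big]^{-1/\alpha^*}h(x).$$ The choice of $r$ gives $\int [r g(rt)]^{1/\alpha^*}dt=1=\int_\Omega h\,dx$.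
   Formalization: In (ii) with 1+β−λ<0 the transformed density must also tend to ∞ at finite ends of its support; at p=1 Fisher information of g is total variation and (iii) gives only a sharp infimum; equality in (i) uses a suitable constant in y; at p*=0 g is (−log|x|)_+^{1/(λ−1)} normalized. *)

theory Defs
  imports "HOL-Probability.Essential_Supremum" "HOL-Analysis.Analysis"
begin

definition eln :: "ennreal \<Rightarrow> ereal" where
  "eln x = (if x = 0 then -\<infinity> else if x = \<infinity> then \<infinity> else ereal (ln (enn2real x)))"

definition eexp :: "ereal \<Rightarrow> ennreal" where
  "eexp x = (if x = \<infinity> then \<infinity> else if x = -\<infinity> then 0 else ennreal (exp (real_of_ereal x)))"

text \<open>In contrast to \<^const>\<open>powr\<close>, a negative power of \<open>0\<close> is \<open>\<infinity>\<close>.\<close>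

definition epowr :: "ennreal \<Rightarrow> real \<Rightarrow> ennreal" where
  "epowr x c =
     (if c = 0 then 1
      else if x = 0 then (if 0 < c then 0 else \<infinity>)
      else if x = \<infinity> then (if 0 < c then \<infinity> else 0)
      else ennreal (enn2real x powr c))"

text \<open>In \<^typ>\<open>ennreal\<close> we have \<open>0 * \<infinity> = 0\<close>; the following excludes these undetermined products.\<close>

definition mult_defined :: "ennreal \<Rightarrow> ennreal \<Rightarrow> bool" where
  "mult_defined u v \<longleftrightarrow> \<not> (u = 0 \<and> v = \<infinity>) \<and> \<not> (u = \<infinity> \<and> v = 0)"

definition ext_integral :: "real set \<Rightarrow> (real \<Rightarrow> real) \<Rightarrow> (real \<Rightarrow> ereal) \<Rightarrow> ereal" where
  "ext_integral S w u =
     enn2ereal (\<integral>\<^sup>+x\<in>S. (ennreal (w x) * e2ennreal (u x)) \<partial>lborel)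
     - enn2ereal (\<integral>\<^sup>+x\<in>S. (ennreal (w x) * e2ennreal (- u x)) \<partial>lborel)"

text \<open>Hoelder conjugate of a real number; the conjugate of \<open>1\<close> is \<open>\<infinity>\<close>.\<close>

definition hconj :: "real \<Rightarrow> ereal" where
  "hconj p = (if p = 1 then \<infinity> else ereal (p / (p - 1)))"

definition support :: "(real \<Rightarrow> real) \<Rightarrow> real set" where
  "support g = {x. 0 < g x}"

definition prob_density_on :: "real set \<Rightarrow> (real \<Rightarrow> real) \<Rightarrow> bool" where
  "prob_density_on \<Omega> f \<longleftrightarrow>
     f \<in> borel_measurable borel \<and> (\<forall>x. 0 \<le> f x) \<and> (\<forall>x\<in>\<Omega>. 0 < f x) \<and>
     (\<forall>x. x \<notin> closure \<Omega> \<longrightarrow> f x = 0) \<and> (\<integral>\<^sup>+x. ennreal (f x) \<partial>lborel) = 1"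

text \<open>
  For \<open>0 < q < \<infinity>\<close> this is \<open>(\<integral>\<^sub>S A^q f)^(1/(q\<alpha>))\<close>; the cases \<open>q = 0\<close> and \<open>q = \<infinity>\<close> are the
  corresponding limits \<open>exp (\<integral>\<^sub>S f log A)^(1/\<alpha>)\<close> and \<open>(ess sup A)^(1/\<alpha>)\<close>. Here \<open>A\<close> is the absolute
  value of the variable whose moment is taken. The classical \<open>\<sigma>\<^sub>q[g]\<close> has \<open>A x = |x|\<close> and \<open>\<alpha> = 1\<close>.
\<close>

definition gen_moment :: "real \<Rightarrow> real set \<Rightarrow> (real \<Rightarrow> real) \<Rightarrow> (real \<Rightarrow> ennreal) \<Rightarrow> ennreal" where
  "gen_moment q S f A = (\<integral>\<^sup>+x\<in>S. (epowr (A x) q * ennreal (f x)) \<partial>lborel)"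

definition gen_sigma ::
  "ereal \<Rightarrow> real \<Rightarrow> real set \<Rightarrow> (real \<Rightarrow> real) \<Rightarrow> (real \<Rightarrow> ennreal) \<Rightarrow> ennreal" where
  "gen_sigma q \<alpha> S f A =
     (if q = \<infinity> then
        epowr (esssup (density lborel (\<lambda>x. ennreal (f x) * indicator S x))
                      (\<lambda>x. A x * indicator S x)) (1 / \<alpha>)
      else if q = 0 then
        eexp (ereal (1 / \<alpha>) * ext_integral S f (\<lambda>x. eln (A x)))
      else
        epowr (gen_moment (real_of_ereal q) S f A) (1 / (real_of_ereal q * \<alpha>)))"

definition sigma :: "ereal \<Rightarrow> (real \<Rightarrow> real) \<Rightarrow> ennreal" where
  "sigma q g = gen_sigma q 1 UNIV g (\<lambda>x. ennreal \<bar>x\<bar>)"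

definition renyi_power :: "real \<Rightarrow> (real \<Rightarrow> real) \<Rightarrow> ennreal" where
  "renyi_power l g =
     (if l = 1 then eexp (- ext_integral (support g) g (\<lambda>x. ereal (ln (g x))))
      else epowr (\<integral>\<^sup>+x\<in>support g. ennreal (g x powr l) \<partial>lborel) (1 / (1 - l)))"

definition total_variation :: "(real \<Rightarrow> real) \<Rightarrow> ennreal" where
  "total_variation u =
     (SUP t\<in>{t :: nat \<Rightarrow> real. mono t}. SUP n. \<Sum>i<n. ennreal \<bar>u (t (Suc i)) - u (t i)\<bar>)"

text \<open>
  For \<open>p = 1\<close> the integral of \<open>|g^(\<beta>-2) g'| g\<close> is read, as is usual for the \<open>(1,\<beta>)\<close>-Fisher
  information, as the total variation of \<open>g^\<beta>/\<beta>\<close>, where \<open>g^\<beta>\<close> is taken to be \<open>0\<close> off the support.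
  This matters only for the extremal density of the case \<open>p = 1\<close>, which is uniform on an interval:
  the pointwise derivative vanishes almost everywhere and sees nothing of the two jumps.
\<close>

definition fisher :: "real \<Rightarrow> real \<Rightarrow> (real \<Rightarrow> real) \<Rightarrow> ennreal" where
  "fisher p \<beta> g =
     (if p = 1 then
        epowr (total_variation (\<lambda>x. if x \<in> support g then g x powr \<beta> else 0) / ennreal \<bar>\<beta>\<bar>) (1 / \<beta>)
      else
        epowr (\<integral>\<^sup>+x\<in>support g. ennreal (\<bar>g x powr (\<beta> - 2) * deriv g x\<bar> powr p * g x) \<partial>lborel)
              (1 / (p * \<beta>)))"

definition renyi_integral :: "real \<Rightarrow> real set \<Rightarrow> (real \<Rightarrow> real) \<Rightarrow> (real \<Rightarrow> real) \<Rightarrow> ennreal" where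
  "renyi_integral \<xi> \<Omega> f h = (\<integral>\<^sup>+x\<in>\<Omega>. ennreal (f x powr \<xi> * h x powr (1 - \<xi>)) \<partial>lborel)"

definition renyi_div :: "real \<Rightarrow> real set \<Rightarrow> (real \<Rightarrow> real) \<Rightarrow> (real \<Rightarrow> real) \<Rightarrow> ereal" where
  "renyi_div \<xi> \<Omega> f h = ereal (1 / (\<xi> - 1)) * eln (renyi_integral \<xi> \<Omega> f h)"

text \<open>For orders \<open>\<xi> \<le> 0\<close> the divergence is only considered when the integral is finite.\<close>

definition renyi_div_defined :: "real \<Rightarrow> real set \<Rightarrow> (real \<Rightarrow> real) \<Rightarrow> (real \<Rightarrow> real) \<Rightarrow> bool" where
  "renyi_div_defined \<xi> \<Omega> f h \<longleftrightarrow> 0 < \<xi> \<or> renyi_integral \<xi> \<Omega> f h < \<infinity>"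

definition rel_order :: "real \<Rightarrow> real \<Rightarrow> real" where
  "rel_order lam \<alpha> = 1 + \<alpha> * (lam - 1)"

text \<open>
  \<open>y\<close> is a coordinate with \<open>y' = f^(1-\<alpha>) h^\<alpha>\<close>, in integrated form since \<open>f\<close> and \<open>h\<close> need not
  be continuous. The integration constant is left free.
\<close>

definition escort_coord ::
  "real \<Rightarrow> real set \<Rightarrow> (real \<Rightarrow> real) \<Rightarrow> (real \<Rightarrow> real) \<Rightarrow> (real \<Rightarrow> real) \<Rightarrow> bool" where
  "escort_coord \<alpha> \<Omega> f h y \<longleftrightarrow>
     (\<forall>s\<in>\<Omega>. \<forall>t\<in>\<Omega>. s \<le> t \<longrightarrow>
        (\<integral>\<^sup>+x\<in>{s..t}. ennreal (f x powr (1 - \<alpha>) * h x powr \<alpha>) \<partial>lborel) = ennreal (y t - y s))"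

text \<open>
  The canonical coordinate \<open>\<integral> f^(1-\<alpha>) h^\<alpha>\<close> from the left end point of \<open>\<Omega>\<close>; it may be infinite.
\<close>

definition canonical_coord ::
  "real \<Rightarrow> ereal \<Rightarrow> (real \<Rightarrow> real) \<Rightarrow> (real \<Rightarrow> real) \<Rightarrow> real \<Rightarrow> ennreal" where
  "canonical_coord \<alpha> a f h x =
     (\<integral>\<^sup>+s\<in>einterval a (ereal x). ennreal (f s powr (1 - \<alpha>) * h s powr \<alpha>) \<partial>lborel)"

definition rel_escort ::
  "real \<Rightarrow> real set \<Rightarrow> (real \<Rightarrow> real) \<Rightarrow> (real \<Rightarrow> real) \<Rightarrow> (real \<Rightarrow> real) \<Rightarrow> real \<Rightarrow> real" where
  "rel_escort \<alpha> \<Omega> f h y v =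
     (if v \<in> y ` \<Omega> then (f (inv_into \<Omega> y v) / h (inv_into \<Omega> y v)) powr \<alpha> else 0)"

definition rel_fisher_div ::
  "real \<Rightarrow> real \<Rightarrow> real set \<Rightarrow> (real \<Rightarrow> real) \<Rightarrow> (real \<Rightarrow> real) \<Rightarrow> ennreal" where
  "rel_fisher_div p lam \<Omega> f h =
     (\<integral>\<^sup>+x\<in>\<Omega>. ennreal (f x powr (1 + p * (lam - 1)) * h x powr (- lam * p)
                        * \<bar>deriv (\<lambda>t. ln (f t / h t)) x\<bar> powr p) \<partial>lborel)"

definition rel_phi ::
  "real \<Rightarrow> real \<Rightarrow> real set \<Rightarrow> (real \<Rightarrow> real) \<Rightarrow> (real \<Rightarrow> real) \<Rightarrow> ennreal" where
  "rel_phi p lam \<Omega> f h = epowr (rel_fisher_div p lam \<Omega> f h) (1 / (p * lam))"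

text \<open>
  For \<open>p = 1\<close>, that is \<open>p\<^sup>* = \<infinity>\<close>, the power \<open>|x|^p\<^sup>*\<close> is \<open>0\<close> for \<open>|x| < 1\<close> and \<open>\<infinity>\<close> for \<open>|x| > 1\<close>.
  For \<open>p = 0\<close>, that is \<open>p\<^sup>* = 0\<close>, the minimizer of the moment-entropy inequality (\<open>\<lambda> > 1\<close>) is
  \<open>(- log |x|)\<^sub>+^(1/(\<lambda>-1))\<close> up to normalization; its value at the singularity \<open>0\<close> is immaterial and is
  chosen positive so that the support is an interval.
\<close>

definition stretched_profile :: "real \<Rightarrow> real \<Rightarrow> real \<Rightarrow> real" where
  "stretched_profile p lam x =
     (if p = 1 then (if \<bar>x\<bar> < 1 then 1 else 0)
      else if p = 0 then (if x = 0 then 1 else max 0 (- ln \<bar>x\<bar>) powr (1 / (lam - 1)))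
      else if lam = 1 then exp (- (\<bar>x\<bar> powr (p / (p - 1))))
      else max 0 (1 + (1 - lam) * \<bar>x\<bar> powr (p / (p - 1))) powr (1 / (lam - 1)))"

definition stretched_gaussian :: "real \<Rightarrow> real \<Rightarrow> real \<Rightarrow> real" where
  "stretched_gaussian p lam x =
     stretched_profile p lam x / (LINT t|lborel. stretched_profile p lam t)"

text \<open>
  Differential-escort transformation, with the integration constant fixed by \<open>y(0) = 0\<close>. It is the
  relative transformation with \<open>h = 1\<close>.
\<close>

definition diff_escort :: "real \<Rightarrow> (real \<Rightarrow> real) \<Rightarrow> real \<Rightarrow> real" where
  "diff_escort \<gamma> g =
     rel_escort \<gamma> (support g) g (\<lambda>_. 1) (\<lambda>x. LBINT t=ereal 0..ereal x. g t powr (1 - \<gamma>))"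

definition stam_density :: "real \<Rightarrow> real \<Rightarrow> real \<Rightarrow> real \<Rightarrow> real" where
  "stam_density p \<beta> lam =
     (let \<theta> = 1 + \<beta> - lam in diff_escort (1 / \<theta>) (stretched_gaussian p (\<beta> / \<theta>)))"

definition K0 :: "real \<Rightarrow> real \<Rightarrow> ennreal" where
  "K0 p lam =
     sigma (hconj p) (stretched_gaussian p lam) / renyi_power lam (stretched_gaussian p lam)"

definition K1 :: "real \<Rightarrow> real \<Rightarrow> real \<Rightarrow> ennreal" where
  "K1 p \<beta> lam =
     epowr (fisher p \<beta> (stam_density p \<beta> lam) * renyi_power lam (stam_density p \<beta> lam))
           (1 + \<beta> - lam)"

text \<open>
  The coordinate \<open>y\<close> with \<open>y' = [r g(r y)]^(-1/\<alpha>\<^sup>*) h\<close>, where \<open>r = N\<^bsub>1/\<alpha>*\<^esub>[g]\<close> and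
  \<open>1/\<alpha>\<^sup>* = (\<alpha>-1)/\<alpha>\<close>, again in integrated form. By the choice of \<open>r\<close> the requirement that
  \<open>r y\<close> stays in the support of \<open>g\<close> on all of \<open>\<Omega>\<close> fixes the integration constant.
\<close>

definition inv_radius :: "real \<Rightarrow> (real \<Rightarrow> real) \<Rightarrow> real" where
  "inv_radius \<alpha> g = enn2real (renyi_power ((\<alpha> - 1) / \<alpha>) g)"

definition inv_coord ::
  "real \<Rightarrow> real set \<Rightarrow> (real \<Rightarrow> real) \<Rightarrow> (real \<Rightarrow> real) \<Rightarrow> (real \<Rightarrow> real) \<Rightarrow> bool" where
  "inv_coord \<alpha> \<Omega> h g y \<longleftrightarrow>
     (\<forall>x\<in>\<Omega>. inv_radius \<alpha> g * y x \<in> support g) \<and>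
     (\<forall>s\<in>\<Omega>. \<forall>t\<in>\<Omega>. s \<le> t \<longrightarrow>
        (\<integral>\<^sup>+x\<in>{s..t}. ennreal ((inv_radius \<alpha> g * g (inv_radius \<alpha> g * y x)) powr (- ((\<alpha> - 1) / \<alpha>))
                              * h x) \<partial>lborel) = ennreal (y t - y s))"

definition inv_transform ::
  "real \<Rightarrow> real set \<Rightarrow> (real \<Rightarrow> real) \<Rightarrow> (real \<Rightarrow> real) \<Rightarrow> (real \<Rightarrow> real) \<Rightarrow> real \<Rightarrow> real" where
  "inv_transform \<alpha> \<Omega> h g y x =
     (if x \<in> \<Omega> then (inv_radius \<alpha> g * g (inv_radius \<alpha> g * y x)) powr (1 / \<alpha>) * h x else 0)"

definition abs_cont_on_Icc :: "real \<Rightarrow> real \<Rightarrow> (real \<Rightarrow> real) \<Rightarrow> bool" where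
  "abs_cont_on_Icc a b u \<longleftrightarrow>
     (\<forall>\<epsilon>>0. \<exists>\<delta>>0. \<forall>D :: (real \<times> real) set.
        finite D \<and> (\<forall>(s, t)\<in>D. a \<le> s \<and> s \<le> t \<and> t \<le> b) \<and>
        pairwise (\<lambda>I J. {fst I<..<snd I} \<inter> {fst J<..<snd J} = {}) D \<and>
        (\<Sum>(s, t)\<in>D. t - s) < \<delta>
        \<longrightarrow> (\<Sum>(s, t)\<in>D. \<bar>u t - u s\<bar>) < \<epsilon>)"

definition loc_abs_cont :: "real set \<Rightarrow> (real \<Rightarrow> real) \<Rightarrow> bool" where
  "loc_abs_cont S u \<longleftrightarrow> (\<forall>a b. {a..b} \<subseteq> S \<longrightarrow> abs_cont_on_Icc a b u)"

text \<open>
  Regularity of a density \<open>R\<close> with open support interval \<open>J\<close> in the Stam inequality with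
  \<open>\<theta> = 1 + \<beta> - \<lambda>\<close>: absolute continuity on \<open>\<real>\<close> if \<open>\<theta> > 0\<close> and on \<open>J\<close> if \<open>\<theta> < 0\<close>. For \<open>\<theta> > 0\<close> it
  forces \<open>R\<close>, hence \<open>R^\<theta>\<close>, to vanish at every finite end point of \<open>J\<close>. For \<open>\<theta> < 0\<close> absolute
  continuity on \<open>J\<close> imposes nothing at the end points, and the inequality fails for uniform
  densities, whose Fisher information on \<open>J\<close> is \<open>0\<close>. The second conjunct asks for the same boundary
  behaviour of \<open>R^\<theta>\<close>, that is, \<open>R \<rightarrow> \<infinity>\<close> at every finite end point of \<open>J\<close>.
\<close>

definition stam_regular :: "real \<Rightarrow> real set \<Rightarrow> (real \<Rightarrow> real) \<Rightarrow> bool" where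
  "stam_regular \<theta> J R \<longleftrightarrow>
     (if 0 < \<theta> then loc_abs_cont UNIV R
      else loc_abs_cont J R \<and> continuous_on UNIV (\<lambda>v. if v \<in> J then R v powr \<theta> else 0))"

text \<open>\<open>A\<close> is the absolute value of the coordinate with respect to which the moment is taken.\<close>

definition moment_entropy_lhs ::
  "real \<Rightarrow> real \<Rightarrow> real \<Rightarrow> real set \<Rightarrow> (real \<Rightarrow> real) \<Rightarrow> (real \<Rightarrow> real) \<Rightarrow> (real \<Rightarrow> ennreal) \<Rightarrow> ennreal" where
  "moment_entropy_lhs p \<alpha> lam \<Omega> f h A =
     eexp (renyi_div (rel_order lam \<alpha>) \<Omega> f h) * gen_sigma (hconj p) \<alpha> \<Omega> f A"

definition moment_entropy_defined ::
  "real \<Rightarrow> real \<Rightarrow> real \<Rightarrow> real set \<Rightarrow> (real \<Rightarrow> real) \<Rightarrow> (real \<Rightarrow> real) \<Rightarrow> (real \<Rightarrow> ennreal) \<Rightarrow> bool" where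
  "moment_entropy_defined p \<alpha> lam \<Omega> f h A \<longleftrightarrow>
     renyi_div_defined (rel_order lam \<alpha>) \<Omega> f h \<and>
     mult_defined (eexp (renyi_div (rel_order lam \<alpha>) \<Omega> f h)) (gen_sigma (hconj p) \<alpha> \<Omega> f A)"

definition stam_lhs ::
  "real \<Rightarrow> real \<Rightarrow> real \<Rightarrow> real \<Rightarrow> real set \<Rightarrow> (real \<Rightarrow> real) \<Rightarrow> (real \<Rightarrow> real) \<Rightarrow> ennreal" where
  "stam_lhs p \<alpha> \<beta> lam \<Omega> f h =
     epowr (eexp (- renyi_div (rel_order lam \<alpha>) \<Omega> f h) * rel_phi p (\<beta> * \<alpha>) \<Omega> f h) (1 + \<beta> - lam)"

definition stam_rhs :: "real \<Rightarrow> real \<Rightarrow> real \<Rightarrow> real \<Rightarrow> ennreal" where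
  "stam_rhs p \<alpha> \<beta> lam =
     ennreal (\<alpha> powr ((lam - \<beta> - 1) / (\<alpha> * \<beta>))) * epowr (K1 p \<beta> lam) (1 / \<alpha>)"

text \<open>
  The regularity condition does not depend on the integration constant in \<open>y\<close>, so it does not matter
  which coordinate is used.
\<close>

definition stam_admissible ::
  "real \<Rightarrow> real \<Rightarrow> real \<Rightarrow> real \<Rightarrow> real set \<Rightarrow> (real \<Rightarrow> real) \<Rightarrow> (real \<Rightarrow> real) \<Rightarrow> bool" where
  "stam_admissible p \<alpha> \<beta> lam \<Omega> f h \<longleftrightarrow>
     prob_density_on \<Omega> f \<and> f differentiable_on \<Omega> \<and>
     renyi_div_defined (rel_order lam \<alpha>) \<Omega> f h \<and>
     mult_defined (eexp (- renyi_div (rel_order lam \<alpha>) \<Omega> f h)) (rel_phi p (\<beta> * \<alpha>) \<Omega> f h) \<and>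
     (\<exists>y. escort_coord \<alpha> \<Omega> f h y \<and>
          stam_regular (1 + \<beta> - lam) (y ` \<Omega>) (rel_escort \<alpha> \<Omega> f h y))"

end

theory Submission
 imports Defs
begin

text \<open>
 In the coordinate \<open>y\<close> with \<open>y' = f^(1-\<alpha>) h^\<alpha>\<close> the function \<open>R = (f/h)^\<alpha>\<close> is a probability density whose
 \<open>\<lambda>\<close>-Renyi entropy is the divergence of \<open>f\<close> from \<open>h\<close>, whose moments are the relative cumulative moments
 and whose Fisher information is, up to a power of \<open>\<alpha>\<close>, the relative Fisher divergence. The moment-entropy
 inequality follows by comparing \<open>R\<close> pointwise, through Young's inequality, with the stretched Gaussian of the
 same moment. For the Stam inequality let \<open>\<theta> = 1 + \<beta> - \<lambda>\<close>, \<open>l = \<beta>/\<theta>\<close> and \<open>k = (f/h)^(\<alpha>\<beta>)\<close>, and let \<open>T\<close> transport \<open>f\<close>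
 monotonically to the stretched Gaussian \<open>G\<close> with parameter \<open>l\<close>. Integration by parts and Hoelder's inequality give
 \<open>\<integral> k T' \<le> \<integral> \<bar>k'\<bar> \<bar>T\<bar> \<le> \<alpha> \<bar>\<beta>\<bar> \<sigma>(G) F^(1/p)\<close>, where \<open>T' = f/G(T)\<close>, and a second use of Young's inequality, with
 \<open>G(T)^l\<close> in the role of the extremal function, bounds \<open>\<integral> k T'\<close> by the entropy. Equality forces \<open>k = c G(T)^l\<close>,
 which is the inverse transformation of the extremal density.
\<close>

text \<open>With p' the conjugate of p, p' \<beta> + \<lambda> - 1 equals (1 + p') \<beta> -
  \<theta>. The sign condition of (ii) therefore says l > 1/(1 + p'), so that the Stam part lives in
  the parameter range of (i) with \<open>l\<close> in place of \<lambda>; the relations \<beta> = l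
  \<theta> and 1 - \<lambda> = \<theta> (1 - l) reduce its exponents to \<open>l\<close> and
  \<alpha>. The power of \<alpha> in (ii) is the \<alpha> of k' = \<alpha> \<beta> k (log (f/h))',
  raised to -1/(l \<alpha>). In (i) \<open>f\<close> and \<open>h\<close> are only measurable and
  \<open>y\<close> need not be differentiable, so changes of variables are identities of measures.
  In (ii) the obstacle is the boundary term of the integration by parts: that \<open>k\<close> comes
  arbitrarily close to 0 at both ends has to be extracted from the regularity of R = (f/h)^\<alpha>
  and a finite Fisher divergence, whether or not the range of \<open>y\<close> is bounded. For p = 1
  the stretched Gaussian is uniform and equality would force f = h almost everywhere; then R is the
  indicator of an interval, which is not admissible. The infimum is approached by perturbations of
  \<open>h\<close> but not attained.\<close>

abbreviation (input) "ivl \<equiv> einterval"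
abbreviation (input) "borelfun \<equiv> borel_measurable borel"

syntax "_NN_set" :: "pttrn \<Rightarrow> real set \<Rightarrow> ennreal \<Rightarrow> ennreal" ("(2NN _:_./ _)" [0, 60, 10] 10)
syntax "_NN" :: "pttrn \<Rightarrow> ennreal \<Rightarrow> ennreal" ("(2NN _./ _)" [0, 10] 10)
translations
 "NN x:A. u" \<rightharpoonup> "CONST nn_integral CONST lborel (\<lambda>x. u * CONST indicator A x)"
 "NN x. u" \<rightharpoonup> "CONST nn_integral CONST lborel (\<lambda>x. u)"

lemma nn_set_cong: "(\<And>x. x \<in> A \<Longrightarrow> u x = v x) \<Longrightarrow> (NN x:A. u x) = (NN x:A. v x)"
 by (intro nn_integral_cong) (auto simp: indicator_def)

lemma nn_set_mono: "(\<And>x. x \<in> A \<Longrightarrow> u x \<le> v x) \<Longrightarrow> (NN x:A. u x) \<le> (NN x:A. v x)"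
 by (intro nn_integral_mono) (auto simp: indicator_def)

section \<open>Coordinates with a prescribed derivative\<close>

lemma einterval_Icc_subset:
 assumes "s \<in> ivl a b" "t \<in> ivl a b"
 shows "{s..t} \<subseteq> ivl a b"
 using assms unfolding einterval_def by (auto intro: less_le_trans le_less_trans simp flip: ereal_less_eq(3))

lemma einterval_two_sided:
 assumes "x \<in> ivl a b"
 obtains s t where "s \<in> ivl a b" "t \<in> ivl a b" "s < x" "x < t"
proof -
 obtain e where "e > 0" "ball x e \<subseteq> ivl a b" using open_einterval assms by (meson open_contains_ball)
 then show thesis by (intro that[of "x - e/2" "x + e/2"]) (auto simp: subset_iff dist_real_def)
qed

lemma einterval_nn_integral_pos:
 fixes w :: "real \<Rightarrow> real"
 assumes [measurable]: "w \<in> borelfun"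
  and pos: "\<And>x. x \<in> {s<..<t} \<Longrightarrow> 0 < w x" and "s < t" and sub: "{s<..<t} \<subseteq> A" 
  and [measurable]: "A \<in> sets borel"
 shows "0 < (NN x:A. ennreal (w x))"
proof (rule ccontr)
 assume "\<not> ?thesis"
 then have "(NN x:A. ennreal (w x)) = 0" by simp
 then have "AE x in lborel. ennreal (w x) * indicator A x = 0" by (subst (asm) nn_integral_0_iff_AE) auto
 then have "AE x in lborel. x \<notin> {s<..<t}"
 proof eventually_elim
  case (elim x)
  then show ?case using sub pos[of x] by (auto simp: indicator_def split: if_splits)
 qed
 then have "{s<..<t} \<in> null_sets lborel" using AE_iff_null_sets[of "{s<..<t}" lborel] by simp
 then have "emeasure lborel {s<..<t} = 0" by auto
 with \<open>s < t\<close> show False by simp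
qed

text \<open>The equation y' = w in integrated form. As \<open>w\<close> is only measurable,
  \<open>y\<close> need not be differentiable, and neither continuity nor measurability of
  \<open>y\<close> is assumed: both follow from the integral identity and the positivity of
  \<open>w\<close>.\<close>

locale coordinate =
 fixes a b :: ereal and w y :: "real \<Rightarrow> real"
 assumes less: "a < b"
  and w_measurable [measurable]: "w \<in> borelfun"
  and w_pos: "x \<in> ivl a b \<Longrightarrow> 0 < w x"
  and integral_eq: "\<lbrakk>s \<in> ivl a b; t \<in> ivl a b; s \<le> t\<rbrakk> \<Longrightarrow>
   (NN x:{s..t}. ennreal (w x)) = ennreal (y t - y s)"
begin

lemma strict_mono:
 assumes "s \<in> ivl a b" "t \<in> ivl a b" "s < t"
 shows "y s < y t"
proof -
 have "0 < (NN x:{s..t}. ennreal (w x))" using assms einterval_Icc_subset[OF assms(1,2)]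
  by (intro einterval_nn_integral_pos[of w s t] w_pos) auto
 then show ?thesis using integral_eq[OF assms(1,2)] assms(3) by (simp add: ennreal_less_zero_iff)
qed

lemma mono:
 assumes "s \<in> ivl a b" "t \<in> ivl a b"
 shows "y s \<le> y t \<longleftrightarrow> s \<le> t" "y s < y t \<longleftrightarrow> s < t" "y s = y t \<longleftrightarrow> s = t"
 using strict_mono[of s t] strict_mono[of t s] assms by (cases s t rule: linorder_cases; simp)+

lemma inj: "inj_on y (ivl a b)"
 by (auto simp: inj_on_def mono)

text \<open>Passes from the nonnegative Lebesgue integral to the gauge integral, for which
  continuity of indefinite integrals and the fundamental theorem are at hand.\<close>

lemma integrable_Icc:
 assumes "s \<in> ivl a b" "t \<in> ivl a b" "s \<le> t"
 shows "w integrable_on {s..t}" "integral {s..t} w = y t - y s"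
proof -
 have m: "set_borel_measurable borel {s..t} w" unfolding set_borel_measurable_def by measurable
 have pos: "\<And>x. x \<in> {s..t} \<Longrightarrow> 0 \<le> w x"
  using w_pos einterval_Icc_subset[OF assms(1,2)] by (meson less_imp_le subsetD)
 have fin: "(NN x:{s..t}. ennreal (w x)) < \<infinity>" using integral_eq[OF assms] by simp
 have "(\<lambda>x. indicator {s..t} x * w x) integrable_on UNIV"
 proof (rule nn_integral_integrable_on)
  show "(NN x. ennreal (indicator {s..t} x * w x)) < \<infinity>"
   using fin by (subst nn_integral_cong[of _ _ "\<lambda>x. ennreal (w x) * indicator {s..t} x"]) (auto simp: indicator_def)
 qed (auto simp: indicator_def pos)
 moreover have "(\<lambda>x. indicator {s..t} x * w x) = (\<lambda>x. if x \<in> {s..t} then w x else 0)"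
  by (auto simp: indicator_def)
 ultimately show 1: "w integrable_on {s..t}" using integrable_restrict_UNIV[of "{s..t}" w] by simp
 have "ennreal (integral {s..t} w) = ennreal (y t - y s)"
  using set_nn_integral_lborel_eq_integral[OF m pos fin] integral_eq[OF assms] by simp
 moreover have "0 \<le> integral {s..t} w" using pos by (rule integral_nonneg[OF 1])
 moreover have "0 \<le> y t - y s" using mono assms by simp
 ultimately show "integral {s..t} w = y t - y s" by simp
qed

lemma continuous: "continuous_on (ivl a b) y"
proof (rule continuous_at_imp_continuous_on, safe)
 fix x assume "x \<in> ivl a b"
 then obtain s t where st: "s \<in> ivl a b" "t \<in> ivl a b" "s < x" "x < t" by (rule einterval_two_sided)
 have "continuous_on {s..t} (\<lambda>u. y s + integral {s..u} w)"
  by (intro continuous_intros indefinite_integral_continuous_1 integrable_Icc) (use st in auto)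
 moreover have "y s + integral {s..u} w = y u" if "u \<in> {s..t}" for u
  using integrable_Icc(2)[of s u] that st einterval_Icc_subset[OF st(1,2)] by auto
 ultimately have "continuous_on {s..t} y"
  using continuous_on_cong[OF refl, of "{s..t}" "\<lambda>u. y s + integral {s..u} w" y] by blast
 then show "isCont y x" using st by (auto intro: continuous_on_interior)
qed

lemma borel_measurable_indicator [measurable]:
 "(\<lambda>x. indicator (ivl a b) x * y x) \<in> borelfun"
 using borel_measurable_continuous_on_indicator[OF borel_einterval continuous] by simp

lemma image_Icc:
 assumes "s \<in> ivl a b" "t \<in> ivl a b" "s \<le> t"
 shows "y ` {s..t} = {y s..y t}"
proof
 show "y ` {s..t} \<subseteq> {y s..y t}"
  using einterval_Icc_subset[OF assms(1,2)] assms by (auto simp: mono subset_iff)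
 have c: "continuous_on {s..t} y" using continuous einterval_Icc_subset[OF assms(1,2)] by (rule continuous_on_subset)
 show "{y s..y t} \<subseteq> y ` {s..t}" using IVT'[OF _ _ assms(3) c] by force
qed

lemma open_image: "open (y ` ivl a b)"
proof (rule openI)
 fix v assume "v \<in> y ` ivl a b"
 then obtain x where x: "x \<in> ivl a b" "v = y x" by auto
 then obtain s t where st: "s \<in> ivl a b" "t \<in> ivl a b" "s < x" "x < t" using einterval_two_sided by metis
 have "{y s..y t} \<subseteq> y ` ivl a b" using image_Icc[of s t] st einterval_Icc_subset[OF st(1,2)] by auto
 moreover have "v \<in> {y s<..<y t}" using x st by (simp add: mono)
 ultimately show "\<exists>e>0. ball v e \<subseteq> y ` ivl a b"
  by (meson greaterThanLessThan_subseteq_atLeastAtMost_iff open_contains_ball open_greaterThanLessThan order.refl order.trans)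
qed

lemma image_measurable [measurable]: "y ` ivl a b \<in> sets borel"
 using open_image by simp

lemma image_interval:
 assumes "u \<in> y ` ivl a b" "v \<in> y ` ivl a b"
 shows "{u..v} \<subseteq> y ` ivl a b"
proof
 fix z assume z: "z \<in> {u..v}"
 obtain s t where st: "s \<in> ivl a b" "t \<in> ivl a b" "u = y s" "v = y t" using assms by auto
 with z have "s \<le> t" by (metis atLeastatMost_empty' empty_iff mono(1))
 with image_Icc[of s t] st z einterval_Icc_subset[OF st(1,2)] show "z \<in> y ` ivl a b" by blast
qed

lemma is_interval_image: "is_interval (y ` ivl a b)"
 unfolding is_interval_1 using image_interval by (meson atLeastAtMost_iff subsetD)

text \<open>Substitution for a \<open>y\<close> that need not be differentiable: the image of
  \<open>w dx\<close> under \<open>y\<close> and Lebesgue measure on the image interval agree on all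
  closed intervals, which generate the Borel sets and are stable under intersection.\<close>

lemma pushforward_Icc:
 fixes \<phi> :: "real \<Rightarrow> ennreal"
 assumes st: "s \<in> ivl a b" "t \<in> ivl a b" "s \<le> t"
  and [measurable]: "\<phi> \<in> borelfun"
 shows "(NN x:{s..t}. \<phi> (y x) * ennreal (w x)) = (NN v:{y s..y t}. \<phi> v)"
proof -
 note sub = einterval_Icc_subset[OF st(1,2)]
 \<comment> \<open>Outside the interval \<open>y\<close> is uncontrolled; cut off there, it is
   measurable.\<close>
 define y0 where "y0 = (\<lambda>x. indicator (ivl a b) x * y x)"
 have [measurable]: "y0 \<in> borelfun" unfolding y0_def by measurable
 have y0: "y0 x = y x" if "x \<in> {s..t}" for x using that sub by (auto simp: y0_def)
 define M where "M = distr (density lborel (\<lambda>x. ennreal (w x) * indicator {s..t} x)) borel y0"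
 define N where "N = density lborel (indicator {y s..y t} :: real \<Rightarrow> ennreal)"
 have "M = N"
 proof (rule measure_eqI_generator_eq[where E = "range (\<lambda>(c, d). {c..d})" and \<Omega> = UNIV and A = "\<lambda>i. {- real i..real i}"])
  show "Int_stable (range (\<lambda>(c::real, d). {c..d}))" by (auto simp: Int_stable_def)
  show "sets M = sigma_sets UNIV (range (\<lambda>(c, d). {c..d}))"
   unfolding M_def using borel_eq_atLeastAtMost by (metis (no_types, lifting) sets_distr sets_measure_of top_greatest Pow_UNIV)
  show "sets N = sigma_sets UNIV (range (\<lambda>(c, d). {c..d}))"
   unfolding N_def using borel_eq_atLeastAtMost by (metis (no_types, lifting) sets_density sets_lborel sets_measure_of top_greatest Pow_UNIV)
  show "(\<Union>i. {- real i..real i}) = UNIV"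
  proof (auto)
   fix x :: real
   obtain n :: nat where "\<bar>x\<bar> \<le> real n" using real_arch_simple by blast
   then show "\<exists>i. - real i \<le> x \<and> x \<le> real i" by (intro exI[of _ n]) auto
  qed
  \<comment> \<open>The preimage of {c..d} is again an interval, whose end points come from the
    intermediate value theorem, so \<open>integral_eq\<close> measures it.\<close>
  have eq: "emeasure M {c..d} = emeasure N {c..d}" for c d proof -
   have "emeasure M {c..d} = (NN x. ennreal (w x) * indicator {s..t} x * indicator (y0 -` {c..d}) x)"
    unfolding M_def using measurable_sets[of y0 borel borel "{c..d}"]
    by (subst emeasure_distr) (simp_all add: emeasure_density)
   also have "\<dots> = (NN x:{x\<in>{s..t}. y x \<in> {c..d}}. ennreal (w x))"
    by (intro nn_integral_cong) (auto simp: indicator_def y0)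
   also have "\<dots> = ennreal (if max c (y s) \<le> min d (y t) then min d (y t) - max c (y s) else 0)"
   proof (cases "max c (y s) \<le> min d (y t)")
    case True
    then have "max c (y s) \<in> {y s..y t}" "min d (y t) \<in> {y s..y t}" by auto
    then obtain u v where uv: "u \<in> {s..t}" "v \<in> {s..t}" "y u = max c (y s)" "y v = min d (y t)"
     using image_Icc[OF st] by (metis (no_types, lifting) imageE)
    have uv': "u \<in> ivl a b" "v \<in> ivl a b" using uv sub by auto
    have "u \<le> v" using True uv' mono(1) unfolding uv(3,4)[symmetric] by blast
    have "{x\<in>{s..t}. y x \<in> {c..d}} = {u..v}"
    proof (safe)
     fix x assume "x \<in> {s..t}" "y x \<in> {c..d}"
     then have "y u \<le> y x" "y x \<le> y v" "x \<in> ivl a b" using sub st by (auto simp: uv mono)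
     then show "x \<in> {u..v}" using mono uv' by auto
    next
     fix x assume x: "x \<in> {u..v}"
     then show "x \<in> {s..t}" using uv by auto
     then have "y u \<le> y x" "y x \<le> y v" using uv' sub x by (auto simp: mono subset_iff)
     then show "y x \<in> {c..d}" by (auto simp: uv)
    qed
    then show ?thesis using integral_eq[OF uv' \<open>u \<le> v\<close>] uv True by simp
   next
    case False
    have "{x\<in>{s..t}. y x \<in> {c..d}} = {}"
    proof safe
     fix x assume "x \<in> {s..t}" "y x \<in> {c..d}"
     moreover from this have "y s \<le> y x" "y x \<le> y t" using st sub by (auto simp: mono subset_iff)
     ultimately show "x \<in> {}" using False by auto
    qed
    then have "(NN x:{x\<in>{s..t}. y x \<in> {c..d}}. ennreal (w x)) = 0" by simp
    then show ?thesis by (simp only: False if_False ennreal_0)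
   qed
   also have "\<dots> = emeasure lborel ({max c (y s)..min d (y t)})" by auto
   also have "{max c (y s)..min d (y t)} = {y s..y t} \<inter> {c..d}" by auto
   also have "emeasure lborel ({y s..y t} \<inter> {c..d}) = emeasure N {c..d}"
    unfolding N_def by (subst emeasure_density) (auto simp flip: indicator_inter_arith)
   finally show ?thesis .
  qed
  then show "emeasure M X = emeasure N X" if "X \<in> range (\<lambda>(c, d). {c..d})" for X using that by auto
  have "emeasure N {- real i..real i} \<le> emeasure lborel {- real i..real i}" for i proof -
   have "emeasure N {- real i..real i} = (NN x. indicator {y s..y t} x * indicator {- real i..real i} x)"
    unfolding N_def by (subst emeasure_density) auto
   also have "\<dots> \<le> (NN x. indicator {- real i..real i} x)"
    by (intro nn_integral_mono) (auto simp: indicator_def)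
   finally show ?thesis by simp
  qed
  then show "emeasure M {- real i..real i} \<noteq> \<infinity>" for i
   unfolding eq by (metis emeasure_lborel_Icc_eq ennreal_less_top infinity_ennreal_def leD)
 qed auto
 have "(NN x:{s..t}. \<phi> (y x) * ennreal (w x)) = (NN x. ennreal (w x) * indicator {s..t} x * \<phi> (y0 x))"
  by (intro nn_integral_cong) (auto simp: indicator_def y0 mult.commute)
 also have "\<dots> = (\<integral>\<^sup>+v. \<phi> v \<partial>M)"
  unfolding M_def by (simp add: nn_integral_distr nn_integral_density)
 also have "\<dots> = (NN v:{y s..y t}. \<phi> v)"
  unfolding \<open>M = N\<close> N_def by (simp add: nn_integral_density mult.commute)
 finally show ?thesis .
qed

text \<open>Exhaust the interval by compact ones and pass to the limit on both sides by monotone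
  convergence.\<close>

lemma pushforward:
 fixes \<phi> :: "real \<Rightarrow> ennreal"
 assumes [measurable]: "\<phi> \<in> borelfun"
 shows "(NN x:ivl a b. \<phi> (y x) * ennreal (w x)) = (NN v:y ` ivl a b. \<phi> v)"
proof -
 obtain u l where ul: "ivl a b = (\<Union>i. {l i .. u i})"
  "incseq u" "decseq l" "\<And>i. l i < u i" "\<And>i. a < l i" "\<And>i. u i < b"
  "(\<lambda>i. ereal (l i)) \<longlonglongrightarrow> a" "(\<lambda>i. ereal (u i)) \<longlonglongrightarrow> b"
  by (rule einterval_Icc_approximation[OF less]) (rule that; assumption)
 have lu: "l i \<in> ivl a b" "u i \<in> ivl a b" for i unfolding ul(1) using ul(4)[of i] by (auto intro!: exI[of _ i])
 define y0 where "y0 = (\<lambda>x. indicator (ivl a b) x * y x)"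
 have [measurable]: "y0 \<in> borelfun" unfolding y0_def by measurable
 have SUP_set: "(SUP i. c * indicator (A i) x) = (c * indicator (\<Union>i. A i) x :: ennreal)" for c x and A :: "nat \<Rightarrow> real set"
 proof (cases "\<exists>i. x \<in> A i")
  case True
  then obtain i where "x \<in> A i" by auto
  then have "c \<le> (SUP i. c * indicator (A i) x)" by (intro SUP_upper2[of i]) auto
  moreover have "(SUP i. c * indicator (A i) x) \<le> c" by (intro SUP_least) (auto simp: indicator_def)
  ultimately show ?thesis using True by (auto simp: indicator_def)
 next
  case False
  then show ?thesis by (auto simp: indicator_def)
 qed
 have inc: "{l i..u i} \<subseteq> {l (Suc i)..u (Suc i)}" for i
  using incseq_SucD[OF ul(2)] decseq_SucD[OF ul(3)] by (meson atLeastatMost_subset_iff)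
 have 1: "(NN x:ivl a b. \<phi> (y x) * ennreal (w x))
   = (NN x. (SUP i. \<phi> (y0 x) * ennreal (w x) * indicator {l i..u i} x))"
  unfolding SUP_set ul(1)[symmetric] by (intro nn_integral_cong) (auto simp: indicator_def y0_def)
 also have "\<dots> = (SUP i. (NN x. \<phi> (y0 x) * ennreal (w x) * indicator {l i..u i} x))"
  by (intro nn_integral_monotone_convergence_SUP incseq_SucI le_funI mult_left_mono)
    (use inc in \<open>auto simp: indicator_def subset_iff\<close>)
 also have "(\<lambda>i. (NN x. \<phi> (y0 x) * ennreal (w x) * indicator {l i..u i} x))
   = (\<lambda>i. (NN x:{l i..u i}. \<phi> (y x) * ennreal (w x)))"
  by (intro ext nn_integral_cong) (auto simp: indicator_def y0_def ul(1))
 also have "\<dots> = (\<lambda>i. (NN v:{y (l i)..y (u i)}. \<phi> v))"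
  by (intro ext pushforward_Icc lu less_imp_le ul) simp
 also have "(SUP i. (NN v:{y (l i)..y (u i)}. \<phi> v))
   = (NN v. (SUP i. \<phi> v * indicator {y (l i)..y (u i)} v))"
 proof (intro nn_integral_monotone_convergence_SUP[symmetric] incseq_SucI le_funI mult_left_mono)
  fix i v
  have "y (l (Suc i)) \<le> y (l i)" "y (u i) \<le> y (u (Suc i))"
   using lu incseq_SucD[OF ul(2)] decseq_SucD[OF ul(3)] by (auto simp: mono)
  then show "indicator {y (l i)..y (u i)} v \<le> (indicator {y (l (Suc i))..y (u (Suc i))} v :: ennreal)"
   by (auto simp: indicator_def)
 qed auto
 also have "\<dots> = (NN v:y ` ivl a b. \<phi> v)" proof -
  have "(\<Union>i. {y (l i)..y (u i)}) = y ` ivl a b"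
   unfolding ul(1) image_UN by (simp add: image_Icc[OF lu less_imp_le[OF ul(4)]])
  then show ?thesis unfolding SUP_set by simp
 qed
 finally show ?thesis .
qed

lemma inv_image:
 "v \<in> y ` ivl a b \<Longrightarrow> inv_into (ivl a b) y v \<in> ivl a b"
 "v \<in> y ` ivl a b \<Longrightarrow> y (inv_into (ivl a b) y v) = v"
 "x \<in> ivl a b \<Longrightarrow> inv_into (ivl a b) y (y x) = x"
 by (auto intro: inv_into_into f_inv_into_f inv_into_f_f inj)

lemma continuous_inv: "continuous_on (y ` ivl a b) (inv_into (ivl a b) y)"
proof (rule continuous_on_inverse_open_map[OF continuous refl])
 fix U assume U: "openin (top_of_set (ivl a b)) U"
 have "open U" and sub: "U \<subseteq> ivl a b" using U by (auto simp: openin_open_eq)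
 show "openin (top_of_set (y ` ivl a b)) (y ` U)"
 proof (subst openin_open_eq[OF open_image], intro conjI image_mono sub openI)
  fix v assume "v \<in> y ` U"
  then obtain x where x: "x \<in> U" "v = y x" by auto
  obtain e where "e > 0" "ball x e \<subseteq> U" using \<open>open U\<close> x by (meson open_contains_ball)
  then have st: "{x - e/2..x+e/2} \<subseteq> U" "x - e/2 < x" "x < x + e/2" by (auto simp: subset_iff dist_real_def)
  define s t where "s = x - e/2" "t = x + e/2"
  have st': "s \<in> ivl a b" "t \<in> ivl a b" "s < x" "x < t" "{s..t} \<subseteq> U"
   using st sub unfolding s_t_def by (auto simp: subset_iff)
  have "{y s..y t} \<subseteq> y ` U" using image_Icc[of s t] st' by auto
  moreover have "v \<in> {y s<..<y t}" using x st' sub by (auto simp: mono)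
  ultimately show "\<exists>e>0. ball v e \<subseteq> y ` U"
   by (meson greaterThanLessThan_subseteq_atLeastAtMost_iff open_contains_ball open_greaterThanLessThan order.refl order.trans)
 qed
qed (auto simp: inv_image)

lemma borel_measurable_inv [measurable]:
 "(\<lambda>v. indicator (y ` ivl a b) v * inv_into (ivl a b) y v) \<in> borelfun"
 using borel_measurable_continuous_on_indicator[OF image_measurable continuous_inv] by simp


text \<open>Surjectivity by counting mass. The image is an interval; if it missed a point
  \<open>z\<close>, it would miss everything on one side of \<open>z\<close>, a set of positive
  \<psi>-mass, although it already carries the full finite mass.\<close>

lemma image_eqI:
 assumes sub: "y ` ivl a b \<subseteq> ivl c d"
  and [measurable]: "\<psi> \<in> borelfun"
  and pos: "\<And>v. v \<in> ivl c d \<Longrightarrow> (0::real) < \<psi> v"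
  and eq: "(NN x:ivl a b. ennreal (\<psi> (y x)) * ennreal (w x)) = (NN v:ivl c d. ennreal (\<psi> v))"
  and fin: "(NN v:ivl c d. ennreal (\<psi> v)) < \<infinity>"
 shows "y ` ivl a b = ivl c d"
proof (rule ccontr)
 define J where "J = y ` ivl a b"
 have [measurable]: "J \<in> sets borel" unfolding J_def by measurable
 assume "\<not> ?thesis"
 then obtain z where z: "z \<in> ivl c d" "z \<notin> J" using sub by (auto simp: J_def)
 obtain x where "x \<in> ivl a b" using einterval_nonempty[OF less] by auto
 then have j: "y x \<in> J" by (auto simp: J_def)
 obtain s t where st: "s \<in> ivl c d" "t \<in> ivl c d" "s < z" "z < t" using einterval_two_sided[OF z(1)] .
 have split: "(NN v:ivl c d. ennreal (\<psi> v)) =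
   (NN v:J. ennreal (\<psi> v)) + (NN v:ivl c d - J. ennreal (\<psi> v))"
  using sub by (subst nn_integral_add[symmetric]) (auto intro!: nn_integral_cong simp: indicator_def J_def[symmetric])
 have J: "(NN v:J. ennreal (\<psi> v)) = (NN v:ivl c d. ennreal (\<psi> v))"
  unfolding J_def using pushforward[of "\<lambda>v. ennreal (\<psi> v)"] eq by simp
 have "0 < (NN v:ivl c d - J. ennreal (\<psi> v))"
 proof (cases "y x < z")
  case True
  have "u \<notin> J" if "z < u" for u using image_interval[of "y x" u] j z(2) that True unfolding J_def
   by (meson atLeastAtMost_iff less_imp_le subsetD)
  then show ?thesis
   using st z einterval_Icc_subset[OF z(1) st(2)] by (intro einterval_nn_integral_pos[of \<psi> z t] pos) auto
 next
  case False
  then have "z < y x" using j z by (metis linorder_neqE_linordered_idom)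
  then have "u \<notin> J" if "u < z" for u
   using image_interval[of u "y x"] j z(2) that \<open>z < y x\<close> unfolding J_def
   by (meson atLeastAtMost_iff less_imp_le subsetD)
  then show ?thesis
   using st z einterval_Icc_subset[OF st(1) z(1)] by (intro einterval_nn_integral_pos[of \<psi> s z] pos) auto
 qed
 then have "(NN v:ivl c d. ennreal (\<psi> v)) <
   (NN v:ivl c d. ennreal (\<psi> v)) + (NN v:ivl c d - J. ennreal (\<psi> v))"
  using fin ennreal_add_left_cancel_less[of "NN v:ivl c d. ennreal (\<psi> v)" 0] by simp
 with split show False unfolding J by simp
qed

text \<open>The weight \<open>f / \<psi> (y)\<close> is the one for which \<open>y\<close>
  transports \<open>f dx\<close> to \<open>\<psi> dv\<close> on its image.\<close>

lemma pushforward_density: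
 fixes \<phi> :: "real \<Rightarrow> ennreal" and f \<psi> :: "real \<Rightarrow> real"
 assumes [measurable]: "\<phi> \<in> borelfun" "\<psi> \<in> borelfun"
  and w: "\<And>x. x \<in> ivl a b \<Longrightarrow> w x = f x / \<psi> (y x)"
  and pos: "\<And>x. x \<in> ivl a b \<Longrightarrow> 0 < \<psi> (y x)"
 shows "(NN x:ivl a b. \<phi> (y x) * ennreal (f x)) = (NN v:y ` ivl a b. \<phi> v * ennreal (\<psi> v))"
proof -
 have "(NN x:ivl a b. \<phi> (y x) * ennreal (f x)) =
  (NN x:ivl a b. \<phi> (y x) * ennreal (\<psi> (y x)) * ennreal (w x))"
 proof (rule nn_set_cong)
  fix x assume True: "x \<in> ivl a b"
  have "f x = \<psi> (y x) * w x" "0 \<le> w x" using w[OF True] pos[OF True] w_pos[OF True] by auto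
  then show "\<phi> (y x) * ennreal (f x) = \<phi> (y x) * ennreal (\<psi> (y x)) * ennreal (w x)" using pos[OF True] by (simp add: ennreal_mult mult.assoc)
 qed
 also have "\<dots> = (NN v:y ` ivl a b. \<phi> v * ennreal (\<psi> v))" by (rule pushforward) measurable
 finally show ?thesis .
qed

lemma has_derivative:
 assumes "continuous_on (ivl a b) w" "x \<in> ivl a b"
 shows "(y has_real_derivative w x) (at x)"
proof -
 obtain s t where st: "s \<in> ivl a b" "t \<in> ivl a b" "s < x" "x < t" using einterval_two_sided[OF assms(2)] .
 have "((\<lambda>u. integral {s..u} w) has_real_derivative w x) (at x within {s..t})"
  using assms einterval_Icc_subset[OF st(1,2)] st
  by (intro integral_has_real_derivative continuous_on_subset[OF assms(1)]) auto
 then have "((\<lambda>u. integral {s..u} w) has_real_derivative w x) (at x)" using st by (simp add: at_within_Icc_at)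
 then have "((\<lambda>u. y s + integral {s..u} w) has_real_derivative 0 + w x) (at x)"
  by (intro DERIV_add DERIV_const)
 then have d: "((\<lambda>u. y s + integral {s..u} w) has_real_derivative w x) (at x)" by simp
 have "eventually (\<lambda>u. u \<in> {s<..<t}) (nhds x)" using st by (intro eventually_nhds_in_open) auto
 then have "eventually (\<lambda>u. y s + integral {s..u} w = y u) (nhds x)"
  by eventually_elim (use integrable_Icc(2)[of s] st einterval_Icc_subset[OF st(1,2)] in \<open>auto simp: subset_iff\<close>)
 with d show ?thesis by (subst (asm) DERIV_cong_ev[OF refl _ refl]) 
qed

lemma inv_has_derivative:
 assumes "continuous_on (ivl a b) w" "x \<in> ivl a b"
 shows "(inv_into (ivl a b) y has_real_derivative inverse (w x)) (at (y x))"
proof -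
 obtain s t where st: "s \<in> ivl a b" "t \<in> ivl a b" "s < x" "x < t" using einterval_two_sided[OF assms(2)] .
 show ?thesis
 proof (rule DERIV_inverse_function[of y])
  show "(y has_real_derivative w x) (at (inv_into (ivl a b) y (y x)))"
   using has_derivative[OF assms] assms by (simp add: inv_image)
  show "w x \<noteq> 0" using w_pos[OF assms(2)] by simp
  show "y s < y x" "y x < y t" using st assms by (simp_all add: mono)
  show "y (inv_into (ivl a b) y u) = u" if "y s < u" "u < y t" for u
   using image_interval[of "y s" "y t"] st that by (intro inv_image) (auto simp: subset_iff)
  show "isCont (inv_into (ivl a b) y) (y x)"
   using continuous_inv open_image assms(2) by (simp add: continuous_on_eq_continuous_at)
 qed
qed

end

lemma coordinate_of_derivative:
 assumes "a < b" and [measurable]: "w \<in> borelfun"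
  and pos: "\<And>x. x \<in> ivl a b \<Longrightarrow> 0 < w x"
  and der: "\<And>x. x \<in> ivl a b \<Longrightarrow> (y has_real_derivative w x) (at x)"
 shows "coordinate a b w y"
proof
 fix s t assume st: "s \<in> ivl a b" "t \<in> ivl a b" "s \<le> t"
 note sub = einterval_Icc_subset[OF st(1,2)]
 have "(y has_vector_derivative w x) (at x within {s..t})" if "x \<in> {s..t}" for x
  unfolding has_real_derivative_iff_has_vector_derivative[symmetric]
  using sub that by (intro has_field_derivative_at_within[OF der]) auto
 then have "(w has_integral (y t - y s)) {s..t}" using st by (intro fundamental_theorem_of_calculus)
 then show "(NN x:{s..t}. ennreal (w x)) = ennreal (y t - y s)"
  using sub by (intro nn_integral_has_integral_lebesgue') (auto intro!: less_imp_le[OF pos])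
qed (use assms in auto)

section \<open>Distribution functions and monotone transport\<close>

lemma density_cdf:
 fixes f :: "real \<Rightarrow> real"
 assumes "a < b" and [measurable]: "f \<in> borelfun"
  and pos: "\<And>x. x \<in> ivl a b \<Longrightarrow> 0 < f x"
  and 1: "(NN x:ivl a b. ennreal (f x)) = 1"
 obtains H where "coordinate a b f H" "H ` ivl a b = {0<..<1}"
proof -
 define A where "A x = ivl a b \<inter> {..x}" for x
 have [measurable]: "A x \<in> sets borel" for x unfolding A_def by measurable
 define e where "e x = (NN u:A x. ennreal (f u))" for x
 define H where "H x = enn2real (e x)" for x
 have e_le: "e x + (NN u:ivl a b \<inter> {x<..}. ennreal (f u)) = 1" for x unfolding e_def 1[symmetric] A_def
  by (subst nn_integral_add[symmetric]) (auto intro!: nn_integral_cong simp: indicator_def)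
 then have "e x \<le> 1" for x by (metis le_iff_add)
 then have eH: "e x = ennreal (H x)" for x
  unfolding H_def by (metis ennreal_enn2real ennreal_one_less_top order.strict_trans1)
 have H0: "0 \<le> H x" for x by (simp add: H_def)
 have c: "coordinate a b f H"
 proof
  fix s t assume st: "s \<in> ivl a b" "t \<in> ivl a b" "s \<le> t"
  have "e t = e s + (NN u:{s<..t}. ennreal (f u))" unfolding e_def A_def using einterval_Icc_subset[OF st(1,2)] st
   by (subst nn_integral_add[symmetric]) (auto intro!: nn_integral_cong simp: indicator_def subset_iff)
  also have "(NN u:{s<..t}. ennreal (f u)) = (NN u:{s..t}. ennreal (f u))"
  proof (intro nn_integral_cong_AE)
   show "AE u in lborel. ennreal (f u) * indicator {s<..t} u = ennreal (f u) * indicator {s..t} u"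
    using AE_lborel_singleton[of s] by eventually_elim (auto simp: indicator_def)
  qed
  finally have *: "ennreal (H t) = ennreal (H s) + (NN u:{s..t}. ennreal (f u))" by (simp add: eH)
  then have "ennreal (H s) \<le> ennreal (H t)" by (metis le_iff_add)
  moreover have "(NN u:{s..t}. ennreal (f u)) = ennreal (H t) - ennreal (H s)"
   unfolding * by (simp add: ennreal_add_diff_cancel_left)
  ultimately show "(NN u:{s..t}. ennreal (f u)) = ennreal (H t - H s)" by (simp add: ennreal_minus H0)
 qed (use assms in auto)
 interpret coordinate a b f H by fact
 \<comment> \<open>Strict monotonicity keeps \<open>H\<close> away from 0 and 1 inside the
   interval.\<close>
 have sub: "H ` ivl a b \<subseteq> einterval 0 1"
 proof (clarsimp simp: zero_ereal_def one_ereal_def)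
  fix x assume x: "x \<in> ivl a b"
  obtain s t where st: "s \<in> ivl a b" "t \<in> ivl a b" "s < x" "x < t" using einterval_two_sided[OF x] .
  have "H s < H x" "H x < H t" using st x by (auto simp: mono)
  moreover have "H t \<le> 1" using \<open>e t \<le> 1\<close> by (simp add: eH)
  ultimately show "0 < H x \<and> H x < 1" using H0[of s] by linarith
 qed
 have "H ` ivl a b = einterval 0 1"
 proof (rule image_eqI[OF sub, of "\<lambda>_. 1"])
  show "(NN x:ivl a b. ennreal 1 * ennreal (f x)) = (NN v:einterval 0 1. ennreal 1)"
   using 1 by (simp add: zero_ereal_def one_ereal_def)
 qed (auto simp: zero_ereal_def one_ereal_def)
 with that[OF c] show thesis by (simp add: zero_ereal_def one_ereal_def)
qed

text \<open>Monotone rearrangement: \<open>y\<close> is the distribution function of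
  \<open>h\<close> followed by the inverse of that of \<psi>. Off the interval \<open>y\<close> has
  no meaning, so the weight is set to 1 there, which keeps it measurable.\<close>

lemma transport:
 fixes h \<psi> :: "real \<Rightarrow> real"
 assumes "a < b" and [measurable]: "h \<in> borelfun"
  and hpos: "\<And>x. x \<in> ivl a b \<Longrightarrow> 0 < h x"
  and h1: "(NN x:ivl a b. ennreal (h x)) = 1"
  and "c < d" and [measurable]: "\<psi> \<in> borelfun"
  and \<psi>pos: "\<And>v. v \<in> ivl c d \<Longrightarrow> 0 < \<psi> v"
  and \<psi>1: "(NN v:ivl c d. ennreal (\<psi> v)) = 1"
 obtains y where "coordinate a b (\<lambda>x. if x \<in> ivl a b then h x / \<psi> (y x) else 1) y"
  "y ` ivl a b = ivl c d" proof -
 obtain H where cH: "coordinate a b h H" and H01: "H ` ivl a b = {0<..<1}" using density_cdf[OF assms(1-4)] .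
 obtain \<Phi> where cP: "coordinate c d \<psi> \<Phi>" and P01: "\<Phi> ` ivl c d = {0<..<1}"
  using density_cdf[OF assms(5-8)] .
 interpret H: coordinate a b h H by fact
 interpret P: coordinate c d \<psi> \<Phi> by fact
 define y where "y = inv_into (ivl c d) \<Phi> \<circ> H"
 have HP: "H x \<in> \<Phi> ` ivl c d" if "x \<in> ivl a b" for x using that H01 P01 by auto
 have yin: "y x \<in> ivl c d" "\<Phi> (y x) = H x" if "x \<in> ivl a b" for x
  unfolding y_def o_def by (rule P.inv_image HP that)+
 define i0 where "i0 = (\<lambda>v. indicator (\<Phi> ` ivl c d) v * inv_into (ivl c d) \<Phi> v)"
 have [measurable]: "i0 \<in> borelfun" unfolding i0_def by measurable
 have i0: "i0 (\<Phi> v) = v" if "v \<in> ivl c d" for v using that by (simp add: i0_def P.inv_image)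
 have i0H: "i0 (H x) = y x" if "x \<in> ivl a b" for x using i0[OF yin(1)[OF that]] yin(2)[OF that] by simp
 define y0 where "y0 = (\<lambda>x. i0 (indicator (ivl a b) x * H x))"
 have [measurable]: "y0 \<in> borelfun" unfolding y0_def by measurable
 have y0: "y0 x = y x" if "x \<in> ivl a b" for x using that by (simp add: y0_def i0H)
 have c: "coordinate a b (\<lambda>x. if x \<in> ivl a b then h x / \<psi> (y x) else 1) y"
 proof
  have "(\<lambda>x. if x \<in> ivl a b then h x / \<psi> (y0 x) else 1) \<in> borelfun" by measurable
  also have "(\<lambda>x. if x \<in> ivl a b then h x / \<psi> (y0 x) else 1) = (\<lambda>x. if x \<in> ivl a b then h x / \<psi> (y x) else 1)"
   by (auto simp: y0)
  finally show "\<dots> \<in> borelfun" .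
  fix s t assume st: "s \<in> ivl a b" "t \<in> ivl a b" "s \<le> t"
  note sub = einterval_Icc_subset[OF st(1,2)]
  have yst: "y s \<le> y t" using st yin by (metis H.mono(1) P.mono(1))
  have "(NN x:{s..t}. ennreal (if x \<in> ivl a b then h x / \<psi> (y x) else 1))
   = (NN x:{s..t}. ennreal (1 / \<psi> (i0 (H x))) * ennreal (h x))"
  proof (rule nn_set_cong)
   fix x assume True: "x \<in> {s..t}"
   then have x: "x \<in> ivl a b" using sub by auto
   then show "ennreal (if x \<in> ivl a b then h x / \<psi> (y x) else 1) = ennreal (1 / \<psi> (i0 (H x))) * ennreal (h x)" using hpos[OF x] \<psi>pos[OF yin(1)[OF x]] by (simp add: i0H ennreal_mult[symmetric])
  qed
  \<comment> \<open>Through \<open>H\<close> to the uniform distribution on (0, 1), then back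
    through the inverse of \<Phi>; the factor 1/\<psi> turns \<psi> dv into Lebesgue
    measure.\<close>
  also have "\<dots> = (NN u:{H s..H t}. ennreal (1 / \<psi> (i0 u)))" by (rule H.pushforward_Icc[OF st]) measurable
  also have "\<dots> = (NN v:{y s..y t}. ennreal (1 / \<psi> (i0 (\<Phi> v))) * ennreal (\<psi> v))"
   unfolding yin(2)[OF st(1), symmetric] yin(2)[OF st(2), symmetric]
   by (rule P.pushforward_Icc[symmetric, OF yin(1) yin(1) yst]) (use st in auto)
  also have "\<dots> = (NN v:{y s..y t}. 1)"
  proof (rule nn_set_cong)
   fix v assume True: "v \<in> {y s..y t}"
   then have v: "v \<in> ivl c d" using einterval_Icc_subset[OF yin(1)[OF st(1)] yin(1)[OF st(2)]] by auto
   then show "ennreal (1 / \<psi> (i0 (\<Phi> v))) * ennreal (\<psi> v) = 1" using \<psi>pos[OF v] by (simp add: i0 ennreal_mult[symmetric])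
  qed
  also have "\<dots> = ennreal (y t - y s)" using yst by simp
  finally show "(NN x:{s..t}. ennreal (if x \<in> ivl a b then h x / \<psi> (y x) else 1)) = ennreal (y t - y s)" .
 qed (use assms(1) hpos \<psi>pos yin in auto)
 have "y ` ivl a b = inv_into (ivl c d) \<Phi> ` (\<Phi> ` ivl c d)" unfolding y_def image_comp[symmetric] H01 P01 ..
 also have "\<dots> = ivl c d" by (rule inv_into_image_cancel[OF P.inj]) simp
 finally show thesis using that c by blast
qed

text \<open>
 Here \<open>y\<close> is not assumed to be measurable. If it decreased somewhere then the integrals over all
 subintervals would vanish, so \<open>y\<close> would be antitone and hence measurable there, and the integral
 of a positive measurable function would be \<open>0\<close>.
\<close>

lemma coordinateI_composite:
 fixes h \<psi> y :: "real \<Rightarrow> real"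
 assumes "a < b" and [measurable]: "h \<in> borelfun"
  and hpos: "\<And>x. x \<in> ivl a b \<Longrightarrow> 0 < h x"
  and [measurable]: "\<psi> \<in> borelfun"
  and \<psi>pos: "\<And>x. x \<in> ivl a b \<Longrightarrow> 0 < \<psi> (y x)"
  and eq: "\<And>s t. s \<in> ivl a b \<Longrightarrow> t \<in> ivl a b \<Longrightarrow> s \<le> t \<Longrightarrow>
   (NN x:{s..t}. ennreal (h x / \<psi> (y x))) = ennreal (y t - y s)"
 shows "coordinate a b (\<lambda>x. if x \<in> ivl a b then h x / \<psi> (y x) else 1) y"
proof -
 have meas: "(\<lambda>x. indicator A x * g x) \<in> borelfun" if "mono_on A g" "A \<in> sets borel" for A and g :: "real \<Rightarrow> real"
  using borel_measurable_mono_on_fnc[OF that(1)] that(2) by (subst (asm) borel_measurable_restrict_space_iff) auto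
 have pos: "y s < y t" if st: "s \<in> ivl a b" "t \<in> ivl a b" "s < t" for s t
 proof (rule ccontr)
  assume neg: "\<not> y s < y t"
  note sub = einterval_Icc_subset[OF st(1,2)]
  have zero: "(NN x:{s..t}. ennreal (h x / \<psi> (y x))) = 0" using eq[OF st(1,2)] st neg by (simp add: ennreal_neg)
  have "y t' \<le> y s'" if "s \<le> s'" "s' \<le> t'" "t' \<le> t" for s' t' proof -
   have "(NN x:{s'..t'}. ennreal (h x / \<psi> (y x))) \<le> (NN x:{s..t}. ennreal (h x / \<psi> (y x)))"
    using that by (intro nn_integral_mono) (auto simp: indicator_def)
   then have "ennreal (y t' - y s') = 0" using eq[of s' t'] zero sub that by (auto simp: subset_iff)
   then show ?thesis by (simp add: ennreal_eq_0_iff)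
  qed
  then have "mono_on {s..t} (\<lambda>x. - y x)" by (auto simp: mono_on_def)
  from meas[OF this] have "(\<lambda>x. - (indicator {s..t} x * - y x)) \<in> borelfun"
   by (intro borel_measurable_uminus) auto
  then have [measurable]: "(\<lambda>x. indicator {s..t} x * y x) \<in> borelfun" by simp
  define v where "v x = (if x \<in> {s..t} then h x / \<psi> (indicator {s..t} x * y x) else 1)" for x
  have [measurable]: "v \<in> borelfun" unfolding v_def by measurable
  have "0 < (NN x:{s..t}. ennreal (v x))"
   using st sub by (intro einterval_nn_integral_pos[of v s t]) (auto simp: v_def intro!: divide_pos_pos hpos \<psi>pos)
  also have "\<dots> = (NN x:{s..t}. ennreal (h x / \<psi> (y x)))"
   by (intro nn_integral_cong) (auto simp: v_def indicator_def)
  finally show False using zero by simp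
 qed
 then have "mono_on (ivl a b) y" by (auto simp: mono_on_def le_less)
 then have [measurable]: "(\<lambda>x. indicator (ivl a b) x * y x) \<in> borelfun" by (intro meas) auto
 show ?thesis
 proof
  have "(\<lambda>x. if x \<in> ivl a b then h x / \<psi> (indicator (ivl a b) x * y x) else 1) \<in> borelfun"
   by measurable
  also have "(\<lambda>x. if x \<in> ivl a b then h x / \<psi> (indicator (ivl a b) x * y x) else 1)
   = (\<lambda>x. if x \<in> ivl a b then h x / \<psi> (y x) else 1)" by auto
  finally show "\<dots> \<in> borelfun" .
  fix s t assume st: "s \<in> ivl a b" "t \<in> ivl a b" "s \<le> t"
  show "(NN x:{s..t}. ennreal (if x \<in> ivl a b then h x / \<psi> (y x) else 1)) = ennreal (y t - y s)"
   unfolding eq[OF st, symmetric] using einterval_Icc_subset[OF st(1,2)]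
   by (intro nn_integral_cong) (auto simp: indicator_def)
 qed (use assms(1) hpos \<psi>pos in auto)
qed

section \<open>Extended powers and Young's inequality\<close>

lemma eexp_eln: "eexp (ereal c * eln x) = epowr x c"
proof -
 consider "x = 0" | "x = \<infinity>" | r where "x = ennreal r" "0 < r" by (cases x) (auto simp: less_le)
 then show ?thesis
 proof cases
  case 3
  then show ?thesis by (auto simp: eexp_def eln_def epowr_def powr_def mult.commute)
 qed (auto simp: eexp_def eln_def epowr_def zero_ereal_def)
qed

lemma epowr_ennreal: "0 < x \<Longrightarrow> epowr (ennreal x) c = ennreal (x powr c)"
 by (auto simp: epowr_def)

lemma epowr_1 [simp]: "epowr 1 c = 1"
 by (simp add: epowr_def)

lemma epowr_nonneg: "0 \<le> x \<Longrightarrow> 0 < c \<Longrightarrow> epowr (ennreal x) c = ennreal (x powr c)"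
 by (auto simp: epowr_def)

lemma epowr_0 [simp]: "0 < c \<Longrightarrow> epowr 0 c = 0" "c < 0 \<Longrightarrow> epowr 0 c = \<infinity>"
 and epowr_top [simp]: "0 < c \<Longrightarrow> epowr \<infinity> c = \<infinity>" "c < 0 \<Longrightarrow> epowr \<infinity> c = 0"
  "0 < c \<Longrightarrow> epowr top c = \<infinity>" "c < 0 \<Longrightarrow> epowr top c = 0"
 by (auto simp: epowr_def)

lemma ennreal_cases_pos:
 obtains "x = 0" | "x = \<infinity>" | r where "x = ennreal r" "0 < r"
 by (cases x) (auto simp: less_le)

lemma epowr_epowr: "epowr (epowr x c) d = epowr x (c * d)"
proof (cases x rule: ennreal_cases_pos)
 case (3 r)
 then show ?thesis by (simp add: epowr_ennreal powr_powr)
qed (cases "c = 0"; cases "d = 0"; cases "c > 0"; cases "d > 0"; force simp: epowr_def zero_less_mult_iff)+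

lemma epowr_mono: 
 assumes "0 \<le> c" "x \<le> y" shows "epowr x c \<le> epowr y c"
 using assms by (cases x rule: ennreal_cases_pos; cases y rule: ennreal_cases_pos; cases "c = 0")
  (auto simp: epowr_ennreal powr_mono2 top_unique, auto simp: epowr_def)

lemma epowr_antimono: 
 assumes "c \<le> 0" "x \<le> y" shows "epowr y c \<le> epowr x c"
 using assms by (cases x rule: ennreal_cases_pos; cases y rule: ennreal_cases_pos; cases "c = 0")
  (auto simp: epowr_ennreal powr_mono2' top_unique, auto simp: epowr_def)

lemma renyi_div_epowr:
 assumes "lam \<noteq> 1" "0 < \<alpha>"
 shows "eexp (renyi_div (rel_order lam \<alpha>) \<Omega> f h) = epowr (renyi_integral (rel_order lam \<alpha>) \<Omega> f h) (1 / (\<alpha> * (lam - 1)))"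
  "eexp (- renyi_div (rel_order lam \<alpha>) \<Omega> f h) = epowr (renyi_integral (rel_order lam \<alpha>) \<Omega> f h) (1 / (\<alpha> * (1 - lam)))"
proof -
 have "- (ereal x * y) = ereal (- x) * y" for x y by (simp flip: uminus_ereal.simps)
 moreover have "- (1 / (\<alpha> * (lam - 1))) = 1 / (\<alpha> * (1 - lam))"
  by (metis minus_diff_eq minus_divide_right mult_minus_right)
 ultimately show "eexp (renyi_div (rel_order lam \<alpha>) \<Omega> f h) = epowr (renyi_integral (rel_order lam \<alpha>) \<Omega> f h) (1 / (\<alpha> * (lam - 1)))"
  "eexp (- renyi_div (rel_order lam \<alpha>) \<Omega> f h) = epowr (renyi_integral (rel_order lam \<alpha>) \<Omega> f h) (1 / (\<alpha> * (1 - lam)))"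
  unfolding renyi_div_def rel_order_def by (simp_all add: eexp_eln)
qed

text \<open>The inequality is weighted AM-GM. Its equality case needs no calculus: applied to s =
  sqrt z and squared, the inequality gains l (1 - l) (s - 1)^2 over the claim for \<open>z\<close>,
  so equality forces s = 1.\<close>

lemma bernoulli_powr_lt:
 fixes z l :: real
 assumes "0 < z" "0 < l" "l < 1"
 shows "z powr l \<le> l * z + (1 - l)" "z powr l = l * z + (1 - l) \<longleftrightarrow> z = 1"
proof -
 have y: "x powr l \<le> l * x + (1 - l)" if "0 < x" for x :: real
  using Youngs_inequality_0[of l "1 - l" x 1] assms that by simp
 then show "z powr l \<le> l * z + (1 - l)" using assms by simp
 show "z powr l = l * z + (1 - l) \<longleftrightarrow> z = 1"
 proof
  assume eq: "z powr l = l * z + (1 - l)"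
  define s where "s = sqrt z"
  have s: "0 < s" "z = s * s" using assms by (auto simp: s_def)
  have "z powr l = (s powr l)\<^sup>2" using s by (simp add: powr_mult power2_eq_square)
  also have "\<dots> \<le> (l * s + (1 - l))\<^sup>2" using y[OF s(1)] by (intro power_mono) auto
  also have "\<dots> = l * z + (1 - l) - l * (1 - l) * (s - 1)\<^sup>2"
   unfolding s(2) by (simp add: power2_eq_square algebra_simps)
  finally have "l * (1 - l) * (s - 1)\<^sup>2 \<le> 0" using eq by simp
  then have "(s - 1)\<^sup>2 \<le> 0" using assms by (simp add: mult_le_0_iff not_le)
  then show "z = 1" using s by simp
 qed simp
qed

text \<open>Reduces to the exponent 1/l < 1 with z^l in place of z.\<close>

lemma bernoulli_powr_gt:
 fixes z l :: real
 assumes "0 < z" "1 < l"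
 shows "l * z \<le> z powr l + (l - 1)" "l * z = z powr l + (l - 1) \<longleftrightarrow> z = 1"
proof -
 have z: "(z powr l) powr (1 / l) = z" using assms by (simp add: powr_powr)
 have eq: "l * (1 / l * z powr l + (1 - 1 / l)) = z powr l + (l - 1)" using assms by (simp add: field_simps)
 show "l * z \<le> z powr l + (l - 1)"
  using bernoulli_powr_lt(1)[of "z powr l" "1 / l"] assms mult_left_mono[of z _ l] unfolding z eq[symmetric] by simp
 show "l * z = z powr l + (l - 1) \<longleftrightarrow> z = 1"
 proof
  assume "l * z = z powr l + (l - 1)"
  then have "z = 1 / l * z powr l + (1 - 1 / l)" unfolding eq[symmetric] using assms by simp
  then have "z powr l = 1" using bernoulli_powr_lt(2)[of "z powr l" "1 / l"] assms unfolding z by simp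
  then show "z = 1" using z by simp
 qed simp
qed

lemma young_powr_gt:
 fixes u v l :: real
 assumes "0 < u" "0 \<le> v" "1 < l"
 shows "l * (u * v powr (l - 1)) \<le> u powr l + (l - 1) * v powr l"
  "l * (u * v powr (l - 1)) = u powr l + (l - 1) * v powr l \<longleftrightarrow> u = v" proof -
 have "l * (u * v powr (l - 1)) \<le> u powr l + (l - 1) * v powr l \<and>
  (l * (u * v powr (l - 1)) = u powr l + (l - 1) * v powr l \<longleftrightarrow> u = v)"
 proof (cases "v = 0")
  case True
  then show ?thesis using assms by auto
 next
  case False
  then have v: "0 < v" using assms by simp
  then have *: "l * (u * v powr (l - 1)) = v powr l * (l * (u / v))"
   "u powr l + (l - 1) * v powr l = v powr l * ((u / v) powr l + (l - 1))"
   using assms by (auto simp: powr_divide powr_diff field_simps)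
  have "0 < v powr l" using v by simp
  then show ?thesis unfolding * mult_cancel_left mult_le_cancel_left_pos[OF \<open>0 < v powr l\<close>]
   using bernoulli_powr_gt[of "u / v" l] assms v by auto
 qed
 then show "l * (u * v powr (l - 1)) \<le> u powr l + (l - 1) * v powr l"
  "l * (u * v powr (l - 1)) = u powr l + (l - 1) * v powr l \<longleftrightarrow> u = v" by auto
qed

text \<open>Here \<open>v\<close> has to be positive: \<open>0 powr (l - 1)\<close> is 0 and not
  infinite, and the inequality would fail.\<close>

lemma young_powr_lt:
 fixes u v l :: real
 assumes "0 < u" "0 < v" "0 < l" "l < 1"
 shows "u powr l \<le> l * (u * v powr (l - 1)) + (1 - l) * v powr l"
  "u powr l = l * (u * v powr (l - 1)) + (1 - l) * v powr l \<longleftrightarrow> u = v" proof -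
 have *: "u powr l = v powr l * (u / v) powr l"
  "l * (u * v powr (l - 1)) + (1 - l) * v powr l = v powr l * (l * (u / v) + (1 - l))"
  using assms by (auto simp: powr_divide powr_diff field_simps)
 show "u powr l \<le> l * (u * v powr (l - 1)) + (1 - l) * v powr l"
  "u powr l = l * (u * v powr (l - 1)) + (1 - l) * v powr l \<longleftrightarrow> u = v"
  unfolding * using bernoulli_powr_lt[of "u / v" l] assms by (auto intro!: mult_left_mono)
qed

text \<open>The tangent inequality for the power \<open>l\<close> at v = G(Y/t)/t, integrated
  against \<open>w\<close>. In the mixed term G^(l-1) is replaced by \<open>E\<close>, its
  continuation by a formula whose integral \<open>m\<close> is determined by the moment alone; where
  G vanishes \<open>E\<close> is nonpositive, which only helps when l > 1. The hypothesis
  \<open>push\<close> is an inequality because \<open>Y / t\<close> need not fill the support of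
  \<open>G\<close>.\<close>

lemma moment_entropy_core:
 fixes M :: "'a measure" and R w Y :: "'a \<Rightarrow> real" and G E :: "real \<Rightarrow> real"
 assumes [measurable]: "R \<in> borel_measurable M" "w \<in> borel_measurable M" "Y \<in> borel_measurable M"
   "G \<in> borelfun" "E \<in> borelfun"
  and Rpos: "\<And>x. x \<in> space M \<Longrightarrow> 0 < R x" and wpos: "\<And>x. x \<in> space M \<Longrightarrow> 0 < w x"
  and Gnn: "\<And>v. 0 \<le> G v"
  and l: "0 < l" "l \<noteq> 1" and t: "0 < t" and m: "0 \<le> m"
  and push: "(\<integral>\<^sup>+x. ennreal (G (Y x / t) powr l) * ennreal (w x) \<partial>M) \<le> ennreal (t * m)"
  and EG: "AE x in M. (0 < G (Y x / t) \<and> E (Y x / t) = G (Y x / t) powr (l - 1)) \<or>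
    (1 < l \<and> G (Y x / t) = 0 \<and> E (Y x / t) \<le> 0)"
  and int: "has_bochner_integral M (\<lambda>x. R x * w x * E (Y x / t)) m"
 defines "I \<equiv> \<integral>\<^sup>+x. ennreal (R x powr l * w x) \<partial>M"
 shows "1 < l \<Longrightarrow> ennreal (t powr (1 - l) * m) \<le> I"
  and "l < 1 \<Longrightarrow> I \<le> ennreal (t powr (1 - l) * m)"
  and "I = ennreal (t powr (1 - l) * m) \<Longrightarrow> AE x in M. R x = G (Y x / t) / t"
proof -
 define T where "T = t powr (1 - l) * m"
 define v where "v x = G (Y x / t) / t" for x
 define V where "V x = v x powr l * w x" for x
 define A where "A x = t powr (1 - l) * (R x * w x * E (Y x / t))" for x
 define X where "X x = R x powr l * w x" for x
 have [measurable]: "v \<in> borel_measurable M" "V \<in> borel_measurable M" "A \<in> borel_measurable M" "X \<in> borel_measurable M"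
  unfolding v_def V_def A_def X_def by measurable
 have T0: "0 \<le> T" using t m by (simp add: T_def)
 have v0: "0 \<le> v x" for x using Gnn t by (simp add: v_def)
 have V0: "0 \<le> V x" if "x \<in> space M" for x using wpos[OF that] by (simp add: V_def)
 have X0: "0 < X x" if "x \<in> space M" for x using Rpos[OF that] wpos[OF that] by (simp add: X_def)
 have "(\<integral>\<^sup>+x. ennreal (V x) \<partial>M) = (\<integral>\<^sup>+x. ennreal (t powr (-l)) * (ennreal (G (Y x / t) powr l) * ennreal (w x)) \<partial>M)"
  using t Gnn wpos
  by (intro nn_integral_cong) (auto simp: V_def v_def powr_divide powr_minus ennreal_mult[symmetric] field_simps less_imp_le)
 also have "\<dots> = ennreal (t powr (-l)) * (\<integral>\<^sup>+x. (ennreal (G (Y x / t) powr l) * ennreal (w x)) \<partial>M)"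
  by (rule nn_integral_cmult) measurable
 also have "\<dots> \<le> ennreal (t powr (-l)) * ennreal (t * m)" by (rule mult_left_mono[OF push]) simp
 also have "\<dots> = ennreal T" proof -
  have "t powr (- l) * t = t powr (1 - l)" using t by (simp add: powr_diff powr_minus field_simps)
  then show ?thesis using t m by (simp add: T_def ennreal_mult[symmetric] mult.assoc[symmetric])
 qed
 finally have Vle: "(\<integral>\<^sup>+x. ennreal (V x) \<partial>M) \<le> ennreal T" .
 have Vint: "integrable M V" using Vle V0 by (intro integrableI_nonneg) (auto intro: le_less_trans)
 have VT: "(\<integral>x. V x \<partial>M) \<le> T" using Vle T0 nn_integral_eq_integral[OF Vint] V0 by simp
 have Aint: "has_bochner_integral M A T" unfolding A_def T_def using int by (rule has_bochner_integral_mult_right)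
 have I: "I = (\<integral>\<^sup>+x. ennreal (X x) \<partial>M)" unfolding I_def X_def ..
 have vE: "v x powr (l - 1) = t powr (1 - l) * G (Y x / t) powr (l - 1)" for x proof -
  have "t powr (1 - l) = inverse (t powr (l - 1))" by (metis minus_diff_eq powr_minus)
  moreover have "v x powr (l - 1) = G (Y x / t) powr (l - 1) / t powr (l - 1)"
   using t Gnn[of "Y x / t"] unfolding v_def by (simp add: powr_divide)
  ultimately show ?thesis by (simp add: divide_inverse)
 qed
 have gt: "ennreal T \<le> I \<and> (I = ennreal T \<longrightarrow> (AE x in M. R x = v x))" if l1: "1 < l"
 proof (cases "I = \<infinity>")
  case True
  then show ?thesis by simp
 next
  case False
  then have Xint: "integrable M X" using X0 by (intro integrableI_nonneg) (auto simp: I less_top less_imp_le)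
  have IX: "I = ennreal (\<integral>x. X x \<partial>M)"
   unfolding I by (rule nn_integral_eq_integral[OF Xint]) (auto intro: less_imp_le[OF X0])
  define D where "D x = X x + (l - 1) * V x - l * A x" for x
  have D: "AE x in M. 0 \<le> D x \<and> (D x = 0 \<longrightarrow> R x = v x)" using EG AE_space
  proof eventually_elim
   case (elim x)
   note R = Rpos[OF elim(2)] and w = wpos[OF elim(2)]
   show ?case
   proof (cases "0 < G (Y x / t)")
    case True
    then have "A x = w x * (R x * v x powr (l - 1))" using elim by (auto simp: A_def vE)
    then have D: "D x = w x * (R x powr l + (l - 1) * v x powr l - l * (R x * v x powr (l - 1)))"
     by (simp add: D_def X_def V_def algebra_simps)
    show ?thesis using young_powr_gt[OF R v0[of x] l1] w unfolding D by auto
   next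
    case False
    \<comment> \<open>Off the support the inequality is strict, so equality of the integrals also
      excludes that \<open>Y / t\<close> leaves the support on a set of positive measure.\<close>
    then have G0: "G (Y x / t) = 0" "E (Y x / t) \<le> 0" using elim Gnn[of "Y x / t"] by auto
    then have "A x \<le> 0" unfolding A_def using R w t by (intro mult_nonneg_nonpos) auto
    moreover have "V x = 0" using G0 by (simp add: V_def v_def)
    ultimately have "0 < D x" using X0[OF elim(2)] l1 mult_nonneg_nonpos[of l "A x"] by (simp add: D_def)
    then show ?thesis by simp
   qed
  qed
  have Dint: "has_bochner_integral M D ((\<integral>x. X x \<partial>M) + (l - 1) * (\<integral>x. V x \<partial>M) - l * T)"
   unfolding D_def
   by (intro has_bochner_integral_add has_bochner_integral_diff has_bochner_integral_mult_right Aint has_bochner_integral_integrable Vint Xint)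
  then have "0 \<le> (\<integral>x. X x \<partial>M) + (l - 1) * (\<integral>x. V x \<partial>M) - l * T"
   using D integral_nonneg_AE[of D M] by (auto simp: has_bochner_integral_iff)
  moreover have VT': "(l - 1) * (\<integral>x. V x \<partial>M) \<le> (l - 1) * T" using VT l1 by simp
  ultimately have XT: "T \<le> (\<integral>x. X x \<partial>M)" by (simp add: algebra_simps)
  have "AE x in M. R x = v x" if "I = ennreal T" proof -
   have "(\<integral>x. X x \<partial>M) = T" using that XT T0 unfolding IX by simp
   then have "(\<integral>x. D x \<partial>M) \<le> 0" using Dint VT' by (auto simp: has_bochner_integral_iff algebra_simps)
   moreover have "0 \<le> (\<integral>x. D x \<partial>M)" using D by (intro integral_nonneg_AE) auto
   ultimately have "(\<integral>x. D x \<partial>M) = 0" by simp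
   then have "AE x in M. D x = 0"
    using D Dint by (subst (asm) integral_nonneg_eq_0_iff_AE) (auto simp: has_bochner_integral_iff)
   with D show ?thesis by eventually_elim auto
  qed
  then show ?thesis using XT by (simp add: IX ennreal_leI)
 qed
 have lt: "I \<le> ennreal T \<and> (I = ennreal T \<longrightarrow> (AE x in M. R x = v x))" if l1: "l < 1" proof -
  define D where "D x = l * A x + (1 - l) * V x - X x" for x
  have D: "AE x in M. 0 \<le> D x \<and> (D x = 0 \<longrightarrow> R x = v x)" using EG AE_space
  proof eventually_elim
   case (elim x)
   note R = Rpos[OF elim(2)] and w = wpos[OF elim(2)]
   have G: "0 < G (Y x / t)" "E (Y x / t) = G (Y x / t) powr (l - 1)" using elim l1 by auto
   then have v: "0 < v x" using t by (simp add: v_def)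
   have "A x = w x * (R x * v x powr (l - 1))" using G by (auto simp: A_def vE)
   then have D: "D x = w x * (l * (R x * v x powr (l - 1)) + (1 - l) * v x powr l - R x powr l)"
    by (simp add: D_def X_def V_def algebra_simps)
   show ?case using young_powr_lt[OF R v l(1) l1] w unfolding D by auto
  qed
  have AV: "has_bochner_integral M (\<lambda>x. l * A x + (1 - l) * V x) (l * T + (1 - l) * (\<integral>x. V x \<partial>M))"
   by (intro has_bochner_integral_add has_bochner_integral_diff has_bochner_integral_mult_right Aint has_bochner_integral_integrable Vint)
  \<comment> \<open>For l < 1 finiteness of the entropy integral is a consequence: D \<ge> 0 bounds
    its integrand by integrable terms.\<close>
  have Xint: "integrable M X"
  proof (rule Bochner_Integration.integrable_bound)
   show "integrable M (\<lambda>x. l * A x + (1 - l) * V x)" using AV by (simp add: has_bochner_integral_iff)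
   show "AE x in M. norm (X x) \<le> norm (l * A x + (1 - l) * V x)"
    using D AE_space by eventually_elim (use X0 in \<open>force simp: D_def\<close>)
  qed simp
  have IX: "I = ennreal (\<integral>x. X x \<partial>M)"
   unfolding I by (rule nn_integral_eq_integral[OF Xint]) (auto intro: less_imp_le[OF X0])
  have Dint: "has_bochner_integral M D (l * T + (1 - l) * (\<integral>x. V x \<partial>M) - (\<integral>x. X x \<partial>M))"
   unfolding D_def by (intro has_bochner_integral_diff AV has_bochner_integral_integrable Xint)
  then have "0 \<le> l * T + (1 - l) * (\<integral>x. V x \<partial>M) - (\<integral>x. X x \<partial>M)"
   using D integral_nonneg_AE[of D M] by (auto simp: has_bochner_integral_iff)
  moreover have VT': "(1 - l) * (\<integral>x. V x \<partial>M) \<le> (1 - l) * T" using VT l1 by simp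
  ultimately have XT: "(\<integral>x. X x \<partial>M) \<le> T" by (simp add: algebra_simps)
  have "AE x in M. R x = v x" if "I = ennreal T" proof -
   have "0 \<le> (\<integral>x. X x \<partial>M)" by (intro integral_nonneg_AE AE_I2) (auto intro: less_imp_le[OF X0])
   then have "(\<integral>x. X x \<partial>M) = T" using that T0 unfolding IX by simp
   then have "(\<integral>x. D x \<partial>M) \<le> 0" using Dint VT' by (auto simp: has_bochner_integral_iff algebra_simps)
   moreover have "0 \<le> (\<integral>x. D x \<partial>M)" using D by (intro integral_nonneg_AE) auto
   ultimately have "(\<integral>x. D x \<partial>M) = 0" by simp
   then have "AE x in M. D x = 0"
    using D Dint by (subst (asm) integral_nonneg_eq_0_iff_AE) (auto simp: has_bochner_integral_iff)
   with D show ?thesis by eventually_elim auto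
  qed
  then show ?thesis using XT by (simp add: IX ennreal_leI)
 qed
 show "1 < l \<Longrightarrow> ennreal (t powr (1 - l) * m) \<le> I" using gt unfolding T_def by auto
 show "l < 1 \<Longrightarrow> I \<le> ennreal (t powr (1 - l) * m)" using lt unfolding T_def by auto
 show "I = ennreal (t powr (1 - l) * m) \<Longrightarrow> AE x in M. R x = G (Y x / t) / t"
  using gt lt l unfolding T_def v_def by (cases "l < 1") auto
qed

section \<open>Moments of positive order and the geometric mean\<close>

lemma gen_sigma_powr:
 assumes "0 < q" "\<And>x. x \<in> S \<Longrightarrow> 0 \<le> f x"
 shows "gen_sigma (ereal q) \<alpha> S f (\<lambda>x. ennreal \<bar>y x\<bar>) = epowr (NN x:S. ennreal (\<bar>y x\<bar> powr q * f x)) (1 / (q * \<alpha>))"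
proof -
 have "gen_moment q S f (\<lambda>x. ennreal \<bar>y x\<bar>) = (NN x:S. ennreal (\<bar>y x\<bar> powr q * f x))"
  unfolding gen_moment_def using assms
  by (intro nn_integral_cong) (auto simp: epowr_nonneg ennreal_mult indicator_def)
 then show ?thesis using assms by (simp add: gen_sigma_def)
qed

lemma eln_abs: "y \<noteq> 0 \<Longrightarrow> eln (ennreal \<bar>y\<bar>) = ereal (ln \<bar>y\<bar>)"
 by (simp add: eln_def)

text \<open>At 0 the real \<open>ln\<close> has the value 0 but \<open>eln\<close> has the value
  -\<infinity>, hence the hypothesis that the zeros of \<open>y\<close> form a null set.\<close>

lemma ext_integral_ln:
 assumes "AE x in lborel. x \<in> S \<longrightarrow> y x \<noteq> 0" "\<And>x. x \<in> S \<Longrightarrow> 0 \<le> f x"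
 shows "ext_integral S f (\<lambda>x. eln (ennreal \<bar>y x\<bar>)) =
  enn2ereal (NN x:S. ennreal (f x * ln \<bar>y x\<bar>)) - enn2ereal (NN x:S. ennreal (- (f x * ln \<bar>y x\<bar>)))"
proof -
 have 1: "AE x in lborel. ennreal (f x) * e2ennreal (eln (ennreal \<bar>y x\<bar>)) * indicator S x = ennreal (f x * ln \<bar>y x\<bar>) * indicator S x"
  using assms(1)
 proof eventually_elim
  case (elim x)
  then show ?case by (cases "x \<in> S") (auto simp: eln_abs ennreal_mult'[symmetric] assms(2))
 qed
 have 2: "AE x in lborel. ennreal (f x) * e2ennreal (- eln (ennreal \<bar>y x\<bar>)) * indicator S x = ennreal (- (f x * ln \<bar>y x\<bar>)) * indicator S x"
  using assms(1)
 proof eventually_elim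
  case (elim x)
  have "ennreal (f x) * ennreal (- ln \<bar>y x\<bar>) = ennreal (- (f x * ln \<bar>y x\<bar>))" if "x \<in> S"
   using assms(2)[OF that] by (simp add: ennreal_mult'[symmetric])
  then show ?case using elim by (cases "x \<in> S") (auto simp: eln_abs)
 qed
 note 1[THEN nn_integral_cong_AE] 2[THEN nn_integral_cong_AE]
 then show ?thesis unfolding ext_integral_def by simp
qed

text \<open>Lets the order 0 be handled by Bochner integrals like the other orders. The third part
  serves to show that the moment is never 0.\<close>

lemma gen_sigma_0:
 fixes f y :: "real \<Rightarrow> real"
 assumes S [measurable]: "S \<in> sets borel" and [measurable]: "f \<in> borelfun"
  and ym [measurable]: "(\<lambda>x. indicator S x * y x) \<in> borelfun"
  and ne: "AE x in lborel. x \<in> S \<longrightarrow> y x \<noteq> 0" and nn: "\<And>x. x \<in> S \<Longrightarrow> 0 \<le> f x" and \<alpha>: "0 < \<alpha>"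
 shows "has_bochner_integral lborel (\<lambda>x. indicator S x * f x * ln \<bar>y x\<bar>) \<mu> \<Longrightarrow>
   gen_sigma 0 \<alpha> S f (\<lambda>x. ennreal \<bar>y x\<bar>) = ennreal (exp (\<mu> / \<alpha>))" (is "?int \<Longrightarrow> _")
  and "gen_sigma 0 \<alpha> S f (\<lambda>x. ennreal \<bar>y x\<bar>) = ennreal s \<Longrightarrow> 0 < s \<Longrightarrow>
   has_bochner_integral lborel (\<lambda>x. indicator S x * f x * ln \<bar>y x\<bar>) (\<alpha> * ln s)"
  and "gen_sigma 0 \<alpha> S f (\<lambda>x. ennreal \<bar>y x\<bar>) = 0 \<Longrightarrow> (NN x:S. ennreal (- (f x * ln \<bar>y x\<bar>))) = \<infinity>"
proof -
 define g where "g x = indicator S x * f x * ln \<bar>y x\<bar>" for x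
 have g: "g x = indicator S x * f x * ln \<bar>indicator S x * y x\<bar>" for x by (auto simp: g_def indicator_def)
 have [measurable]: "g \<in> borelfun" unfolding g by measurable
 define P where "P = (NN x:S. ennreal (f x * ln \<bar>y x\<bar>))"
 define N where "N = (NN x:S. ennreal (- (f x * ln \<bar>y x\<bar>)))"
 have P: "P = (NN x. ennreal (g x))" and N: "N = (NN x. ennreal (- g x))"
  unfolding P_def N_def g_def by (auto intro!: nn_integral_cong simp: indicator_def)
 have sig: "gen_sigma 0 \<alpha> S f (\<lambda>x. ennreal \<bar>y x\<bar>) = eexp (ereal (1 / \<alpha>) * (enn2ereal P - enn2ereal N))"
  unfolding gen_sigma_def P_def N_def using ext_integral_ln[OF ne nn] by simp
 have fin: "has_bochner_integral lborel g (p - n)" if "P = ennreal p" "N = ennreal n" "0 \<le> p" "0 \<le> n" for p n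
 proof -
  have int: "integrable lborel g" using that P N unfolding real_integrable_def by simp
  have "integral\<^sup>L lborel g = p - n" using real_lebesgue_integral_def[OF int] that P N by simp
  with int show ?thesis by (simp add: has_bochner_integral_iff)
 qed
 show "gen_sigma 0 \<alpha> S f (\<lambda>x. ennreal \<bar>y x\<bar>) = ennreal (exp (\<mu> / \<alpha>))" if ?int
 proof -
  have int: "integrable lborel g" "integral\<^sup>L lborel g = \<mu>"
   using that unfolding g_def[symmetric] by (auto simp: has_bochner_integral_iff)
  obtain p n where pn: "P = ennreal p" "N = ennreal n" "0 \<le> p" "0 \<le> n"
   using integrableE[OF int(1)] unfolding P N by metis
  have "p - n = \<mu>" using fin[OF pn] int by (simp add: has_bochner_integral_iff)
  then show ?thesis unfolding sig pn using pn by (simp add: eexp_def)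
 qed
 show "has_bochner_integral lborel (\<lambda>x. indicator S x * f x * ln \<bar>y x\<bar>) (\<alpha> * ln s)"
  if s: "gen_sigma 0 \<alpha> S f (\<lambda>x. ennreal \<bar>y x\<bar>) = ennreal s" "0 < s" proof -
  have eq: "eexp (ereal (1 / \<alpha>) * (enn2ereal P - enn2ereal N)) = ennreal s" using s unfolding sig by simp
  \<comment> \<open>In \<open>ereal\<close> even \<infinity> - \<infinity> is \<infinity>, so an
    infinite positive part makes the value infinite whatever the negative part is.\<close>
  have "P \<noteq> \<infinity>"
  proof
   assume "P = \<infinity>" then show False using eq \<alpha> by (simp add: eexp_def)
  qed
  then obtain p where p: "P = ennreal p" "0 \<le> p" by (cases P) auto
  have "N \<noteq> \<infinity>"
  proof
   assume "N = \<infinity>" then show False using eq \<alpha> p s by (simp add: eexp_def)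
  qed
  then obtain n where n: "N = ennreal n" "0 \<le> n" by (cases N) auto
  have "exp ((p - n) / \<alpha>) = s" using eq s p n by (simp add: eexp_def)
  then have "ln s = (p - n) / \<alpha>" by (metis ln_exp)
  then have "p - n = \<alpha> * ln s" using \<alpha> by simp
  then show ?thesis using fin[OF p(1) n(1) p(2) n(2)] unfolding g_def by simp
 qed
 show "(NN x:S. ennreal (- (f x * ln \<bar>y x\<bar>))) = \<infinity>" if "gen_sigma 0 \<alpha> S f (\<lambda>x. ennreal \<bar>y x\<bar>) = 0"
 proof (rule ccontr)
  assume "\<not> ?thesis"
  then obtain n where n: "N = ennreal n" "0 \<le> n" unfolding N_def[symmetric] by (cases N) auto
  then show False using that \<alpha> unfolding sig by (cases P) (auto simp: eexp_def)
 qed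
qed

section \<open>Stretched Gaussians\<close>

text \<open>The parameter range of (i). The Stam part uses it with \<open>l\<close> in place of
  \<lambda>.\<close>

definition me_range :: "real \<Rightarrow> real \<Rightarrow> bool" where
 "me_range p lam \<longleftrightarrow> 0 \<le> hconj p \<and> 1 / (1 + hconj p) < ereal lam \<and> lam \<noteq> 1"

text \<open>The three regimes p' = \<infinity>, p' = 0 and 0 < p' < \<infinity> of the conjugate
  exponent. In the last one the lower bound on \<lambda> becomes 1 < \<lambda> (1 + q), which for
  \<lambda> < 1 is integrability of the profile with its moment at infinity.\<close>

lemma me_range_cases:
 assumes "me_range p lam"
 obtains (one) "p = 1" "hconj p = \<infinity>" "0 < lam" "lam \<noteq> 1"
  | (zero) "p = 0" "hconj p = 0" "1 < lam"
  | (powr) q where "p \<noteq> 0" "p \<noteq> 1" "q = p / (p - 1)" "hconj p = ereal q" "0 < q" "1 < lam * (1 + q)" "0 < lam" "lam \<noteq> 1"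
proof -
 consider "p = 1" | "p = 0" | "p \<noteq> 0" "p \<noteq> 1" by auto
 then show thesis
 proof cases
  case 1
  then show thesis using assms by (intro one) (auto simp: me_range_def hconj_def)
 next
  case 2
  then show thesis using assms by (intro zero) (auto simp: me_range_def hconj_def one_ereal_def)
 next
  case 3
  define q where "q = p / (p - 1)"
  have h: "hconj p = ereal q" using 3 by (simp add: hconj_def q_def)
  have "0 \<le> q" using assms unfolding me_range_def h by simp
  moreover have "q \<noteq> 0" using 3 by (simp add: q_def)
  ultimately have q: "0 < q" by simp
  then have *: "1 / (1 + q) < lam" using assms unfolding me_range_def h by (simp add: one_ereal_def)
  then have l: "1 < lam * (1 + q)" using q by (simp add: field_simps)
  have "0 < lam" using order.strict_trans[OF _ *, of 0] q by simp
  then show thesis using assms q l h q_def 3 by (intro powr) (auto simp: me_range_def)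
 qed
qed

lemma me_rangeD: "me_range p lam \<Longrightarrow> 0 < lam" "me_range p lam \<Longrightarrow> lam \<noteq> 1"
 by (auto elim: me_range_cases)

lemma integrable_even:
 fixes g :: "real \<Rightarrow> real"
 assumes [measurable]: "g \<in> borelfun"
  and "integrable lborel (\<lambda>x. indicator {0..} x * g x)"
 shows "integrable lborel (\<lambda>x. g \<bar>x\<bar>)"
proof -
 have "integrable lborel (\<lambda>x. indicator {0..} (0 + (-1) * x) * g (0 + (-1) * x))"
  using assms(2) by (subst lborel_integrable_real_affine_iff) auto
 then have "integrable lborel (\<lambda>x. \<bar>indicator {0..} x * g x\<bar> + \<bar>indicator {0..} (- x) * g (- x)\<bar>)"
  using assms(2) by (intro Bochner_Integration.integrable_add) (auto intro: integrable_abs simp del: abs_mult)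
 then show ?thesis by (rule Bochner_Integration.integrable_bound) (auto simp: indicator_def abs_if)
qed

lemma integrable_of_has_integral:
 fixes g :: "real \<Rightarrow> real"
 assumes [measurable]: "g \<in> borelfun" "A \<in> sets borel"
  and "(g has_integral I) A" "\<And>x. x \<in> A \<Longrightarrow> 0 \<le> g x"
 shows "integrable lborel (\<lambda>x. indicator A x * g x)"
proof (rule integrableI_nonneg)
 have "(NN x. ennreal (indicator A x * g x)) = (NN x. ennreal (g x) * indicator A x)"
  by (intro nn_integral_cong) (auto simp: indicator_def)
 also have "\<dots> = ennreal I" using assms by (intro nn_integral_has_integral_lebesgue')
 finally show "(NN x. ennreal (indicator A x * g x)) < \<infinity>" by simp
qed (use assms in \<open>auto simp: indicator_def\<close>)

lemma integrable_powr_tail: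
 assumes "e < - 1"
 shows "integrable lborel (\<lambda>x::real. indicator {1..} \<bar>x\<bar> * \<bar>x\<bar> powr e)"
proof (rule integrable_even)
 have "integrable lborel (\<lambda>x. indicator {1..} x * x powr e)"
  by (rule integrable_of_has_integral[OF _ _ has_integral_powr_to_inf]) (use assms in auto)
 then show "integrable lborel (\<lambda>x. indicator {0..} x * (indicator {1..} x * x powr e))"
  by (rule Bochner_Integration.integrable_bound) (auto simp: indicator_def)
qed simp

lemma integrable_powr_zero:
 assumes "- 1 < e"
 shows "integrable lborel (\<lambda>x::real. indicator {0..1} \<bar>x\<bar> * \<bar>x\<bar> powr e)"
proof (rule integrable_even)
 have "integrable lborel (\<lambda>x::real. indicator {0..1} x * x powr e)"
  by (rule integrable_of_has_integral[OF _ _ has_integral_powr_from_0]) (use assms in auto)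
 then show "integrable lborel (\<lambda>x. indicator {0..} x * (indicator {0..1} x * x powr e))"
  by (rule Bochner_Integration.integrable_bound) (auto simp: indicator_def)
qed simp

lemma stretched_profile_measurable [measurable]: "stretched_profile p lam \<in> borelfun"
proof -
 have "stretched_profile 1 lam = (\<lambda>x. if \<bar>x\<bar> < 1 then 1 else 0)"
  "stretched_profile 0 lam = (\<lambda>x. if x = 0 then 1 else max 0 (- ln \<bar>x\<bar>) powr (1 / (lam - 1)))"
  "p \<noteq> 0 \<Longrightarrow> p \<noteq> 1 \<Longrightarrow> lam = 1 \<Longrightarrow> stretched_profile p lam = (\<lambda>x. exp (- (\<bar>x\<bar> powr (p / (p - 1)))))"
  "p \<noteq> 0 \<Longrightarrow> p \<noteq> 1 \<Longrightarrow> lam \<noteq> 1 \<Longrightarrow> stretched_profile p lam = (\<lambda>x. max 0 (1 + (1 - lam) * \<bar>x\<bar> powr (p / (p - 1))) powr (1 / (lam - 1)))"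
  by (auto simp: stretched_profile_def fun_eq_iff)
 note * = this
 consider "p = 1" | "p = 0" | "p \<noteq> 0" "p \<noteq> 1" "lam = 1" | "p \<noteq> 0" "p \<noteq> 1" "lam \<noteq> 1" by auto
 then show ?thesis
 proof cases
  case 3
  then have "stretched_profile p lam = (\<lambda>x. exp (- (\<bar>x\<bar> powr (p / (p - 1)))))" by (rule *(3))
  then show ?thesis by (simp only:) measurable
 qed (simp_all add: *)
qed

lemma stretched_profile_nonneg: "0 \<le> stretched_profile p lam x"
 by (auto simp: stretched_profile_def)

text \<open>The power \<open>\<lambda> - 1\<close> of the profile, continued by its formula off the support.\<close>

definition profile_base :: "real \<Rightarrow> real \<Rightarrow> real \<Rightarrow> real" where
 "profile_base p lam x =
   (if p = 1 then 1 else if p = 0 then - ln \<bar>x\<bar> else 1 + (1 - lam) * \<bar>x\<bar> powr (p / (p - 1)))"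

lemma profile_base_measurable [measurable]: "profile_base p lam \<in> borelfun"
proof -
 have "profile_base 1 lam = (\<lambda>x. 1)" "profile_base 0 lam = (\<lambda>x. - ln \<bar>x\<bar>)"
  "p \<noteq> 0 \<Longrightarrow> p \<noteq> 1 \<Longrightarrow> profile_base p lam = (\<lambda>x. 1 + (1 - lam) * \<bar>x\<bar> powr (p / (p - 1)))"
  by (auto simp: profile_base_def fun_eq_iff)
 then show ?thesis by (cases "p = 1"; cases "p = 0") simp_all
qed

lemma profile_base_powr:
 assumes "lam \<noteq> 1" "p = 0 \<Longrightarrow> x \<noteq> 0" "0 < stretched_profile p lam x"
 shows "stretched_profile p lam x powr (lam - 1) = profile_base p lam x"
  "0 < profile_base p lam x" proof -
 consider "p = 1" | "p = 0" | "p \<noteq> 0" "p \<noteq> 1" by auto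
 then have "stretched_profile p lam x powr (lam - 1) = profile_base p lam x \<and> 0 < profile_base p lam x"
 proof cases
  case 1
  then show ?thesis using assms by (simp add: stretched_profile_def profile_base_def split: if_splits)
 next
  case 2
  then show ?thesis using assms by (auto simp: stretched_profile_def profile_base_def powr_powr max_def split: if_splits)
 next
  case 3
  then show ?thesis using assms by (auto simp: stretched_profile_def profile_base_def powr_powr max_def split: if_splits)
 qed
 then show "stretched_profile p lam x powr (lam - 1) = profile_base p lam x" "0 < profile_base p lam x" by auto
qed

text \<open>Supplies the sign that the comparison needs where the profile vanishes. For p = 1 it
  fails, the base being constantly 1; there the essential supremum keeps the coordinate inside the
  support instead.\<close>

lemma profile_base_nonpos:
 assumes "p \<noteq> 1" "p = 0 \<Longrightarrow> x \<noteq> 0" "lam \<noteq> 1" "stretched_profile p lam x = 0"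
 shows "profile_base p lam x \<le> 0"
 using assms by (auto simp: stretched_profile_def profile_base_def max_def split: if_splits)

lemma stretched_profile_integrable:
 assumes "me_range p lam"
 shows "integrable lborel (stretched_profile p lam)"
  "p = 0 \<Longrightarrow> integrable lborel (\<lambda>x. stretched_profile p lam x * ln \<bar>x\<bar>)"
  "p \<noteq> 0 \<Longrightarrow> p \<noteq> 1 \<Longrightarrow> integrable lborel (\<lambda>x. stretched_profile p lam x * \<bar>x\<bar> powr (p / (p - 1)))"
proof -
 have *: "integrable lborel (stretched_profile p lam) \<and>
  (p = 0 \<longrightarrow> integrable lborel (\<lambda>x. stretched_profile p lam x * ln \<bar>x\<bar>)) \<and>
  (p \<noteq> 0 \<longrightarrow> p \<noteq> 1 \<longrightarrow> integrable lborel (\<lambda>x. stretched_profile p lam x * \<bar>x\<bar> powr (p / (p - 1))))"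
  using assms
 proof (cases rule: me_range_cases)
  case one
  have "stretched_profile p lam = (\<lambda>x. indicator {-1<..<1} x * 1)"
   using one by (auto simp: stretched_profile_def fun_eq_iff indicator_def abs_less_iff)
  then show ?thesis using one by simp
 next
  case zero
  define r where "r = 1 / (lam - 1)"
  have r: "0 < r" using zero by (simp add: r_def)
  \<comment> \<open>A logarithm is dominated by every power; the exponent 1/(2 k) is chosen so that
    its k-th power costs |x|^(-1/2), which is integrable at 0.\<close>
  have bound: "L powr k \<le> (2 * k) powr k * \<bar>x\<bar> powr (- (1 / 2))" if k: "0 < k" and L: "L = - ln \<bar>x\<bar>" and x: "0 < \<bar>x\<bar>" "\<bar>x\<bar> < 1" for L k and x :: real
  proof -
   have 1: "L = ln (1 / \<bar>x\<bar>)" using x by (simp add: L ln_div)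
   have "L \<le> (1 / \<bar>x\<bar>) powr (1 / (2 * k)) / (1 / (2 * k))"
    unfolding 1 using x k by (intro ln_powr_bound) auto
   moreover have "0 \<le> L" using x by (simp add: L)
   ultimately have "L powr k \<le> ((1 / \<bar>x\<bar>) powr (1 / (2 * k)) / (1 / (2 * k))) powr k"
    using k by (intro powr_mono2) auto
   also have "\<dots> = (2 * k) powr k * \<bar>x\<bar> powr (- (1 / 2))"
    using k x by (simp add: powr_divide powr_mult powr_powr powr_minus field_simps)
   finally show ?thesis .
  qed
  define D where "D x = indicator {0..1} \<bar>x\<bar> * \<bar>x\<bar> powr (- (1/2))" for x :: real
  have D: "integrable lborel D" unfolding D_def by (rule integrable_powr_zero) simp
  have prof: "stretched_profile p lam x = max 0 (- ln \<bar>x\<bar>) powr r" if "x \<noteq> 0" for x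
   using that zero by (simp add: stretched_profile_def r_def)
  have "integrable lborel (stretched_profile p lam)"
  proof (rule Bochner_Integration.integrable_bound)
   show "integrable lborel (\<lambda>x. (2 * r) powr r * D x)" using D by simp
   show "AE x in lborel. norm (stretched_profile p lam x) \<le> norm ((2 * r) powr r * D x)"
    using AE_lborel_singleton[of 0]
   proof eventually_elim
    case (elim x)
    then show ?case using bound[OF r refl, of x]
     by (cases "\<bar>x\<bar> < 1") (auto simp: prof D_def max_def indicator_def)
   qed
  qed simp
  moreover have "integrable lborel (\<lambda>x. stretched_profile p lam x * ln \<bar>x\<bar>)"
  proof (rule Bochner_Integration.integrable_bound)
   show "integrable lborel (\<lambda>x. (2 * (r + 1)) powr (r + 1) * D x)" using D by simp
   show "AE x in lborel. norm (stretched_profile p lam x * ln \<bar>x\<bar>) \<le> norm ((2 * (r + 1)) powr (r + 1) * D x)"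
    using AE_lborel_singleton[of 0]
   proof eventually_elim
    case (elim x)
    then have "\<bar>x\<bar> < 1 \<Longrightarrow> (- ln \<bar>x\<bar>) powr r * (- ln \<bar>x\<bar>) = (- ln \<bar>x\<bar>) powr (r + 1)"
     by (simp add: powr_add)
    then show ?case using bound[OF _ refl, of "r + 1" x] r elim
     by (cases "\<bar>x\<bar> < 1") (auto simp: prof D_def max_def indicator_def abs_mult)
   qed
  qed simp
  ultimately show ?thesis using zero by simp
 next
  case (powr q)
  have prof: "stretched_profile p lam x = max 0 (1 + (1 - lam) * \<bar>x\<bar> powr q) powr (1 / (lam - 1))" for x
   using powr by (simp add: stretched_profile_def)
  \<comment> \<open>One function that dominates both the profile and the integrand of its
    moment.\<close>
  define B where "B x = (1 + \<bar>x\<bar> powr q) * stretched_profile p lam x" for x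
  have [measurable]: "B \<in> borelfun" unfolding B_def by measurable
  have "integrable lborel B"
  proof (cases "1 < lam")
   case True
   \<comment> \<open>The radius at which 1 + (1 - \<lambda>) |x|^q vanishes.\<close>
   define \<rho> where "\<rho> = (1 / (lam - 1)) powr (1 / q)"
   have "norm (B x) \<le> norm (indicator {-\<rho>..\<rho>} x * (1 + \<rho> powr q))" for x
   proof (cases "1 + (1 - lam) * \<bar>x\<bar> powr q \<le> 0")
    case True
    then show ?thesis by (simp add: B_def prof max_def)
   next
    case False
    then have "\<bar>x\<bar> powr q < 1 / (lam - 1)" using \<open>1 < lam\<close> by (simp add: field_simps)
    then have "(\<bar>x\<bar> powr q) powr (1 / q) \<le> \<rho>"
     unfolding \<rho>_def using \<open>0 < q\<close> by (intro powr_mono2) (auto simp del: powr(3))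
    then have x: "\<bar>x\<bar> \<le> \<rho>" using powr by (simp add: powr_powr)
    have "stretched_profile p lam x \<le> 1 powr (1 / (lam - 1))"
     unfolding prof using \<open>1 < lam\<close> by (intro powr_mono2) (auto simp: mult_nonpos_nonneg)
    moreover have "\<bar>x\<bar> powr q \<le> \<rho> powr q" using x powr by (intro powr_mono2) auto
    ultimately have "B x \<le> (1 + \<rho> powr q) * 1" unfolding B_def
     by (intro mult_mono) (auto simp: stretched_profile_nonneg add_nonneg_nonneg)
    moreover have "0 \<le> B x" unfolding B_def
     by (intro mult_nonneg_nonneg) (auto simp: stretched_profile_nonneg add_nonneg_nonneg)
    ultimately show ?thesis using x by (auto simp: indicator_def)
   qed
   then have "AE x in lborel. norm (B x) \<le> norm (indicator {-\<rho>..\<rho>} x * (1 + \<rho> powr q))" by (rule AE_I2)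
   moreover have "integrable lborel (\<lambda>x. indicator {-\<rho>..\<rho>} x * (1 + \<rho> powr q))"
    by (intro integrable_mult_left integrable_real_indicator) (auto simp: emeasure_lborel_Icc_eq)
   moreover have "B \<in> borel_measurable lborel" by simp
   ultimately show ?thesis using Bochner_Integration.integrable_bound by blast
  next
   case False
   then have lam: "0 < lam" "lam < 1" using powr by auto
   define a where "a = 1 - lam"
   have a: "0 < a" "a < 1" using lam by (auto simp: a_def)
   \<comment> \<open>The decay exponent q/a - q of \<open>B\<close>. That it exceeds 1 is the
     condition \<lambda> (1 + q) > 1.\<close>
   define k where "k = q * (lam / (1 - lam))"
   have k: "1 < k" using powr lam by (simp add: k_def field_simps)
   have Beq: "B x = (1 + \<bar>x\<bar> powr q) * (1 + a * \<bar>x\<bar> powr q) powr (- (1 / a))" for x proof -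
    have "1 / (lam - 1) = - (1 / a)" by (metis a_def minus_diff_eq minus_divide_right)
    moreover have "0 \<le> a * \<bar>x\<bar> powr q" using a by simp
    ultimately show ?thesis by (simp add: B_def prof a_def max_def)
   qed
   have B0: "0 \<le> B x" for x unfolding Beq by (intro mult_nonneg_nonneg) (auto simp: add_nonneg_nonneg)
   have B1: "B x \<le> 1 / a * (1 + a * \<bar>x\<bar> powr q) powr (- (lam / (1 - lam)))" for x proof -
    have pos: "0 < 1 + a * \<bar>x\<bar> powr q" using a by (simp add: add_pos_nonneg)
    have "1 + \<bar>x\<bar> powr q \<le> 1 / a * (1 + a * \<bar>x\<bar> powr q)" using a by (simp add: field_simps)
    then have "B x \<le> 1 / a * (1 + a * \<bar>x\<bar> powr q) * (1 + a * \<bar>x\<bar> powr q) powr (- (1 / a))"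
     unfolding Beq by (intro mult_right_mono) auto
    also have "\<dots> = 1 / a * (1 + a * \<bar>x\<bar> powr q) powr (1 + - (1 / a))"
     using pos by (subst powr_add) simp
    also have "1 + - (1 / a) = - (lam / (1 - lam))" using lam by (simp add: a_def field_simps)
    finally show ?thesis .
   qed
   have le: "norm (B x) \<le> norm (1 / a * (indicator {-1..1} x + a powr (- (lam / (1 - lam))) * (indicator {1..} \<bar>x\<bar> * \<bar>x\<bar> powr (- k))))" for x
   proof (cases "\<bar>x\<bar> < 1")
    case True
    have "(1 + a * \<bar>x\<bar> powr q) powr (- (lam / (1 - lam))) \<le> 1 powr (- (lam / (1 - lam)))"
     using a lam by (intro powr_mono2') auto
    then have "B x \<le> 1 / a" using order.trans[OF B1[of x]] a by (simp add: divide_right_mono)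
    also have "1 / a \<le> 1 / a * (indicator {-1..1} x + a powr (- (lam / (1 - lam))) * (indicator {1..} \<bar>x\<bar> * \<bar>x\<bar> powr (- k)))"
     using True a by (auto simp: indicator_def abs_less_iff)
    finally show ?thesis using B0[of x] a by simp
   next
    case False
    have "0 < a * \<bar>x\<bar> powr q" using a False by (intro mult_pos_pos) auto
    then have "(1 + a * \<bar>x\<bar> powr q) powr (- (lam / (1 - lam))) \<le> (a * \<bar>x\<bar> powr q) powr (- (lam / (1 - lam)))"
     using lam by (intro powr_mono2') simp_all
    also have "\<dots> = a powr (- (lam / (1 - lam))) * \<bar>x\<bar> powr (- k)"
     using a by (simp add: powr_mult powr_powr k_def)
    finally have "B x \<le> 1 / a * (a powr (- (lam / (1 - lam))) * \<bar>x\<bar> powr (- k))"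
     using a by (intro order.trans[OF B1[of x]] mult_left_mono) auto
    moreover have "\<dots> \<le> 1 / a * (indicator {-1..1} x + a powr (- (lam / (1 - lam))) * (indicator {1..} \<bar>x\<bar> * \<bar>x\<bar> powr (- k)))"
     using a False by (intro mult_left_mono) (auto simp: indicator_def)
    ultimately have "B x \<le> 1 / a * (indicator {-1..1} x + a powr (- (lam / (1 - lam))) * (indicator {1..} \<bar>x\<bar> * \<bar>x\<bar> powr (- k)))" by linarith
    then show ?thesis using B0[of x] a by simp
   qed
   have "integrable lborel (\<lambda>x::real. indicator {1..} \<bar>x\<bar> * \<bar>x\<bar> powr (- k))"
    using k by (intro integrable_powr_tail) simp
   then have "integrable lborel (\<lambda>x. 1 / a * (indicator {-1..1} x + a powr (- (lam / (1 - lam))) * (indicator {1..} \<bar>x\<bar> * \<bar>x\<bar> powr (- k))))"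
    by (intro integrable_mult_right Bochner_Integration.integrable_add) auto
   then show ?thesis by (rule Bochner_Integration.integrable_bound) (use le in auto)
  qed
  have le: "stretched_profile p lam x \<le> B x" "stretched_profile p lam x * \<bar>x\<bar> powr q \<le> B x" for x
   by (auto simp: B_def stretched_profile_nonneg algebra_simps)
  from \<open>integrable lborel B\<close> have "integrable lborel (stretched_profile p lam)"
   by (rule Bochner_Integration.integrable_bound)
    (auto simp: stretched_profile_nonneg intro!: AE_I2 order.trans[OF le(1)])
  moreover from \<open>integrable lborel B\<close> have "integrable lborel (\<lambda>x. stretched_profile p lam x * \<bar>x\<bar> powr q)"
  proof (rule Bochner_Integration.integrable_bound)
   show "AE x in lborel. norm (stretched_profile p lam x * \<bar>x\<bar> powr q) \<le> norm (B x)"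
    using le(2) stretched_profile_nonneg by (intro AE_I2) (simp add: abs_mult order.trans[OF _ abs_ge_self])
  qed measurable
  ultimately have "integrable lborel (stretched_profile p lam) \<and> integrable lborel (\<lambda>x. stretched_profile p lam x * \<bar>x\<bar> powr q)"
   by blast
  then show ?thesis using powr by simp
 qed
 then show "integrable lborel (stretched_profile p lam)"
  "p = 0 \<Longrightarrow> integrable lborel (\<lambda>x. stretched_profile p lam x * ln \<bar>x\<bar>)"
  "p \<noteq> 0 \<Longrightarrow> p \<noteq> 1 \<Longrightarrow> integrable lborel (\<lambda>x. stretched_profile p lam x * \<bar>x\<bar> powr (p / (p - 1)))"
  by auto
qed

lemma stretched_profile_support:
 assumes "me_range p lam"
 obtains \<rho> where "0 < \<rho>" "support (stretched_profile p lam) = ivl (- \<rho>) \<rho>"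
 using assms
proof (cases rule: me_range_cases)
 case one
 then have "support (stretched_profile p lam) = ivl (- 1) 1"
  by (auto simp: support_def stretched_profile_def einterval_iff one_ereal_def)
 then show thesis using that[of 1] by simp
next
 case zero
 have "support (stretched_profile p lam) = {-1<..<1}"
  using zero by (auto simp: support_def stretched_profile_def max_def split: if_splits)
 then show thesis using that[of 1] by (simp add: one_ereal_def)
next
 case (powr q)
 have prof: "stretched_profile p lam x = max 0 (1 + (1 - lam) * \<bar>x\<bar> powr q) powr (1 / (lam - 1))" for x
  using powr by (simp add: stretched_profile_def)
 show thesis
 proof (cases "1 < lam")
  case True
  define \<rho> where "\<rho> = (1 / (lam - 1)) powr (1 / q)"
  have \<rho>: "0 < \<rho>" "\<rho> powr q = 1 / (lam - 1)" using True \<open>0 < q\<close> unfolding \<rho>_def by (auto simp: powr_powr simp del: powr(3))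
  have "0 < stretched_profile p lam x \<longleftrightarrow> \<bar>x\<bar> < \<rho>" for x proof -
   have "0 < stretched_profile p lam x \<longleftrightarrow> 0 < 1 + (1 - lam) * \<bar>x\<bar> powr q"
    by (auto simp: prof max_def)
   also have "\<dots> \<longleftrightarrow> \<bar>x\<bar> powr q < \<rho> powr q"
    unfolding \<rho> using True by (simp add: field_simps)
   also have "\<dots> \<longleftrightarrow> \<bar>x\<bar> < \<rho>"
    using \<rho> \<open>0 < q\<close> by (metis abs_ge_zero less_imp_le not_le powr_less_mono2 powr_mono2)
   finally show ?thesis .
  qed
  then have "support (stretched_profile p lam) = {-\<rho><..<\<rho>}"
   unfolding support_def set_eq_iff mem_Collect_eq greaterThanLessThan_iff abs_less_iff by simp linarith
  then show thesis using that[of "ereal \<rho>"] \<rho> by simp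
 next
  case False
  have "0 < stretched_profile p lam x" for x proof -
   have "0 \<le> (1 - lam) * \<bar>x\<bar> powr q" using False by simp
   then show ?thesis unfolding prof by (simp add: max_def)
  qed
  then show thesis using that[of \<infinity>] by (simp add: support_def)
 qed
qed

lemma profile_integral_pos:
 assumes "me_range p lam"
 shows "0 < (LINT x|lborel. stretched_profile p lam x)"
proof -
 obtain \<rho> where \<rho>: "0 < \<rho>" "support (stretched_profile p lam) = ivl (- \<rho>) \<rho>"
  using stretched_profile_support[OF assms] .
 have "0 < (NN x:UNIV. ennreal (stretched_profile p lam x))" proof -
  have "- \<rho> < \<rho>" using \<rho> by (cases \<rho>) auto
  then obtain x where "x \<in> ivl (- \<rho>) \<rho>" using einterval_nonempty by blast
  then obtain s t where "s \<in> ivl (- \<rho>) \<rho>" "t \<in> ivl (- \<rho>) \<rho>" "s < x" "x < t"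
   using einterval_two_sided by blast
  moreover from this einterval_Icc_subset have "{s..t} \<subseteq> support (stretched_profile p lam)" unfolding \<rho> by blast
  ultimately show ?thesis by (intro einterval_nn_integral_pos[of _ s t]) (auto simp: support_def subset_iff)
 qed
 also have "\<dots> = ennreal (LINT x|lborel. stretched_profile p lam x)"
  using stretched_profile_integrable(1)[OF assms] by (simp add: nn_integral_eq_integral stretched_profile_nonneg)
 finally show ?thesis by simp
qed

lemma stretched_gaussian_measurable [measurable]: "stretched_gaussian p lam \<in> borelfun"
 unfolding stretched_gaussian_def[abs_def] by measurable

text \<open>The power \<lambda> - 1 of the normalized Gaussian G, continued by its formula beyond
  the support. It is affine in |x|^q, or in log |x| for p = 0, and constant for p = 1; so its
  integral against a density depends on that density only through the moment.\<close>

definition gaussian_base :: "real \<Rightarrow> real \<Rightarrow> real \<Rightarrow> real" where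
 "gaussian_base p lam x = (1 / (LINT t|lborel. stretched_profile p lam t)) powr (lam - 1) * profile_base p lam x"

lemma gaussian_base_measurable [measurable]: "gaussian_base p lam \<in> borelfun"
 unfolding gaussian_base_def[abs_def] by measurable

text \<open>The integral of G^\<lambda>, written through the base so that it is visibly determined
  by the moment of G.\<close>

definition gaussian_mass :: "real \<Rightarrow> real \<Rightarrow> real" where
 "gaussian_mass p lam = (LINT x|lborel. stretched_gaussian p lam x * gaussian_base p lam x)"

definition gaussian_sigma :: "real \<Rightarrow> real \<Rightarrow> real" where
 "gaussian_sigma p lam = enn2real (sigma (hconj p) (stretched_gaussian p lam))"

context
 fixes p lam :: real
 assumes range: "me_range p lam"
begin

lemma support_stretched_gaussian: "support (stretched_gaussian p lam) = support (stretched_profile p lam)"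
 using profile_integral_pos[OF range]
 by (auto simp: support_def stretched_gaussian_def zero_less_divide_iff stretched_profile_nonneg not_less)

lemma stretched_gaussian_nonneg: "0 \<le> stretched_gaussian p lam x"
 using profile_integral_pos[OF range] by (simp add: stretched_gaussian_def stretched_profile_nonneg)

lemma stretched_gaussian_integral: "has_bochner_integral lborel (stretched_gaussian p lam) 1"
 using stretched_profile_integrable(1)[OF range] profile_integral_pos[OF range]
 unfolding stretched_gaussian_def[abs_def] has_bochner_integral_iff by simp

lemma stretched_gaussian_nn_integral: "(NN x. ennreal (stretched_gaussian p lam x)) = 1"
 using stretched_gaussian_integral stretched_gaussian_nonneg
 by (simp add: has_bochner_integral_iff nn_integral_eq_integral)

lemma gaussian_base_powr:
 assumes "p = 0 \<Longrightarrow> x \<noteq> 0"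
 shows "0 < stretched_gaussian p lam x \<Longrightarrow> stretched_gaussian p lam x powr (lam - 1) = gaussian_base p lam x"
  "0 < stretched_gaussian p lam x \<Longrightarrow> 0 < gaussian_base p lam x"
  "stretched_gaussian p lam x = 0 \<Longrightarrow> p \<noteq> 1 \<Longrightarrow> 1 < lam \<and> gaussian_base p lam x \<le> 0"
proof -
 define c where "c = 1 / (LINT t|lborel. stretched_profile p lam t)"
 have c: "0 < c" "stretched_gaussian p lam x = c * stretched_profile p lam x"
  using profile_integral_pos[OF range] by (auto simp: c_def stretched_gaussian_def)
 have b: "gaussian_base p lam x = c powr (lam - 1) * profile_base p lam x" by (simp add: gaussian_base_def c_def)
 have l: "lam \<noteq> 1" using range by (rule me_rangeD)
 show "0 < stretched_gaussian p lam x \<Longrightarrow> stretched_gaussian p lam x powr (lam - 1) = gaussian_base p lam x"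
  "0 < stretched_gaussian p lam x \<Longrightarrow> 0 < gaussian_base p lam x"
  using profile_base_powr[of lam p x, OF l assms] c unfolding b
  by (auto simp: powr_mult zero_less_mult_iff stretched_profile_nonneg)
 assume z: "stretched_gaussian p lam x = 0" "p \<noteq> 1"
 then have z': "stretched_profile p lam x = 0" using c by simp
 have "1 < lam" using range
 proof (cases rule: me_range_cases)
  case (powr q)
  show ?thesis
  proof (rule ccontr)
   assume "\<not> 1 < lam"
   then have "0 \<le> (1 - lam) * \<bar>x\<bar> powr q" by simp
   then show False using z' powr by (simp add: stretched_profile_def max_def split: if_splits)
  qed
 qed (use z in auto)
 then show "1 < lam \<and> gaussian_base p lam x \<le> 0"
  using profile_base_nonpos[of p x lam, OF z(2) assms l z'] c unfolding b by (auto intro: mult_nonneg_nonpos)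
qed

lemma gaussian_mass_integral:
 "has_bochner_integral lborel (\<lambda>x. stretched_gaussian p lam x * gaussian_base p lam x) (gaussian_mass p lam)"
proof -
 define Z where "Z = (LINT t|lborel. stretched_profile p lam t)"
 have "integrable lborel (\<lambda>x. stretched_profile p lam x * profile_base p lam x)" using range
 proof (cases rule: me_range_cases)
  case one
  then show ?thesis using stretched_profile_integrable(1)[OF range] by (simp add: profile_base_def)
 next
  case zero
  then show ?thesis using stretched_profile_integrable(2)[OF range] by (simp add: profile_base_def)
 next
  case (powr q)
  then have "integrable lborel (\<lambda>x. stretched_profile p lam x + (1 - lam) * (stretched_profile p lam x * \<bar>x\<bar> powr q))"
   using stretched_profile_integrable(1,3)[OF range] by simp
  then show ?thesis using powr by (simp add: profile_base_def algebra_simps)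
 qed
 then have "integrable lborel (\<lambda>x. (1 / Z) powr (lam - 1) / Z * (stretched_profile p lam x * profile_base p lam x))"
  by simp
 then show ?thesis unfolding has_bochner_integral_iff gaussian_mass_def
  by (simp add: gaussian_base_def stretched_gaussian_def Z_def mult_ac)
qed

lemma gaussian_mass_nn_integral:
 "(NN x. ennreal (stretched_gaussian p lam x powr lam)) = ennreal (gaussian_mass p lam)"
 "(NN x:support (stretched_gaussian p lam). ennreal (stretched_gaussian p lam x powr lam)) = ennreal (gaussian_mass p lam)"
 "0 < gaussian_mass p lam" proof -
 have AE: "AE x in lborel. stretched_gaussian p lam x powr lam = stretched_gaussian p lam x * gaussian_base p lam x"
  using AE_lborel_singleton[of 0]
 proof eventually_elim
  case (elim x)
  show ?case
  proof (cases "0 < stretched_gaussian p lam x")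
   case True
   have "stretched_gaussian p lam x powr lam = stretched_gaussian p lam x powr 1 * stretched_gaussian p lam x powr (lam - 1)"
    using powr_add[of "stretched_gaussian p lam x" 1 "lam - 1"] by simp
   then show ?thesis using True gaussian_base_powr(1)[of x] elim by simp
  qed (use stretched_gaussian_nonneg[of x] me_rangeD[OF range] in auto)
 qed
 have "(NN x. ennreal (stretched_gaussian p lam x powr lam)) = (NN x. ennreal (stretched_gaussian p lam x * gaussian_base p lam x))"
  using AE by (intro nn_integral_cong_AE) auto
 also have "\<dots> = ennreal (gaussian_mass p lam)" proof -
  have "AE x in lborel. 0 \<le> stretched_gaussian p lam x * gaussian_base p lam x"
   using AE by eventually_elim (metis powr_ge_zero)
  then show ?thesis using gaussian_mass_integral by (simp add: nn_integral_eq_integral has_bochner_integral_iff)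
 qed
 finally show 1: "(NN x. ennreal (stretched_gaussian p lam x powr lam)) = ennreal (gaussian_mass p lam)" .
 have "(NN x:support (stretched_gaussian p lam). ennreal (stretched_gaussian p lam x powr lam))
  = (NN x. ennreal (stretched_gaussian p lam x powr lam))"
  using stretched_gaussian_nonneg me_rangeD[OF range] by (intro nn_integral_cong) (auto simp: indicator_def support_def not_less dest: antisym)
 with 1 show "(NN x:support (stretched_gaussian p lam). ennreal (stretched_gaussian p lam x powr lam)) = ennreal (gaussian_mass p lam)"
  by simp
 have "(NN x. ennreal (stretched_gaussian p lam x powr lam)) \<noteq> 0"
 proof
  assume "(NN x. ennreal (stretched_gaussian p lam x powr lam)) = 0"
  then have "AE x in lborel. ennreal (stretched_gaussian p lam x powr lam) = 0"
   by (subst (asm) nn_integral_0_iff_AE) auto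
  then have "AE x in lborel. ennreal (stretched_gaussian p lam x) = 0" by eventually_elim auto
  then have "(NN x. ennreal (stretched_gaussian p lam x)) = 0" by (subst nn_integral_0_iff_AE) auto
  then show False using stretched_gaussian_nn_integral by simp
 qed
 then show "0 < gaussian_mass p lam" unfolding 1 by (simp add: ennreal_eq_0_iff)
qed

end

lemma base_integral_powr:
 assumes "has_bochner_integral lborel u 1" "has_bochner_integral lborel (\<lambda>x. u x * \<bar>y x\<bar> powr q) (\<mu>::real)" "0 < t"
 shows "has_bochner_integral lborel (\<lambda>x. u x * (C * (1 + k * \<bar>y x / t\<bar> powr q))) (C * (1 + k * (\<mu> / t powr q)))"
proof -
 have "has_bochner_integral lborel (\<lambda>x. C * (u x + k * (u x * \<bar>y x\<bar> powr q / t powr q))) (C * (1 + k * (\<mu> / t powr q)))"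
  using assms by (intro has_bochner_integral_mult_right has_bochner_integral_add has_bochner_integral_divide)
 moreover have "(\<lambda>x. C * (u x + k * (u x * \<bar>y x\<bar> powr q / t powr q))) = (\<lambda>x. u x * (C * (1 + k * \<bar>y x / t\<bar> powr q)))"
  using assms(3) by (auto simp: powr_divide algebra_simps)
 ultimately show ?thesis by simp
qed

lemma base_integral_ln:
 fixes y :: "real \<Rightarrow> real"
 assumes "has_bochner_integral lborel u 1" "has_bochner_integral lborel (\<lambda>x. u x * ln \<bar>y x\<bar>) (\<mu>::real)" "0 < t"
  and ne: "AE x in lborel. u x \<noteq> 0 \<longrightarrow> y x \<noteq> 0"
  and m: "(\<lambda>x. u x * (C * (- ln \<bar>y x / t\<bar>))) \<in> borel_measurable lborel"
 shows "has_bochner_integral lborel (\<lambda>x. u x * (C * (- ln \<bar>y x / t\<bar>))) (C * (ln t - \<mu>))"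
proof -
 have 1: "has_bochner_integral lborel (\<lambda>x. C * (u x * ln t - u x * ln \<bar>y x\<bar>)) (C * (1 * ln t - \<mu>))"
  using assms by (intro has_bochner_integral_mult_right has_bochner_integral_diff has_bochner_integral_mult_left)
 have "AE x in lborel. u x * (C * (- ln \<bar>y x / t\<bar>)) = C * (u x * ln t - u x * ln \<bar>y x\<bar>)" using ne
 proof eventually_elim
  case (elim x)
  show ?case
  proof (cases "u x = 0")
   case False
   then have "y x \<noteq> 0" using elim by simp
   moreover have "\<bar>y x / t\<bar> = \<bar>y x\<bar> / t" using assms(3) by simp
   ultimately have "ln \<bar>y x / t\<bar> = ln \<bar>y x\<bar> - ln t" using assms(3) by (simp add: ln_div del: abs_divide)
   then have ln: "- ln \<bar>y x / t\<bar> = ln t - ln \<bar>y x\<bar>" by simp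
   show ?thesis unfolding ln by (simp add: algebra_simps)
  qed auto
 qed
 from has_bochner_integral_cong_AE[THEN iffD2, OF _ _ this 1] m 1 show ?thesis
  by (simp add: borel_measurable_has_bochner_integral)
qed

lemma esssup_density_le:
 fixes f :: "real \<Rightarrow> real" and A :: "real \<Rightarrow> ennreal"
 assumes [measurable]: "S \<in> sets borel" "f \<in> borelfun"
  and [measurable]: "(\<lambda>x. A x * indicator S x) \<in> borelfun"
  and AE: "AE x in lborel. x \<in> S \<longrightarrow> A x \<le> c"
 shows "esssup (density lborel (\<lambda>x. ennreal (f x) * indicator S x)) (\<lambda>x. A x * indicator S x) \<le> c"
proof (rule esssup_I)
 show "AE x in density lborel (\<lambda>x. ennreal (f x) * indicator S x). A x * indicator S x \<le> c"
  using AE by (subst AE_density) (auto elim!: eventually_mono simp: indicator_def)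
qed simp

lemma AE_le_esssup_density:
 fixes f :: "real \<Rightarrow> real" and A :: "real \<Rightarrow> ennreal"
 assumes [measurable]: "S \<in> sets borel" "f \<in> borelfun"
  and pos: "\<And>x. x \<in> S \<Longrightarrow> 0 < f x"
 shows "AE x in lborel. x \<in> S \<longrightarrow> A x \<le> esssup (density lborel (\<lambda>x. ennreal (f x) * indicator S x)) (\<lambda>x. A x * indicator S x)"
proof -
 have "AE x in density lborel (\<lambda>x. ennreal (f x) * indicator S x).
  A x * indicator S x \<le> esssup (density lborel (\<lambda>x. ennreal (f x) * indicator S x)) (\<lambda>x. A x * indicator S x)"
  by (rule esssup_AE)
 then show ?thesis by (subst (asm) AE_density) (auto elim!: eventually_mono simp: indicator_def pos)
qed

lemma gen_sigma_cong:
 assumes "\<And>x. x \<in> S \<Longrightarrow> A x = B x"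
 shows "gen_sigma q \<alpha> S f A = gen_sigma q \<alpha> S f B"
proof -
 have 1: "(\<lambda>x. A x * indicator S x) = (\<lambda>x. B x * indicator S x)"
  using assms by (auto simp: indicator_def)
 have 2: "ext_integral S f (\<lambda>x. eln (A x)) = ext_integral S f (\<lambda>x. eln (B x))"
  unfolding ext_integral_def by (intro arg_cong2[where f = minus] arg_cong[where f = enn2ereal] nn_integral_cong) (auto simp: indicator_def assms)
 have 3: "gen_moment r S f A = gen_moment r S f B" for r
  unfolding gen_moment_def by (intro nn_integral_cong) (auto simp: indicator_def assms)
 show ?thesis unfolding gen_sigma_def 1 2 3 ..
qed

section \<open>Moments of the stretched Gaussians in the three regimes\<close>

lemma gaussian_powr_moment:
 assumes "me_range p lam" "p \<noteq> 0" "p \<noteq> 1" "q = p / (p - 1)" "0 < q"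
 obtains \<mu> where "0 < \<mu>" "has_bochner_integral lborel (\<lambda>x. stretched_gaussian p lam x * \<bar>x\<bar> powr q) \<mu>"
  "gaussian_mass p lam = (1 / (LINT t|lborel. stretched_profile p lam t)) powr (lam - 1) * (1 + (1 - lam) * \<mu>)"
  "sigma (hconj p) (stretched_gaussian p lam) = ennreal (\<mu> powr (1 / q))" proof -
 define G where "G = stretched_gaussian p lam"
 have [measurable]: "G \<in> borelfun" unfolding G_def by measurable
 have Gnn: "0 \<le> G x" for x using stretched_gaussian_nonneg[OF assms(1)] by (simp add: G_def)
 define \<mu> where "\<mu> = (LINT x|lborel. G x * \<bar>x\<bar> powr q)"
 have int: "has_bochner_integral lborel (\<lambda>x. G x * \<bar>x\<bar> powr q) \<mu>"
  using stretched_profile_integrable(3)[OF assms(1-3)] assms(4)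
  unfolding has_bochner_integral_iff \<mu>_def G_def stretched_gaussian_def by simp
 have nn: "(NN x. ennreal (G x * \<bar>x\<bar> powr q)) = ennreal \<mu>"
  using int Gnn by (simp add: nn_integral_eq_integral has_bochner_integral_iff)
 have "(NN x. ennreal (G x * \<bar>x\<bar> powr q)) \<noteq> 0"
 proof
  assume "(NN x. ennreal (G x * \<bar>x\<bar> powr q)) = 0"
  then have "AE x in lborel. ennreal (G x * \<bar>x\<bar> powr q) = 0" by (subst (asm) nn_integral_0_iff_AE) auto
  then have "AE x in lborel. ennreal (G x) = 0"
   using AE_lborel_singleton[of 0] by eventually_elim (auto simp: ennreal_eq_0_iff mult_le_0_iff)
  then have "(NN x. ennreal (G x)) = 0" by (subst nn_integral_0_iff_AE) auto
  then show False using stretched_gaussian_nn_integral[OF assms(1)] by (simp add: G_def)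
 qed
 then have \<mu>: "0 < \<mu>" unfolding nn by (simp add: ennreal_eq_0_iff)
 define C where "C = (1 / (LINT t|lborel. stretched_profile p lam t)) powr (lam - 1)"
 have "has_bochner_integral lborel (\<lambda>x. G x * (C * (1 + (1 - lam) * \<bar>x / 1\<bar> powr q))) (C * (1 + (1 - lam) * (\<mu> / 1 powr q)))"
  using stretched_gaussian_integral[OF assms(1)] int unfolding G_def[symmetric] by (rule base_integral_powr) simp
 moreover have "(\<lambda>x. G x * (C * (1 + (1 - lam) * \<bar>x / 1\<bar> powr q))) = (\<lambda>x. G x * gaussian_base p lam x)"
  using assms by (simp add: gaussian_base_def profile_base_def C_def)
 ultimately have mass: "gaussian_mass p lam = C * (1 + (1 - lam) * \<mu>)"
  using has_bochner_integral_eq[OF gaussian_mass_integral[OF assms(1)]] by (simp add: G_def)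
 have h: "hconj p = ereal q" using assms by (simp add: hconj_def)
 have "sigma (hconj p) G = epowr (NN x:UNIV. ennreal (\<bar>x\<bar> powr q * G x)) (1 / (q * 1))"
  unfolding sigma_def h by (rule gen_sigma_powr) (use assms Gnn in auto)
 also have "\<dots> = ennreal (\<mu> powr (1 / q))" using nn \<mu> by (simp add: epowr_ennreal mult.commute)
 finally show thesis using that[OF \<mu>] int mass by (simp add: G_def C_def)
qed

lemma gaussian_ln_moment:
 assumes "me_range 0 lam"
 obtains \<mu> where "has_bochner_integral lborel (\<lambda>x. stretched_gaussian 0 lam x * ln \<bar>x\<bar>) \<mu>"
  "gaussian_mass 0 lam = (1 / (LINT t|lborel. stretched_profile 0 lam t)) powr (lam - 1) * (- \<mu>)"
  "sigma 0 (stretched_gaussian 0 lam) = ennreal (exp \<mu>)" proof -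
 define G where "G = stretched_gaussian 0 lam"
 have [measurable]: "G \<in> borelfun" unfolding G_def by measurable
 have Gnn: "0 \<le> G x" for x using stretched_gaussian_nonneg[OF assms(1)] by (simp add: G_def)
 define \<mu> where "\<mu> = (LINT x|lborel. G x * ln \<bar>x\<bar>)"
 have int: "has_bochner_integral lborel (\<lambda>x. G x * ln \<bar>x\<bar>) \<mu>"
  using stretched_profile_integrable(2)[OF assms(1)]
  unfolding has_bochner_integral_iff \<mu>_def G_def stretched_gaussian_def by simp
 define C where "C = (1 / (LINT t|lborel. stretched_profile 0 lam t)) powr (lam - 1)"
 have "has_bochner_integral lborel (\<lambda>x. G x * (C * (- ln \<bar>x\<bar>))) (C * (- \<mu>))"
  using has_bochner_integral_mult_right[OF int, of "- C"] by (simp add: algebra_simps)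
 moreover have "(\<lambda>x. G x * (C * (- ln \<bar>x\<bar>))) = (\<lambda>x. G x * gaussian_base 0 lam x)"
  using assms by (simp add: gaussian_base_def profile_base_def C_def)
 ultimately have mass: "gaussian_mass 0 lam = C * (- \<mu>)"
  using has_bochner_integral_eq[OF gaussian_mass_integral[OF assms(1)]] by (simp add: G_def)
 have "sigma 0 G = ennreal (exp (\<mu> / 1))" unfolding sigma_def
 proof (rule gen_sigma_0(1))
  show "has_bochner_integral lborel (\<lambda>x. indicator UNIV x * G x * ln \<bar>x\<bar>) \<mu>" using int by simp
  show "AE x::real in lborel. x \<in> UNIV \<longrightarrow> x \<noteq> 0" using AE_lborel_singleton[of 0] by simp
 qed (use Gnn in auto)
 then show thesis using that[OF int[unfolded G_def]] mass by (simp add: G_def C_def)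
qed

lemma gaussian_sup_moment:
 assumes "0 < lam" "lam \<noteq> 1"
 shows "sigma \<infinity> (stretched_gaussian 1 lam) = 1"
  "stretched_gaussian 1 lam = (\<lambda>x. if \<bar>x\<bar> < 1 then 1 / 2 else 0)"
  "gaussian_mass 1 lam = 2 powr (1 - lam)" "gaussian_base 1 lam = (\<lambda>x. 2 powr (1 - lam))" proof -
 have range: "me_range 1 lam" using assms by (simp add: me_range_def hconj_def)
 have prof: "stretched_profile 1 lam = indicator {-1<..<1}"
  by (auto simp: stretched_profile_def fun_eq_iff indicator_def abs_less_iff)
 then have Z: "(LINT t|lborel. stretched_profile 1 lam t) = 2" by simp
 then show G: "stretched_gaussian 1 lam = (\<lambda>x. if \<bar>x\<bar> < 1 then 1 / 2 else 0)"
  by (auto simp: stretched_gaussian_def stretched_profile_def)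
 have "(1 / 2) powr (lam - 1) = (2::real) powr (1 - lam)"
  by (simp add: powr_divide) (metis inverse_eq_divide minus_diff_eq powr_minus)
 then show base: "gaussian_base 1 lam = (\<lambda>x. 2 powr (1 - lam))"
  unfolding gaussian_base_def[abs_def] Z by (simp add: profile_base_def fun_eq_iff)
 have "has_bochner_integral lborel (\<lambda>x. stretched_gaussian 1 lam x * gaussian_base 1 lam x) (1 * 2 powr (1 - lam))"
  unfolding base by (intro has_bochner_integral_mult_left stretched_gaussian_integral range)
 with gaussian_mass_integral[OF range] show "gaussian_mass 1 lam = 2 powr (1 - lam)"
  using has_bochner_integral_eq by fastforce
 define e where "e = esssup (density lborel (\<lambda>x. ennreal (stretched_gaussian 1 lam x) * indicator UNIV x)) (\<lambda>x. ennreal \<bar>x\<bar> * indicator UNIV x)"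
 have eq: "density lborel (\<lambda>x. ennreal (stretched_gaussian 1 lam x) * indicator UNIV x)
   = density lborel (\<lambda>x. ennreal (stretched_gaussian 1 lam x))" by simp
 have "e \<le> 1" unfolding e_def eq using assms by (intro esssup_I) (auto simp: AE_density G)
 \<comment> \<open>A smaller bound would make an interval next to 1 a null set, although the density
   is 1/2 there.\<close>
 moreover have "\<not> e < 1"
 proof
  assume "e < 1"
  then obtain r where r: "e = ennreal r" "0 \<le> r" "r < 1"
   by (cases e) (auto simp: ennreal_less_iff simp flip: ennreal_1)
  have "AE x in density lborel (\<lambda>x. ennreal (stretched_gaussian 1 lam x) * indicator UNIV x). ennreal \<bar>x\<bar> * indicator UNIV x \<le> e"
   unfolding e_def by (rule esssup_AE)
  then have "AE x in lborel. x \<notin> {r<..<1}"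
   unfolding eq by (subst (asm) AE_density) (use r in \<open>auto elim!: eventually_mono simp: G ennreal_le_iff\<close>)
  then have "{r<..<1} \<in> null_sets lborel" using AE_iff_null_sets[of "{r<..<1}" lborel] by simp
  then show False using r by (auto simp: null_sets_def)
 qed
 ultimately have "e = 1" by (simp add: not_less)
 then show "sigma \<infinity> (stretched_gaussian 1 lam) = 1"
  unfolding sigma_def gen_sigma_def e_def[symmetric] by simp
qed

lemma sigma_stretched_gaussian:
 assumes "me_range p lam"
 shows "sigma (hconj p) (stretched_gaussian p lam) = ennreal (gaussian_sigma p lam)" "0 < gaussian_sigma p lam"
proof -
 have "\<exists>s>0. sigma (hconj p) (stretched_gaussian p lam) = ennreal s" using assms
 proof (cases rule: me_range_cases)
  case one
  then show ?thesis using gaussian_sup_moment(1)[of lam] by (intro exI[of _ 1]) simp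
 next
  case zero
  then show ?thesis using gaussian_ln_moment[of lam] assms by (metis exp_gt_zero)
 next
  case (powr q)
  then show ?thesis using gaussian_powr_moment[OF assms powr(1,2,3,5)] by (metis powr_gt_zero less_irrefl)
 qed
 then show "sigma (hconj p) (stretched_gaussian p lam) = ennreal (gaussian_sigma p lam)" "0 < gaussian_sigma p lam"
  by (auto simp: gaussian_sigma_def)
qed

text \<open>\<open>t\<close> is the scale at which \<open>y / t\<close> has the same moment as the
  Gaussian: \<open>s\<close> is defined with the exponent 1/(q \<alpha>), so s^\<alpha> is the
  classical deviation of \<open>y\<close>. Equal moments give equal integrals of the base.\<close>

lemma moment_condition:
 fixes f y :: "real \<Rightarrow> real"
 assumes range: "me_range p lam" and S [measurable]: "S \<in> sets borel" and [measurable]: "f \<in> borelfun"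
  and ym [measurable]: "(\<lambda>x. indicator S x * y x) \<in> borelfun"
  and pos: "\<And>x. x \<in> S \<Longrightarrow> 0 < f x" and f1: "(NN x:S. ennreal (f x)) = 1"
  and ne: "AE x in lborel. x \<in> S \<longrightarrow> y x \<noteq> 0" and \<alpha>: "0 < \<alpha>"
  and s: "gen_sigma (hconj p) \<alpha> S f (\<lambda>x. ennreal \<bar>y x\<bar>) = ennreal s" "0 < s"
 defines "t \<equiv> s powr \<alpha> / gaussian_sigma p lam"
 shows "has_bochner_integral lborel (\<lambda>x. indicator S x * f x * gaussian_base p lam (y x / t)) (gaussian_mass p lam)"
  and "p = 1 \<Longrightarrow> AE x in lborel. x \<in> S \<longrightarrow> \<bar>y x\<bar> \<le> t"
proof -
 have t: "0 < t" using s sigma_stretched_gaussian[OF range] by (simp add: t_def)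
 define u where "u x = indicator S x * f x" for x
 have [measurable]: "u \<in> borelfun" unfolding u_def by measurable
 have u0: "0 \<le> u x" for x using pos[of x] by (auto simp: u_def indicator_def)
 have un: "(NN x. ennreal (u x)) = ennreal 1"
  unfolding ennreal_1 f1[symmetric] by (intro nn_integral_cong) (auto simp: u_def indicator_def)
 have u1: "has_bochner_integral lborel u 1" by (rule has_bochner_integral_nn_integral[OF _ _ _ un]) (use u0 in auto)
 have le1: "AE x in lborel. x \<in> S \<longrightarrow> \<bar>y x\<bar> \<le> t" if "p = 1" proof -
  have h: "hconj p = \<infinity>" using that by (simp add: hconj_def)
  define e where "e = esssup (density lborel (\<lambda>x. ennreal (f x) * indicator S x)) (\<lambda>x. ennreal \<bar>y x\<bar> * indicator S x)"
  have "epowr e (1 / \<alpha>) = ennreal s" using s unfolding h gen_sigma_def e_def by simp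
  then have "epowr (epowr e (1 / \<alpha>)) \<alpha> = ennreal (s powr \<alpha>)" using s by (simp add: epowr_ennreal)
  then have e: "e = ennreal (s powr \<alpha>)"
   using \<alpha> unfolding epowr_epowr by (cases e rule: ennreal_cases_pos) (auto simp: epowr_ennreal)
  have "gaussian_sigma p lam = 1"
   using gaussian_sup_moment(1)[OF me_rangeD[OF range]] that h by (simp add: gaussian_sigma_def)
  then show ?thesis
   using AE_le_esssup_density[of S f "\<lambda>x. ennreal \<bar>y x\<bar>", OF _ _ pos] unfolding e_def[symmetric] e t_def by simp
 qed
 then show "p = 1 \<Longrightarrow> AE x in lborel. x \<in> S \<longrightarrow> \<bar>y x\<bar> \<le> t" .
 show "has_bochner_integral lborel (\<lambda>x. indicator S x * f x * gaussian_base p lam (y x / t)) (gaussian_mass p lam)"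
  using range
 proof (cases rule: me_range_cases)
  case one
  show ?thesis unfolding one gaussian_sup_moment(3,4)[OF one(3,4)]
   using has_bochner_integral_mult_left[OF u1, of "2 powr (1 - lam)"] by (simp add: u_def)
 next
  case zero
  obtain \<mu> where \<mu>: "has_bochner_integral lborel (\<lambda>x. stretched_gaussian 0 lam x * ln \<bar>x\<bar>) \<mu>"
   "gaussian_mass 0 lam = (1 / (LINT t|lborel. stretched_profile 0 lam t)) powr (lam - 1) * (- \<mu>)"
   "sigma 0 (stretched_gaussian 0 lam) = ennreal (exp \<mu>)" using gaussian_ln_moment range zero by metis
  have sig: "gaussian_sigma p lam = exp \<mu>" using \<mu>(3) zero by (simp add: gaussian_sigma_def)
  have lnt: "ln t - \<alpha> * ln s = - \<mu>" using s unfolding t_def sig by (simp add: ln_div ln_powr)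
  have "has_bochner_integral lborel (\<lambda>x. indicator S x * f x * ln \<bar>y x\<bar>) (\<alpha> * ln s)"
   by (rule gen_sigma_0(2)) (use s zero ne \<alpha> pos less_imp_le in auto)
  then have uln: "has_bochner_integral lborel (\<lambda>x. u x * ln \<bar>y x\<bar>) (\<alpha> * ln s)" by (simp add: u_def)
  define C where "C = (1 / (LINT t|lborel. stretched_profile 0 lam t)) powr (lam - 1)"
  have une: "AE x in lborel. u x \<noteq> 0 \<longrightarrow> y x \<noteq> 0" using ne by eventually_elim (auto simp: u_def)
  have "(\<lambda>x. u x * (C * (- ln \<bar>(indicator S x * y x) / t\<bar>))) \<in> borelfun" by measurable
  also have "(\<lambda>x. u x * (C * (- ln \<bar>(indicator S x * y x) / t\<bar>))) = (\<lambda>x. u x * (C * (- ln \<bar>y x / t\<bar>)))"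
   by (auto simp: u_def indicator_def)
  finally have "has_bochner_integral lborel (\<lambda>x. u x * (C * (- ln \<bar>y x / t\<bar>))) (C * (ln t - \<alpha> * ln s))"
   by (intro base_integral_ln[OF u1 uln t une]) simp
  then show ?thesis unfolding lnt using \<mu>(2) by (simp add: C_def zero gaussian_base_def profile_base_def u_def)
 next
  case (powr q)
  obtain \<mu> where \<mu>: "0 < \<mu>" "has_bochner_integral lborel (\<lambda>x. stretched_gaussian p lam x * \<bar>x\<bar> powr q) \<mu>"
   "gaussian_mass p lam = (1 / (LINT t|lborel. stretched_profile p lam t)) powr (lam - 1) * (1 + (1 - lam) * \<mu>)"
   "sigma (hconj p) (stretched_gaussian p lam) = ennreal (\<mu> powr (1 / q))"
   using gaussian_powr_moment[OF range powr(1,2,3,5)] .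
  have sig: "gaussian_sigma p lam = \<mu> powr (1 / q)" using \<mu> by (simp add: gaussian_sigma_def)
  have q: "0 < q" by (rule powr(5))
  have "epowr (NN x:S. ennreal (\<bar>y x\<bar> powr q * f x)) (1 / (q * \<alpha>)) = ennreal s"
   using s(1) gen_sigma_powr[of q S f \<alpha> y, OF q less_imp_le[OF pos]] unfolding powr(4) by simp
  then have "epowr (epowr (NN x:S. ennreal (\<bar>y x\<bar> powr q * f x)) (1 / (q * \<alpha>))) (q * \<alpha>) = ennreal (s powr (q * \<alpha>))"
   using s by (simp add: epowr_ennreal)
  then have 1: "(NN x:S. ennreal (\<bar>y x\<bar> powr q * f x)) = ennreal (s powr (q * \<alpha>))"
   using \<alpha> q unfolding epowr_epowr
   by (cases "NN x:S. ennreal (\<bar>y x\<bar> powr q * f x)" rule: ennreal_cases_pos) (auto simp: epowr_ennreal)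
  have "has_bochner_integral lborel (\<lambda>x. u x * \<bar>y x\<bar> powr q) (s powr (q * \<alpha>))"
  proof (rule has_bochner_integral_nn_integral)
   have "(\<lambda>x. u x * \<bar>indicator S x * y x\<bar> powr q) \<in> borelfun" by measurable
   also have "(\<lambda>x. u x * \<bar>indicator S x * y x\<bar> powr q) = (\<lambda>x. u x * \<bar>y x\<bar> powr q)"
    by (auto simp: u_def indicator_def)
   finally show "\<dots> \<in> borel_measurable lborel" by simp
   show "(NN x. ennreal (u x * \<bar>y x\<bar> powr q)) = ennreal (s powr (q * \<alpha>))"
    unfolding 1[symmetric] by (intro nn_integral_cong) (auto simp: u_def indicator_def mult.commute)
  qed (use u0 in auto)
  from base_integral_powr[OF u1 this t, of "(1 / (LINT t|lborel. stretched_profile p lam t)) powr (lam - 1)" "1 - lam"]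
  have "has_bochner_integral lborel (\<lambda>x. u x * gaussian_base p lam (y x / t))
   ((1 / (LINT t|lborel. stretched_profile p lam t)) powr (lam - 1) * (1 + (1 - lam) * (s powr (q * \<alpha>) / t powr q)))"
   using powr by (simp add: gaussian_base_def profile_base_def)
  moreover have "s powr (q * \<alpha>) / t powr q = \<mu>"
   unfolding t_def sig using s \<mu> q by (simp add: powr_divide powr_powr mult.commute)
  ultimately show ?thesis unfolding \<mu>(3) by (simp add: u_def)
 qed
qed

section \<open>The moment-entropy inequality\<close>

text \<open>The closure adds at most the two end points, where \<open>prob_density_on\<close> leaves
  the value of the density free.\<close>

lemma AE_not_frontier_einterval:
 "AE x in lborel. x \<in> closure (ivl a b) \<longrightarrow> x \<in> ivl a b" proof -
 have "closed {x. a \<le> ereal x \<and> ereal x \<le> b}"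
  by (intro closed_Collect_conj closed_Collect_le continuous_intros)
 moreover have "ivl a b \<subseteq> {x. a \<le> ereal x \<and> ereal x \<le> b}" by (auto simp: einterval_iff)
 ultimately have c: "closure (ivl a b) \<subseteq> {x. a \<le> ereal x \<and> ereal x \<le> b}"
  by (rule closure_minimal[rotated])
 \<comment> \<open>For an infinite end point \<open>real_of_ereal\<close> gives 0; excluding this
   further point does no harm.\<close>
 show ?thesis using AE_lborel_singleton[of "real_of_ereal a"] AE_lborel_singleton[of "real_of_ereal b"]
 proof eventually_elim
  case (elim x)
  show ?case
  proof
   assume "x \<in> closure (ivl a b)"
   then have "a \<le> ereal x" "ereal x \<le> b" using c by auto
   moreover have "a \<noteq> ereal x" "ereal x \<noteq> b" using elim by auto
   ultimately show "x \<in> ivl a b" by (auto simp: einterval_iff less_le)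
  qed
 qed
qed

lemma prob_density_onD:
 assumes "prob_density_on (ivl a b) f"
 shows "f \<in> borelfun" "0 \<le> f x" "x \<in> ivl a b \<Longrightarrow> 0 < f x"
  "(NN x:ivl a b. ennreal (f x)) = 1" proof -
 show "f \<in> borelfun" "0 \<le> f x" "x \<in> ivl a b \<Longrightarrow> 0 < f x"
  using assms by (auto simp: prob_density_on_def)
 have "(NN x:ivl a b. ennreal (f x)) = (NN x. ennreal (f x))" using AE_not_frontier_einterval[of a b] assms
  by (intro nn_integral_cong_AE) (auto elim!: eventually_mono simp: prob_density_on_def indicator_def)
 then show "(NN x:ivl a b. ennreal (f x)) = 1" using assms by (simp add: prob_density_on_def)
qed

lemma prob_density_onI:
 assumes "f \<in> borelfun" "\<And>x. x \<in> ivl a b \<Longrightarrow> 0 < f x" "\<And>x. x \<notin> ivl a b \<Longrightarrow> f x = 0"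
  "(NN x:ivl a b. ennreal (f x)) = 1"
 shows "prob_density_on (ivl a b) f"
proof -
 have "(NN x:ivl a b. ennreal (f x)) = (NN x. ennreal (f x))"
  using assms(3) by (intro nn_integral_cong) (auto simp: indicator_def)
 moreover have "0 \<le> f x" for x using assms(2,3)[of x] by (cases "x \<in> ivl a b") auto
 moreover have "x \<notin> closure (ivl a b) \<Longrightarrow> f x = 0" for x using assms(3) closure_subset by blast
 ultimately show ?thesis using assms by (auto simp: prob_density_on_def)
qed

section \<open>The relative escort transformation\<close>

lemma escort_coordinate:
 assumes "a < b" "prob_density_on (ivl a b) f" "prob_density_on (ivl a b) h" "escort_coord \<alpha> (ivl a b) f h y"
 shows "coordinate a b (\<lambda>x. f x powr (1 - \<alpha>) * h x powr \<alpha>) y"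
proof
 show "(\<lambda>x. f x powr (1 - \<alpha>) * h x powr \<alpha>) \<in> borelfun"
  using assms(2,3)[THEN prob_density_onD(1)] by measurable
 show "0 < f x powr (1 - \<alpha>) * h x powr \<alpha>" if "x \<in> ivl a b" for x
  using prob_density_onD(3)[OF assms(2) that] prob_density_onD(3)[OF assms(3) that] by simp
qed (use assms in \<open>auto simp: escort_coord_def\<close>)

text \<open>With R = (f/h)^\<alpha> and y' = f^(1-\<alpha>) h^\<alpha>, these are R y' = f, which
  makes R a probability density in \<open>y\<close>, the identity of R^\<lambda> y' with the
  integrand of the divergence, and R^((\<alpha>-1)/\<alpha>) y' = h, which fixes the scale of the
  inverse transformation.\<close>

lemma escort_identities:
 fixes f h \<alpha> :: real
 assumes "0 < f" "0 < h"
 shows "(f / h) powr \<alpha> * (f powr (1 - \<alpha>) * h powr \<alpha>) = f"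
  "((f / h) powr \<alpha>) powr lam * (f powr (1 - \<alpha>) * h powr \<alpha>) = f powr rel_order lam \<alpha> * h powr (1 - rel_order lam \<alpha>)"
  "\<alpha> \<noteq> 0 \<Longrightarrow> ((f / h) powr \<alpha>) powr ((\<alpha> - 1) / \<alpha>) * (f powr (1 - \<alpha>) * h powr \<alpha>) = h"
proof -
 have 1: "(f / h) powr k * (f powr (1 - \<alpha>) * h powr \<alpha>) = f powr (k + (1 - \<alpha>)) * h powr (- k + \<alpha>)" for k
 proof -
  have "(f / h) powr k = f powr k * h powr (- k)"
   using assms by (subst powr_divide) (simp_all add: powr_minus divide_inverse)
  then show ?thesis by (simp only: powr_add mult_ac)
 qed
 show "(f / h) powr \<alpha> * (f powr (1 - \<alpha>) * h powr \<alpha>) = f" unfolding 1 using assms by simp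
 have e: "\<alpha> * lam + (1 - \<alpha>) = rel_order lam \<alpha>" "- (\<alpha> * lam) + \<alpha> = 1 - rel_order lam \<alpha>"
  by (simp_all add: rel_order_def algebra_simps)
 then show "((f / h) powr \<alpha>) powr lam * (f powr (1 - \<alpha>) * h powr \<alpha>) = f powr rel_order lam \<alpha> * h powr (1 - rel_order lam \<alpha>)"
  by (simp only: powr_powr 1 e)
 assume "\<alpha> \<noteq> 0"
 then have "\<alpha> * ((\<alpha> - 1) / \<alpha>) = \<alpha> - 1" by simp
 then show "((f / h) powr \<alpha>) powr ((\<alpha> - 1) / \<alpha>) * (f powr (1 - \<alpha>) * h powr \<alpha>) = h"
  unfolding powr_powr 1 using assms by simp
qed

lemma renyi_integral_pos:
 assumes "a < b" "prob_density_on (ivl a b) f" "prob_density_on (ivl a b) h"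
 shows "0 < renyi_integral \<xi> (ivl a b) f h"
proof -
 note [measurable] = assms(2,3)[THEN prob_density_onD(1)]
 obtain x where "x \<in> ivl a b" using einterval_nonempty[OF assms(1)] by auto
 then obtain s t where "s \<in> ivl a b" "t \<in> ivl a b" "s < x" "x < t" by (rule einterval_two_sided)
 moreover from this einterval_Icc_subset have sub: "{s..t} \<subseteq> ivl a b" by blast
 moreover have "0 < f x powr \<xi> * h x powr (1 - \<xi>)" if "x \<in> {s<..<t}" for x
  using prob_density_onD(3)[OF assms(2), of x] prob_density_onD(3)[OF assms(3), of x] sub that by (simp add: subset_iff)
 ultimately show ?thesis unfolding renyi_integral_def by (intro einterval_nn_integral_pos[of _ s t]) auto
qed

text \<open>Level sets of the injective \<open>y\<close> are at most single points.\<close>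

lemma (in coordinate) AE_neq: "AE x\<in>ivl a b in lborel. y x \<noteq> c"
proof (cases "c \<in> y ` ivl a b")
 case True
 then obtain z where z: "z \<in> ivl a b" "y z = c" by auto
 show ?thesis using AE_lborel_singleton[of z] by eventually_elim (use z mono(3) in auto)
qed auto

lemma nn_integral_scale:
 fixes \<phi> :: "real \<Rightarrow> ennreal"
 assumes [measurable]: "\<phi> \<in> borelfun" and "0 < t"
 shows "(NN v. \<phi> (v / t)) = ennreal t * (NN v. \<phi> v)"
 using nn_integral_real_affine[of "\<lambda>v. \<phi> (v / t)" t 0] assms by simp

lemma renyi_power_stretched_gaussian:
 assumes "me_range p lam"
 shows "renyi_power lam (stretched_gaussian p lam) = ennreal (gaussian_mass p lam powr (1 / (1 - lam)))"
 unfolding renyi_power_def using gaussian_mass_nn_integral[OF assms] me_rangeD[OF assms] by (simp add: epowr_ennreal)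

lemma epowr_K0:
 assumes "me_range p lam" "0 < \<alpha>"
 shows "epowr (K0 p lam) (1 / \<alpha>) =
  ennreal (gaussian_mass p lam powr (1 / (\<alpha> * (lam - 1))) * gaussian_sigma p lam powr (1 / \<alpha>))" proof -
 have "0 < gaussian_mass p lam" "0 < gaussian_sigma p lam"
  using gaussian_mass_nn_integral[OF assms(1)] sigma_stretched_gaussian[OF assms(1)] by auto
 note pos = this
 then have "K0 p lam = ennreal (gaussian_sigma p lam / gaussian_mass p lam powr (1 / (1 - lam)))"
  unfolding K0_def renyi_power_stretched_gaussian[OF assms(1)] sigma_stretched_gaussian[OF assms(1)]
  by (simp add: divide_ennreal)
 also have "epowr \<dots> (1 / \<alpha>) = ennreal ((gaussian_sigma p lam / gaussian_mass p lam powr (1 / (1 - lam))) powr (1 / \<alpha>))"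
  using pos by (simp add: epowr_ennreal)
 also have "(gaussian_sigma p lam / gaussian_mass p lam powr (1 / (1 - lam))) powr (1 / \<alpha>)
  = gaussian_mass p lam powr (- (1 / (1 - lam) * (1 / \<alpha>))) * gaussian_sigma p lam powr (1 / \<alpha>)"
  using pos by (subst powr_divide) (simp_all add: powr_powr powr_minus field_simps)
 also have "- (1 / (1 - lam) * (1 / \<alpha>)) = 1 / (\<alpha> * (lam - 1))"
  by (simp add: mult.commute) (metis minus_diff_eq minus_divide_right minus_mult_right)
 finally show ?thesis .
qed

text \<open>
 The inequality compares \<open>(f/h)^\<alpha>\<close> as a function of \<open>y\<close> with the rescaled stretched Gaussian
 having the same moment.
\<close>

lemma moment_entropy_renyi:
 assumes ab: "a < b" and f: "prob_density_on (ivl a b) f" and h: "prob_density_on (ivl a b) h"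
  and range: "me_range p lam" and \<alpha>: "0 < \<alpha>" and y: "escort_coord \<alpha> (ivl a b) f h y"
  and s: "gen_sigma (hconj p) \<alpha> (ivl a b) f (\<lambda>x. ennreal \<bar>y x\<bar>) = ennreal s" "0 < s"
 defines "t \<equiv> s powr \<alpha> / gaussian_sigma p lam"
  and "I \<equiv> renyi_integral (rel_order lam \<alpha>) (ivl a b) f h"
 shows "1 < lam \<Longrightarrow> ennreal (t powr (1 - lam) * gaussian_mass p lam) \<le> I"
  and "lam < 1 \<Longrightarrow> I \<le> ennreal (t powr (1 - lam) * gaussian_mass p lam)"
  and "I = ennreal (t powr (1 - lam) * gaussian_mass p lam) \<Longrightarrow>
   AE x\<in>ivl a b in lborel. (f x / h x) powr \<alpha> = stretched_gaussian p lam (y x / t) / t" proof -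
 note [measurable] = f[THEN prob_density_onD(1)] h[THEN prob_density_onD(1)]
 note fpos = prob_density_onD(3)[OF f] and hpos = prob_density_onD(3)[OF h]
 interpret coordinate a b "\<lambda>x. f x powr (1 - \<alpha>) * h x powr \<alpha>" y by (rule escort_coordinate[OF ab f h y])
 have t: "0 < t" using s sigma_stretched_gaussian[OF range] by (simp add: t_def)
 define G where "G = stretched_gaussian p lam"
 have [measurable]: "G \<in> borelfun" unfolding G_def by measurable
 have Gnn: "0 \<le> G v" for v unfolding G_def by (rule stretched_gaussian_nonneg[OF range])
 have mass: "0 < gaussian_mass p lam" by (rule gaussian_mass_nn_integral(3)[OF range])
 \<comment> \<open>On the restricted measure the weight and the transformed density are positive at
   every point of the space, as \<open>moment_entropy_core\<close> demands.\<close>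
 define M where "M = restrict_space lborel (ivl a b)"
 have spM: "space M = ivl a b" by (simp add: M_def)
 have measM: "g \<in> borel_measurable M" if "g \<in> borelfun" for g :: "real \<Rightarrow> real"
  unfolding M_def using that by (intro measurable_restrict_space1) simp
 have yM: "y \<in> borel_measurable M" unfolding M_def using borel_measurable_indicator
  by (subst borel_measurable_restrict_space_iff) simp_all
 have mc: "has_bochner_integral lborel (\<lambda>x. indicator (ivl a b) x * f x * gaussian_base p lam (y x / t)) (gaussian_mass p lam)"
  "p = 1 \<Longrightarrow> AE x\<in>ivl a b in lborel. \<bar>y x\<bar> \<le> t" unfolding t_def
  by (rule moment_condition[OF range borel_einterval _ borel_measurable_indicator _ prob_density_onD(4)[OF f] AE_neq \<alpha> s]; (simp add: fpos)?)+
 have ne: "AE x in M. y x / t \<noteq> 0"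
  unfolding M_def using AE_neq[of 0] t by (subst AE_restrict_space_iff) (auto elim!: eventually_mono)
 have EG: "AE x in M. (0 < G (y x / t) \<and> gaussian_base p lam (y x / t) = G (y x / t) powr (lam - 1)) \<or>
    (1 < lam \<and> G (y x / t) = 0 \<and> gaussian_base p lam (y x / t) \<le> 0)"
 proof (cases "p = 1")
  case False
  show ?thesis using ne
  proof eventually_elim
   case (elim x)
   show ?case
   proof (cases "0 < G (y x / t)")
    case True
    then show ?thesis using gaussian_base_powr(1)[OF range, of "y x / t"] elim by (simp add: G_def)
   next
    case G: False
    then have "G (y x / t) = 0" using Gnn[of "y x / t"] by simp
    then show ?thesis using gaussian_base_powr(3)[OF range, of "y x / t"] elim False by (simp add: G_def)
   qed
  qed
 next
  case True
  \<comment> \<open>The essential supremum yields only |y| \<le> t, but equality occurs at no more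
    than two points.\<close>
  have "AE x in M. \<bar>y x / t\<bar> < 1" proof -
   have "AE x\<in>ivl a b in lborel. \<bar>y x / t\<bar> < 1" using AE_neq[of t] AE_neq[of "- t"] mc(2)[OF True]
   proof eventually_elim
    case (elim x)
    then have "x \<in> ivl a b \<Longrightarrow> \<bar>y x\<bar> < t" by auto
    then show ?case using t by simp
   qed
   then show ?thesis unfolding M_def by (subst AE_restrict_space_iff) simp_all
  qed
  then show ?thesis using ne
  proof eventually_elim
   case (elim x)
   then have "0 < G (y x / t)" using gaussian_sup_moment(2)[OF me_rangeD[OF range]] True by (simp add: G_def)
   then show ?case using gaussian_base_powr(1)[OF range, of "y x / t"] elim by (simp add: G_def)
  qed
 qed
 have push: "(\<integral>\<^sup>+x. ennreal (G (y x / t) powr lam) * ennreal (f x powr (1 - \<alpha>) * h x powr \<alpha>) \<partial>M) \<le> ennreal (t * gaussian_mass p lam)"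
 proof -
  have "(\<integral>\<^sup>+x. ennreal (G (y x / t) powr lam) * ennreal (f x powr (1 - \<alpha>) * h x powr \<alpha>) \<partial>M)
   = (NN x:ivl a b. ennreal (G (y x / t) powr lam) * ennreal (f x powr (1 - \<alpha>) * h x powr \<alpha>))"
   unfolding M_def by (subst nn_integral_restrict_space) simp_all
  also have "\<dots> = (NN v:y ` ivl a b. ennreal (G (v / t) powr lam))" by (rule pushforward) measurable
  also have "\<dots> \<le> (NN v. ennreal (G (v / t) powr lam))"
   by (intro nn_integral_mono) (auto simp: indicator_def)
  also have "\<dots> = ennreal t * (NN v. ennreal (G v powr lam))" by (rule nn_integral_scale[OF _ t]) measurable
  also have "\<dots> = ennreal (t * gaussian_mass p lam)"
   using gaussian_mass_nn_integral(1)[OF range] t mass by (simp add: G_def ennreal_mult)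
  finally show ?thesis .
 qed
 have int: "has_bochner_integral M (\<lambda>x. (f x / h x) powr \<alpha> * (f x powr (1 - \<alpha>) * h x powr \<alpha>) * gaussian_base p lam (y x / t)) (gaussian_mass p lam)"
 proof -
  have "has_bochner_integral lborel (\<lambda>x. indicator (ivl a b) x *\<^sub>R (f x * gaussian_base p lam (y x / t))) (gaussian_mass p lam)"
   using mc(1) by (simp add: mult.assoc)
  then have "has_bochner_integral M (\<lambda>x. f x * gaussian_base p lam (y x / t)) (gaussian_mass p lam)"
   unfolding M_def has_bochner_integral_iff by (simp add: integrable_restrict_space integral_restrict_space)
  then show ?thesis
   by (rule has_bochner_integral_cong[THEN iffD1, rotated -1]) (auto simp: spM escort_identities(1)[OF fpos hpos])
 qed
 have I: "I = (\<integral>\<^sup>+x. ennreal (((f x / h x) powr \<alpha>) powr lam * (f x powr (1 - \<alpha>) * h x powr \<alpha>)) \<partial>M)"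
  unfolding I_def renyi_integral_def M_def
  by (subst nn_integral_restrict_space) (auto intro!: nn_integral_cong simp: indicator_def escort_identities(2)[OF fpos hpos])
 have wpos: "0 < f x powr (1 - \<alpha>) * h x powr \<alpha>" "0 < (f x / h x) powr \<alpha>" if "x \<in> space M" for x
  using fpos[of x] hpos[of x] that by (auto simp: spM)
 have mw: "(\<lambda>x. f x powr (1 - \<alpha>) * h x powr \<alpha>) \<in> borel_measurable M" "(\<lambda>x. (f x / h x) powr \<alpha>) \<in> borel_measurable M"
  by (rule measM; measurable)+
 note core = moment_entropy_core[OF mw(2,1) yM _ gaussian_base_measurable wpos(2,1) Gnn me_rangeD[OF range] t less_imp_le[OF mass] push EG int, folded I]
 show "1 < lam \<Longrightarrow> ennreal (t powr (1 - lam) * gaussian_mass p lam) \<le> I" by (rule core(1)) simp_all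
 show "lam < 1 \<Longrightarrow> I \<le> ennreal (t powr (1 - lam) * gaussian_mass p lam)" by (rule core(2)) simp_all
 assume "I = ennreal (t powr (1 - lam) * gaussian_mass p lam)"
 then have "AE x in M. (f x / h x) powr \<alpha> = G (y x / t) / t" by (intro core(3)) simp_all
 then show "AE x\<in>ivl a b in lborel. (f x / h x) powr \<alpha> = stretched_gaussian p lam (y x / t) / t"
  unfolding M_def G_def by (subst (asm) AE_restrict_space_iff) simp_all
qed

text \<open>Rules out a vanishing moment in (i). For positive or infinite order it would force y = 0
  almost everywhere, but \<open>y\<close> is injective. For order 0 it would make the integral of -f
  log |y| infinite, whereas Young's inequality bounds this by the Renyi integral plus a multiple of
  the finite integral of V^\<lambda>.\<close>

lemma gen_sigma_nonzero:
 assumes ab: "a < b" and f: "prob_density_on (ivl a b) f" and h: "prob_density_on (ivl a b) h"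
  and range: "me_range p lam" and \<alpha>: "0 < \<alpha>" and y: "escort_coord \<alpha> (ivl a b) f h y"
  and I: "1 < lam \<Longrightarrow> renyi_integral (rel_order lam \<alpha>) (ivl a b) f h < \<infinity>"
 shows "gen_sigma (hconj p) \<alpha> (ivl a b) f (\<lambda>x. ennreal \<bar>y x\<bar>) \<noteq> 0"
proof
 assume z: "gen_sigma (hconj p) \<alpha> (ivl a b) f (\<lambda>x. ennreal \<bar>y x\<bar>) = 0"
 note [measurable] = f[THEN prob_density_onD(1)] h[THEN prob_density_onD(1)]
 note fpos = prob_density_onD(3)[OF f] and hpos = prob_density_onD(3)[OF h]
 interpret coordinate a b "\<lambda>x. f x powr (1 - \<alpha>) * h x powr \<alpha>" y by (rule escort_coordinate[OF ab f h y])
 have contr: False if AE0: "AE x\<in>ivl a b in lborel. y x = 0" proof -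
  have "AE x in lborel. x \<notin> ivl a b" using AE0 AE_neq[of 0] by eventually_elim auto
  then have "(NN x:ivl a b. ennreal (f x)) = 0" by (subst nn_integral_0_iff_AE) (auto elim!: eventually_mono)
  then show False using prob_density_onD(4)[OF f] by simp
 qed
 show False using range
 proof (cases rule: me_range_cases)
  case one
  define e where "e = esssup (density lborel (\<lambda>x. ennreal (f x) * indicator (ivl a b) x)) (\<lambda>x. ennreal \<bar>y x\<bar> * indicator (ivl a b) x)"
  have "epowr e (1 / \<alpha>) = 0" using z one unfolding gen_sigma_def e_def by simp
  then have "e = 0" using \<alpha> by (cases e rule: ennreal_cases_pos) (auto simp: epowr_ennreal)
  then show False
   using AE_le_esssup_density[of "ivl a b" f "\<lambda>x. ennreal \<bar>y x\<bar>", OF _ _ fpos] unfolding e_def[symmetric]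
   by (intro contr) simp
 next
  case (powr q)
  have "epowr (NN x:ivl a b. ennreal (\<bar>y x\<bar> powr q * f x)) (1 / (q * \<alpha>)) = 0"
   using z gen_sigma_powr[of q "ivl a b" f \<alpha> y, OF powr(5) less_imp_le[OF fpos]] powr by simp
  then have "0 = (NN x:ivl a b. ennreal (\<bar>y x\<bar> powr q * f x))"
   using \<alpha> \<open>0 < q\<close> by (cases "NN x:ivl a b. ennreal (\<bar>y x\<bar> powr q * f x)" rule: ennreal_cases_pos) (auto simp: epowr_ennreal)
  also have "(NN x:ivl a b. ennreal (\<bar>y x\<bar> powr q * f x))
   = (NN x. ennreal (\<bar>indicator (ivl a b) x * y x\<bar> powr q * f x) * indicator (ivl a b) x)"
   by (intro nn_integral_cong) (auto simp: indicator_def)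
  finally have "AE x in lborel. ennreal (\<bar>indicator (ivl a b) x * y x\<bar> powr q * f x) * indicator (ivl a b) x = 0"
   using borel_measurable_indicator by (subst nn_integral_0_iff_AE[symmetric]) simp_all
  then show False
  proof (intro contr, eventually_elim)
   case (elim x)
   then show ?case using fpos[of x] by (auto simp: ennreal_eq_0_iff mult_le_0_iff not_le)
  qed
 next
  case zero
  define I where "I = renyi_integral (rel_order lam \<alpha>) (ivl a b) f h"
  have "(NN x:ivl a b. ennreal (- (f x * ln \<bar>y x\<bar>))) = \<infinity>"
   by (rule gen_sigma_0(3)[of _ _ _ \<alpha>]) (use z zero AE_neq \<alpha> fpos less_imp_le borel_measurable_indicator in auto)
  moreover have "(NN x:ivl a b. ennreal (- (f x * ln \<bar>y x\<bar>))) < \<infinity>" proof -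
   \<comment> \<open>The unnormalized extremal profile for p = 0, whose power \<lambda> - 1 is the
     positive part of -log |v|.\<close>
   define V where "V v = max 0 (- ln \<bar>v\<bar>) powr (1 / (lam - 1))" for v :: real
   have [measurable]: "V \<in> borelfun" unfolding V_def by measurable
   define Z where "Z = (LINT t|lborel. stretched_profile 0 lam t)"
   have Z: "0 < Z" unfolding Z_def using range zero by (intro profile_integral_pos) simp
   have VG: "AE v in lborel. V v = Z * stretched_gaussian 0 lam v" using AE_lborel_singleton[of 0]
   proof eventually_elim
    case (elim v)
    have "Z * stretched_gaussian 0 lam v = stretched_profile 0 lam v"
     using Z by (simp add: stretched_gaussian_def Z_def[symmetric])
    then show ?case using elim by (simp add: V_def stretched_profile_def)
   qed
   have Vfin: "(NN v. ennreal (V v powr lam)) < \<infinity>" proof -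
    have "(NN v. ennreal (V v powr lam)) = (NN v. ennreal (Z powr lam) * ennreal (stretched_gaussian 0 lam v powr lam))"
     using VG Z stretched_gaussian_nonneg[OF range] zero
     by (intro nn_integral_cong_AE) (auto elim!: eventually_mono simp: powr_mult ennreal_mult)
    also have "\<dots> = ennreal (Z powr lam) * (NN v. ennreal (stretched_gaussian 0 lam v powr lam))"
     by (rule nn_integral_cmult) measurable
    also have "\<dots> < \<infinity>"
     using gaussian_mass_nn_integral(1)[OF range] zero by (simp add: ennreal_mult[symmetric] flip: ennreal_mult')
    finally show ?thesis .
   qed
   have le: "- (f x * ln \<bar>y x\<bar>) \<le> f x powr rel_order lam \<alpha> * h x powr (1 - rel_order lam \<alpha>) + (lam - 1) * (V (y x) powr lam * (f x powr (1 - \<alpha>) * h x powr \<alpha>))"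
    if x: "x \<in> ivl a b" for x proof -
    define R where "R = (f x / h x) powr \<alpha>"
    define w where "w = f x powr (1 - \<alpha>) * h x powr \<alpha>"
    have R: "0 < R" and w: "0 < w" using fpos[OF x] hpos[OF x] by (auto simp: R_def w_def)
    have Rw: "f x = R * w" "R powr lam * w = f x powr rel_order lam \<alpha> * h x powr (1 - rel_order lam \<alpha>)"
     using escort_identities[OF fpos[OF x] hpos[OF x]] by (simp_all add: R_def w_def)
    have "V (y x) powr (lam - 1) = max 0 (- ln \<bar>y x\<bar>)" using zero by (simp add: V_def powr_powr)
    then have "- ln \<bar>y x\<bar> \<le> V (y x) powr (lam - 1)" by simp
    then have "R * (- ln \<bar>y x\<bar>) \<le> R * V (y x) powr (lam - 1)" using R by (intro mult_left_mono) auto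
    also have "\<dots> \<le> lam * (R * V (y x) powr (lam - 1))" using zero R mult_right_mono[of 1 lam "R * V (y x) powr (lam - 1)"] by simp
    also have "\<dots> \<le> R powr lam + (lam - 1) * V (y x) powr lam"
     using R zero by (intro young_powr_gt) (auto simp: V_def)
    finally have "R * (- ln \<bar>y x\<bar>) * w \<le> (R powr lam + (lam - 1) * V (y x) powr lam) * w"
     using w by (intro mult_right_mono) auto
    then show ?thesis unfolding Rw(2)[symmetric] w_def[symmetric] by (simp add: Rw(1) algebra_simps)
   qed
   have "(NN x:ivl a b. ennreal (- (f x * ln \<bar>y x\<bar>)))
    \<le> (NN x. ennreal (f x powr rel_order lam \<alpha> * h x powr (1 - rel_order lam \<alpha>)) * indicator (ivl a b) x +
      ennreal (lam - 1) * (ennreal (V (indicator (ivl a b) x * y x) powr lam) * ennreal (f x powr (1 - \<alpha>) * h x powr \<alpha>) * indicator (ivl a b) x))"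
   proof (intro nn_integral_mono)
    fix x
    show "ennreal (- (f x * ln \<bar>y x\<bar>)) * indicator (ivl a b) x \<le> ennreal (f x powr rel_order lam \<alpha> * h x powr (1 - rel_order lam \<alpha>)) * indicator (ivl a b) x +
      ennreal (lam - 1) * (ennreal (V (indicator (ivl a b) x * y x) powr lam) * ennreal (f x powr (1 - \<alpha>) * h x powr \<alpha>) * indicator (ivl a b) x)"
     using le[of x] zero by (cases "x \<in> ivl a b") (simp_all add: ennreal_leI flip: ennreal_mult ennreal_plus)
   qed
   also have "\<dots> = I + ennreal (lam - 1) * (NN x. ennreal (V (indicator (ivl a b) x * y x) powr lam) * ennreal (f x powr (1 - \<alpha>) * h x powr \<alpha>) * indicator (ivl a b) x)"
    unfolding I_def renyi_integral_def using borel_measurable_indicator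
    by (subst nn_integral_add) (simp_all add: nn_integral_cmult)
   also have "(NN x. ennreal (V (indicator (ivl a b) x * y x) powr lam) * ennreal (f x powr (1 - \<alpha>) * h x powr \<alpha>) * indicator (ivl a b) x)
     = (NN x:ivl a b. ennreal (V (y x) powr lam) * ennreal (f x powr (1 - \<alpha>) * h x powr \<alpha>))"
    by (intro nn_integral_cong) (auto simp: indicator_def)
   also have "\<dots> = (NN v:y ` ivl a b. ennreal (V v powr lam))" by (rule pushforward) measurable
   also have "I + ennreal (lam - 1) * \<dots> < \<infinity>" proof -
    have "(NN v:y ` ivl a b. ennreal (V v powr lam)) \<le> (NN v. ennreal (V v powr lam))"
     by (intro nn_integral_mono) (auto simp: indicator_def)
    then have "(NN v:y ` ivl a b. ennreal (V v powr lam)) < \<infinity>" using Vfin by (rule le_less_trans)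
    then show ?thesis using I[OF zero(3)] unfolding I_def by (simp add: ennreal_mult_less_top)
   qed
   finally show ?thesis .
  qed
  ultimately show False by simp
 qed
qed

text \<open>The left side is I^e s with e = 1/(\<alpha> (\<lambda> - 1)) and the right side is T^e
  s, where \<open>T\<close> is the bound of \<open>moment_entropy_renyi\<close>. The direction of
  that bound changes at \<lambda> = 1 together with the sign of \<open>e\<close>.\<close>

lemma moment_entropy_inequality:
 assumes ab: "a < b" and f: "prob_density_on (ivl a b) f" and h: "prob_density_on (ivl a b) h"
  and range: "me_range p lam" and \<alpha>: "0 < \<alpha>" and y: "escort_coord \<alpha> (ivl a b) f h y"
  and def: "moment_entropy_defined p \<alpha> lam (ivl a b) f h (\<lambda>x. ennreal \<bar>y x\<bar>)"
 shows "epowr (K0 p lam) (1 / \<alpha>) \<le> moment_entropy_lhs p \<alpha> lam (ivl a b) f h (\<lambda>x. ennreal \<bar>y x\<bar>)"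
  and "moment_entropy_lhs p \<alpha> lam (ivl a b) f h (\<lambda>x. ennreal \<bar>y x\<bar>) = epowr (K0 p lam) (1 / \<alpha>) \<Longrightarrow>
   \<exists>t>0. AE x\<in>ivl a b in lborel. (f x / h x) powr \<alpha> = stretched_gaussian p lam (y x / t) / t"
proof -
 define I where "I = renyi_integral (rel_order lam \<alpha>) (ivl a b) f h"
 define e where "e = 1 / (\<alpha> * (lam - 1))"
 define gs where "gs = gen_sigma (hconj p) \<alpha> (ivl a b) f (\<lambda>x. ennreal \<bar>y x\<bar>)"
 note l = me_rangeD[OF range]
 note mass = gaussian_mass_nn_integral(3)[OF range] and sig = sigma_stretched_gaussian(2)[OF range]
 have e0: "e \<noteq> 0" "0 < e \<longleftrightarrow> 1 < lam" using \<alpha> l by (auto simp: e_def zero_less_divide_iff zero_less_mult_iff)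
 have lhs: "moment_entropy_lhs p \<alpha> lam (ivl a b) f h (\<lambda>x. ennreal \<bar>y x\<bar>) = epowr I e * gs"
  unfolding moment_entropy_lhs_def gs_def renyi_div_epowr[OF l(2) \<alpha>] I_def e_def ..
 have md: "\<not> (epowr I e = 0 \<and> gs = \<infinity>)" "\<not> (epowr I e = \<infinity> \<and> gs = 0)"
  using def unfolding moment_entropy_defined_def mult_defined_def renyi_div_epowr[OF l(2) \<alpha>] I_def e_def gs_def by auto
 have K0: "epowr (K0 p lam) (1 / \<alpha>) = ennreal (gaussian_mass p lam powr e * gaussian_sigma p lam powr (1 / \<alpha>))"
  unfolding e_def by (rule epowr_K0[OF range \<alpha>])
 \<comment> \<open>For \<lambda> > 1 an infinite \<open>I\<close> together with a zero moment would
   be an undetermined product, which is excluded; in all other cases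
   \<open>gen_sigma_nonzero\<close> applies.\<close>
 have gs0: "gs \<noteq> 0"
 proof
  assume z: "gs = 0"
  have "I < \<infinity>" if "1 < lam"
  proof (rule ccontr)
   assume "\<not> I < \<infinity>"
   then have "I = \<infinity>" by (metis infinity_ennreal_def top.not_eq_extremum)
   then show False using md(2) z e0 that by simp
  qed
  then show False using gen_sigma_nonzero[OF ab f h range \<alpha> y] z unfolding gs_def I_def by blast
 qed
 have main: "epowr (K0 p lam) (1 / \<alpha>) \<le> epowr I e * gs \<and> (epowr I e * gs = epowr (K0 p lam) (1 / \<alpha>) \<longrightarrow>
  (\<exists>t>0. AE x\<in>ivl a b in lborel. (f x / h x) powr \<alpha> = stretched_gaussian p lam (y x / t) / t))"
 proof (cases gs rule: ennreal_cases_pos)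
  case 1
  then show ?thesis using gs0 by simp
 next
  case 2
  then have "epowr I e * gs = \<infinity>" using md by (simp add: ennreal_mult_top)
  then show ?thesis unfolding K0 by simp
 next
  case (3 s)
  define t where "t = s powr \<alpha> / gaussian_sigma p lam"
  define T where "T = t powr (1 - lam) * gaussian_mass p lam"
  have t: "0 < t" using 3 sig by (simp add: t_def)
  have T: "0 < T" using t mass by (simp add: T_def)
  note mr = moment_entropy_renyi[OF ab f h range \<alpha> y 3[unfolded gs_def], folded t_def I_def, folded T_def]
  \<comment> \<open>The power of \<open>t\<close> contributes t^(-1/\<alpha>), and by the choice of
    \<open>t\<close> this is \<sigma>(G)^(1/\<alpha>) / s.\<close>
  have Te: "gaussian_mass p lam powr e * gaussian_sigma p lam powr (1 / \<alpha>) = T powr e * s" proof -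
   have "T powr e = t powr ((1 - lam) * e) * gaussian_mass p lam powr e"
    using t mass by (simp add: T_def powr_mult powr_powr)
   also have "(1 - lam) * e = - (1 / \<alpha>)" using l \<alpha> by (simp add: e_def field_simps)
   also have "t powr (- (1 / \<alpha>)) = gaussian_sigma p lam powr (1 / \<alpha>) / s"
    using 3 sig \<alpha> by (simp add: t_def powr_divide powr_powr powr_minus)
   finally show ?thesis using 3 by simp
  qed
  have K: "epowr (K0 p lam) (1 / \<alpha>) = ennreal (T powr e) * gs"
   unfolding K0 Te 3 using 3 by (simp add: ennreal_mult)
  have TI: "ennreal (T powr e) \<le> epowr I e" unfolding epowr_ennreal[OF T, symmetric]
  proof (cases "1 < lam")
   case True
   then show "epowr (ennreal T) e \<le> epowr I e" using mr(1) e0 by (intro epowr_mono) auto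
  next
   case False
   then show "epowr (ennreal T) e \<le> epowr I e" using mr(2) e0 l by (intro epowr_antimono) auto
  qed
  have "I = ennreal T" if "epowr I e * gs = epowr (K0 p lam) (1 / \<alpha>)" proof -
   have "epowr I e = ennreal (T powr e)"
    using that 3 unfolding K by (metis ennreal_eq_0_iff ennreal_mult_divide_eq ennreal_neq_top not_le)
   then have "epowr (epowr I e) (1 / e) = ennreal T" using T e0 by (simp add: epowr_ennreal powr_powr)
   then show ?thesis using e0 unfolding epowr_epowr by (cases I rule: ennreal_cases_pos) (auto simp: epowr_ennreal)
  qed
  then show ?thesis using mr(3) t TI unfolding K by (auto intro: mult_right_mono)
 qed
 then show "epowr (K0 p lam) (1 / \<alpha>) \<le> moment_entropy_lhs p \<alpha> lam (ivl a b) f h (\<lambda>x. ennreal \<bar>y x\<bar>)"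
  "moment_entropy_lhs p \<alpha> lam (ivl a b) f h (\<lambda>x. ennreal \<bar>y x\<bar>) = epowr (K0 p lam) (1 / \<alpha>) \<Longrightarrow>
   \<exists>t>0. AE x\<in>ivl a b in lborel. (f x / h x) powr \<alpha> = stretched_gaussian p lam (y x / t) / t"
  unfolding lhs by auto
qed

text \<open>The canonical coordinate may be infinite. If it is finite throughout, it is an escort
  coordinate; otherwise it is infinite on an interval of positive length, the moment is infinite,
  and so is the left side.\<close>

lemma moment_entropy_canonical:
 assumes ab: "a < b" and f: "prob_density_on (ivl a b) f" and h: "prob_density_on (ivl a b) h"
  and range: "me_range p lam" and \<alpha>: "0 < \<alpha>"
  and def: "moment_entropy_defined p \<alpha> lam (ivl a b) f h (canonical_coord \<alpha> a f h)"
 shows "epowr (K0 p lam) (1 / \<alpha>) \<le> moment_entropy_lhs p \<alpha> lam (ivl a b) f h (canonical_coord \<alpha> a f h)"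
proof -
 note [measurable] = f[THEN prob_density_onD(1)] h[THEN prob_density_onD(1)]
 note fpos = prob_density_onD(3)[OF f]
 define A where "A = canonical_coord \<alpha> a f h"
 define w where "w x = f x powr (1 - \<alpha>) * h x powr \<alpha>" for x
 have [measurable]: "w \<in> borelfun" unfolding w_def by measurable
 have A: "A x = (NN s:einterval a x. ennreal (w s))" for x unfolding A_def canonical_coord_def w_def ..
 have A_add: "A t = A s + (NN x:{s..t}. ennreal (w x))" if "s \<in> ivl a b" "t \<in> ivl a b" "s \<le> t" for s t
 proof -
  have "A s + (NN x:{s..t}. ennreal (w x)) = (NN x. ennreal (w x) * indicator (einterval a s) x + ennreal (w x) * indicator {s..t} x)"
   unfolding A by (rule nn_integral_add[symmetric]) measurable
  also have "\<dots> = A t" unfolding A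
  proof (rule nn_integral_cong_AE)
   show "AE x in lborel. ennreal (w x) * indicator (einterval a s) x + ennreal (w x) * indicator {s..t} x = ennreal (w x) * indicator (einterval a t) x"
    using AE_lborel_singleton[of t]
   proof eventually_elim
    case (elim x)
    have "a < ereal x" if "s \<le> x" using \<open>s \<in> ivl a b\<close> that by (auto simp: einterval_iff intro: less_le_trans)
    then show ?case using elim \<open>s \<le> t\<close> by (auto simp: indicator_def einterval_iff)
   qed
  qed
  finally show ?thesis by simp
 qed
 show ?thesis
 proof (cases "\<forall>x\<in>ivl a b. A x < \<infinity>")
  case True
  define y where "y x = enn2real (A x)" for x
  have Ay: "A x = ennreal \<bar>y x\<bar>" if "x \<in> ivl a b" for x using True that by (simp add: y_def)
  have "escort_coord \<alpha> (ivl a b) f h y" unfolding escort_coord_def w_def[symmetric]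
  proof (intro ballI impI)
   fix s t assume st: "s \<in> ivl a b" "t \<in> ivl a b" "s \<le> t"
   have At: "A s = ennreal (y s)" "A t = ennreal (y t)" "0 \<le> y s" using True st by (auto simp: y_def)
   have "(NN x:{s..t}. ennreal (w x)) = A t - A s"
    unfolding A_add[OF st] using At by (simp add: ennreal_add_diff_cancel_left)
   also have "\<dots> = ennreal (y t - y s)" unfolding At by (simp add: ennreal_minus At)
   finally show "(NN x:{s..t}. ennreal (w x)) = ennreal (y t - y s)" .
  qed
  moreover have gs: "gen_sigma (hconj p) \<alpha> (ivl a b) f A = gen_sigma (hconj p) \<alpha> (ivl a b) f (\<lambda>x. ennreal \<bar>y x\<bar>)"
   by (rule gen_sigma_cong) (rule Ay)
  ultimately show ?thesis using moment_entropy_inequality(1)[OF ab f h range \<alpha>, of y] def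
   unfolding moment_entropy_lhs_def moment_entropy_defined_def A_def[symmetric] by simp
 next
  case False
  then obtain c where c: "c \<in> ivl a b" "A c = \<infinity>" by (metis infinity_ennreal_def top.not_eq_extremum)
  obtain d where d: "d \<in> ivl a b" "c < d" using einterval_two_sided[OF c(1)] by metis
  have sub: "{c..d} \<subseteq> ivl a b" by (rule einterval_Icc_subset[OF c(1) d(1)])
  \<comment> \<open>Once infinite, the coordinate stays infinite to the right.\<close>
  have Atop: "A x = \<infinity>" if "x \<in> {c..d}" for x using A_add[OF c(1), of x] c(2) sub that by auto
  have big: "(NN x:ivl a b. u x) = \<infinity>" if "\<And>x. x \<in> {c..d} \<Longrightarrow> u x = \<infinity>" for u :: "real \<Rightarrow> ennreal"
  proof -
   have "(NN x. \<infinity> * indicator {c..d} x) \<le> (NN x:ivl a b. u x)"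
    using sub by (intro nn_integral_mono) (auto simp: indicator_def that)
   moreover have "(NN x. \<infinity> * indicator {c..d} x) = (\<infinity>::ennreal)"
    using d by (subst nn_integral_cmult_indicator) (auto simp: ennreal_mult_top)
   ultimately show ?thesis by (simp add: top_unique)
  qed
  have "gen_sigma (hconj p) \<alpha> (ivl a b) f A = \<infinity>" using range
  proof (cases rule: me_range_cases)
   case one
   define e where "e = esssup (density lborel (\<lambda>x. ennreal (f x) * indicator (ivl a b) x)) (\<lambda>x. A x * indicator (ivl a b) x)"
   have "e = \<infinity>"
   proof (rule ccontr)
    assume "e \<noteq> \<infinity>"
    have "AE x\<in>ivl a b in lborel. A x \<le> e" unfolding e_def by (rule AE_le_esssup_density) (auto simp: fpos)
    then have "AE x in lborel. x \<notin> {c..d}"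
    proof eventually_elim
     case (elim x)
     then show ?case using Atop[of x] sub \<open>e \<noteq> \<infinity>\<close> by (auto simp: top_unique)
    qed
    then have "{c..d} \<in> null_sets lborel" using AE_iff_null_sets[of "{c..d}" lborel] by simp
    then show False using d by (auto simp: null_sets_def)
   qed
   then show ?thesis using one \<alpha> unfolding gen_sigma_def e_def[symmetric] by simp
  next
   case zero
   have "ext_integral (ivl a b) f (\<lambda>x. eln (A x)) = \<infinity>" unfolding ext_integral_def
   proof (subst big)
    fix x assume "x \<in> {c..d}"
    then show "ennreal (f x) * e2ennreal (eln (A x)) = \<infinity>"
     using Atop[of x] fpos[of x] sub by (auto simp: eln_def ennreal_mult_top)
   qed simp
   then show ?thesis using zero \<alpha> by (simp add: gen_sigma_def eexp_def)
  next
   case (powr q)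
   have "gen_moment q (ivl a b) f A = \<infinity>" unfolding gen_moment_def
   proof (rule big)
    fix x assume "x \<in> {c..d}"
    then show "epowr (A x) q * ennreal (f x) = \<infinity>"
     using Atop[of x] fpos[of x] sub \<open>0 < q\<close> by (auto simp: ennreal_top_mult)
   qed
   then show ?thesis using powr(4,5) \<alpha> by (simp add: gen_sigma_def)
  qed
  then have "moment_entropy_lhs p \<alpha> lam (ivl a b) f h A = \<infinity>"
   using def unfolding moment_entropy_lhs_def moment_entropy_defined_def mult_defined_def A_def[symmetric]
   by (auto simp: ennreal_mult_top)
  then show ?thesis unfolding A_def by simp
 qed
qed

section \<open>The inverse transformation\<close>

lemma einterval_scale:
 assumes "0 < r"
 shows "{v. r * v \<in> ivl c d} = ivl (c / ereal r) (d / ereal r)"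
 using assms by (cases c; cases d) (auto simp: einterval_iff pos_divide_less_eq pos_less_divide_eq mult.commute)

lemma einterval_scale_less: "0 < r \<Longrightarrow> c < d \<Longrightarrow> c / ereal r < d / ereal r"
 by (cases c; cases d) (auto simp: divide_strict_right_mono)

text \<open>Stated for a general \<open>g\<close> whose support is an interval, because the
  construction is applied both to the stretched Gaussians and to
  \<open>stam_density\<close>.\<close>

context
 fixes a b c d :: ereal and h g :: "real \<Rightarrow> real" and \<alpha> r :: real
 assumes ab: "a < b" and h: "prob_density_on (ivl a b) h"
  and g_meas [measurable]: "g \<in> borelfun" and g_nonneg: "\<And>v. 0 \<le> g v"
  and g_supp: "support g = ivl c d" and cd: "c < d" and \<alpha>: "0 < \<alpha>"
  and fin: "renyi_power ((\<alpha> - 1) / \<alpha>) g < \<infinity>"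
 defines "r \<equiv> inv_radius \<alpha> g"
begin

text \<open>With s = (\<alpha> - 1)/\<alpha> and N the integral of g^s over the support, r =
  N^\<alpha>. Substituting u = r v leaves r^(s-1) N, and s - 1 = -1/\<alpha> makes this 1.\<close>

lemma inv_radius_props:
 shows "0 < r" and "(NN v:{v. r * v \<in> support g}. ennreal ((r * g (r * v)) powr ((\<alpha> - 1) / \<alpha>))) = 1"
proof -
 define s where "s = (\<alpha> - 1) / \<alpha>"
 have s: "s \<noteq> 1" "1 / (1 - s) = \<alpha>" "s - 1 = - (1 / \<alpha>)" using \<alpha> by (auto simp: s_def field_simps)
 define N where "N = (NN v:support g. ennreal (g v powr s))"
 have ren: "renyi_power s g = epowr N \<alpha>" using s by (simp add: renyi_power_def N_def)
 obtain x where "x \<in> ivl c d" using einterval_nonempty[OF cd] by auto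
 then obtain u v where uv: "u \<in> ivl c d" "v \<in> ivl c d" "u < x" "x < v" by (rule einterval_two_sided)
 have sub: "{u..v} \<subseteq> support g" using einterval_Icc_subset[OF uv(1,2)] g_supp by simp
 have "0 < g x" if "x \<in> {u<..<v}" for x using sub that by (auto simp: support_def subset_iff)
 moreover have "support g \<in> sets borel" unfolding g_supp by measurable
 ultimately have "0 < N" unfolding N_def using uv sub
  by (intro einterval_nn_integral_pos[of _ u v]) (auto simp: powr_gt_zero less_imp_neq[THEN not_sym])
 moreover have "N \<noteq> \<infinity>" using fin \<alpha> unfolding s_def[symmetric] ren by auto
 ultimately obtain n where n: "N = ennreal n" "0 < n" by (cases N rule: ennreal_cases_pos) auto
 have r: "r = n powr \<alpha>"
  unfolding r_def inv_radius_def s_def[symmetric] ren n(1) using n by (simp add: epowr_ennreal)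
 then show r0: "0 < r" using n by simp
 have [measurable]: "support g \<in> sets borel" unfolding g_supp by measurable
 have "(NN v:{v. r * v \<in> support g}. ennreal ((r * g (r * v)) powr s))
  = (NN v. ennreal (r powr s) * (ennreal (g (v / (1 / r)) powr s) * indicator (support g) (v / (1 / r))))"
  using r0 g_nonneg by (intro nn_integral_cong) (auto simp: indicator_def powr_mult ennreal_mult mult.commute)
 also have "\<dots> = ennreal (r powr s) * (NN v. ennreal (g (v / (1 / r)) powr s) * indicator (support g) (v / (1 / r)))"
  by (rule nn_integral_cmult) measurable
 also have "\<dots> = ennreal (r powr s) * (ennreal (1 / r) * N)"
  unfolding N_def using r0 by (subst nn_integral_scale) auto
 also have "\<dots> = ennreal (r powr s * (1 / r * n))" unfolding n using r0 n by (simp add: ennreal_mult[symmetric])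
 also have "r powr s * (1 / r * n) = r powr (s - 1) * n" using r0 by (simp add: powr_diff)
 also have "r powr (s - 1) * n = 1" unfolding s r using \<alpha> n by (simp add: powr_powr powr_minus)
 finally show "(NN v:{v. r * v \<in> support g}. ennreal ((r * g (r * v)) powr ((\<alpha> - 1) / \<alpha>))) = 1"
  by (simp add: s_def)
qed

lemma support_scale: "{v. r * v \<in> support g} = ivl (c / ereal r) (d / ereal r)"
 unfolding g_supp using inv_radius_props(1) by (rule einterval_scale)

text \<open>By the choice of \<open>r\<close> the function (r g(r v))^((\<alpha>-1)/\<alpha>) is a
  probability density on the scaled support, and \<open>y\<close> is the monotone transport of
  \<open>h\<close> to it.\<close>

lemma inv_coord_exists: "\<exists>y. inv_coord \<alpha> (ivl a b) h g y"
proof -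
 define \<psi> where "\<psi> v = (r * g (r * v)) powr ((\<alpha> - 1) / \<alpha>)" for v
 have [measurable]: "\<psi> \<in> borelfun" unfolding \<psi>_def by measurable
 have pos: "0 < r * g (r * v)" if "v \<in> ivl (c / ereal r) (d / ereal r)" for v
  using that inv_radius_props(1) unfolding support_scale[symmetric] by (simp add: support_def)
 obtain y where y: "coordinate a b (\<lambda>x. if x \<in> ivl a b then h x / \<psi> (y x) else 1) y"
  "y ` ivl a b = ivl (c / ereal r) (d / ereal r)"
 proof (rule transport[OF ab prob_density_onD(1)[OF h] _ prob_density_onD(4)[OF h]])
  show "c / ereal r < d / ereal r" by (rule einterval_scale_less[OF inv_radius_props(1) cd])
  show "0 < \<psi> v" if "v \<in> ivl (c / ereal r) (d / ereal r)" for v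
   using pos[OF that] unfolding \<psi>_def by (metis less_irrefl powr_gt_zero)
  show "(NN v:ivl (c / ereal r) (d / ereal r). ennreal (\<psi> v)) = 1"
   using inv_radius_props(2) unfolding support_scale \<psi>_def .
 qed (use prob_density_onD(3)[OF h] in auto)
 interpret coordinate a b "\<lambda>x. if x \<in> ivl a b then h x / \<psi> (y x) else 1" y by fact
 have "inv_coord \<alpha> (ivl a b) h g y" unfolding inv_coord_def r_def[symmetric]
 proof (intro conjI ballI impI)
  show "r * y x \<in> support g" if "x \<in> ivl a b" for x using y(2) that unfolding support_scale[symmetric] by auto
  fix s t assume st: "s \<in> ivl a b" "t \<in> ivl a b" "s \<le> t"
  show "(NN x:{s..t}. ennreal ((r * g (r * y x)) powr - ((\<alpha> - 1) / \<alpha>) * h x)) = ennreal (y t - y s)"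
   unfolding integral_eq[OF st, symmetric] using einterval_Icc_subset[OF st(1,2)]
   by (intro nn_integral_cong) (auto simp: indicator_def \<psi>_def powr_minus_divide)
 qed
 then show ?thesis by blast
qed

context
 fixes y f :: "real \<Rightarrow> real"
 assumes y: "inv_coord \<alpha> (ivl a b) h g y"
 defines "f \<equiv> inv_transform \<alpha> (ivl a b) h g y"
begin

lemma inv_coord_pos: "x \<in> ivl a b \<Longrightarrow> 0 < r * g (r * y x)" "x \<in> ivl a b \<Longrightarrow> r * y x \<in> support g"
 using y inv_radius_props(1) unfolding inv_coord_def r_def[symmetric] by (auto simp: support_def)

lemma inv_coord_coordinate:
 "coordinate a b (\<lambda>x. if x \<in> ivl a b then h x / (r * g (r * y x)) powr ((\<alpha> - 1) / \<alpha>) else 1) y"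
proof (rule coordinateI_composite[of a b h "\<lambda>v. (r * g (r * v)) powr ((\<alpha> - 1) / \<alpha>)" y])
 show "0 < (r * g (r * y x)) powr ((\<alpha> - 1) / \<alpha>)" if "x \<in> ivl a b" for x
  using inv_coord_pos(1)[OF that] by (metis less_irrefl powr_gt_zero)
qed (use ab prob_density_onD(1,3)[OF h] y in
   \<open>auto simp: inv_coord_def r_def[symmetric] powr_minus_divide\<close>)

text \<open>Both \<open>h\<close> on the interval and the target density on the scaled support have
  mass 1, so \<open>y\<close> cannot miss a part of the latter.\<close>

lemma inv_coord_image: "y ` ivl a b = {v. r * v \<in> support g}"
proof -
 interpret coordinate a b "\<lambda>x. if x \<in> ivl a b then h x / (r * g (r * y x)) powr ((\<alpha> - 1) / \<alpha>) else 1" y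
  by (rule inv_coord_coordinate)
 show ?thesis unfolding support_scale
 proof (rule image_eqI[of _ _ "\<lambda>v. (r * g (r * v)) powr ((\<alpha> - 1) / \<alpha>)"])
  show "y ` ivl a b \<subseteq> ivl (c / ereal r) (d / ereal r)"
   unfolding support_scale[symmetric] using inv_coord_pos(2) by auto
  show "0 < (r * g (r * v)) powr ((\<alpha> - 1) / \<alpha>)" if "v \<in> ivl (c / ereal r) (d / ereal r)" for v
   using that inv_radius_props(1) unfolding support_scale[symmetric] by (auto simp: support_def)
  have "(NN x:ivl a b. ennreal ((r * g (r * y x)) powr ((\<alpha> - 1) / \<alpha>)) *
    ennreal (if x \<in> ivl a b then h x / (r * g (r * y x)) powr ((\<alpha> - 1) / \<alpha>) else 1))
   = (NN x:ivl a b. ennreal (h x))"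
  proof (intro nn_integral_cong)
   fix x
   show "ennreal ((r * g (r * y x)) powr ((\<alpha> - 1) / \<alpha>)) *
    ennreal (if x \<in> ivl a b then h x / (r * g (r * y x)) powr ((\<alpha> - 1) / \<alpha>) else 1) * indicator (ivl a b) x =
    ennreal (h x) * indicator (ivl a b) x"
    using inv_coord_pos(1)[of x] by (auto simp: indicator_def ennreal_mult'[symmetric])
  qed
  then show "(NN x:ivl a b. ennreal ((r * g (r * y x)) powr ((\<alpha> - 1) / \<alpha>)) *
    ennreal (if x \<in> ivl a b then h x / (r * g (r * y x)) powr ((\<alpha> - 1) / \<alpha>) else 1))
   = (NN v:ivl (c / ereal r) (d / ereal r). ennreal ((r * g (r * v)) powr ((\<alpha> - 1) / \<alpha>)))"
   using prob_density_onD(4)[OF h] inv_radius_props(2) unfolding support_scale by simp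
  show "(NN v:ivl (c / ereal r) (d / ereal r). ennreal ((r * g (r * v)) powr ((\<alpha> - 1) / \<alpha>))) < \<infinity>"
   using inv_radius_props(2) unfolding support_scale by simp
 qed measurable
qed

lemma inv_transform_eq: "x \<in> ivl a b \<Longrightarrow> f x = (r * g (r * y x)) powr (1 / \<alpha>) * h x"
 by (simp add: f_def inv_transform_def r_def)

lemma inv_transform_pos: "x \<in> ivl a b \<Longrightarrow> 0 < f x"
 using inv_coord_pos(1)[of x] prob_density_onD(3)[OF h, of x] unfolding inv_transform_eq
 by (metis less_irrefl mult_pos_pos powr_gt_zero)

lemma inv_transform_ratio: "x \<in> ivl a b \<Longrightarrow> (f x / h x) powr \<alpha> = r * g (r * y x)"
 using inv_coord_pos(1)[of x] prob_density_onD(3)[OF h, of x] \<alpha> by (simp add: inv_transform_eq powr_powr)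

lemma inv_transform_measurable [measurable]: "f \<in> borelfun"
proof -
 interpret coordinate a b "\<lambda>x. if x \<in> ivl a b then h x / (r * g (r * y x)) powr ((\<alpha> - 1) / \<alpha>) else 1" y
  by (rule inv_coord_coordinate)
 note [measurable] = prob_density_onD(1)[OF h]
 have "(\<lambda>x. if x \<in> ivl a b then (r * g (r * (indicator (ivl a b) x * y x))) powr (1 / \<alpha>) * h x else 0) \<in> borelfun"
  by measurable
 also have "(\<lambda>x. if x \<in> ivl a b then (r * g (r * (indicator (ivl a b) x * y x))) powr (1 / \<alpha>) * h x else 0) = f"
  by (auto simp: f_def inv_transform_def r_def)
 finally show ?thesis .
qed

text \<open>Since 1/\<alpha> + (\<alpha> - 1)/\<alpha> = 1, f dx is r g(r y) dy, and
  \<open>r y\<close> carries it to g du. Moments and entropies of \<open>f\<close> thereby become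
  integrals of \<open>g\<close>.\<close>

lemma inv_transform_pushforward:
 fixes \<phi> :: "real \<Rightarrow> ennreal"
 assumes [measurable]: "\<phi> \<in> borelfun"
 shows "(NN x:ivl a b. \<phi> (r * y x) * ennreal (f x)) = (NN u. \<phi> u * ennreal (g u))"
proof -
 interpret coordinate a b "\<lambda>x. if x \<in> ivl a b then h x / (r * g (r * y x)) powr ((\<alpha> - 1) / \<alpha>) else 1" y
  by (rule inv_coord_coordinate)
 have [measurable]: "support g \<in> sets borel" unfolding g_supp by measurable
 have r: "0 < r" by (rule inv_radius_props)
 have "(NN x:ivl a b. \<phi> (r * y x) * ennreal (f x)) =
   (NN v:y ` ivl a b. \<phi> (r * v) * ennreal (r * g (r * v)))"
 proof (rule pushforward_density[of "\<lambda>v. \<phi> (r * v)"])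
  fix x assume x: "x \<in> ivl a b"
  have "(r * g (r * y x)) powr (1 / \<alpha>) * (r * g (r * y x)) powr ((\<alpha> - 1) / \<alpha>) = (r * g (r * y x)) powr (1 / \<alpha> + (\<alpha> - 1) / \<alpha>)"
   by (simp add: powr_add)
  also have "1 / \<alpha> + (\<alpha> - 1) / \<alpha> = 1" using \<alpha> by (simp add: field_simps)
  finally have "(r * g (r * y x)) powr (1 / \<alpha>) * (r * g (r * y x)) powr ((\<alpha> - 1) / \<alpha>) = r * g (r * y x)"
   using inv_coord_pos(1)[OF x] by simp
  then show "(if x \<in> ivl a b then h x / (r * g (r * y x)) powr ((\<alpha> - 1) / \<alpha>) else 1) = f x / (r * g (r * y x))"
   using x inv_coord_pos(1)[OF x] by (simp add: inv_transform_eq divide_simps)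
 qed (use inv_coord_pos in auto)
 also have "\<dots> = (NN v. ennreal r * ((\<phi> (v / (1 / r)) * ennreal (g (v / (1 / r)))) * indicator (support g) (v / (1 / r))))"
  unfolding inv_coord_image using r g_nonneg
  by (intro nn_integral_cong) (auto simp: indicator_def ennreal_mult mult_ac)
 also have "\<dots> = ennreal r * (NN v. (\<phi> (v / (1 / r)) * ennreal (g (v / (1 / r)))) * indicator (support g) (v / (1 / r)))"
  by (rule nn_integral_cmult) measurable
 also have "\<dots> = ennreal r * (ennreal (1 / r) * (NN u:support g. \<phi> u * ennreal (g u)))"
  using r by (subst nn_integral_scale[of "\<lambda>v. \<phi> v * ennreal (g v) * indicator (support g) v"]) auto
 also have "\<dots> = (NN u:support g. \<phi> u * ennreal (g u))"
  using r by (simp add: mult.assoc[symmetric] ennreal_mult[symmetric])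
 also have "\<dots> = (NN u. \<phi> u * ennreal (g u))"
  using g_nonneg by (intro nn_integral_cong) (auto simp: indicator_def support_def not_less dest: antisym)
 finally show ?thesis .
qed

lemma inv_transform_bochner:
 fixes F :: "real \<Rightarrow> real"
 assumes [measurable]: "F \<in> borelfun"
  and int: "has_bochner_integral lborel (\<lambda>u. g u * F u) \<mu>"
 shows "has_bochner_integral lborel (\<lambda>x. indicator (ivl a b) x * f x * F (r * y x)) \<mu>"
proof -
 interpret coordinate a b "\<lambda>x. if x \<in> ivl a b then h x / (r * g (r * y x)) powr ((\<alpha> - 1) / \<alpha>) else 1" y
  by (rule inv_coord_coordinate)
 define k where "k x = indicator (ivl a b) x * f x * F (r * y x)" for x
 have "(\<lambda>x. indicator (ivl a b) x * f x * F (r * (indicator (ivl a b) x * y x))) \<in> borelfun" by measurable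
 also have "(\<lambda>x. indicator (ivl a b) x * f x * F (r * (indicator (ivl a b) x * y x))) = k"
  by (auto simp: k_def indicator_def)
 finally have [measurable]: "k \<in> borelfun" .
 \<comment> \<open>The values e = 1 and e = -1 give the positive and the negative part.\<close>
 have P: "(NN x. ennreal (e * k x)) = (NN u. ennreal (e * (g u * F u)))" for e :: real proof -
  have "(NN x. ennreal (e * k x)) = (NN x:ivl a b. ennreal (e * F (r * y x)) * ennreal (f x))"
  proof (intro nn_integral_cong)
   fix x
   show "ennreal (e * k x) = ennreal (e * F (r * y x)) * ennreal (f x) * indicator (ivl a b) x"
   proof (cases "x \<in> ivl a b")
    case True
    then have "e * k x = e * F (r * y x) * f x" by (simp add: k_def mult_ac)
    moreover have "ennreal (e * F (r * y x) * f x) = ennreal (e * F (r * y x)) * ennreal (f x)"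
     by (rule ennreal_mult'') (rule less_imp_le[OF inv_transform_pos[OF True]])
    ultimately show ?thesis using True by (metis indicator_simps(1) mult.right_neutral)
   qed (simp add: k_def)
  qed
  also have "\<dots> = (NN u. ennreal (e * F u) * ennreal (g u))" by (rule inv_transform_pushforward) measurable
  also have "\<dots> = (NN u. ennreal (e * (g u * F u)))"
  proof (intro nn_integral_cong)
   fix u
   have "e * (g u * F u) = e * F u * g u" by (simp add: mult_ac)
   moreover have "ennreal (e * F u * g u) = ennreal (e * F u) * ennreal (g u)"
    by (rule ennreal_mult'') (rule g_nonneg)
   ultimately show "ennreal (e * F u) * ennreal (g u) = ennreal (e * (g u * F u))" by metis
  qed
  finally show ?thesis .
 qed
 have i: "integrable lborel (\<lambda>u. g u * F u)" "integral\<^sup>L lborel (\<lambda>u. g u * F u) = \<mu>"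
  using int by (auto simp: has_bochner_integral_iff)
 have ik: "integrable lborel k" using i(1) P[of 1] P[of "-1"] unfolding real_integrable_def by simp
 have "integral\<^sup>L lborel k = \<mu>"
  unfolding real_lebesgue_integral_def[OF ik] i(2)[symmetric] real_lebesgue_integral_def[OF i(1)]
  using P[of 1] P[of "-1"] by simp
 with ik show ?thesis unfolding k_def by (simp add: has_bochner_integral_iff)
qed

lemma inv_transform_escort_coord: "escort_coord \<alpha> (ivl a b) f h y"
 unfolding escort_coord_def
proof (intro ballI impI)
 fix s t assume st: "s \<in> ivl a b" "t \<in> ivl a b" "s \<le> t"
 interpret coordinate a b "\<lambda>x. if x \<in> ivl a b then h x / (r * g (r * y x)) powr ((\<alpha> - 1) / \<alpha>) else 1" y
  by (rule inv_coord_coordinate)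
 have eq: "f x powr (1 - \<alpha>) * h x powr \<alpha> = h x / (r * g (r * y x)) powr ((\<alpha> - 1) / \<alpha>)" if x: "x \<in> ivl a b" for x
 proof -
  have hx: "0 < h x" by (rule prob_density_onD(3)[OF h x])
  have "f x powr (1 - \<alpha>) = (r * g (r * y x)) powr ((1 - \<alpha>) / \<alpha>) * h x powr (1 - \<alpha>)"
   using inv_coord_pos(1)[OF x] hx by (simp add: inv_transform_eq[OF x] powr_mult powr_powr)
  moreover have "h x powr (1 - \<alpha>) * h x powr \<alpha> = h x" using hx by (simp flip: powr_add)
  moreover have "(1 - \<alpha>) / \<alpha> = - ((\<alpha> - 1) / \<alpha>)" by (metis minus_diff_eq minus_divide_left)
  ultimately show ?thesis by (simp add: powr_minus_divide mult.assoc)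
 qed
 show "(NN x:{s..t}. ennreal (f x powr (1 - \<alpha>) * h x powr \<alpha>)) = ennreal (y t - y s)"
  unfolding integral_eq[OF st, symmetric] using einterval_Icc_subset[OF st(1,2)]
  by (intro nn_integral_cong) (auto simp: indicator_def eq)
qed

lemma inv_transform_prob_density:
 assumes "(NN u. ennreal (g u)) = 1"
 shows "prob_density_on (ivl a b) f"
proof (rule prob_density_onI)
 show "(NN x:ivl a b. ennreal (f x)) = 1" using inv_transform_pushforward[of "\<lambda>_. 1"] assms by simp
 show "f x = 0" if "x \<notin> ivl a b" for x using that by (simp add: f_def inv_transform_def)
qed (use inv_transform_pos in auto)

text \<open>The integrand is R^(\<lambda>-1) f with R = (f/h)^\<alpha> = r g(r y); transporting
  \<open>f\<close> to \<open>g\<close> does the rest.\<close>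

lemma inv_transform_renyi: "renyi_integral (rel_order lam \<alpha>) (ivl a b) f h = ennreal (r powr (lam - 1)) * (NN u. ennreal (g u powr lam))"
proof -
 have eq: "f x powr rel_order lam \<alpha> * h x powr (1 - rel_order lam \<alpha>) = (r * g (r * y x)) powr (lam - 1) * f x" if x: "x \<in> ivl a b" for x
 proof -
  have f0: "0 < f x" and h0: "0 < h x" using inv_transform_pos[OF x] prob_density_onD(3)[OF h x] by auto
  have "((f x / h x) powr \<alpha>) powr lam = ((f x / h x) powr \<alpha>) powr (lam - 1) * (f x / h x) powr \<alpha>"
   using f0 h0 by (simp add: powr_powr algebra_simps flip: powr_add)
  then show ?thesis
   unfolding escort_identities(2)[OF f0 h0, symmetric] using escort_identities(1)[OF f0 h0, of \<alpha>]
   by (simp only: mult.assoc inv_transform_ratio[OF x])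
 qed
 have "renyi_integral (rel_order lam \<alpha>) (ivl a b) f h = (NN x:ivl a b. ennreal ((r * g (r * y x)) powr (lam - 1)) * ennreal (f x))"
  unfolding renyi_integral_def
 proof (rule nn_set_cong)
  fix x assume True: "x \<in> ivl a b"
  show "ennreal (f x powr rel_order lam \<alpha> * h x powr (1 - rel_order lam \<alpha>)) = ennreal ((r * g (r * y x)) powr (lam - 1)) * ennreal (f x)" unfolding eq[OF True] using less_imp_le[OF inv_transform_pos[OF True]] by (simp add: ennreal_mult'')
 qed
 also have "\<dots> = (NN u. ennreal ((r * g u) powr (lam - 1)) * ennreal (g u))"
  by (rule inv_transform_pushforward) measurable
 also have "\<dots> = (NN u. ennreal (r powr (lam - 1)) * ennreal (g u powr lam))"
 proof (intro nn_integral_cong)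
  fix u
  have "g u powr lam = g u powr (lam - 1) * g u"  using powr_add[of "g u" "lam - 1" 1] g_nonneg[of u] by simp
  then show "ennreal ((r * g u) powr (lam - 1)) * ennreal (g u) = ennreal (r powr (lam - 1)) * ennreal (g u powr lam)"
   using inv_radius_props(1) g_nonneg[of u] by (simp add: powr_mult ennreal_mult mult.assoc)
 qed
 also have "\<dots> = ennreal (r powr (lam - 1)) * (NN u. ennreal (g u powr lam))"
  by (rule nn_integral_cmult) measurable
 finally show ?thesis .
qed

end

end

text \<open>
 The scale is the one for which \<open>h\<close> has integral \<open>1\<close>, since \<open>h\<close> is \<open>((f/h)^\<alpha>)^((\<alpha>-1)/\<alpha>)\<close> times
 the derivative of \<open>y\<close>.
\<close>

lemma inv_coord_of_ratio:
 assumes ab: "a < b" and f: "prob_density_on (ivl a b) f" and h: "prob_density_on (ivl a b) h"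
  and \<alpha>: "0 < \<alpha>" and y: "escort_coord \<alpha> (ivl a b) f h y"
  and g [measurable]: "g \<in> borelfun" and g_nonneg: "\<And>v. 0 \<le> g v"
  and supp: "support g = ivl c d" and g1: "(NN v. ennreal (g v)) = 1"
  and t: "0 < t"
  and ratio: "AE x\<in>ivl a b in lborel. (f x / h x) powr \<alpha> = g (y x / t) / t"
 shows "inv_coord \<alpha> (ivl a b) h g y"
  "AE x\<in>ivl a b in lborel. f x = inv_transform \<alpha> (ivl a b) h g y x"
  "inv_radius \<alpha> g = 1 / t" proof -
 note [measurable] = f[THEN prob_density_onD(1)] h[THEN prob_density_onD(1)]
 note fpos = prob_density_onD(3)[OF f] and hpos = prob_density_onD(3)[OF h]
 define w where "w x = f x powr (1 - \<alpha>) * h x powr \<alpha>" for x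
 interpret coordinate a b w y unfolding w_def by (rule escort_coordinate[OF ab f h y])
 define s where "s = (\<alpha> - 1) / \<alpha>"
 have s: "s \<noteq> 1" "1 / (1 - s) = \<alpha>" "1 - s = 1 / \<alpha>" using \<alpha> by (auto simp: s_def field_simps)
 have [measurable]: "support g \<in> sets borel" unfolding supp by measurable
 have ne: "AE x\<in>ivl a b in lborel. 0 < g (y x / t)" using ratio
 proof eventually_elim
  case (elim x)
  show ?case
  proof
   assume x: "x \<in> ivl a b"
   have "0 < (f x / h x) powr \<alpha>" using fpos[OF x] hpos[OF x] by simp
   then show "0 < g (y x / t)" using elim x t by (simp add: zero_less_divide_iff)
  qed
 qed
 have no_interval: False if "u < v" "{u<..<v} \<subseteq> ivl a b" "\<And>x. x \<in> {u<..<v} \<Longrightarrow> g (y x / t) = 0" for u v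
 proof -
  have "AE x in lborel. x \<notin> {u<..<v}" using ne by eventually_elim (use that(2,3) in force)
  then have "{u<..<v} \<in> null_sets lborel" using AE_iff_null_sets[of "{u<..<v}" lborel] by simp
  then show False using that(1) by (auto simp: null_sets_def)
 qed
 \<comment> \<open>The hypothesis holds almost everywhere, but monotonicity of \<open>y\<close>
   makes this pointwise: leaving the support at one point means leaving it on a whole interval to
   one side.\<close>
 have inS: "y x / t \<in> ivl c d" if x: "x \<in> ivl a b" for x
 proof (rule ccontr)
  assume out: "y x / t \<notin> ivl c d"
  obtain u v where uv: "u \<in> ivl a b" "v \<in> ivl a b" "u < x" "x < v" using einterval_two_sided[OF x] .
  have g0: "g z = 0" if "z \<notin> ivl c d" for z
   using that g_nonneg[of z] unfolding supp[symmetric] by (simp add: support_def)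
  consider "ereal (y x / t) \<le> c" | "d \<le> ereal (y x / t)" using out by (auto simp: einterval_iff not_less)
  then show False
  proof cases
   case 1
   have "g (y z / t) = 0" if "z \<in> {u<..<x}" for z
   proof (rule g0)
    have "z \<in> ivl a b" using einterval_Icc_subset[OF uv(1) x] that by auto
    then have "y z / t < y x / t" using that t x by (simp add: mono divide_strict_right_mono)
    then have "ereal (y z / t) < c" using 1 by (metis less_ereal.simps(1) order.strict_trans2)
    then show "y z / t \<notin> ivl c d" by (auto simp: einterval_iff)
   qed
   then show False using no_interval[of u x] uv einterval_Icc_subset[OF uv(1) x] by (auto simp: subset_iff)
  next
   case 2
   have "g (y z / t) = 0" if "z \<in> {x<..<v}" for z
   proof (rule g0)
    have "z \<in> ivl a b" using einterval_Icc_subset[OF x uv(2)] that by auto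
    then have "y x / t < y z / t" using that t x by (simp add: mono divide_strict_right_mono)
    then have "d < ereal (y z / t)" using 2 by (metis less_ereal.simps(1) order.strict_trans1)
    then show "y z / t \<notin> ivl c d" by (auto simp: einterval_iff)
   qed
   then show False using no_interval[of x v] uv einterval_Icc_subset[OF x uv(2)] by (auto simp: subset_iff)
  qed
 qed
 have gpos: "0 < g (y x / t)" if "x \<in> ivl a b" for x
  using inS[OF that] unfolding supp[symmetric] by (simp add: support_def)
 have S: "{v. v / t \<in> ivl c d} = ivl (c / ereal (1 / t)) (d / ereal (1 / t))"
  using einterval_scale[of "1 / t" c d] t by simp
 have ratio': "AE x\<in>ivl a b in lborel. ennreal (((g (y x / t) / t)) powr k) = ennreal (((f x / h x) powr \<alpha>) powr k)" for k
  using ratio by eventually_elim auto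
 have image: "y ` ivl a b = {v. v / t \<in> ivl c d}" unfolding S
 proof (rule image_eqI[of _ _ "\<lambda>v. g (v / t) / t"])
  show "y ` ivl a b \<subseteq> ivl (c / ereal (1 / t)) (d / ereal (1 / t))" unfolding S[symmetric] using inS by auto
  show "0 < g (v / t) / t" if "v \<in> ivl (c / ereal (1 / t)) (d / ereal (1 / t))" for v
   using that t unfolding S[symmetric] supp[symmetric] by (simp add: support_def)
  have "(NN x:ivl a b. ennreal (g (y x / t) / t) * ennreal (w x))
   = (NN x:ivl a b. ennreal (f x))"
  proof (rule nn_integral_cong_AE)
   show "AE x in lborel. ennreal (g (y x / t) / t) * ennreal (w x) * indicator (ivl a b) x = ennreal (f x) * indicator (ivl a b) x"
    using ratio
   proof eventually_elim
    case (elim x)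
    show ?case
    proof (cases "x \<in> ivl a b")
     case True
     then have "ennreal (g (y x / t) / t) * ennreal (w x) = ennreal ((f x / h x) powr \<alpha> * w x)"
      using elim w_pos[OF True] by (simp add: ennreal_mult'' del: times_divide_eq_left)
     then show ?thesis unfolding w_def escort_identities(1)[OF fpos[OF True] hpos[OF True]] by simp
    qed auto
   qed
  qed
  moreover have "(NN v:ivl (c / ereal (1 / t)) (d / ereal (1 / t)). ennreal (g (v / t) / t)) = 1" proof -
   have "(NN v:ivl (c / ereal (1 / t)) (d / ereal (1 / t)). ennreal (g (v / t) / t))
    = (NN v. ennreal (1 / t) * ennreal (g (v / t)))" unfolding S[symmetric] supp[symmetric] using t g_nonneg
    by (intro nn_integral_cong) (auto simp: indicator_def support_def ennreal_mult[symmetric] not_less dest: antisym)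
   also have "\<dots> = ennreal (1 / t) * (NN v. ennreal (g (v / t)))" by (rule nn_integral_cmult) measurable
   also have "\<dots> = ennreal (1 / t) * (ennreal t * 1)"
    using t by (subst nn_integral_scale[of "\<lambda>v. ennreal (g v)"]) (auto simp: g1)
   also have "\<dots> = 1" using t by (simp add: ennreal_mult[symmetric])
   finally show ?thesis .
  qed
  ultimately show "(NN x:ivl a b. ennreal (g (y x / t) / t) * ennreal (w x))
   = (NN v:ivl (c / ereal (1 / t)) (d / ereal (1 / t)). ennreal (g (v / t) / t))"
   "(NN v:ivl (c / ereal (1 / t)) (d / ereal (1 / t)). ennreal (g (v / t) / t)) < \<infinity>"
   using prob_density_onD(4)[OF f] by auto
 qed measurable
 define N where "N = (NN v:support g. ennreal (g v powr s))"
 \<comment> \<open>The mass of \<open>h\<close>, computed through the third escort identity as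
   t^(1/\<alpha>) N, determines N and with it the radius.\<close>
 have "1 = (NN x:ivl a b. ennreal (h x))" using prob_density_onD(4)[OF h] by simp
 also have "\<dots> = (NN x:ivl a b. ennreal ((g (y x / t) / t) powr s) * ennreal (w x))"
 proof (rule nn_integral_cong_AE)
  show "AE x in lborel. ennreal (h x) * indicator (ivl a b) x = ennreal ((g (y x / t) / t) powr s) * ennreal (w x) * indicator (ivl a b) x"
   using ratio'[of s]
  proof eventually_elim
   case (elim x)
   show ?case
   proof (cases "x \<in> ivl a b")
    case True
    then have "ennreal ((g (y x / t) / t) powr s) * ennreal (w x) = ennreal (((f x / h x) powr \<alpha>) powr s * w x)"
     using elim w_pos[OF True] by (simp add: ennreal_mult)
    then show ?thesis using True \<alpha> escort_identities(3)[OF fpos[OF True] hpos[OF True], of \<alpha>] unfolding w_def s_def by simp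
   qed auto
  qed
 qed
 also have "\<dots> = (NN v:{v. v / t \<in> ivl c d}. ennreal ((g (v / t) / t) powr s))"
  unfolding image[symmetric] by (rule pushforward) measurable
 also have "\<dots> = (NN v. ennreal (t powr (-s)) * (ennreal (g (v / t) powr s) * indicator (support g) (v / t)))"
  unfolding supp[symmetric]
 proof (intro nn_integral_cong)
  fix v
  have "(g (v / t) / t) powr s = t powr (- s) * g (v / t) powr s"
   using t g_nonneg by (subst powr_divide) (simp_all add: powr_minus divide_inverse mult.commute)
  then show "ennreal ((g (v / t) / t) powr s) * indicator {v. v / t \<in> support g} v
   = ennreal (t powr - s) * (ennreal (g (v / t) powr s) * indicator (support g) (v / t))"
   by (auto simp: indicator_def ennreal_mult)
 qed
 also have "\<dots> = ennreal (t powr (-s)) * (NN v. ennreal (g (v / t) powr s) * indicator (support g) (v / t))"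
  by (rule nn_integral_cmult) measurable
 also have "\<dots> = ennreal (t powr (-s)) * (ennreal t * N)"
  unfolding N_def using t by (subst nn_integral_scale[of "\<lambda>v. ennreal (g v powr s) * indicator (support g) v"]) auto
 also have "\<dots> = ennreal (t powr (1 / \<alpha>)) * N" proof -
  have "t powr (- s) * t = t powr (1 / \<alpha>)" unfolding s(3)[symmetric] using t powr_add[of t "- s" 1] by simp
  then show ?thesis using t by (simp add: mult.assoc[symmetric] ennreal_mult[symmetric])
 qed
 finally have tN: "ennreal (t powr (1 / \<alpha>)) * N = 1" by simp
 then obtain n where n: "N = ennreal n" "0 < n"
  by (cases N rule: ennreal_cases_pos) (use t in \<open>auto simp: ennreal_mult_top\<close>)
 have "t powr (1 / \<alpha>) * n = 1" using tN n by (simp add: ennreal_mult[symmetric])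
 then have "n = 1 / t powr (1 / \<alpha>)" using t by (simp add: field_simps)
 then have "n powr \<alpha> = 1 / t" using t \<alpha> by (simp add: powr_divide powr_powr)
 then show r: "inv_radius \<alpha> g = 1 / t"
  unfolding inv_radius_def s_def[symmetric] renyi_power_def N_def[symmetric] using s n t by (simp add: epowr_ennreal)
 have conv: "(1 / t * g (1 / t * y x)) = g (y x / t) / t" for x by simp
 show "inv_coord \<alpha> (ivl a b) h g y" unfolding inv_coord_def r conv s_def[symmetric]
 proof (intro conjI ballI impI)
  show "1 / t * y x \<in> support g" if "x \<in> ivl a b" for x using gpos[OF that] by (simp add: support_def)
  fix u v assume uv: "u \<in> ivl a b" "v \<in> ivl a b" "u \<le> v"
  show "(NN x:{u..v}. ennreal ((g (y x / t) / t) powr - s * h x)) = ennreal (y v - y u)"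
   unfolding integral_eq[OF uv, symmetric]
  proof (rule nn_integral_cong_AE)
   show "AE x in lborel. ennreal ((g (y x / t) / t) powr - s * h x) * indicator {u..v} x = ennreal (w x) * indicator {u..v} x"
    using ratio
   proof eventually_elim
    case (elim x)
    show ?case
    proof (cases "x \<in> {u..v}")
     case True
     then have x: "x \<in> ivl a b" using einterval_Icc_subset[OF uv(1,2)] by auto
     have "((f x / h x) powr \<alpha>) powr (- s) * (((f x / h x) powr \<alpha>) powr s * w x) = w x"
      using fpos[OF x] hpos[OF x] by (simp add: mult.assoc[symmetric] flip: powr_add)
     moreover have "((f x / h x) powr \<alpha>) powr s * w x = h x"
      using \<alpha> escort_identities(3)[OF fpos[OF x] hpos[OF x], of \<alpha>] unfolding w_def s_def by simp
     ultimately have "((f x / h x) powr \<alpha>) powr (- s) * h x = w x" by simp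
     moreover have "(f x / h x) powr \<alpha> = g (y x / t) / t" using elim x by blast
     ultimately show ?thesis by simp
    qed auto
   qed
  qed
 qed
 show "AE x\<in>ivl a b in lborel. f x = inv_transform \<alpha> (ivl a b) h g y x" using ratio
 proof eventually_elim
  case (elim x)
  show ?case
  proof
   assume x: "x \<in> ivl a b"
   have "((f x / h x) powr \<alpha>) powr (1 / \<alpha>) * h x = f x"
    using fpos[OF x] hpos[OF x] \<alpha> by (simp add: powr_powr)
   then show "f x = inv_transform \<alpha> (ivl a b) h g y x" using elim x unfolding inv_transform_def r conv by simp
  qed
 qed
qed

text \<open>Only an upper bound for the left side has to be computed; the opposite inequality is (i)
  itself.\<close>

lemma moment_entropy_minimizer:
 assumes ab: "a < b" and h: "prob_density_on (ivl a b) h" and range: "me_range p lam" and \<alpha>: "0 < \<alpha>"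
  and fin: "renyi_power ((\<alpha> - 1) / \<alpha>) (stretched_gaussian p lam) < \<infinity>"
 shows "\<exists>y. inv_coord \<alpha> (ivl a b) h (stretched_gaussian p lam) y"
  and "inv_coord \<alpha> (ivl a b) h (stretched_gaussian p lam) y \<Longrightarrow>
    f = inv_transform \<alpha> (ivl a b) h (stretched_gaussian p lam) y \<Longrightarrow>
    prob_density_on (ivl a b) f \<and> escort_coord \<alpha> (ivl a b) f h y \<and>
    moment_entropy_defined p \<alpha> lam (ivl a b) f h (\<lambda>x. ennreal \<bar>y x\<bar>) \<and>
    moment_entropy_lhs p \<alpha> lam (ivl a b) f h (\<lambda>x. ennreal \<bar>y x\<bar>) = epowr (K0 p lam) (1 / \<alpha>)"
proof -
 define G where "G = stretched_gaussian p lam"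
 have [measurable]: "G \<in> borelfun" unfolding G_def by measurable
 have Gnn: "0 \<le> G v" for v unfolding G_def by (rule stretched_gaussian_nonneg[OF range])
 obtain \<rho> where "0 < \<rho>" "support G = ivl (- \<rho>) \<rho>"
  using stretched_profile_support[OF range] unfolding G_def support_stretched_gaussian[OF range] .
 note supp = this(2)
 have \<rho>: "- \<rho> < \<rho>" using \<open>0 < \<rho>\<close> by (cases \<rho>) auto
 have Gm: "G \<in> borelfun" by measurable
 show "\<exists>y. inv_coord \<alpha> (ivl a b) h (stretched_gaussian p lam) y"
  using inv_coord_exists[OF ab h Gm Gnn supp \<rho> \<alpha> fin[folded G_def]] by (simp add: G_def)
 assume "inv_coord \<alpha> (ivl a b) h (stretched_gaussian p lam) y"
  and f_eq: "f = inv_transform \<alpha> (ivl a b) h (stretched_gaussian p lam) y"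
 then have y: "inv_coord \<alpha> (ivl a b) h G y" and f_def: "f = inv_transform \<alpha> (ivl a b) h G y"
  by (auto simp: G_def)
 define r where "r = inv_radius \<alpha> G"
 note inv = inv_coord_exists[OF ab h Gm Gnn supp \<rho> \<alpha> fin[folded G_def]] ab h Gm Gnn supp \<rho> \<alpha> fin[folded G_def] y
 have r: "0 < r" unfolding r_def by (rule inv_radius_props[OF inv(2-9)])
 note l = me_rangeD[OF range]
 note mass = gaussian_mass_nn_integral[OF range] and sig = sigma_stretched_gaussian[OF range]
 have f: "prob_density_on (ivl a b) f" unfolding f_def by (rule inv_transform_prob_density[OF inv(2-10)])
   (simp add: G_def stretched_gaussian_nn_integral[OF range])
 note [measurable] = f[THEN prob_density_onD(1)] h[THEN prob_density_onD(1)]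
 note fpos = prob_density_onD(3)[OF f]
 have ey: "escort_coord \<alpha> (ivl a b) f h y" unfolding f_def by (rule inv_transform_escort_coord[OF inv(2-10)])
 interpret coordinate a b "\<lambda>x. f x powr (1 - \<alpha>) * h x powr \<alpha>" y by (rule escort_coordinate[OF ab f h ey])
 define gs where "gs = gen_sigma (hconj p) \<alpha> (ivl a b) f (\<lambda>x. ennreal \<bar>y x\<bar>)"
 define e where "e = 1 / (\<alpha> * (lam - 1))"
 have I: "renyi_integral (rel_order lam \<alpha>) (ivl a b) f h = ennreal (r powr (lam - 1) * gaussian_mass p lam)"
  using inv_transform_renyi[OF inv(2-10)] mass
  unfolding f_def[symmetric] r_def[symmetric] by (simp add: G_def ennreal_mult)
 have gs: "gs \<le> ennreal ((gaussian_sigma p lam / r) powr (1 / \<alpha>))" using range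
 proof (cases rule: me_range_cases)
  case one
  have G: "G = (\<lambda>x. if \<bar>x\<bar> < 1 then 1 / 2 else 0)"
   using gaussian_sup_moment(2)[OF l] one by (simp add: G_def)
  have s1: "gaussian_sigma p lam = 1" using gaussian_sup_moment(1)[OF l] one by (simp add: gaussian_sigma_def)
  have "\<bar>y x\<bar> \<le> 1 / r" if "x \<in> ivl a b" for x proof -
   have "r * y x \<in> support G" using inv_coord_pos(2)[OF inv(2-10) that] by (simp add: r_def)
   then have "\<bar>r * y x\<bar> < 1" by (auto simp: support_def G split: if_splits)
   then show ?thesis using r by (simp add: abs_mult field_simps)
  qed
  then have "esssup (density lborel (\<lambda>x. ennreal (f x) * indicator (ivl a b) x)) (\<lambda>x. ennreal \<bar>y x\<bar> * indicator (ivl a b) x) \<le> ennreal (1 / r)"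
  proof (intro esssup_density_le)
   have "(\<lambda>x. ennreal \<bar>indicator (ivl a b) x * y x\<bar>) \<in> borelfun" by measurable
   also have "(\<lambda>x. ennreal \<bar>indicator (ivl a b) x * y x\<bar>) = (\<lambda>x. ennreal \<bar>y x\<bar> * indicator (ivl a b) x)"
    by (auto simp: indicator_def)
   finally show "\<dots> \<in> borelfun" .
  qed (auto intro: ennreal_leI)
  then have "gs \<le> epowr (ennreal (1 / r)) (1 / \<alpha>)"
   unfolding gs_def gen_sigma_def using one \<alpha> by (auto intro: epowr_mono)
  then show ?thesis using r unfolding s1 by (simp add: epowr_ennreal)
 next
  case zero
  obtain \<mu> where \<mu>: "has_bochner_integral lborel (\<lambda>x. stretched_gaussian 0 lam x * ln \<bar>x\<bar>) \<mu>"
   "sigma 0 (stretched_gaussian 0 lam) = ennreal (exp \<mu>)" using gaussian_ln_moment range zero by metis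
  have s1: "gaussian_sigma p lam = exp \<mu>" using \<mu> zero by (simp add: gaussian_sigma_def)
  have i1: "has_bochner_integral lborel (\<lambda>x. indicator (ivl a b) x * f x * 1) 1"
   unfolding f_def by (rule inv_transform_bochner[OF inv(2-10)])
    (use stretched_gaussian_integral[OF range] in \<open>auto simp: G_def\<close>)
  have i2: "has_bochner_integral lborel (\<lambda>x. indicator (ivl a b) x * f x * ln \<bar>r * y x\<bar>) \<mu>"
   unfolding f_def r_def by (rule inv_transform_bochner[OF inv(2-10)])
    (use \<mu> zero in \<open>auto simp: G_def\<close>)
  have "has_bochner_integral lborel (\<lambda>x. indicator (ivl a b) x * f x * (- 1 * (- ln \<bar>r * y x / r\<bar>))) (- 1 * (ln r - \<mu>))"
  proof (rule base_integral_ln[OF _ i2 r])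
   show "AE x in lborel. indicator (ivl a b) x * f x \<noteq> 0 \<longrightarrow> r * y x \<noteq> 0"
    using AE_neq[of 0] by eventually_elim (use r in auto)
   have "(\<lambda>x. indicator (ivl a b) x * f x * (- 1 * (- ln \<bar>r * (indicator (ivl a b) x * y x) / r\<bar>))) \<in> borelfun"
    by measurable
   also have "(\<lambda>x. indicator (ivl a b) x * f x * (- 1 * (- ln \<bar>r * (indicator (ivl a b) x * y x) / r\<bar>)))
    = (\<lambda>x. indicator (ivl a b) x * f x * (- 1 * (- ln \<bar>r * y x / r\<bar>)))"
    by (auto simp: indicator_def)
   finally show "\<dots> \<in> borel_measurable lborel" by simp
  qed (use i1 in simp)
  then have "has_bochner_integral lborel (\<lambda>x. indicator (ivl a b) x * f x * ln \<bar>y x\<bar>) (\<mu> - ln r)"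
   using r by simp
  then have "gen_sigma 0 \<alpha> (ivl a b) f (\<lambda>x. ennreal \<bar>y x\<bar>) = ennreal (exp ((\<mu> - ln r) / \<alpha>))"
   by (intro gen_sigma_0(1)) (use AE_neq[of 0] \<alpha> less_imp_le[OF fpos] borel_measurable_indicator in auto)
  also have "exp ((\<mu> - ln r) / \<alpha>) = (gaussian_sigma p lam / r) powr (1 / \<alpha>)"
   using r unfolding s1 by (simp add: powr_def ln_div)
  finally show ?thesis unfolding gs_def using zero by simp
 next
  case (powr q)
  obtain \<mu> where \<mu>: "0 < \<mu>" "has_bochner_integral lborel (\<lambda>x. stretched_gaussian p lam x * \<bar>x\<bar> powr q) \<mu>"
   "sigma (hconj p) (stretched_gaussian p lam) = ennreal (\<mu> powr (1 / q))"
   using gaussian_powr_moment[OF range powr(1,2,3,5)] .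
  have s1: "gaussian_sigma p lam = \<mu> powr (1 / q)" using \<mu> by (simp add: gaussian_sigma_def)
  have q: "0 < q" by (rule powr(5))
  have i: "has_bochner_integral lborel (\<lambda>x. indicator (ivl a b) x * f x * (\<bar>r * y x\<bar> powr q / r powr q)) (\<mu> / r powr q)"
   unfolding f_def r_def
   using inv_transform_bochner[OF inv(2-10), of "\<lambda>u. \<bar>u\<bar> powr q / inv_radius \<alpha> G powr q" "\<mu> / inv_radius \<alpha> G powr q"]
    has_bochner_integral_divide[OF \<mu>(2), of "inv_radius \<alpha> G powr q"] r by (simp add: G_def r_def)
  have i': "(\<lambda>x. indicator (ivl a b) x * f x * (\<bar>r * y x\<bar> powr q / r powr q)) = (\<lambda>x. indicator (ivl a b) x * (\<bar>y x\<bar> powr q * f x))"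
   using r by (auto simp: abs_mult powr_mult)
  have "(NN x:ivl a b. ennreal (\<bar>y x\<bar> powr q * f x)) = (NN x. ennreal (indicator (ivl a b) x * (\<bar>y x\<bar> powr q * f x)))"
   by (intro nn_integral_cong) (auto simp: indicator_def)
  also have "\<dots> = ennreal (\<mu> / r powr q)"
   using i prob_density_onD(2)[OF f] unfolding i' by (simp add: nn_integral_eq_integral has_bochner_integral_iff)
  finally have "gs = ennreal ((\<mu> / r powr q) powr (1 / (q * \<alpha>)))"
   unfolding gs_def powr(4) using gen_sigma_powr[of q "ivl a b" f \<alpha> y, OF q less_imp_le[OF fpos]] \<mu> r
   by (simp add: epowr_ennreal)
  also have "(\<mu> / r powr q) powr (1 / (q * \<alpha>)) = (gaussian_sigma p lam / r) powr (1 / \<alpha>)"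
   unfolding s1 using \<mu> r q by (simp add: powr_divide powr_powr)
  finally show ?thesis by simp
 qed
 have ED: "eexp (renyi_div (rel_order lam \<alpha>) (ivl a b) f h) = ennreal ((r powr (lam - 1) * gaussian_mass p lam) powr e)"
  unfolding renyi_div_epowr[OF l(2) \<alpha>] I e_def using r mass by (simp add: epowr_ennreal)
 have def: "moment_entropy_defined p \<alpha> lam (ivl a b) f h (\<lambda>x. ennreal \<bar>y x\<bar>)"
  unfolding moment_entropy_defined_def mult_defined_def ED renyi_div_defined_def I gs_def[symmetric]
  using gs r mass by (auto simp: top_unique)
 have "moment_entropy_lhs p \<alpha> lam (ivl a b) f h (\<lambda>x. ennreal \<bar>y x\<bar>)
  \<le> ennreal ((r powr (lam - 1) * gaussian_mass p lam) powr e) * ennreal ((gaussian_sigma p lam / r) powr (1 / \<alpha>))"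
  unfolding moment_entropy_lhs_def ED gs_def[symmetric] using gs by (rule mult_left_mono) simp
 also have "\<dots> = ennreal ((r powr (lam - 1) * gaussian_mass p lam) powr e * (gaussian_sigma p lam / r) powr (1 / \<alpha>))"
  by (simp add: ennreal_mult)
 \<comment> \<open>The scale enters as r^((\<lambda>-1) e) r^(-1/\<alpha>) with (\<lambda> - 1) e =
   1/\<alpha> and cancels.\<close>
 also have "(r powr (lam - 1) * gaussian_mass p lam) powr e * (gaussian_sigma p lam / r) powr (1 / \<alpha>)
  = gaussian_mass p lam powr e * gaussian_sigma p lam powr (1 / \<alpha>)" proof -
  have "(lam - 1) * e = 1 / \<alpha>" using l \<alpha> by (simp add: e_def)
  then show ?thesis using r mass sig by (simp add: powr_mult powr_divide powr_powr)
 qed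
 also have "ennreal \<dots> = epowr (K0 p lam) (1 / \<alpha>)" unfolding e_def by (rule epowr_K0[OF range \<alpha>, symmetric])
 finally show "prob_density_on (ivl a b) f \<and> escort_coord \<alpha> (ivl a b) f h y \<and>
    moment_entropy_defined p \<alpha> lam (ivl a b) f h (\<lambda>x. ennreal \<bar>y x\<bar>) \<and>
    moment_entropy_lhs p \<alpha> lam (ivl a b) f h (\<lambda>x. ennreal \<bar>y x\<bar>) = epowr (K0 p lam) (1 / \<alpha>)"
  using f ey def moment_entropy_inequality(1)[OF ab f h range \<alpha> ey def] by auto
qed

section \<open>The transport argument\<close>

text \<open>A derivative is the pointwise limit of difference quotients, and these are measurable
  because \<open>k\<close> is continuous.\<close>

lemma borel_measurable_deriv_einterval:
 fixes k dk :: "real \<Rightarrow> real"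
 assumes "\<And>x. x \<in> ivl a b \<Longrightarrow> (k has_real_derivative dk x) (at x)"
 shows "(\<lambda>x. indicator (ivl a b) x * k x) \<in> borelfun"
  "(\<lambda>x. indicator (ivl a b) x * dk x) \<in> borelfun" proof -
 have "continuous_on (ivl a b) k" using assms by (intro continuous_at_imp_continuous_on) (auto intro: DERIV_isCont)
 from borel_measurable_continuous_on_indicator[OF borel_einterval this]
 show m: "(\<lambda>x. indicator (ivl a b) x * k x) \<in> borelfun" by simp
 define k0 where "k0 x = indicator (ivl a b) x * k x" for x
 have [measurable]: "k0 \<in> borelfun" using m unfolding k0_def[abs_def] .
 define u where "u n x = indicator (ivl a b) x * ((k0 (x + 1 / real (Suc n)) - k0 x) / (1 / real (Suc n)))" for n x
 show "(\<lambda>x. indicator (ivl a b) x * dk x) \<in> borelfun"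
 proof (rule borel_measurable_LIMSEQ_real)
  show "u n \<in> borelfun" for n unfolding u_def by measurable
  fix x
  show "(\<lambda>n. u n x) \<longlonglongrightarrow> indicator (ivl a b) x * dk x"
  proof (cases "x \<in> ivl a b")
   case True
   have seq: "(\<lambda>n. 1 / real (Suc n)) \<longlonglongrightarrow> 0" by (rule LIMSEQ_Suc[OF lim_1_over_n])
   then have at: "filterlim (\<lambda>n. 1 / real (Suc n)) (at 0) sequentially" by (auto simp: filterlim_at)
   have "((\<lambda>e. (k (x + e) - k x) / e) \<longlongrightarrow> dk x) (at 0)"
    using assms[OF True] by (simp add: DERIV_def)
   then have lim: "(\<lambda>n. (k (x + 1 / real (Suc n)) - k x) / (1 / real (Suc n))) \<longlonglongrightarrow> dk x"
    by (rule filterlim_compose[OF _ at])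
   \<comment> \<open>Eventually the shifted point lies in the interval, where cutting off
     \<open>k\<close> changes nothing.\<close>
   have "(\<lambda>n. x + 1 / real (Suc n)) \<longlonglongrightarrow> x + 0" by (intro tendsto_intros seq)
   then have "eventually (\<lambda>n. x + 1 / real (Suc n) \<in> ivl a b) sequentially"
    using True by (intro topological_tendstoD[OF _ open_einterval]) auto
   then have "eventually (\<lambda>n. (k (x + 1 / real (Suc n)) - k x) / (1 / real (Suc n)) = u n x) sequentially"
    by eventually_elim (use True in \<open>simp add: u_def k0_def\<close>)
   from Lim_transform_eventually[OF lim this] show ?thesis using True by simp
  qed (simp add: u_def)
 qed
qed

text \<open>The derivative need not be locally integrable. If it is integrable on {s..t}, the gauge
  integral of the fundamental theorem is the Lebesgue integral; if not, the right side is
  infinite.\<close>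

lemma nn_integral_deriv_ge:
 fixes k dk :: "real \<Rightarrow> real"
 assumes der: "\<And>x. x \<in> ivl a b \<Longrightarrow> (k has_real_derivative dk x) (at x)"
  and st: "s \<in> ivl a b" "t \<in> ivl a b" "s \<le> t"
 shows "ennreal \<bar>k t - k s\<bar> \<le> (NN x:{s..t}. ennreal \<bar>dk x\<bar>)"
proof (cases "(NN x:{s..t}. ennreal \<bar>dk x\<bar>) < \<infinity>")
 case True
 note sub = einterval_Icc_subset[OF st(1,2)]
 define g where "g x = indicator {s..t} x * (indicator (ivl a b) x * dk x)" for x
 have [measurable]: "g \<in> borelfun" unfolding g_def using borel_measurable_deriv_einterval(2)[OF der] by measurable
 have g: "g x = (if x \<in> {s..t} then dk x else 0)" for x using sub by (auto simp: g_def indicator_def)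
 have nn: "(NN x. ennreal (norm (g x))) = (NN x:{s..t}. ennreal \<bar>dk x\<bar>)"
  by (intro nn_integral_cong) (auto simp: g indicator_def)
 have int: "integrable lborel g" using True nn by (intro integrableI_bounded) auto
 have "(k has_vector_derivative dk x) (at x within {s..t})" if "x \<in> {s..t}" for x
  unfolding has_real_derivative_iff_has_vector_derivative[symmetric]
  using sub that by (intro has_field_derivative_at_within[OF der]) auto
 then have "(dk has_integral (k t - k s)) {s..t}" using st by (intro fundamental_theorem_of_calculus)
 then have "(g has_integral (k t - k s)) UNIV" unfolding g[abs_def] by (simp only: has_integral_restrict_UNIV)
 moreover have "(g has_integral (integral\<^sup>L lborel g)) UNIV" by (rule has_integral_integral_lborel[OF int])
 ultimately have "k t - k s = integral\<^sup>L lborel g" by (rule has_integral_unique)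
 then have "\<bar>k t - k s\<bar> \<le> (\<integral>x. norm (g x) \<partial>lborel)" using integral_norm_bound[of lborel g] by simp
 also have "ennreal \<dots> = (NN x. ennreal (norm (g x)))"
  using int by (intro nn_integral_eq_integral[symmetric]) auto
 finally show ?thesis unfolding nn by (simp add: ennreal_leI)
next
 case False
 then show ?thesis by (simp add: top.not_eq_extremum[symmetric])
qed

text \<open>A derivative of constant sign is automatically integrable, with the increment as its
  integral.\<close>

lemma nn_integral_deriv_eq:
 fixes k dk :: "real \<Rightarrow> real"
 assumes der: "\<And>x. x \<in> {s..t} \<Longrightarrow> (k has_real_derivative dk x) (at x)" and "s \<le> t"
  and sgn: "(\<forall>x\<in>{s..t}. 0 \<le> dk x) \<or> (\<forall>x\<in>{s..t}. dk x \<le> 0)"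
 shows "(NN x:{s..t}. ennreal \<bar>dk x\<bar>) = ennreal \<bar>k t - k s\<bar>"
proof -
 have "(k has_vector_derivative dk x) (at x within {s..t})" if "x \<in> {s..t}" for x
  unfolding has_real_derivative_iff_has_vector_derivative[symmetric]
  using that by (intro has_field_derivative_at_within[OF der]) auto
 then have int: "(dk has_integral (k t - k s)) {s..t}"
  using \<open>s \<le> t\<close> by (intro fundamental_theorem_of_calculus)
 from sgn show ?thesis
 proof
  assume pos: "\<forall>x\<in>{s..t}. 0 \<le> dk x"
  then have "0 \<le> k t - k s" using int by (intro has_integral_nonneg[OF int]) auto
  moreover have "(NN x:{s..t}. ennreal \<bar>dk x\<bar>) = (NN x:{s..t}. ennreal (dk x))"
   using pos by (intro nn_integral_cong) (auto simp: indicator_def)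
  ultimately show ?thesis using pos nn_integral_has_integral_lebesgue'[OF _ int] by auto
 next
  assume neg: "\<forall>x\<in>{s..t}. dk x \<le> 0"
  have int': "((\<lambda>x. - dk x) has_integral - (k t - k s)) {s..t}" using int by (rule has_integral_neg)
  then have "0 \<le> - (k t - k s)" using neg by (intro has_integral_nonneg[OF int']) auto
  moreover have "(NN x:{s..t}. ennreal \<bar>dk x\<bar>) = (NN x:{s..t}. ennreal (- dk x))"
   using neg by (intro nn_integral_cong) (auto simp: indicator_def)
  ultimately show ?thesis using neg nn_integral_has_integral_lebesgue'[OF _ int'] by auto
 qed
qed

text \<open>
 A function that vanishes at both ends is bounded at \<open>x\<close> by its variation over this set. Integrated
 against \<open>y'\<close> with \<open>y x0 = 0\<close>, the bound becomes by Tonelli the variation weighted with \<open>\<bar>y\<bar>\<close>.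
\<close>

definition outward :: "ereal \<Rightarrow> ereal \<Rightarrow> real \<Rightarrow> real \<Rightarrow> real set" where
 "outward a b x0 x = {s \<in> ivl a b. if x0 \<le> x then x \<le> s else s \<le> x}"

lemma outward_measurable [measurable]: "outward a b x0 x \<in> sets borel"
 unfolding outward_def by measurable

text \<open>Vanishing at the ends enters only through some point \<open>t\<close> beyond
  \<open>x\<close> with k t < e: this costs at most \<open>e\<close>, and the variation between
  \<open>x\<close> and \<open>t\<close> is part of the variation over the outward set.\<close>

lemma outward_bound:
 fixes k dk :: "real \<Rightarrow> real"
 assumes der: "\<And>x. x \<in> ivl a b \<Longrightarrow> (k has_real_derivative dk x) (at x)"
  and right: "\<And>e x. 0 < e \<Longrightarrow> x \<in> ivl a b \<Longrightarrow> \<exists>t\<in>ivl a b. x < t \<and> k t < e"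
  and left: "\<And>e x. 0 < e \<Longrightarrow> x \<in> ivl a b \<Longrightarrow> \<exists>t\<in>ivl a b. t < x \<and> k t < e"
  and x: "x \<in> ivl a b"
 shows "ennreal (k x) \<le> (NN s:outward a b x0 x. ennreal \<bar>dk s\<bar>)"
proof (rule ennreal_le_epsilon)
 fix e :: real assume e: "0 < e"
 obtain t where t: "t \<in> ivl a b" "k t < e" "if x0 \<le> x then x < t else t < x"
  using right[OF e x] left[OF e x] by (cases "x0 \<le> x") auto
 define D where "D = (if x0 \<le> x then {x..t} else {t..x})"
 have D: "ennreal \<bar>k t - k x\<bar> \<le> (NN s:D. ennreal \<bar>dk s\<bar>)"
  using nn_integral_deriv_ge[OF der x t(1)] nn_integral_deriv_ge[OF der t(1) x] t(3)
  by (auto simp: D_def abs_minus_commute split: if_splits)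
 have "D \<subseteq> outward a b x0 x"
  using einterval_Icc_subset[OF x t(1)] einterval_Icc_subset[OF t(1) x] t(3) by (auto simp: D_def outward_def split: if_splits)
 then have "(NN s:D. ennreal \<bar>dk s\<bar>) \<le> (NN s:outward a b x0 x. ennreal \<bar>dk s\<bar>)"
  by (intro nn_integral_mono) (auto simp: indicator_def)
 with D have "ennreal \<bar>k t - k x\<bar> \<le> (NN s:outward a b x0 x. ennreal \<bar>dk s\<bar>)" by (rule order.trans)
 moreover have "ennreal (k x) \<le> ennreal (\<bar>k t - k x\<bar> + e)" using t(2) by (intro ennreal_leI) linarith
 then have "ennreal (k x) \<le> ennreal \<bar>k t - k x\<bar> + ennreal e" using e by (simp add: ennreal_plus)
 ultimately show "ennreal (k x) \<le> (NN s:outward a b x0 x. ennreal \<bar>dk s\<bar>) + ennreal e"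
  by (meson add_right_mono order.trans)
qed

text \<open>For fixed \<open>s\<close> the points \<open>x\<close> whose outward set contains
  \<open>s\<close> are those between \<open>x0\<close> and \<open>s\<close>, up to a null set; their
  \<open>w dx\<close> measure is |y s| because y x0 = 0.\<close>

lemma (in coordinate) outward_tonelli:
 fixes k dk :: "real \<Rightarrow> real"
 assumes m: "(\<lambda>x. indicator (ivl a b) x * dk x) \<in> borelfun"
  and x0: "x0 \<in> ivl a b" "y x0 = 0"
 shows "(NN x:ivl a b. (NN s:outward a b x0 x. ennreal \<bar>dk s\<bar>) * ennreal (w x))
  = (NN x:ivl a b. ennreal (\<bar>dk x\<bar> * \<bar>y x\<bar>))" proof -
 define d where "d x = indicator (ivl a b) x * dk x" for x
 have [measurable]: "d \<in> borelfun" using m unfolding d_def[abs_def] .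
 define H where "H x s = ennreal \<bar>d s\<bar> * (if x0 \<le> x then (if x \<le> s then 1 else 0) else (if s \<le> x then 1 else 0)) * ennreal (w x) * indicator (ivl a b) x" for x s
 have [measurable]: "case_prod H \<in> borel_measurable (lborel \<Otimes>\<^sub>M lborel)"
  unfolding H_def by measurable
 have 1: "(NN x:ivl a b. (NN s:outward a b x0 x. ennreal \<bar>dk s\<bar>) * ennreal (w x)) = (NN x. NN s. H x s)"
 proof (intro nn_integral_cong)
  fix x
  have "(NN s. H x s) = (NN s. (ennreal \<bar>d s\<bar> * indicator (outward a b x0 x) s) * (ennreal (w x) * indicator (ivl a b) x))"
   unfolding H_def by (intro nn_integral_cong) (auto simp: outward_def indicator_def d_def)
  also have "\<dots> = (NN s:outward a b x0 x. ennreal \<bar>d s\<bar>) * (ennreal (w x) * indicator (ivl a b) x)"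
   by (rule nn_integral_multc) measurable
  also have "(NN s:outward a b x0 x. ennreal \<bar>d s\<bar>) = (NN s:outward a b x0 x. ennreal \<bar>dk s\<bar>)"
   by (intro nn_integral_cong) (auto simp: outward_def indicator_def d_def)
  finally show "(NN s:outward a b x0 x. ennreal \<bar>dk s\<bar>) * ennreal (w x) * indicator (ivl a b) x = (NN s. H x s)"
   by (simp add: mult.assoc)
 qed
 also have "\<dots> = (NN s. NN x. H x s)" by (rule lborel_pair.Fubini'[symmetric]) measurable
 also have "\<dots> = (NN x:ivl a b. ennreal (\<bar>dk x\<bar> * \<bar>y x\<bar>))"
 proof (intro nn_integral_cong)
  fix s
  show "(NN x. H x s) = ennreal (\<bar>dk s\<bar> * \<bar>y s\<bar>) * indicator (ivl a b) s"
  proof (cases "s \<in> ivl a b")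
   case True
   define D where "D = (if x0 \<le> s then {x0..s} else {s..x0})"
   have sub: "D \<subseteq> ivl a b"
    using einterval_Icc_subset[OF x0(1) True] einterval_Icc_subset[OF True x0(1)] by (auto simp: D_def)
   have "(NN x. H x s) = (NN x. ennreal \<bar>d s\<bar> * (ennreal (w x) * indicator D x))"
   proof (rule nn_integral_cong_AE)
    show "AE x in lborel. H x s = ennreal \<bar>d s\<bar> * (ennreal (w x) * indicator D x)"
     using AE_lborel_singleton[of x0]
    proof eventually_elim
     case (elim x)
     have "(if x0 \<le> x then (if x \<le> s then 1 else 0) else (if s \<le> x then 1 else 0)) * indicator (ivl a b) x = (indicator D x :: ennreal)"
      using elim sub by (auto simp: D_def indicator_def subset_iff split: if_splits)
     then show ?case unfolding H_def by (metis mult.assoc mult.left_commute)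
    qed
   qed
   also have "\<dots> = ennreal \<bar>d s\<bar> * (NN x:D. ennreal (w x))"
    unfolding D_def by (rule nn_integral_cmult) measurable
   also have "(NN x:D. ennreal (w x)) = ennreal \<bar>y s\<bar>"
   proof (cases "x0 \<le> s")
    case True: True
    then have "0 \<le> y s" using mono(1)[OF x0(1) \<open>s \<in> ivl a b\<close>] x0 by simp
    then show ?thesis using integral_eq[OF x0(1) \<open>s \<in> ivl a b\<close>] True x0 by (simp add: D_def)
   next
    case False
    then have "y s \<le> 0" using mono(1)[OF True x0(1)] x0 by simp
    then show ?thesis using integral_eq[OF True x0(1)] False x0 by (simp add: D_def)
   qed
   finally show ?thesis using True by (simp add: d_def ennreal_mult)
  next
   case False
   then show ?thesis by (simp add: H_def d_def)
  qed
 qed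
 finally show ?thesis .
qed

lemma nn_integral_Holder:
 fixes u v :: "'a \<Rightarrow> real"
 assumes [measurable]: "u \<in> borel_measurable M" "v \<in> borel_measurable M"
  and nn: "\<And>x. x \<in> space M \<Longrightarrow> 0 \<le> u x" "\<And>x. x \<in> space M \<Longrightarrow> 0 \<le> v x"
  and pq: "1 < p" "1 < q" "1 / p + 1 / q = 1"
  and A: "(\<integral>\<^sup>+x. ennreal (u x powr p) \<partial>M) = ennreal A" "0 < A"
  and B: "(\<integral>\<^sup>+x. ennreal (v x powr q) \<partial>M) = ennreal B" "0 < B"
 shows "(\<integral>\<^sup>+x. ennreal (u x * v x) \<partial>M) \<le> ennreal (A powr (1 / p) * B powr (1 / q))"
proof -
 define c where "c = A powr (1 / p)"
 define d where "d = B powr (1 / q)"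
 have cd: "0 < c" "0 < d" "c powr p = A" "d powr q = B" using A B pq by (auto simp: c_def d_def powr_powr)
 have "u x * v x \<le> c * d / (p * A) * u x powr p + c * d / (q * B) * v x powr q" if "x \<in> space M" for x proof -
  have "u x * v x = c * d * ((u x / c) * (v x / d))" using cd by simp
  also have "\<dots> \<le> c * d * ((u x / c) powr p / p + (v x / d) powr q / q)"
   using nn[OF that] cd pq by (intro mult_left_mono Youngs_inequality) auto
  also have "\<dots> = c * d / (p * A) * u x powr p + c * d / (q * B) * v x powr q"
   using nn[OF that] cd by (simp add: powr_divide algebra_simps)
  finally show ?thesis .
 qed
 then have "(\<integral>\<^sup>+x. ennreal (u x * v x) \<partial>M) \<le> (\<integral>\<^sup>+x. ennreal (c * d / (p * A)) * ennreal (u x powr p) + ennreal (c * d / (q * B)) * ennreal (v x powr q) \<partial>M)"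
  using cd A B pq by (intro nn_integral_mono) (simp add: ennreal_mult[symmetric] ennreal_plus[symmetric] ennreal_leI del: ennreal_plus)
 also have "\<dots> = ennreal (c * d / (p * A)) * ennreal A + ennreal (c * d / (q * B)) * ennreal B"
  by (subst nn_integral_add) (simp_all add: nn_integral_cmult A B)
 also have "\<dots> = ennreal (c * d / (p * A) * A + c * d / (q * B) * B)"
  using cd A B pq by (simp add: ennreal_mult[symmetric] ennreal_plus[symmetric] del: ennreal_plus)
 also have "c * d / (p * A) * A + c * d / (q * B) * B = c * d * (1 / p + 1 / q)" using A B by (simp add: algebra_simps)
 finally show ?thesis using pq by (simp add: c_def d_def)
qed

lemma AE_eq_of_nn_integral_le:
 fixes f g :: "'a \<Rightarrow> ennreal"
 assumes [measurable]: "f \<in> borel_measurable M" "g \<in> borel_measurable M"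
  and le: "AE x in M. f x \<le> g x" and int: "integral\<^sup>N M g \<le> integral\<^sup>N M f" "integral\<^sup>N M f < \<infinity>"
 shows "AE x in M. f x = g x"
proof -
 have "(\<integral>\<^sup>+x. g x - f x \<partial>M) = integral\<^sup>N M g - integral\<^sup>N M f"
  using le int by (intro nn_integral_diff) auto
 also have "\<dots> = 0" using int by (simp add: diff_eq_0_iff_ennreal)
 finally have "AE x in M. g x - f x = 0" by (subst (asm) nn_integral_0_iff_AE) auto
 with le show ?thesis
 proof eventually_elim
  case (elim x)
  then show ?case by (metis diff_eq_0_iff_ennreal order_antisym)
 qed
qed

text \<open>
 \<open>u\<close> is the stretched Gaussian along a transport map \<open>T\<close>, \<open>w\<close> the derivative of \<open>T\<close>, and \<open>k^(1/l)\<close> plays the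
 role of the density that is transported; the inequality for \<open>c k\<close> in place of \<open>k\<close> is optimized over
 \<open>c\<close>.
\<close>

lemma stam_core:
 fixes M :: "'a measure" and u k w :: "'a \<Rightarrow> real"
 assumes [measurable]: "u \<in> borel_measurable M" "k \<in> borel_measurable M" "w \<in> borel_measurable M"
  and pos: "\<And>x. x \<in> space M \<Longrightarrow> 0 < u x" "\<And>x. x \<in> space M \<Longrightarrow> 0 < k x" "\<And>x. x \<in> space M \<Longrightarrow> 0 < w x"
  and l: "0 < l" "l \<noteq> 1" and m: "0 < m" and X: "0 < X"
  and um: "(\<integral>\<^sup>+x. ennreal (u x powr l * w x) \<partial>M) = ennreal m"
  and kX: "(\<integral>\<^sup>+x. ennreal (k x * w x) \<partial>M) \<le> ennreal X"
 defines "N \<equiv> \<integral>\<^sup>+x. ennreal (k x powr (1 - 1 / l) * (u x * w x)) \<partial>M"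
 shows "1 < l \<Longrightarrow> N < \<infinity>"
  and "N = ennreal \<mu> \<Longrightarrow> 0 < \<mu> \<Longrightarrow> l < 1 \<Longrightarrow> m \<le> \<mu> powr l * X powr (1 - l)"
  and "N = ennreal \<mu> \<Longrightarrow> 0 < \<mu> \<Longrightarrow> 1 < l \<Longrightarrow> \<mu> powr l * X powr (1 - l) \<le> m"
  and "N = ennreal \<mu> \<Longrightarrow> 0 < \<mu> \<Longrightarrow> m = \<mu> powr l * X powr (1 - l) \<Longrightarrow> \<exists>c>0. AE x in M. k x = c * u x powr l"
proof -
 \<comment> \<open>The comparison function of Young's inequality, whose equality case reads u = (c
   k)^(1/l).\<close>
 define v where "v c x = (c * k x) powr (1 / l)" for c x
 have [measurable]: "v c \<in> borel_measurable M" for c unfolding v_def by measurable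
 have v: "0 < v c x" "v c x powr l = c * k x" "v c x powr (l - 1) = c powr (1 - 1 / l) * k x powr (1 - 1 / l)"
  if "0 < c" "x \<in> space M" for c x proof -
  have ck: "0 < c * k x" using pos(2)[OF that(2)] that by simp
  then show "0 < v c x" "v c x powr l = c * k x" using l by (auto simp: v_def powr_powr)
  have "1 / l * (l - 1) = 1 - 1 / l" using l by (simp add: field_simps)
  then have "v c x powr (l - 1) = (c * k x) powr (1 - 1 / l)" unfolding v_def powr_powr by simp
  then show "v c x powr (l - 1) = c powr (1 - 1 / l) * k x powr (1 - 1 / l)"
   using that pos(2)[OF that(2)] by (simp add: powr_mult)
 qed
 define P where "P x = u x powr l * w x" for x
 define Q where "Q c x = l * c powr (1 - 1 / l) * (k x powr (1 - 1 / l) * (u x * w x))" for c x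
 define S where "S c x = \<bar>1 - l\<bar> * c * (k x * w x)" for c x
 have [measurable]: "P \<in> borel_measurable M" "Q c \<in> borel_measurable M" "S c \<in> borel_measurable M" for c
  unfolding P_def Q_def S_def by measurable
 have PQS: "0 \<le> P x" "0 \<le> Q c x" "0 \<le> S c x" if "0 < c" "x \<in> space M" for c x
  using pos[OF that(2)] that l by (auto simp: P_def Q_def S_def)
 have lt: "P x \<le> Q c x + S c x" "P x = Q c x + S c x \<longleftrightarrow> u x = v c x" if "l < 1" "0 < c" "x \<in> space M" for c x
 proof -
  have e: "P x = w x * u x powr l" "Q c x + S c x = w x * (l * (u x * v c x powr (l - 1)) + (1 - l) * v c x powr l)"
   using v[OF that(2,3)] \<open>l < 1\<close> by (simp_all add: P_def Q_def S_def algebra_simps)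
  show "P x \<le> Q c x + S c x" "P x = Q c x + S c x \<longleftrightarrow> u x = v c x"
   unfolding e using young_powr_lt[OF pos(1)[OF that(3)] v(1)[OF that(2,3)] l(1) that(1)] pos(3)[OF that(3)]
   by (auto intro: mult_left_mono)
 qed
 have gt: "Q c x \<le> P x + S c x" "Q c x = P x + S c x \<longleftrightarrow> u x = v c x" if "1 < l" "0 < c" "x \<in> space M" for c x
 proof -
  have e: "Q c x = w x * (l * (u x * v c x powr (l - 1)))" "P x + S c x = w x * (u x powr l + (l - 1) * v c x powr l)"
   using v[OF that(2,3)] \<open>1 < l\<close> by (simp_all add: P_def Q_def S_def algebra_simps)
  show "Q c x \<le> P x + S c x" "Q c x = P x + S c x \<longleftrightarrow> u x = v c x"
   unfolding e using young_powr_gt[OF pos(1)[OF that(3)] less_imp_le[OF v(1)[OF that(2,3)]] that(1)] pos(3)[OF that(3)]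
   by (auto intro: mult_left_mono)
 qed
 have iP: "(\<integral>\<^sup>+x. ennreal (P x) \<partial>M) = ennreal m" unfolding P_def um ..
 have iQ: "(\<integral>\<^sup>+x. ennreal (Q c x) \<partial>M) = ennreal (l * c powr (1 - 1 / l)) * N" for c proof -
  have "(\<integral>\<^sup>+x. ennreal (Q c x) \<partial>M) = (\<integral>\<^sup>+x. ennreal (l * c powr (1 - 1 / l)) * ennreal (k x powr (1 - 1 / l) * (u x * w x)) \<partial>M)"
   unfolding Q_def using l by (intro nn_integral_cong) (subst ennreal_mult', auto)
  then show ?thesis unfolding N_def by (simp add: nn_integral_cmult)
 qed
 have iS: "(\<integral>\<^sup>+x. ennreal (S c x) \<partial>M) \<le> ennreal (\<bar>1 - l\<bar> * c * X)" if "0 < c" for c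
 proof -
  have "(\<integral>\<^sup>+x. ennreal (S c x) \<partial>M) = (\<integral>\<^sup>+x. ennreal (\<bar>1 - l\<bar> * c) * ennreal (k x * w x) \<partial>M)"
   unfolding S_def using that by (intro nn_integral_cong) (subst ennreal_mult', auto)
  also have "\<dots> = ennreal (\<bar>1 - l\<bar> * c) * (\<integral>\<^sup>+x. ennreal (k x * w x) \<partial>M)" by (simp add: nn_integral_cmult)
  also have "\<dots> \<le> ennreal (\<bar>1 - l\<bar> * c) * ennreal X" by (intro mult_left_mono kX) simp
  finally show ?thesis using that X by (simp add: ennreal_mult)
 qed
 have add: "(\<integral>\<^sup>+x. ennreal (A x + S c x) \<partial>M) = (\<integral>\<^sup>+x. ennreal (A x) \<partial>M) + (\<integral>\<^sup>+x. ennreal (S c x) \<partial>M)"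
  if [measurable]: "A \<in> borel_measurable M" and "\<And>x. x \<in> space M \<Longrightarrow> 0 \<le> A x" "0 < c" for A c
 proof -
  have "(\<integral>\<^sup>+x. ennreal (A x + S c x) \<partial>M) = (\<integral>\<^sup>+x. ennreal (A x) + ennreal (S c x) \<partial>M)"
   using that PQS(3) by (intro nn_integral_cong) (simp add: ennreal_plus)
  then show ?thesis by (simp add: nn_integral_add)
 qed
 show fin: "N < \<infinity>" if "1 < l" proof -
  \<comment> \<open>For finiteness the choice c = 1 is enough.\<close>
  have "ennreal (l * 1 powr (1 - 1 / l)) * N \<le> ennreal m + ennreal (\<bar>1 - l\<bar> * 1 * X)" proof -
   have "(\<integral>\<^sup>+x. ennreal (Q 1 x) \<partial>M) \<le> (\<integral>\<^sup>+x. ennreal (P x + S 1 x) \<partial>M)"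
    using gt(1)[OF that] by (intro nn_integral_mono ennreal_leI) auto
   also have "\<dots> = ennreal m + (\<integral>\<^sup>+x. ennreal (S 1 x) \<partial>M)" using add[of P 1] PQS(1)[of 1] iP by simp
   also have "\<dots> \<le> ennreal m + ennreal (\<bar>1 - l\<bar> * 1 * X)" by (intro add_left_mono iS) simp
   finally show ?thesis unfolding iQ .
  qed
  also have "\<dots> < \<infinity>" by simp
  finally show ?thesis using l by (auto simp: ennreal_mult_less_top)
 qed
 have main: "(l < 1 \<longrightarrow> m \<le> \<mu> powr l * X powr (1 - l)) \<and> (1 < l \<longrightarrow> \<mu> powr l * X powr (1 - l) \<le> m) \<and>
   (m = \<mu> powr l * X powr (1 - l) \<longrightarrow> (\<exists>c>0. AE x in M. k x = c * u x powr l))"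
  if N: "N = ennreal \<mu>" and \<mu>: "0 < \<mu>" proof -
  \<comment> \<open>The stationary point of l c^(1-1/l) \<mu> + (1 - l) c X; there c X and c^(1-1/l)
    \<mu> have the common value \<open>t\<close>.\<close>
  define c where "c = (\<mu> / X) powr l"
  have c: "0 < c" using \<mu> X by (simp add: c_def)
  define t where "t = \<mu> powr l * X powr (1 - l)"
  have t: "0 < t" using \<mu> X by (simp add: t_def)
  have cX: "c * X = t" using \<mu> X by (simp add: c_def t_def powr_divide powr_diff)
  have c\<mu>: "c powr (1 - 1 / l) * \<mu> = t" proof -
   have "l * (1 - 1 / l) = l - 1" using l by (simp add: field_simps)
   then have "c powr (1 - 1 / l) = (\<mu> / X) powr (l - 1)" by (simp add: c_def powr_powr)
   also have "\<dots> * \<mu> = t" using \<mu> X by (simp add: t_def powr_divide powr_diff)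
   finally show ?thesis .
  qed
  have iQ': "(\<integral>\<^sup>+x. ennreal (Q c x) \<partial>M) = ennreal (l * t)"
   unfolding iQ N c\<mu>[symmetric] using l \<mu> by (simp add: ennreal_mult[symmetric] mult.assoc)
  have iS': "(\<integral>\<^sup>+x. ennreal (S c x) \<partial>M) \<le> ennreal (\<bar>1 - l\<bar> * t)"
   using iS[OF c] by (simp add: cX mult.assoc)
  have concl: "\<exists>c>0. AE x in M. k x = c * u x powr l" if "AE x in M. u x = v c x"
  proof (intro exI[of _ "1 / c"] conjI)
   show "AE x in M. k x = 1 / c * u x powr l" using that AE_space by eventually_elim (use v(2)[OF c] c in simp)
  qed (use c in simp)
  show ?thesis
  proof (cases "l < 1")
   case True
   have le: "AE x in M. ennreal (P x) \<le> ennreal (Q c x + S c x)"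
    using lt(1)[OF True c] by (intro AE_I2 ennreal_leI) auto
   have QS: "(\<integral>\<^sup>+x. ennreal (Q c x + S c x) \<partial>M) \<le> ennreal t" proof -
    have "(\<integral>\<^sup>+x. ennreal (Q c x + S c x) \<partial>M) \<le> ennreal (l * t) + ennreal (\<bar>1 - l\<bar> * t)"
     using add[of "Q c" c] PQS(2)[OF c] c iQ' iS' by (simp add: add_left_mono)
    also have "\<dots> = ennreal (l * t + (1 - l) * t)" using True l t by (simp add: ennreal_plus)
    also have "l * t + (1 - l) * t = t" by (simp add: algebra_simps)
    finally show ?thesis .
   qed
   have "ennreal m \<le> ennreal t" using nn_integral_mono_AE[OF le] QS unfolding iP by (rule order.trans)
   then have mt: "m \<le> t" using t by (simp add: ennreal_le_iff)
   have "AE x in M. u x = v c x" if "m = t" proof -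
    have "AE x in M. ennreal (P x) = ennreal (Q c x + S c x)"
     by (rule AE_eq_of_nn_integral_le[OF _ _ le]) (use QS iP that in auto)
    then show ?thesis using AE_space
    proof eventually_elim
     case (elim x)
     then have "P x = Q c x + S c x" using PQS[OF c elim(2)] by (subst (asm) ennreal_inj) auto
     then show ?case using lt(2)[OF True c elim(2)] by simp
    qed
   qed
   then show ?thesis using mt concl True unfolding t_def[symmetric] by auto
  next
   case False
   then have l1: "1 < l" using l by simp
   have le: "AE x in M. ennreal (Q c x) \<le> ennreal (P x + S c x)"
    using gt(1)[OF l1 c] by (intro AE_I2 ennreal_leI) auto
   have PS: "(\<integral>\<^sup>+x. ennreal (P x + S c x) \<partial>M) \<le> ennreal (m + (l - 1) * t)" proof -
    have "(\<integral>\<^sup>+x. ennreal (P x + S c x) \<partial>M) \<le> ennreal m + ennreal (\<bar>1 - l\<bar> * t)"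
     using add[of P c] PQS(1)[OF c] c iP iS' by (simp add: add_left_mono)
    also have "\<dots> = ennreal (m + (l - 1) * t)" using l1 m t by (simp add: ennreal_plus)
    finally show ?thesis .
   qed
   have "ennreal (l * t) \<le> ennreal (m + (l - 1) * t)"
    using nn_integral_mono_AE[OF le] PS unfolding iQ' by (rule order.trans)
   then have "l * t \<le> m + (l - 1) * t" using t l1 m by (subst (asm) ennreal_le_iff) auto
   then have mt: "t \<le> m" by (simp add: algebra_simps)
   have "AE x in M. u x = v c x" if "m = t" proof -
    have "m + (l - 1) * t = l * t" using that by (simp add: algebra_simps)
    then have "AE x in M. ennreal (Q c x) = ennreal (P x + S c x)"
     by (intro AE_eq_of_nn_integral_le[OF _ _ le]) (use PS iQ' in auto)
    then show ?thesis using AE_space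
    proof eventually_elim
     case (elim x)
     then have "Q c x = P x + S c x" using PQS[OF c elim(2)] by (subst (asm) ennreal_inj) auto
     then show ?case using gt(2)[OF l1 c elim(2)] by simp
    qed
   qed
   then show ?thesis using mt concl False unfolding t_def[symmetric] by auto
  qed
 qed
 show "N = ennreal \<mu> \<Longrightarrow> 0 < \<mu> \<Longrightarrow> l < 1 \<Longrightarrow> m \<le> \<mu> powr l * X powr (1 - l)"
  "N = ennreal \<mu> \<Longrightarrow> 0 < \<mu> \<Longrightarrow> 1 < l \<Longrightarrow> \<mu> powr l * X powr (1 - l) \<le> m"
  "N = ennreal \<mu> \<Longrightarrow> 0 < \<mu> \<Longrightarrow> m = \<mu> powr l * X powr (1 - l) \<Longrightarrow> \<exists>c>0. AE x in M. k x = c * u x powr l"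
  using main by auto
qed

lemma nn_integral_einterval_le:
 fixes \<phi> :: "real \<Rightarrow> ennreal"
 assumes "a < b" and m: "(\<lambda>x. \<phi> x * indicator (ivl a b) x) \<in> borelfun"
  and le: "\<And>s t. s \<in> ivl a b \<Longrightarrow> t \<in> ivl a b \<Longrightarrow> s \<le> t \<Longrightarrow> (NN x:{s..t}. \<phi> x) \<le> C"
 shows "(NN x:ivl a b. \<phi> x) \<le> C"
proof -
 obtain u l where ul: "ivl a b = (\<Union>i. {l i .. u i})"
  "incseq u" "decseq l" "\<And>i. l i < u i" "\<And>i. a < l i" "\<And>i. u i < b"
  "(\<lambda>i. ereal (l i)) \<longlonglongrightarrow> a" "(\<lambda>i. ereal (u i)) \<longlonglongrightarrow> b"
  by (rule einterval_Icc_approximation[OF \<open>a < b\<close>]) (rule that; assumption)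
 have lu: "l i \<in> ivl a b" "u i \<in> ivl a b" for i unfolding ul(1) using ul(4)[of i] by (auto intro!: exI[of _ i])
 have inc: "{l i..u i} \<subseteq> {l (Suc i)..u (Suc i)}" for i
  using incseq_SucD[OF ul(2)] decseq_SucD[OF ul(3)] by (meson atLeastatMost_subset_iff)
 define \<psi> where "\<psi> x = \<phi> x * indicator (ivl a b) x" for x
 have [measurable]: "\<psi> \<in> borelfun" using m unfolding \<psi>_def[abs_def] .
 have "\<psi> x = (SUP i. \<psi> x * indicator {l i..u i} x)" for x
 proof (cases "\<exists>i. x \<in> {l i..u i}")
  case True
  then obtain i where "x \<in> {l i..u i}" by auto
  then have "\<psi> x \<le> (SUP i. \<psi> x * indicator {l i..u i} x)" by (intro SUP_upper2[of i]) auto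
  moreover have "(SUP i. \<psi> x * indicator {l i..u i} x) \<le> \<psi> x" by (intro SUP_least) (auto simp: indicator_def)
  ultimately show ?thesis by simp
 next
  case False
  then have "x \<notin> ivl a b" unfolding ul(1) by auto
  then show ?thesis by (simp add: \<psi>_def)
 qed
 then have "(NN x:ivl a b. \<phi> x) = (NN x. (SUP i. \<psi> x * indicator {l i..u i} x))"
  unfolding \<psi>_def[symmetric] by (intro nn_integral_cong) 
 also have "\<dots> = (SUP i. (NN x. \<psi> x * indicator {l i..u i} x))"
  by (intro nn_integral_monotone_convergence_SUP incseq_SucI le_funI mult_left_mono)
    (use inc in \<open>auto simp: indicator_def subset_iff\<close>)
 also have "\<dots> \<le> C"
 proof (rule SUP_least)
  fix i
  have "(NN x. \<psi> x * indicator {l i..u i} x) = (NN x:{l i..u i}. \<phi> x)"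
   unfolding \<psi>_def using einterval_Icc_subset[OF lu[of i]] by (intro nn_integral_cong) (auto simp: indicator_def)
  also have "\<dots> \<le> C" by (intro le lu less_imp_le ul)
  finally show "(NN x. \<psi> x * indicator {l i..u i} x) \<le> C" .
 qed
 finally show ?thesis .
qed

text \<open>On either side of the peak \<open>k\<close> is monotone, so its variation is a
  difference of two values, and the outer one is nonnegative.\<close>

lemma unimodal_variation:
 fixes k dk :: "real \<Rightarrow> real"
 assumes ab: "a < b" and der: "\<And>x. x \<in> ivl a b \<Longrightarrow> (k has_real_derivative dk x) (at x)"
  and nn: "\<And>x. x \<in> ivl a b \<Longrightarrow> 0 \<le> k x"
  and x0: "x0 \<in> ivl a b"
  and sgn: "\<And>x. x \<in> ivl a b \<Longrightarrow> x \<le> x0 \<Longrightarrow> 0 \<le> dk x" "\<And>x. x \<in> ivl a b \<Longrightarrow> x0 \<le> x \<Longrightarrow> dk x \<le> 0"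
 shows "x \<in> ivl a b \<Longrightarrow> (NN s:outward a b x0 x. ennreal \<bar>dk s\<bar>) \<le> ennreal (k x)"
  and "(NN s:ivl a b. ennreal \<bar>dk s\<bar>) \<le> ennreal (2 * k x0)"
proof -
 note m = borel_measurable_deriv_einterval[OF der]
 define d where "d x = indicator (ivl a b) x * dk x" for x
 have [measurable]: "d \<in> borelfun" using m(2) unfolding d_def[abs_def] by simp
 have right: "(NN s:{u..v}. ennreal \<bar>dk s\<bar>) \<le> ennreal (k u)"
  if "u \<in> ivl a b" "v \<in> ivl a b" "x0 \<le> u" "u \<le> v" for u v proof -
  note sub = einterval_Icc_subset[OF that(1,2)]
  have "(NN s:{u..v}. ennreal \<bar>dk s\<bar>) = ennreal \<bar>k v - k u\<bar>"
   using sub that by (intro nn_integral_deriv_eq der sgn(2) disjI2 ballI) auto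
  moreover have "k v \<le> k u"
   using sub that by (intro DERIV_nonpos_imp_nonincreasing[of u v k]) (auto intro!: der sgn(2) exI)
  ultimately show ?thesis using nn[OF that(2)] by (auto intro!: ennreal_leI)
 qed
 have left: "(NN s:{u..v}. ennreal \<bar>dk s\<bar>) \<le> ennreal (k v)"
  if "u \<in> ivl a b" "v \<in> ivl a b" "v \<le> x0" "u \<le> v" for u v proof -
  note sub = einterval_Icc_subset[OF that(1,2)]
  have "(NN s:{u..v}. ennreal \<bar>dk s\<bar>) = ennreal \<bar>k v - k u\<bar>"
   using sub that by (intro nn_integral_deriv_eq der sgn(1) disjI1 ballI) auto
  moreover have "k u \<le> k v"
   using sub that by (intro DERIV_nonneg_imp_nondecreasing[of u v k]) (auto intro!: der sgn(1) exI)
  ultimately show ?thesis using nn[OF that(1)] by (auto intro!: ennreal_leI)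
 qed
 show "(NN s:outward a b x0 x. ennreal \<bar>dk s\<bar>) \<le> ennreal (k x)" if x: "x \<in> ivl a b" proof -
  have "(NN s:outward a b x0 x. ennreal \<bar>dk s\<bar>) = (NN s:ivl a b. ennreal \<bar>dk s\<bar> * indicator (outward a b x0 x) s)"
   by (intro nn_integral_cong) (auto simp: outward_def indicator_def)
  also have "\<dots> \<le> ennreal (k x)"
  proof (rule nn_integral_einterval_le[OF ab])
   have "(\<lambda>s. ennreal \<bar>d s\<bar> * indicator (outward a b x0 x) s) \<in> borelfun" by measurable
   also have "(\<lambda>s. ennreal \<bar>d s\<bar> * indicator (outward a b x0 x) s) = (\<lambda>s. ennreal \<bar>dk s\<bar> * indicator (outward a b x0 x) s * indicator (ivl a b) s)"
    by (auto simp: d_def indicator_def outward_def)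
   finally show "\<dots> \<in> borelfun" .
   fix s t assume st: "s \<in> ivl a b" "t \<in> ivl a b" "s \<le> t"
   show "(NN u:{s..t}. ennreal \<bar>dk u\<bar> * indicator (outward a b x0 x) u) \<le> ennreal (k x)"
   proof (cases "x0 \<le> x")
    case True
    have "(NN u:{s..t}. ennreal \<bar>dk u\<bar> * indicator (outward a b x0 x) u) \<le> (NN u:{x..max x t}. ennreal \<bar>dk u\<bar>)"
     using True by (intro nn_integral_mono) (auto simp: indicator_def outward_def)
    also have "\<dots> \<le> ennreal (k x)" using True x st by (intro right) (auto simp: max_def)
    finally show ?thesis .
   next
    case False
    have "(NN u:{s..t}. ennreal \<bar>dk u\<bar> * indicator (outward a b x0 x) u) \<le> (NN u:{min x s..x}. ennreal \<bar>dk u\<bar>)"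
     using False by (intro nn_integral_mono) (auto simp: indicator_def outward_def)
    also have "\<dots> \<le> ennreal (k x)" using False x st by (intro left) (auto simp: min_def)
    finally show ?thesis .
   qed
  qed
  finally show ?thesis .
 qed
 show "(NN s:ivl a b. ennreal \<bar>dk s\<bar>) \<le> ennreal (2 * k x0)"
 proof (rule nn_integral_einterval_le[OF ab])
  have "(\<lambda>s. ennreal \<bar>d s\<bar>) \<in> borelfun" by measurable
  also have "(\<lambda>s. ennreal \<bar>d s\<bar>) = (\<lambda>s. ennreal \<bar>dk s\<bar> * indicator (ivl a b) s)"
   by (auto simp: d_def indicator_def)
  finally show "\<dots> \<in> borelfun" .
  fix s t assume st: "s \<in> ivl a b" "t \<in> ivl a b" "s \<le> t"
  define s' where "s' = min s x0"
  define t' where "t' = max t x0"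
  have st': "s' \<in> ivl a b" "t' \<in> ivl a b" "s' \<le> x0" "x0 \<le> t'"
   using st x0 by (auto simp: s'_def t'_def min_def max_def)
  have "(NN u:{s..t}. ennreal \<bar>dk u\<bar>) \<le> (NN u. ennreal \<bar>d u\<bar> * indicator {s'..x0} u + ennreal \<bar>d u\<bar> * indicator {x0..t'} u)"
   using einterval_Icc_subset[OF st(1,2)] by (intro nn_integral_mono) (auto simp: indicator_def d_def s'_def t'_def)
  also have "\<dots> = (NN u:{s'..x0}. ennreal \<bar>d u\<bar>) + (NN u:{x0..t'}. ennreal \<bar>d u\<bar>)"
   by (rule nn_integral_add) measurable
  also have "(NN u:{s'..x0}. ennreal \<bar>d u\<bar>) = (NN u:{s'..x0}. ennreal \<bar>dk u\<bar>)"
   using einterval_Icc_subset[OF st'(1) x0] by (intro nn_integral_cong) (auto simp: indicator_def d_def)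
  also have "(NN u:{x0..t'}. ennreal \<bar>d u\<bar>) = (NN u:{x0..t'}. ennreal \<bar>dk u\<bar>)"
   using einterval_Icc_subset[OF x0 st'(2)] by (intro nn_integral_cong) (auto simp: indicator_def d_def)
  also have "(NN u:{s'..x0}. ennreal \<bar>dk u\<bar>) + (NN u:{x0..t'}. ennreal \<bar>dk u\<bar>) \<le> ennreal (k x0) + ennreal (k x0)"
   using st' x0 by (intro add_mono left right) auto
  also have "\<dots> = ennreal (2 * k x0)" using nn[OF x0] by (simp add: ennreal_plus[symmetric] del: ennreal_plus)
  finally show "(NN u:{s..t}. ennreal \<bar>dk u\<bar>) \<le> ennreal (2 * k x0)" .
 qed
qed

section \<open>Derivative and decay of the stretched Gaussian\<close>

lemma abs_powr_has_derivative:
 fixes v q :: real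
 assumes "1 < q"
 shows "((\<lambda>v. \<bar>v\<bar> powr q) has_real_derivative q * \<bar>v\<bar> powr (q - 1) * sgn v) (at v)"
proof (cases v "0 :: real" rule: linorder_cases)
 case greater
 have "((\<lambda>v. v powr q) has_real_derivative q * v powr (q - 1)) (at v)"
  using greater by (rule has_real_derivative_powr)
 then have "((\<lambda>v. \<bar>v\<bar> powr q) has_real_derivative q * v powr (q - 1)) (at v)"
  by (rule has_field_derivative_transform_within_open[of _ _ _ "{0<..}"]) (use greater in auto)
 then show ?thesis using greater by simp
next
 case less
 have "((\<lambda>v. (- v) powr q) has_real_derivative q * (- v) powr (q - real_of_nat 1) * (- 1)) (at v)"
  using less by (intro DERIV_fun_powr) (auto intro!: derivative_eq_intros)
 then have "((\<lambda>v. \<bar>v\<bar> powr q) has_real_derivative q * (- v) powr (q - real_of_nat 1) * (- 1)) (at v)"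
  by (rule has_field_derivative_transform_within_open[of _ _ _ "{..<0}"]) (use less in auto)
 then show ?thesis using less by simp
next
 case equal
 \<comment> \<open>At 0 the difference quotient is |h|^(q-1) up to sign and tends to 0 because q >
   1.\<close>
 have "((\<lambda>h::real. \<bar>h\<bar> powr (q - 1)) \<longlongrightarrow> \<bar>0\<bar> powr (q - 1)) (at 0)"
  using assms by (intro tendsto_powr' tendsto_intros) auto
 then have "((\<lambda>h::real. \<bar>h\<bar> powr (q - 1)) \<longlongrightarrow> 0) (at 0)" using assms by simp
 then have "((\<lambda>h::real. (\<bar>0 + h\<bar> powr q - \<bar>0\<bar> powr q) / h) \<longlongrightarrow> 0) (at 0)"
 proof (rule Lim_null_comparison[rotated])
  have "norm (\<bar>h\<bar> powr q / h) \<le> \<bar>h\<bar> powr (q - 1)" if "h \<noteq> 0" for h :: real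
   using that by (simp add: powr_diff abs_divide)
  then show "\<forall>\<^sub>F h::real in at 0. norm ((\<bar>0 + h\<bar> powr q - \<bar>0\<bar> powr q) / h) \<le> \<bar>h\<bar> powr (q - 1)"
   by (auto simp: eventually_at_filter)
 qed
 then show ?thesis using equal assms by (simp add: DERIV_def)
qed

text \<open>This is |G^(l-2) G'|, the quantity whose p-th moment defines the Fisher information. For
  p = 1 it is 0, G being constant on its support.\<close>

definition gaussian_slope :: "real \<Rightarrow> real \<Rightarrow> real \<Rightarrow> real" where
 "gaussian_slope p l v = (if p = 1 then 0 else
   (1 / (LINT t|lborel. stretched_profile p l t)) powr (l - 1) * (p / (p - 1)) * \<bar>v\<bar> powr (p / (p - 1) - 1))"

lemma stretched_gaussian_even: "stretched_gaussian p l (- v) = stretched_gaussian p l v"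
 by (simp add: stretched_gaussian_def stretched_profile_def)

context
 fixes p l :: real
 assumes p: "1 \<le> p" and range: "me_range p l"
begin

lemma stam_support:
 obtains \<rho> where "0 < \<rho>" "- \<rho> < \<rho>" "support (stretched_gaussian p l) = ivl (- \<rho>) \<rho>" "0 \<in> ivl (- \<rho>) \<rho>"
proof -
 obtain \<rho> where \<rho>: "0 < \<rho>" "support (stretched_gaussian p l) = ivl (- \<rho>) \<rho>"
  using stretched_profile_support[OF range] unfolding support_stretched_gaussian[OF range] .
 then show thesis using that[of \<rho>] by (cases \<rho>) (auto simp: einterval_iff)
qed

lemma gaussian_slope_nonneg: "0 \<le> gaussian_slope p l v"
 using p by (simp add: gaussian_slope_def)

lemma stretched_gaussian_pos: "v \<in> support (stretched_gaussian p l) \<Longrightarrow> 0 < stretched_gaussian p l v"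
 by (simp add: support_def)

lemma open_support: "open (support (stretched_gaussian p l))"
proof -
 obtain \<rho> where "support (stretched_gaussian p l) = ivl (- \<rho>) \<rho>" using stam_support by blast
 then show ?thesis by simp
qed

lemma stretched_gaussian_deriv:
 assumes v: "v \<in> support (stretched_gaussian p l)"
 shows "(stretched_gaussian p l has_real_derivative - sgn v * gaussian_slope p l v * stretched_gaussian p l v powr (2 - l)) (at v)"
proof (cases "p = 1")
 case True
 have G: "stretched_gaussian p l = (\<lambda>x. if \<bar>x\<bar> < 1 then 1 / 2 else 0)"
  using gaussian_sup_moment(2)[OF me_rangeD[OF range]] True by simp
 then have S: "support (stretched_gaussian p l) = {-1<..<1}" by (auto simp: support_def abs_less_iff)
 have "((\<lambda>x::real. 1 / 2) has_real_derivative 0) (at v)" by (rule DERIV_const)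
 then have "(stretched_gaussian p l has_real_derivative 0) (at v)"
  by (rule has_field_derivative_transform_within_open[of _ _ _ "{-1<..<1}"]) (use v G S in auto)
 then show ?thesis using True by (simp add: gaussian_slope_def)
next
 case False
 define C where "C = (1 / (LINT t|lborel. stretched_profile p l t)) powr (l - 1)"
 define q where "q = p / (p - 1)"
 have q: "1 < q" using p False by (simp add: q_def field_simps)
 define B where "B v = C * (1 + (1 - l) * \<bar>v\<bar> powr q)" for v
 have l: "l \<noteq> 1" using me_rangeD[OF range] by simp
 have B: "gaussian_base p l = B"
  using p False by (simp add: gaussian_base_def profile_base_def B_def C_def q_def fun_eq_iff)
 have GB: "stretched_gaussian p l u powr (l - 1) = B u" "0 < B u" "stretched_gaussian p l u = B u powr (1 / (l - 1))"
  if u: "u \<in> support (stretched_gaussian p l)" for u proof -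
  show "stretched_gaussian p l u powr (l - 1) = B u" "0 < B u"
   using gaussian_base_powr(1,2)[OF range, of u] p stretched_gaussian_pos[OF u] unfolding B by auto
  then show "stretched_gaussian p l u = B u powr (1 / (l - 1))"
   using l stretched_gaussian_pos[OF u] by (metis (no_types, lifting) less_imp_le powr_one powr_powr nonzero_mult_div_cancel_left right_minus_eq times_divide_eq_right mult.right_neutral)
 qed
 have dB: "(B has_real_derivative C * ((1 - l) * (q * \<bar>v\<bar> powr (q - 1) * sgn v))) (at v)"
  unfolding B_def using DERIV_add[OF DERIV_const DERIV_cmult[OF abs_powr_has_derivative[OF q, of v], of "1 - l"], of 1]
  by (intro DERIV_cmult) simp
 have "((\<lambda>v. B v powr (1 / (l - 1))) has_real_derivative
   1 / (l - 1) * B v powr (1 / (l - 1) - real_of_nat 1) * (C * ((1 - l) * (q * \<bar>v\<bar> powr (q - 1) * sgn v)))) (at v)"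
  by (rule DERIV_fun_powr[OF dB GB(2)[OF v]])
 then have d: "(stretched_gaussian p l has_real_derivative
   1 / (l - 1) * B v powr (1 / (l - 1) - real_of_nat 1) * (C * ((1 - l) * (q * \<bar>v\<bar> powr (q - 1) * sgn v)))) (at v)"
  by (rule has_field_derivative_transform_within_open[OF _ open_support v]) (simp add: GB(3))
 have "(l - 1) * (1 / (l - 1) - 1) = 2 - l" using l by (simp add: field_simps)
 then have "B v powr (1 / (l - 1) - real_of_nat 1) = stretched_gaussian p l v powr (2 - l)"
  unfolding GB(1)[OF v, symmetric] powr_powr by simp
 then have "1 / (l - 1) * B v powr (1 / (l - 1) - real_of_nat 1) * (C * ((1 - l) * (q * \<bar>v\<bar> powr (q - 1) * sgn v)))
  = - sgn v * gaussian_slope p l v * stretched_gaussian p l v powr (2 - l)"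
  using l False by (simp add: gaussian_slope_def C_def q_def divide_simps) (simp add: algebra_simps)
 with d show ?thesis by simp
qed

text \<open>For e = l the last exponent is 1, so the derivative of G^l is the slope times G up to a
  factor; this is why G^l is the function to integrate by parts.\<close>

lemma stretched_gaussian_powr_deriv:
 assumes v: "v \<in> support (stretched_gaussian p l)"
 shows "((\<lambda>v. stretched_gaussian p l v powr e) has_real_derivative
  - e * sgn v * gaussian_slope p l v * stretched_gaussian p l v powr (e + 1 - l)) (at v)" proof -
 have "((\<lambda>v. stretched_gaussian p l v powr e) has_real_derivative
  e * stretched_gaussian p l v powr (e - real_of_nat 1) * (- sgn v * gaussian_slope p l v * stretched_gaussian p l v powr (2 - l))) (at v)"
  by (rule DERIV_fun_powr[OF stretched_gaussian_deriv[OF v] stretched_gaussian_pos[OF v]])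
 moreover have "stretched_gaussian p l v powr (e - real_of_nat 1) * stretched_gaussian p l v powr (2 - l) = stretched_gaussian p l v powr (e + 1 - l)"
 proof -
  have "e - real_of_nat 1 + (2 - l) = e + 1 - l" by simp
  then show ?thesis by (metis powr_add)
 qed
 ultimately show ?thesis by (simp add: mult_ac)
qed

lemma stretched_gaussian_continuous: "continuous_on (support (stretched_gaussian p l)) (stretched_gaussian p l)"
 by (intro continuous_at_imp_continuous_on ballI DERIV_isCont[OF stretched_gaussian_deriv])

text \<open>At a finite end of the support G is continuous with value 0; on an unbounded support a
  positive lower bound on a half-line would contradict total mass 1. For p = 1 the uniform density
  stays away from 0.\<close>

lemma stretched_gaussian_small:
 assumes p1: "p \<noteq> 1" and e: "0 < e" and x: "x \<in> support (stretched_gaussian p l)"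
 shows "\<exists>t\<in>support (stretched_gaussian p l). x < t \<and> stretched_gaussian p l t powr l < e"
  "\<exists>t\<in>support (stretched_gaussian p l). t < x \<and> stretched_gaussian p l t powr l < e" proof -
 define G where "G = stretched_gaussian p l"
 have l: "0 < l" "l \<noteq> 1" using me_rangeD[OF range] by auto
 have [measurable]: "G \<in> borelfun" unfolding G_def by measurable
 obtain \<rho> where \<rho>: "0 < \<rho>" "support G = ivl (- \<rho>) \<rho>" unfolding G_def using stam_support by metis
 have right: "\<exists>t\<in>support G. x < t \<and> G t powr l < e" if x: "x \<in> support G" for x
 proof (cases \<rho>)
  case (real r)
  have r: "0 < r" "support G = {-r<..<r}" using \<rho> real by auto
  have l1: "1 < l"
  proof (rule gaussian_base_powr(3)[OF range, of r, THEN conjunct1])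
   show "stretched_gaussian p l r = 0"
    using r stretched_gaussian_nonneg[OF range, of r] unfolding G_def support_def by force
  qed (use p p1 in auto)
  define Z where "Z = (LINT t|lborel. stretched_profile p l t)"
  have Z: "0 < Z" unfolding Z_def by (rule profile_integral_pos[OF range])
  have G: "G = (\<lambda>v. max 0 (1 + (1 - l) * \<bar>v\<bar> powr (p / (p - 1))) powr (1 / (l - 1)) / Z)"
   using p p1 l by (auto simp: G_def stretched_gaussian_def stretched_profile_def Z_def fun_eq_iff)
  have q: "0 < p / (p - 1)" using p p1 by simp
  have "continuous_on UNIV (\<lambda>v. G v powr l)"
   unfolding G using l1 Z q by (intro continuous_on_powr' continuous_intros) auto
  then have "isCont (\<lambda>v. G v powr l) r" by (simp add: continuous_on_eq_continuous_at)
  moreover have "G r = 0" using r stretched_gaussian_nonneg[OF range, of r] unfolding G_def support_def by force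
  ultimately have "((\<lambda>v. G v powr l) \<longlongrightarrow> 0) (at r)" using l by (simp add: isCont_def)
  then have "((\<lambda>v. G v powr l) \<longlongrightarrow> 0) (at_left r)" by (rule tendsto_mono[OF at_le, rotated]) simp
  then have "eventually (\<lambda>v. G v powr l < e) (at_left r)" using e by (rule order_tendstoD)
  moreover have "eventually (\<lambda>v. v \<in> {max x (-r)<..<r}) (at_left r)"
   using x r by (intro eventually_at_left_real) auto
  ultimately have "eventually (\<lambda>v. v \<in> {max x (-r)<..<r} \<and> G v powr l < e) (at_left r)" by (rule eventually_elim2) auto
  then have "\<exists>v. v \<in> {max x (-r)<..<r} \<and> G v powr l < e"
   by (rule eventually_happens'[OF trivial_limit_at_left_real])
  then show ?thesis using r by auto
 next
  case PInf
  then have S: "support G = UNIV" using \<rho> by simp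
  show ?thesis
  proof (rule ccontr)
   assume contr: "\<not> ?thesis"
   have ge: "e \<le> G t powr l" if "x < t" for t using contr that S by (metis UNIV_I not_le)
   define d where "d = e powr (1 / l)"
   have d: "0 < d" using e by (simp add: d_def)
   have "d \<le> G t" if "x < t" for t proof -
    have "d \<le> (G t powr l) powr (1 / l)" unfolding d_def using ge[OF that] e l by (intro powr_mono2) auto
    then show ?thesis using l stretched_gaussian_nonneg[OF range] by (simp add: powr_powr G_def)
   qed
   \<comment> \<open>The length 1/d + 1 gives the mass 1 + d, more than the total.\<close>
   then have "ennreal d * emeasure lborel {x<..x + (1 / d + 1)} \<le> (NN t. ennreal (G t))"
    by (subst nn_integral_cmult_indicator[symmetric]) (auto intro!: nn_integral_mono ennreal_leI simp: indicator_def)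
   moreover have "emeasure lborel {x<..x + (1 / d + 1)} = ennreal (1 / d + 1)" using d by (subst emeasure_lborel_Ioc) auto
   ultimately have "ennreal (d * (1 / d + 1)) \<le> 1"
    using d stretched_gaussian_nn_integral[OF range] by (simp add: G_def ennreal_mult)
   then have "d * (1 / d + 1) \<le> 1" by (simp flip: ennreal_1)
   then show False using d mult_pos_pos[OF d d] by (simp add: field_simps)
  qed
 qed (use \<rho> in simp)
 then show "\<exists>t\<in>support (stretched_gaussian p l). x < t \<and> stretched_gaussian p l t powr l < e"
  using x by (simp add: G_def)
 have "- x \<in> support G" using x by (simp add: support_def stretched_gaussian_even G_def)
 then obtain t where "t \<in> support G" "- x < t" "G t powr l < e" using right by blast
 then show "\<exists>t\<in>support (stretched_gaussian p l). t < x \<and> stretched_gaussian p l t powr l < e"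
  by (intro bexI[of _ "- t"]) (auto simp: G_def support_def stretched_gaussian_even)
qed

text \<open>Integration by parts for the stretched Gaussian itself.\<close>

lemma gaussian_mass_moment:
 assumes p1: "p \<noteq> 1" and q: "q = p / (p - 1)"
  and \<mu>: "has_bochner_integral lborel (\<lambda>x. stretched_gaussian p l x * \<bar>x\<bar> powr q) \<mu>"
 shows "gaussian_mass p l = l * ((1 / (LINT t|lborel. stretched_profile p l t)) powr (l - 1) * q) * \<mu>"
proof -
 define G where "G = stretched_gaussian p l"
 have l: "0 < l" "l \<noteq> 1" using me_rangeD[OF range] by auto
 define K where "K = l * ((1 / (LINT t|lborel. stretched_profile p l t)) powr (l - 1) * q)"
 have K: "0 \<le> K" using l p p1 by (simp add: K_def q)
 have [measurable]: "G \<in> borelfun" unfolding G_def by measurable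
 obtain \<rho> where \<rho>: "0 < \<rho>" "- \<rho> < \<rho>" "support G = ivl (- \<rho>) \<rho>" "0 \<in> ivl (- \<rho>) \<rho>"
  unfolding G_def using stam_support by metis
 interpret coordinate "- \<rho>" \<rho> "\<lambda>_. 1" "\<lambda>v. v"
  by (rule coordinate_of_derivative[OF \<rho>(2)]) auto
 define k where "k v = G v powr l" for v
 define dk where "dk v = - l * sgn v * gaussian_slope p l v * G v" for v
 have der: "(k has_real_derivative dk v) (at v)" if "v \<in> ivl (- \<rho>) \<rho>" for v
  using stretched_gaussian_powr_deriv[of v l] that \<rho> stretched_gaussian_nonneg[OF range, of v]
  by (simp add: k_def[abs_def] dk_def G_def)
 have slope: "gaussian_slope p l v * \<bar>v\<bar> * l = K * \<bar>v\<bar> powr q" for v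
  using p1 by (cases "v = 0") (auto simp: gaussian_slope_def K_def q powr_diff)
 \<comment> \<open>Unimodality turns the outward bound into an equality, so the integration by parts
   loses nothing.\<close>
 have out: "(NN s:outward (- \<rho>) \<rho> 0 x. ennreal \<bar>dk s\<bar>) = ennreal (k x)" if x: "x \<in> ivl (- \<rho>) \<rho>" for x
 proof (rule antisym)
  have "0 \<le> gaussian_slope p l v * G v" for v using gaussian_slope_nonneg stretched_gaussian_nonneg[OF range] by (simp add: G_def)
  then have s: "0 \<le> dk v" if "v \<le> 0" for v using that l by (cases "v = 0") (simp_all add: dk_def mult.assoc)
  have s': "dk v \<le> 0" if "0 \<le> v" for v using that l \<open>\<And>v. 0 \<le> gaussian_slope p l v * G v\<close>
   by (cases "v = 0") (simp_all add: dk_def mult.assoc)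
  show "(NN s:outward (- \<rho>) \<rho> 0 x. ennreal \<bar>dk s\<bar>) \<le> ennreal (k x)"
   by (rule unimodal_variation(1)[OF \<rho>(2) der _ \<rho>(4) _ _ x]) (auto simp: k_def s s')
  show "ennreal (k x) \<le> (NN s:outward (- \<rho>) \<rho> 0 x. ennreal \<bar>dk s\<bar>)"
   by (rule outward_bound[OF der _ _ x])
    (use stretched_gaussian_small[OF p1] \<rho>(3) in \<open>auto simp: k_def G_def\<close>)
 qed
 have "ennreal (gaussian_mass p l) = (NN v:ivl (- \<rho>) \<rho>. ennreal (k v))"
  unfolding gaussian_mass_nn_integral(2)[OF range, symmetric] using \<rho> by (simp add: k_def G_def)
 also have "\<dots> = (NN x:ivl (- \<rho>) \<rho>. (NN s:outward (- \<rho>) \<rho> 0 x. ennreal \<bar>dk s\<bar>) * ennreal 1)"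
 proof (intro nn_integral_cong)
  fix x
  show "ennreal (k x) * indicator (ivl (- \<rho>) \<rho>) x =
   (NN s:outward (- \<rho>) \<rho> 0 x. ennreal \<bar>dk s\<bar>) * ennreal 1 * indicator (ivl (- \<rho>) \<rho>) x"
   by (cases "x \<in> ivl (- \<rho>) \<rho>") (auto simp: out)
 qed
 also have "\<dots> = (NN x:ivl (- \<rho>) \<rho>. ennreal (\<bar>dk x\<bar> * \<bar>x\<bar>))"
  by (rule outward_tonelli[OF borel_measurable_deriv_einterval(2)[OF der] \<rho>(4) refl])
 also have "\<dots> = (NN x. ennreal (K * (G x * \<bar>x\<bar> powr q)))"
 proof (intro nn_integral_cong)
  fix x
  have Gx: "0 \<le> G x" "x \<notin> ivl (- \<rho>) \<rho> \<Longrightarrow> G x = 0"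
   using stretched_gaussian_nonneg[OF range, of x] unfolding \<rho>(3)[symmetric] by (auto simp: G_def support_def)
  have "\<bar>dk x\<bar> * \<bar>x\<bar> = gaussian_slope p l x * \<bar>x\<bar> * l * G x"
   using l gaussian_slope_nonneg[of x] Gx by (cases "x = 0") (auto simp: dk_def abs_mult abs_sgn_eq)
  then have "\<bar>dk x\<bar> * \<bar>x\<bar> = K * (G x * \<bar>x\<bar> powr q)" unfolding slope by (simp add: mult_ac)
  then show "ennreal (\<bar>dk x\<bar> * \<bar>x\<bar>) * indicator (ivl (- \<rho>) \<rho>) x = ennreal (K * (G x * \<bar>x\<bar> powr q))"
   using Gx by (auto simp: indicator_def)
 qed
 also have "\<dots> = ennreal (K * \<mu>)" using \<mu> K stretched_gaussian_nonneg[OF range]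
  by (subst nn_integral_eq_integral) (auto simp: has_bochner_integral_iff G_def)
 finally have "ennreal (gaussian_mass p l) = ennreal (K * \<mu>)" .
 moreover have "0 < gaussian_mass p l" by (rule gaussian_mass_nn_integral(3)[OF range])
 ultimately have "gaussian_mass p l = K * \<mu>"
  by (metis ennreal_inj ennreal_less_zero_iff less_imp_le ennreal_eq_0_iff linorder_not_le)
 then show ?thesis by (simp add: K_def)
qed

end

section \<open>The extremal density of the Stam inequality\<close>

lemma is_interval_einterval:
 fixes J :: "real set"
 assumes "open J" "is_interval J" "J \<noteq> {}"
 obtains c d where "c < d" "J = ivl c d"
proof -
 define c where "c = (INF x\<in>J. ereal x)"
 define d where "d = (SUP x\<in>J. ereal x)"
 have "J = ivl c d"
 proof (rule set_eqI, rule iffI)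
  fix x assume x: "x \<in> J"
  obtain e where e: "0 < e" "ball x e \<subseteq> J" using assms(1) x by (meson open_contains_ball)
  then have "x - e / 2 \<in> J" "x + e / 2 \<in> J" by (auto simp: subset_iff dist_real_def)
  then have "c \<le> ereal (x - e / 2)" "ereal (x + e / 2) \<le> d"
   unfolding c_def d_def by (auto intro: INF_lower SUP_upper)
  moreover have "ereal (x - e / 2) < ereal x" "ereal x < ereal (x + e / 2)" using e by auto
  ultimately show "x \<in> ivl c d" unfolding einterval_iff by (meson le_less_trans less_le_trans)
 next
  fix x assume "x \<in> ivl c d"
  then have "c < ereal x" "ereal x < d" by (auto simp: einterval_iff)
  then obtain u v where "u \<in> J" "u < x" "v \<in> J" "x < v"
   unfolding c_def d_def INF_less_iff less_SUP_iff by auto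
  then show "x \<in> J" using assms(2) unfolding is_interval_1 by (meson less_imp_le)
 qed
 moreover from this assms(3) have "c < d" by (auto simp: einterval_iff intro: less_trans)
 ultimately show thesis using that by blast
qed

text \<open>
 The density \<open>stam_density\<close> is the stretched Gaussian \<open>G\<close> for the parameter \<open>l\<close>, raised to the power \<open>1/\<theta>\<close> and
 expressed in the coordinate \<open>Y\<close>.
\<close>

locale stam_params =
 fixes p \<beta> lam \<theta> l :: real
 assumes p: "1 \<le> p" and theta: "\<theta> = 1 + \<beta> - lam" "\<theta> \<noteq> 0" and l: "l = \<beta> / \<theta>" and range: "me_range p l"
begin

definition "G = stretched_gaussian p l"
definition "S = support G"
definition "Y x = (LBINT t=ereal 0..ereal x. G t powr (1 - 1 / \<theta>))"
definition "wY x = (if x \<in> S then G x powr (1 - 1 / \<theta>) else 1)"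
definition "g = stam_density p \<beta> lam"
definition "m = gaussian_mass p l"
definition "sig = gaussian_sigma p l"

lemma l_pos: "0 < l" "l \<noteq> 1"
 using me_rangeD[OF range] by auto

lemma beta: "\<beta> = l * \<theta>" "\<beta> \<noteq> 0" "0 < \<beta> \<longleftrightarrow> 0 < \<theta>" "1 - lam = \<theta> * (1 - l)" "lam \<noteq> 1"
proof -
 show 1: "\<beta> = l * \<theta>" using l theta by simp
 show "\<beta> \<noteq> 0" using 1 l_pos(1) theta(2) by (metis less_irrefl mult_eq_0_iff)
 show "0 < \<beta> \<longleftrightarrow> 0 < \<theta>" unfolding 1 using l_pos by (simp add: zero_less_mult_iff)
 show 2: "1 - lam = \<theta> * (1 - l)" using theta(1) 1 by (simp add: algebra_simps)
 show "lam \<noteq> 1" using 2 l_pos theta(2) by auto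
qed

lemma m_pos: "0 < m"
 unfolding m_def by (rule gaussian_mass_nn_integral(3)[OF range])

lemma sig_pos: "0 < sig"
 unfolding sig_def by (rule sigma_stretched_gaussian(2)[OF range])

lemma G_meas [measurable]: "G \<in> borelfun"
 unfolding G_def by measurable

lemma G_nonneg: "0 \<le> G x"
 unfolding G_def by (rule stretched_gaussian_nonneg[OF range])

lemma G_pos: "x \<in> S \<Longrightarrow> 0 < G x"
 by (simp add: S_def support_def)

lemma G_neq: "x \<in> S \<Longrightarrow> G x \<noteq> 0"
 using G_pos by (metis less_irrefl)

lemma G_off: "x \<notin> S \<Longrightarrow> G x = 0"
 using G_nonneg[of x] by (simp add: S_def support_def)

lemma S_einterval: obtains \<rho> where "0 < \<rho>" "- \<rho> < \<rho>" "S = ivl (- \<rho>) \<rho>" "0 \<in> ivl (- \<rho>) \<rho>"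
 using stam_support[OF p range] unfolding S_def G_def by metis

lemma S_meas [measurable]: "S \<in> sets borel"
 using S_einterval by (metis borel_einterval)

lemma G_integral: "(NN x. ennreal (G x)) = 1" "(NN x:S. ennreal (G x)) = 1"
proof -
 show 1: "(NN x. ennreal (G x)) = 1" unfolding G_def by (rule stretched_gaussian_nn_integral[OF range])
 have "(NN x:S. ennreal (G x)) = (NN x. ennreal (G x))" by (intro nn_integral_cong) (auto simp: indicator_def G_off)
 with 1 show "(NN x:S. ennreal (G x)) = 1" by simp
qed

lemma G_continuous: "continuous_on S G"
 unfolding S_def G_def by (rule stretched_gaussian_continuous[OF p range])

lemma wY_continuous: "continuous_on S wY"
proof -
 have "continuous_on S (\<lambda>x. G x powr (1 - 1 / \<theta>))"
  using G_neq by (intro continuous_on_powr G_continuous continuous_intros) auto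
 then show ?thesis by (rule continuous_on_eq) (simp add: wY_def)
qed

lemma wY_meas [measurable]: "wY \<in> borelfun"
 unfolding wY_def[abs_def] by measurable

lemma wY_pos: "0 < wY x"
 using G_pos[of x] by (auto simp: wY_def)

context
 fixes \<rho> :: ereal
 assumes rho: "0 < \<rho>" "- \<rho> < \<rho>" "S = ivl (- \<rho>) \<rho>" "0 \<in> ivl (- \<rho>) \<rho>"
begin

lemma coordinate_Y: "coordinate (- \<rho>) \<rho> wY Y"
proof (rule coordinate_of_derivative[OF rho(2)])
 fix x assume x: "x \<in> ivl (- \<rho>) \<rho>"
 obtain s t where st: "s \<in> ivl (- \<rho>) \<rho>" "t \<in> ivl (- \<rho>) \<rho>" "s < x" "x < t"
  using einterval_two_sided[OF x] .
 define s' where "s' = min s 0"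
 define t' where "t' = max t 0"
 have st': "s' \<in> ivl (- \<rho>) \<rho>" "t' \<in> ivl (- \<rho>) \<rho>" "s' < x" "x < t'" "s' \<le> 0" "0 \<le> t'"
  using st rho by (auto simp: s'_def t'_def min_def max_def)
 have sub: "{s'..t'} \<subseteq> S" using einterval_Icc_subset[OF st'(1,2)] rho by simp
 have "continuous_on {s'..t'} (\<lambda>x. G x powr (1 - 1 / \<theta>))"
  using G_neq sub by (intro continuous_on_powr continuous_on_subset[OF G_continuous] continuous_intros) (auto simp: subset_iff)
 then have "((\<lambda>u. LBINT t=0..u. G t powr (1 - 1 / \<theta>)) has_vector_derivative (G x powr (1 - 1 / \<theta>))) (at x within {s'..t'})"
  using st' interval_integral_FTC2[of s' 0 t' "\<lambda>x. G x powr (1 - 1 / \<theta>)" x] by (simp add: zero_ereal_def)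
 then have "(Y has_real_derivative (G x powr (1 - 1 / \<theta>))) (at x within {s'..t'})"
  unfolding has_real_derivative_iff_has_vector_derivative Y_def[abs_def] by (simp add: zero_ereal_def)
 then show "(Y has_real_derivative wY x) (at x)" using st' x rho by (simp add: at_within_Icc_at wY_def)
qed (use wY_pos in auto)

lemma stam_g: "g v = (if v \<in> Y ` S then G (inv_into S Y v) powr (1 / \<theta>) else 0)"
proof -
 have "g = rel_escort (1 / \<theta>) S G (\<lambda>_. 1) Y"
  unfolding g_def stam_density_def Let_def diff_escort_def S_def G_def Y_def[abs_def] theta(1)[symmetric] l[symmetric] ..
 then show ?thesis by (simp add: rel_escort_def)
qed

lemma g_Y: "x \<in> S \<Longrightarrow> g (Y x) = G x powr (1 / \<theta>)"
 using coordinate.inv_image(3)[OF coordinate_Y] unfolding stam_g by (auto simp: rho)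

lemma g_nonneg': "0 \<le> g v"
 unfolding stam_g by simp

lemma support_g: "support g = Y ` S"
proof -
 have "0 < g v \<longleftrightarrow> v \<in> Y ` S" for v
 proof (cases "v \<in> Y ` S")
  case True
  then have "G (inv_into S Y v) \<noteq> 0" using coordinate.inv_image(1)[OF coordinate_Y, of v] G_neq rho(3) by simp
  then show ?thesis using True by (simp add: stam_g)
 qed (simp add: stam_g)
 then show ?thesis by (auto simp: support_def)
qed

lemma g_meas': "g \<in> borelfun"
proof -
 interpret coordinate "- \<rho>" \<rho> wY Y by (rule coordinate_Y)
 have "(\<lambda>v. if v \<in> Y ` ivl (- \<rho>) \<rho> then G (indicator (Y ` ivl (- \<rho>) \<rho>) v * inv_into (ivl (- \<rho>) \<rho>) Y v) powr (1 / \<theta>) else 0) \<in> borelfun"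
  by measurable
 also have "(\<lambda>v. if v \<in> Y ` ivl (- \<rho>) \<rho> then G (indicator (Y ` ivl (- \<rho>) \<rho>) v * inv_into (ivl (- \<rho>) \<rho>) Y v) powr (1 / \<theta>) else 0) = g"
  unfolding stam_g[abs_def] rho(3) by auto
 finally show ?thesis .
qed

lemma support_g_einterval': "\<exists>c d. c < d \<and> support g = ivl c d"
proof -
 interpret coordinate "- \<rho>" \<rho> wY Y by (rule coordinate_Y)
 have "Y 0 \<in> Y ` ivl (- \<rho>) \<rho>" using rho by blast
 then show ?thesis unfolding support_g rho(3)
  by (metis is_interval_einterval[OF open_image is_interval_image] empty_iff)
qed

lemma g_pushforward:
 fixes \<phi> :: "real \<Rightarrow> ennreal"
 assumes "\<phi> \<in> borelfun"
 shows "(NN v:support g. \<phi> v) = (NN x:S. \<phi> (Y x) * ennreal (G x powr (1 - 1 / \<theta>)))"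
proof -
 interpret coordinate "- \<rho>" \<rho> wY Y by (rule coordinate_Y)
 show ?thesis unfolding support_g rho(3) pushforward[OF assms, symmetric]
  by (intro nn_integral_cong) (auto simp: indicator_def wY_def rho)
qed

text \<open>The parameter \<open>l\<close> is the one for which g^\<lambda> dY becomes G^l dx:
  \<lambda>/\<theta> + 1 - 1/\<theta> = \<beta>/\<theta>.\<close>

lemma g_powr_integral': "(NN v:support g. ennreal (g v powr lam)) = ennreal m" "(NN v. ennreal (g v)) = 1"
proof -
 have [measurable]: "g \<in> borelfun" by (rule g_meas')
 have "(NN v:support g. ennreal (g v powr lam)) = (NN x:S. ennreal (g (Y x) powr lam) * ennreal (G x powr (1 - 1 / \<theta>)))"
  by (rule g_pushforward) measurable
 also have "\<dots> = (NN x:S. ennreal (G x powr l))"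
 proof (rule nn_set_cong)
  fix x assume xA: "x \<in> S"
  have "1 / \<theta> * lam + (1 - 1 / \<theta>) = l" using theta l by (simp add: field_simps)
  then have "G x powr (1 / \<theta> * lam) * G x powr (1 - 1 / \<theta>) = G x powr l" by (simp flip: powr_add)
  then show "ennreal (g (Y x) powr lam) * ennreal (G x powr (1 - 1 / \<theta>)) = ennreal (G x powr l)"
   using xA by (simp_all add: g_Y powr_powr ennreal_mult[symmetric])
 qed
 also have "\<dots> = ennreal m" unfolding S_def G_def m_def by (rule gaussian_mass_nn_integral(2)[OF range])
 finally show "(NN v:support g. ennreal (g v powr lam)) = ennreal m" .
 have "(NN v. ennreal (g v)) = (NN v:support g. ennreal (g v))"
  using g_nonneg' by (intro nn_integral_cong) (auto simp: indicator_def support_def not_less dest: antisym)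
 also have "\<dots> = (NN x:S. ennreal (g (Y x)) * ennreal (G x powr (1 - 1 / \<theta>)))"
  by (rule g_pushforward) measurable
 also have "\<dots> = (NN x:S. ennreal (G x))"
 proof (rule nn_set_cong)
  fix x assume xA: "x \<in> S"
  have "G x powr (1 / \<theta>) * G x powr (1 - 1 / \<theta>) = G x" using G_nonneg[of x] by (simp flip: powr_add)
  then show "ennreal (g (Y x)) * ennreal (G x powr (1 - 1 / \<theta>)) = ennreal (G x)"
   using xA by (simp_all add: g_Y ennreal_mult[symmetric])
 qed
 finally show "(NN v. ennreal (g v)) = 1" using G_integral by simp
qed

lemma g_has_derivative:
 assumes x: "x \<in> S"
 shows "(g has_real_derivative - (1 / \<theta>) * sgn x * gaussian_slope p l x * G x powr (2 / \<theta> - l)) (at (Y x))"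
proof -
 interpret coordinate "- \<rho>" \<rho> wY Y by (rule coordinate_Y)
 have xS: "x \<in> ivl (- \<rho>) \<rho>" using x rho by simp
 have 1: "((\<lambda>v. G v powr (1 / \<theta>)) has_real_derivative - (1 / \<theta>) * sgn x * gaussian_slope p l x * G x powr (1 / \<theta> + 1 - l)) (at (inv_into S Y (Y x)))"
  using stretched_gaussian_powr_deriv[OF p range, of x "1 / \<theta>"] x inv_image(3)[OF xS] unfolding S_def[symmetric] G_def[symmetric] rho(3)[symmetric]
  by (simp add: S_def G_def)
 have 2: "(inv_into S Y has_real_derivative inverse (wY x)) (at (Y x))"
  using inv_has_derivative[OF _ xS] wY_continuous unfolding rho(3)[symmetric] by simp
 have "((\<lambda>v. G (inv_into S Y v) powr (1 / \<theta>)) has_real_derivative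
   (- (1 / \<theta>) * sgn x * gaussian_slope p l x * G x powr (1 / \<theta> + 1 - l)) * inverse (wY x)) (at (Y x))"
  using DERIV_chain2[OF 1 2] .
 moreover have "G x powr (1 / \<theta> + 1 - l) * inverse (wY x) = G x powr (2 / \<theta> - l)" proof -
  have "inverse (wY x) = G x powr (- (1 - 1 / \<theta>))" using x by (simp only: wY_def powr_minus if_True)
  moreover have "(1 / \<theta> + 1 - l) + (- (1 - 1 / \<theta>)) = 2 / \<theta> - l" by simp
  ultimately show ?thesis by (metis powr_add)
 qed
 ultimately have "((\<lambda>v. G (inv_into S Y v) powr (1 / \<theta>)) has_real_derivative
   - (1 / \<theta>) * sgn x * gaussian_slope p l x * G x powr (2 / \<theta> - l)) (at (Y x))"
  by (simp only: mult.assoc)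
 then show ?thesis
 proof (rule has_field_derivative_transform_within_open)
  show "open (Y ` S)" unfolding rho(3) by (rule open_image)
  show "Y x \<in> Y ` S" using x by simp
 qed (simp add: stam_g)
qed

text \<open>For p > 1 the powers of G cancel in g^(\<beta>-2) g' and leave a multiple of |x|^(q-1),
  so the Fisher information is a moment of G, which \<open>gaussian_mass_moment\<close> expresses
  through \<open>m\<close>. For p = 1 the variation of g^\<beta> consists of two jumps.\<close>

lemma fisher_g': "fisher p \<beta> g = ennreal ((m / (\<bar>\<beta>\<bar> * sig)) powr (1 / \<beta>))"
proof (cases "p = 1")
 case True
 have sig1: "sig = 1" unfolding sig_def gaussian_sigma_def unfolding True hconj_def using gaussian_sup_moment(1)[OF l_pos] by simp
 have m1: "m = 2 powr (1 - l)" unfolding m_def unfolding True by (rule gaussian_sup_moment(3)[OF l_pos])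
 have G: "G = (\<lambda>x. if \<bar>x\<bar> < 1 then 1 / 2 else 0)" unfolding G_def unfolding True by (rule gaussian_sup_moment(2)[OF l_pos])
 have S: "S = {-1<..<1}" by (auto simp: S_def support_def G abs_less_iff)
 define K where "K = (1 / 2 :: real) powr (1 - 1 / \<theta>)"
 have K: "0 < K" by (simp add: K_def)
 have Y: "Y x = K * x" if "x \<in> S" for x proof -
  have "Y x = (LBINT t=ereal 0..ereal x. K)"
   unfolding Y_def using that S by (intro interval_integral_cong) (auto simp: G K_def min_def max_def split: if_splits)
  then show ?thesis by simp
 qed
 have J: "support g = {v. \<bar>v\<bar> < K}" proof -
  have "Y ` S = {v. \<bar>v\<bar> < K}"
  proof safe
   fix x assume "x \<in> S" then show "\<bar>Y x\<bar> < K" using K by (simp add: Y S abs_mult abs_less_iff)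
  next
   fix v :: real assume "\<bar>v\<bar> < K"
   then have "v / K \<in> S" using K by (auto simp: S field_simps)
   moreover from Y[OF this] K have "v = Y (v / K)" by simp
   ultimately show "v \<in> Y ` S" by blast
  qed
  then show ?thesis by (simp add: support_g)
 qed
 define c where "c = (1 / 2 :: real) powr l"
 have c: "0 < c" by (simp add: c_def)
 have gv: "g v powr \<beta> = c" if "v \<in> support g" for v proof -
  obtain x where "x \<in> S" "v = Y x" using \<open>v \<in> support g\<close> support_g by auto
  then have "g v = (1 / 2) powr (1 / \<theta>)" using S by (simp add: g_Y G abs_less_iff)
  then have "g v powr \<beta> = (1 / 2) powr (1 / \<theta> * \<beta>)" by (simp only: powr_powr)
  then show ?thesis using l by (simp add: c_def)
 qed
 define u where "u v = (if \<bar>v\<bar> < K then c else 0)" for v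
 have u: "(\<lambda>x. if x \<in> support g then g x powr \<beta> else 0) = u" using gv by (auto simp: u_def J)
 have "total_variation u = ennreal (2 * c)"
 proof (rule antisym)
  \<comment> \<open>A monotone function whose increments dominate those of \<open>u\<close>, rising
    by \<open>c\<close> at each jump; the sums telescope.\<close>
  define \<Phi> where "\<Phi> v = (if v \<le> - K then 0 else if v < K then c else 2 * c)" for v
  have step: "\<bar>u t - u s\<bar> \<le> \<Phi> t - \<Phi> s" if "s \<le> t" for s t
   using that c K by (auto simp: u_def \<Phi>_def abs_less_iff)
  show "total_variation u \<le> ennreal (2 * c)" unfolding total_variation_def
  proof (intro SUP_least)
   fix t :: "nat \<Rightarrow> real" and n
   assume "t \<in> {t. mono t}"
   then have mt: "t i \<le> t (Suc i)" for i by (auto simp: mono_def)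
   have "(\<Sum>i<n. ennreal \<bar>u (t (Suc i)) - u (t i)\<bar>) = ennreal (\<Sum>i<n. \<bar>u (t (Suc i)) - u (t i)\<bar>)"
    by (rule sum_ennreal) simp
   also have "\<dots> \<le> ennreal (\<Sum>i<n. \<Phi> (t (Suc i)) - \<Phi> (t i))"
    by (intro ennreal_leI sum_mono step mt)
   also have "(\<Sum>i<n. \<Phi> (t (Suc i)) - \<Phi> (t i)) = \<Phi> (t n) - \<Phi> (t 0)"
    by (rule sum_lessThan_telescope)
   also have "\<Phi> (t n) - \<Phi> (t 0) \<le> 2 * c" using c by (auto simp: \<Phi>_def)
   finally show "(\<Sum>i<n. ennreal \<bar>u (t (Suc i)) - u (t i)\<bar>) \<le> ennreal (2 * c)"
    by (simp add: ennreal_leI)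
  qed
  \<comment> \<open>The partition -K, 0, K sees both jumps, since \<open>u\<close> is 0 at the end
    points.\<close>
  define t where "t i = (if i = 0 then - K else if i = 1 then 0 else K)" for i :: nat
  have "mono t" using K by (auto simp: mono_def t_def)
  have "ennreal (2 * c) = (\<Sum>i<2. ennreal \<bar>u (t (Suc i)) - u (t i)\<bar>)"
   using K c by (simp add: numeral_2_eq_2 u_def t_def ennreal_plus[symmetric] del: ennreal_plus)
  also have "\<dots> \<le> total_variation u"
   unfolding total_variation_def using \<open>mono t\<close> by (intro SUP_upper2[of t] SUP_upper2[of 2]) auto
  finally show "ennreal (2 * c) \<le> total_variation u" .
 qed
 moreover have "2 * c = m" unfolding m1 c_def by (simp add: powr_diff powr_divide)
 ultimately have "fisher p \<beta> g = epowr (ennreal m / ennreal \<bar>\<beta>\<bar>) (1 / \<beta>)"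
  using True unfolding fisher_def u by simp
 also have "ennreal m / ennreal \<bar>\<beta>\<bar> = ennreal (m / \<bar>\<beta>\<bar>)" using m_pos beta by (intro divide_ennreal) auto
 finally show ?thesis using m_pos beta unfolding sig1 by (simp add: epowr_ennreal)
next
 case False
 have p1: "1 < p" using p False by simp
 define q where "q = p / (p - 1)"
 have q: "1 < q" "(q - 1) * p = q" "0 < q" using p1 by (auto simp: q_def field_simps)
 define C where "C = (1 / (LINT t|lborel. stretched_profile p l t)) powr (l - 1)"
 have C: "0 < C" using profile_integral_pos[OF range] by (simp add: C_def)
 obtain \<mu> where \<mu>: "0 < \<mu>" "has_bochner_integral lborel (\<lambda>x. stretched_gaussian p l x * \<bar>x\<bar> powr q) \<mu>"
  "sigma (hconj p) (stretched_gaussian p l) = ennreal (\<mu> powr (1 / q))"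
  using gaussian_powr_moment[OF range _ False q_def q(3)] p1 by (metis not_one_less_zero)
 have sig: "sig = \<mu> powr (1 / q)" using \<mu> by (simp add: sig_def gaussian_sigma_def)
 have mass: "m = l * (C * q) * \<mu>"
  unfolding m_def C_def by (rule gaussian_mass_moment[OF p range False q_def \<mu>(2)])
 have [measurable]: "g \<in> borelfun" by (rule g_meas')
 interpret coordinate "- \<rho>" \<rho> wY Y by (rule coordinate_Y)
 define K0 where "K0 = C * q / \<bar>\<theta>\<bar>"
 define K where "K = K0 powr p"
 have Kpos: "0 < K0" using C q theta(2) by (simp add: K0_def)
 have dg: "deriv g (Y x) = - (1 / \<theta>) * sgn x * gaussian_slope p l x * G x powr (2 / \<theta> - l)" if "x \<in> S" for x
  using g_has_derivative[OF that] by (rule DERIV_imp_deriv)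
 have gm: "(\<lambda>v. indicator (support g) v * deriv g v) \<in> borelfun" proof -
  obtain c d where cd: "support g = ivl c d" using support_g_einterval' by auto
  show ?thesis unfolding cd
  proof (rule borel_measurable_deriv_einterval(2)[of _ _ g])
   fix v assume "v \<in> ivl c d"
   then obtain x where "x \<in> S" "v = Y x" using cd support_g by auto
   then show "(g has_real_derivative deriv g v) (at v)" using g_has_derivative[of x] dg[of x] by simp
  qed
 qed
 define \<phi> where "\<phi> v = ennreal (\<bar>g v powr (\<beta> - 2) * (indicator (support g) v * deriv g v)\<bar> powr p * g v)" for v
 have [measurable]: "\<phi> \<in> borelfun" unfolding \<phi>_def using gm by measurable
 have "(NN v:support g. ennreal (\<bar>g v powr (\<beta> - 2) * deriv g v\<bar> powr p * g v)) = (NN v:support g. \<phi> v)"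
  by (intro nn_integral_cong) (auto simp: \<phi>_def indicator_def)
 also have "\<dots> = (NN x:S. \<phi> (Y x) * ennreal (G x powr (1 - 1 / \<theta>)))"
  by (rule g_pushforward) measurable
 also have "\<dots> = (NN x. ennreal (K * (G x * \<bar>x\<bar> powr q)))"
 proof (intro nn_integral_cong)
  fix x
  show "\<phi> (Y x) * ennreal (G x powr (1 - 1 / \<theta>)) * indicator S x = ennreal (K * (G x * \<bar>x\<bar> powr q))"
  proof (cases "x \<in> S")
   case True
   have Gx: "0 < G x" by (rule G_pos[OF True])
   have "(1 / \<theta>) * (\<beta> - 2) + (2 / \<theta> - l) = 0" using theta l by (simp add: field_simps)
   then have "G x powr ((1 / \<theta>) * (\<beta> - 2)) * G x powr (2 / \<theta> - l) = 1"
    using Gx by (simp flip: powr_add)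
   then have "\<bar>g (Y x) powr (\<beta> - 2) * deriv g (Y x)\<bar> = gaussian_slope p l x * \<bar>sgn x\<bar> / \<bar>\<theta>\<bar>"
    using gaussian_slope_nonneg[OF p range, of x] unfolding g_Y[OF True] powr_powr dg[OF True]
    by (simp add: abs_mult abs_divide field_simps)
   also have "\<dots> = K0 * \<bar>x\<bar> powr (q - 1)"
    using False q by (cases "x = 0") (simp_all add: gaussian_slope_def C_def q_def abs_sgn_eq K0_def)
   finally have "\<bar>g (Y x) powr (\<beta> - 2) * deriv g (Y x)\<bar> powr p = K * \<bar>x\<bar> powr q"
    using Kpos q by (simp add: powr_mult powr_powr K_def)
   moreover have "G x powr (1 / \<theta>) * G x powr (1 - 1 / \<theta>) = G x" using Gx by (simp flip: powr_add)
   moreover have "Y x \<in> support g" using True support_g by simp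
   ultimately have "\<phi> (Y x) * ennreal (G x powr (1 - 1 / \<theta>)) = ennreal (K * \<bar>x\<bar> powr q * G x)"
    unfolding \<phi>_def by (simp add: ennreal_mult''[symmetric] g_Y[OF True] mult.assoc)
   then show ?thesis using True by (simp add: mult_ac)
  next
   case False
   then show ?thesis by (simp add: G_off)
  qed
 qed
 also have "\<dots> = ennreal (K * \<mu>)" using \<mu>(2) G_nonneg
  by (subst nn_integral_eq_integral) (auto simp: has_bochner_integral_iff G_def K_def)
 finally have "fisher p \<beta> g = epowr (ennreal (K * \<mu>)) (1 / (p * \<beta>))"
  using False by (simp add: fisher_def)
 also have "\<dots> = ennreal ((K * \<mu>) powr (1 / (p * \<beta>)))"
  using \<mu> Kpos by (intro epowr_ennreal) (simp add: K_def)
 also have "(K * \<mu>) powr (1 / (p * \<beta>)) = ((K * \<mu>) powr (1 / p)) powr (1 / \<beta>)"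
  by (simp add: powr_powr)
 \<comment> \<open>Here 1/p = 1 - 1/q splits the power of \<mu> into the factor \<mu> of
   \<open>m\<close> and the factor \<mu>^(1/q) = \<open>sig\<close>.\<close>
 also have "(K * \<mu>) powr (1 / p) = m / (\<bar>\<beta>\<bar> * sig)" proof -
  have "1 / p = 1 - 1 / q" using p1 by (simp add: q_def field_simps)
  then have "\<mu> powr (1 / p) = \<mu> / \<mu> powr (1 / q)" using \<mu> by (simp add: powr_diff)
  moreover have "K powr (1 / p) = K0" using Kpos p1 by (simp add: K_def powr_powr)
  moreover have "\<bar>\<beta>\<bar> = l * \<bar>\<theta>\<bar>" using beta(1) l_pos by (simp add: abs_mult)
  ultimately have "(K * \<mu>) powr (1 / p) = K0 * (\<mu> / \<mu> powr (1 / q))" "\<bar>\<beta>\<bar> = l * \<bar>\<theta>\<bar>"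
   using \<mu>(1) Kpos by (simp_all add: powr_mult K_def)
  then show ?thesis using \<mu>(1) l_pos theta(2) unfolding mass sig K0_def by (simp add: divide_simps)
 qed
 finally show ?thesis .
qed

end

lemma g_meas [measurable]: "g \<in> borelfun"
 using S_einterval g_meas' by metis

lemma g_nonneg: "0 \<le> g v"
 using S_einterval g_nonneg' by metis

lemma g_integral: "(NN v. ennreal (g v)) = 1"
 using S_einterval g_powr_integral'(2) by metis

lemma g_support_einterval: obtains c d where "c < d" "support g = ivl c d"
 using S_einterval support_g_einterval' by metis

lemma epowr_K1:
 assumes \<alpha>: "0 < \<alpha>"
 shows "epowr (K1 p \<beta> lam) (1 / \<alpha>) = ennreal (((m / (\<bar>\<beta>\<bar> * sig)) powr (1 / l) * m powr (1 / (1 - l))) powr (1 / \<alpha>))"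
proof -
 have f: "fisher p \<beta> g = ennreal ((m / (\<bar>\<beta>\<bar> * sig)) powr (1 / \<beta>))"
  using S_einterval fisher_g' by metis
 have "(NN v:support g. ennreal (g v powr lam)) = ennreal m" using S_einterval g_powr_integral'(1) by metis
 then have r: "renyi_power lam g = ennreal (m powr (1 / (1 - lam)))"
  using beta(5) m_pos by (simp add: renyi_power_def epowr_ennreal)
 define u where "u = m / (\<bar>\<beta>\<bar> * sig)"
 have u: "0 < u" using m_pos sig_pos beta by (simp add: u_def)
 have "K1 p \<beta> lam = ennreal ((u powr (1 / \<beta>) * m powr (1 / (1 - lam))) powr \<theta>)"
  unfolding K1_def g_def[symmetric] f r theta(1)[symmetric] u_def[symmetric]
  using u m_pos by (simp add: ennreal_mult[symmetric] epowr_ennreal)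
 also have "(u powr (1 / \<beta>) * m powr (1 / (1 - lam))) powr \<theta> = u powr (1 / l) * m powr (1 / (1 - l))"
 proof -
  have "1 / \<beta> * \<theta> = 1 / l" using l theta by simp
  moreover have "1 / (1 - lam) * \<theta> = 1 / (1 - l)" unfolding beta(4) using theta by simp
  ultimately show ?thesis using u m_pos by (simp add: powr_mult powr_powr)
 qed
 finally show ?thesis using u m_pos unfolding u_def[symmetric] by (simp add: epowr_ennreal)
qed

end

section \<open>The Stam inequality\<close>

lemma abs_cont_on_Icc_pair:
 assumes "abs_cont_on_Icc c d u" "0 < e"
 obtains \<delta> where "0 < \<delta>" "\<And>s t. c \<le> s \<Longrightarrow> s \<le> t \<Longrightarrow> t \<le> d \<Longrightarrow> t - s < \<delta> \<Longrightarrow> \<bar>u t - u s\<bar> < e"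
proof -
 obtain \<delta> where \<delta>: "0 < \<delta>" "\<And>D :: (real \<times> real) set. finite D \<and> (\<forall>(s, t)\<in>D. c \<le> s \<and> s \<le> t \<and> t \<le> d) \<and>
    pairwise (\<lambda>I J. {fst I<..<snd I} \<inter> {fst J<..<snd J} = {}) D \<and>
    (\<Sum>(s, t)\<in>D. t - s) < \<delta> \<Longrightarrow> (\<Sum>(s, t)\<in>D. \<bar>u t - u s\<bar>) < e"
  using assms unfolding abs_cont_on_Icc_def by blast
 show thesis
 proof (rule that[OF \<delta>(1)])
  fix s t assume "c \<le> s" "s \<le> t" "t \<le> d" "t - s < \<delta>"
  then show "\<bar>u t - u s\<bar> < e" using \<delta>(2)[of "{(s, t)}"] by simp
 qed
qed

lemma loc_abs_cont_continuous:
 assumes "loc_abs_cont UNIV u"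
 shows "continuous_on UNIV u"
 unfolding continuous_on_iff
proof (intro ballI allI impI)
 fix v e :: real assume "0 < e"
 have "abs_cont_on_Icc (v - 1) (v + 1) u" using assms by (simp add: loc_abs_cont_def)
 then obtain \<delta> where \<delta>: "0 < \<delta>" "\<And>s t. v - 1 \<le> s \<Longrightarrow> s \<le> t \<Longrightarrow> t \<le> v + 1 \<Longrightarrow> t - s < \<delta> \<Longrightarrow> \<bar>u t - u s\<bar> < e"
  using abs_cont_on_Icc_pair[OF _ \<open>0 < e\<close>] by metis
 show "\<exists>d>0. \<forall>v'\<in>UNIV. dist v' v < d \<longrightarrow> dist (u v') (u v) < e"
 proof (intro exI[of _ "min 1 \<delta>"] conjI ballI impI)
  fix v' assume "dist v' v < min 1 \<delta>"
  then show "dist (u v') (u v) < e"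
   using \<delta>(2)[of v v'] \<delta>(2)[of v' v] by (cases "v \<le> v'") (auto simp: dist_real_def abs_minus_commute)
 qed (use \<delta> in simp)
qed

text \<open>If \<open>y\<close> stays bounded towards an end, its image has a finite end point
  there, which does not belong to the open image. So \<open>r\<close> is 0 at it and, by continuity,
  small at nearby values of \<open>y\<close>.\<close>

lemma (in coordinate) vanishing_at_ends:
 fixes r :: "real \<Rightarrow> real"
 assumes cont: "continuous_on UNIV r" and off: "\<And>v. v \<notin> y ` ivl a b \<Longrightarrow> r v = 0"
  and e: "0 < e" and x: "x \<in> ivl a b"
 shows "(\<And>t. t \<in> ivl a b \<Longrightarrow> x < t \<Longrightarrow> y t \<le> B) \<Longrightarrow> \<exists>t\<in>ivl a b. x < t \<and> \<bar>r (y t)\<bar> < e"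
  and "(\<And>t. t \<in> ivl a b \<Longrightarrow> t < x \<Longrightarrow> B \<le> y t) \<Longrightarrow> \<exists>t\<in>ivl a b. t < x \<and> \<bar>r (y t)\<bar> < e"
proof -
 define J where "J = y ` ivl a b"
 have J: "open J" "y x \<in> J" using open_image x by (auto simp: J_def)
 have near: "\<exists>d>0. \<forall>v'. \<bar>v' - v\<bar> < d \<longrightarrow> \<bar>r v'\<bar> < e" if "v \<notin> J" for v
 proof -
  have "r v = 0" using off that by (simp add: J_def)
  moreover obtain d where "0 < d" "\<And>v'. dist v' v < d \<Longrightarrow> dist (r v') (r v) < e"
   using cont e unfolding continuous_on_iff by (meson UNIV_I)
  ultimately show ?thesis by (intro exI[of _ d]) (auto simp: dist_real_def)
 qed
 show "\<exists>t\<in>ivl a b. x < t \<and> \<bar>r (y t)\<bar> < e" if B: "\<And>t. t \<in> ivl a b \<Longrightarrow> x < t \<Longrightarrow> y t \<le> B"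
 proof -
  have le: "z \<le> max B (y x)" if "z \<in> J" for z proof -
   obtain t where t: "t \<in> ivl a b" "z = y t" using \<open>z \<in> J\<close> unfolding J_def by (rule imageE)
   then show ?thesis using B[of t] mono(1)[OF t(1) x] by (cases "x < t") auto
  qed
  then have bdd: "bdd_above J" by (rule bdd_aboveI)
  define s where "s = Sup J"
  have s: "z \<le> s" if "z \<in> J" for z unfolding s_def using that bdd by (rule cSup_upper)
  have "s \<notin> J"
  proof
   assume "s \<in> J"
   then obtain d where "0 < d" "ball s d \<subseteq> J" using J(1) by (meson open_contains_ball)
   then have "s + d / 2 \<in> J" by (auto simp: subset_iff dist_real_def)
   then show False using s[of "s + d / 2"] \<open>0 < d\<close> by simp
  qed
  then obtain d where d: "0 < d" "\<And>v'. \<bar>v' - s\<bar> < d \<Longrightarrow> \<bar>r v'\<bar> < e" using near by blast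
  have "y x < s" using s[OF J(2)] \<open>s \<notin> J\<close> J(2) by (metis less_le)
  then have "max (y x) (s - d) < s" using d by simp
  then obtain z where z: "z \<in> J" "max (y x) (s - d) < z" unfolding s_def using J(2) less_cSup_iff[OF _ bdd] by blast
  then obtain t where t: "t \<in> ivl a b" "z = y t" by (auto simp: J_def)
  have "x < t" using z t mono(2)[OF x t(1)] by simp
  moreover have "\<bar>r (y t)\<bar> < e" using d(2)[of z] z s[OF z(1)] t by auto
  ultimately show ?thesis using t by blast
 qed
 show "\<exists>t\<in>ivl a b. t < x \<and> \<bar>r (y t)\<bar> < e" if B: "\<And>t. t \<in> ivl a b \<Longrightarrow> t < x \<Longrightarrow> B \<le> y t"
 proof -
  have le: "min B (y x) \<le> z" if "z \<in> J" for z proof -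
   obtain t where t: "t \<in> ivl a b" "z = y t" using \<open>z \<in> J\<close> unfolding J_def by (rule imageE)
   then show ?thesis using B[of t] mono(1)[OF x t(1)] by (cases "t < x") auto
  qed
  then have bdd: "bdd_below J" by (rule bdd_belowI)
  define s where "s = Inf J"
  have s: "s \<le> z" if "z \<in> J" for z unfolding s_def using that bdd by (rule cInf_lower)
  have "s \<notin> J"
  proof
   assume "s \<in> J"
   then obtain d where "0 < d" "ball s d \<subseteq> J" using J(1) by (meson open_contains_ball)
   then have "s - d / 2 \<in> J" by (auto simp: subset_iff dist_real_def)
   then show False using s[of "s - d / 2"] \<open>0 < d\<close> by simp
  qed
  then obtain d where d: "0 < d" "\<And>v'. \<bar>v' - s\<bar> < d \<Longrightarrow> \<bar>r v'\<bar> < e" using near by blast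
  have "s < y x" using s[OF J(2)] \<open>s \<notin> J\<close> J(2) by (metis less_le)
  then have "s < min (y x) (s + d)" using d by simp
  then obtain z where z: "z \<in> J" "z < min (y x) (s + d)" unfolding s_def using J(2) cInf_less_iff[OF _ bdd] by blast
  then obtain t where t: "t \<in> ivl a b" "z = y t" by (auto simp: J_def)
  have "t < x" using z t mono(2)[OF t(1) x] by simp
  moreover have "\<bar>r (y t)\<bar> < e" using d(2)[of z] z s[OF z(1)] t by auto
  ultimately show ?thesis using t by blast
 qed
qed

section \<open>The function \<open>k\<close> and its boundary behaviour\<close>

locale stam_setting = stam_params +
 fixes a b :: ereal and \<alpha> :: real and f h :: "real \<Rightarrow> real"
 assumes ab: "a < b" and f: "prob_density_on (ivl a b) f" and h: "prob_density_on (ivl a b) h"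
  and f_diff: "f differentiable_on ivl a b" and h_diff: "h differentiable_on ivl a b"
  and \<alpha>: "0 < \<alpha>"
begin

text \<open>The power \<beta> of the transformed density R = (f/h)^\<alpha>, seen in the variable
  \<open>x\<close>.\<close>

definition "k x = (f x / h x) powr (\<alpha> * \<beta>)"
definition "dL x = deriv (\<lambda>t. ln (f t / h t)) x"
definition "dk x = \<alpha> * \<beta> * k x * dL x"
definition "F = rel_fisher_div p (\<beta> * \<alpha>) (ivl a b) f h"
definition "I = renyi_integral (rel_order lam \<alpha>) (ivl a b) f h"

lemmas f_meas [measurable] = prob_density_onD(1)[OF f] and h_meas [measurable] = prob_density_onD(1)[OF h]
lemmas fpos = prob_density_onD(3)[OF f] and hpos = prob_density_onD(3)[OF h]

lemma f_cont: "continuous_on (ivl a b) f" and h_cont: "continuous_on (ivl a b) h"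
 using f_diff h_diff differentiable_imp_continuous_on by auto

lemma kpos: "x \<in> ivl a b \<Longrightarrow> 0 < k x"
 using fpos[of x] hpos[of x] by (simp add: k_def)

lemma has_deriv: 
 assumes x: "x \<in> ivl a b"
 shows "((\<lambda>t. ln (f t / h t)) has_real_derivative dL x) (at x)" "(k has_real_derivative dk x) (at x)"
proof -
 have "f differentiable at x" "h differentiable at x"
  using f_diff h_diff x by (auto simp: differentiable_on_eq_differentiable_at)
 then obtain f' h' where "(f has_real_derivative f') (at x)" "(h has_real_derivative h') (at x)"
  by (metis real_differentiable_def)
 then have "((\<lambda>t. f t / h t) has_real_derivative (f' * h x - f x * h') / (h x * h x)) (at x)"
  using hpos[OF x] by (intro DERIV_divide) auto
 then have "((\<lambda>t. ln (f t / h t)) has_real_derivative (1 / (f x / h x)) * ((f' * h x - f x * h') / (h x * h x))) (at x)"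
  using fpos[OF x] hpos[OF x] by (intro DERIV_chain2[OF DERIV_ln_divide]) auto
 then show L: "((\<lambda>t. ln (f t / h t)) has_real_derivative dL x) (at x)"
  unfolding dL_def by (metis DERIV_imp_deriv)
 have "((\<lambda>t. exp (\<alpha> * \<beta> * ln (f t / h t))) has_real_derivative exp (\<alpha> * \<beta> * ln (f x / h x)) * (\<alpha> * \<beta> * dL x)) (at x)"
  by (intro DERIV_chain2[OF DERIV_exp] DERIV_cmult L)
 then have "(k has_real_derivative exp (\<alpha> * \<beta> * ln (f x / h x)) * (\<alpha> * \<beta> * dL x)) (at x)"
 proof (rule has_field_derivative_transform_within_open[OF _ open_einterval x])
  fix t assume t: "t \<in> ivl a b"
  show "exp (\<alpha> * \<beta> * ln (f t / h t)) = k t" using fpos[OF t] hpos[OF t] by (simp add: k_def powr_def)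
 qed
 moreover have "exp (\<alpha> * \<beta> * ln (f x / h x)) = k x" using fpos[OF x] hpos[OF x] by (simp add: k_def powr_def)
 ultimately show "(k has_real_derivative dk x) (at x)" by (simp add: dk_def mult_ac)
qed

lemmas k_der_meas = borel_measurable_deriv_einterval[OF has_deriv(2)]

text \<open>The exponents meet because \<beta> (1 - 1/l) = \<beta> - \<theta> = \<lambda> - 1. The
  first part is the integrand of the Renyi integral, the second expresses y' through
  \<open>f\<close> and \<open>k\<close>, the third is R^\<theta>.\<close>

lemma k_powr:
 assumes x: "x \<in> ivl a b"
 shows "k x powr (1 - 1 / l) * f x = f x powr rel_order lam \<alpha> * h x powr (1 - rel_order lam \<alpha>)"
  "f x powr (1 - \<alpha>) * h x powr \<alpha> = f x * k x powr (- (1 / \<beta>))"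
  "((f x / h x) powr \<alpha>) powr \<theta> = k x powr (1 / l)" proof -
 have f0: "0 < f x" and h0: "0 < h x" using fpos[OF x] hpos[OF x] .
 have e: "\<alpha> * \<beta> * (1 - 1 / l) = \<alpha> * (lam - 1)" proof -
  have "\<beta> * (1 - 1 / l) = \<beta> - \<theta>" using beta(1) l_pos by (simp add: right_diff_distrib)
  also have "\<dots> = lam - 1" using theta(1) by simp
  finally show ?thesis by (simp only: mult.assoc)
 qed
 have fh: "(f x / h x) powr e = f x powr e * h x powr (- e)" for e
  using f0 h0 by (subst powr_divide) (simp_all add: powr_minus divide_inverse)
 have "k x powr (1 - 1 / l) * f x = f x powr (\<alpha> * (lam - 1)) * f x powr 1 * h x powr (- (\<alpha> * (lam - 1)))"
  unfolding k_def powr_powr e unfolding fh using f0 by simp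
 also have "\<dots> = f x powr rel_order lam \<alpha> * h x powr (1 - rel_order lam \<alpha>)"
  unfolding powr_add[symmetric] rel_order_def by (simp add: add.commute)
 finally show "k x powr (1 - 1 / l) * f x = f x powr rel_order lam \<alpha> * h x powr (1 - rel_order lam \<alpha>)" .
 have "\<alpha> * \<beta> * - (1 / \<beta>) = - \<alpha>" using beta by simp
 then have "f x * k x powr (- (1 / \<beta>)) = f x powr 1 * (f x powr (- \<alpha>) * h x powr (- (- \<alpha>)))"
  unfolding k_def powr_powr fh[symmetric] using f0 by simp
 also have "\<dots> = f x powr (1 - \<alpha>) * h x powr \<alpha>" unfolding mult.assoc[symmetric] powr_add[symmetric] by simp
 finally show "f x powr (1 - \<alpha>) * h x powr \<alpha> = f x * k x powr (- (1 / \<beta>))" by simp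
 have "\<alpha> * \<beta> * (1 / l) = \<alpha> * \<theta>" using beta(1) l_pos by simp
 then show "((f x / h x) powr \<alpha>) powr \<theta> = k x powr (1 / l)" unfolding k_def powr_powr by simp
qed

lemma I_eq: "I = (NN x:ivl a b. ennreal (k x powr (1 - 1 / l) * f x))"
 unfolding I_def renyi_integral_def by (intro nn_integral_cong) (auto simp: indicator_def k_powr(1))

text \<open>The factor comes from k' = \<alpha> \<beta> k (log (f/h))' and is the origin of the
  power of \<alpha> in (ii). On the left the divergence is a p-th moment of |k'| / f with respect to
  f dx, ready for Hoelder's inequality.\<close>

lemma F_eq: "(NN x:ivl a b. ennreal ((\<bar>dk x\<bar> / f x) powr p * f x)) = ennreal ((\<alpha> * \<bar>\<beta>\<bar>) powr p) * F"
proof -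
 define \<phi> where "\<phi> x = f x powr (1 + p * (\<beta> * \<alpha> - 1)) * h x powr (- (\<beta> * \<alpha>) * p) * \<bar>dL x\<bar> powr p" for x
 have eq: "(\<bar>dk x\<bar> / f x) powr p * f x = (\<alpha> * \<bar>\<beta>\<bar>) powr p * \<phi> x" if x: "x \<in> ivl a b" for x
 proof -
  have f0: "0 < f x" and h0: "0 < h x" using fpos[OF x] hpos[OF x] .
  have fh: "(f x / h x) powr e = f x powr e * h x powr (- e)" for e
   using f0 h0 by (subst powr_divide) (simp_all add: powr_minus divide_inverse)
  have dkf: "\<bar>dk x\<bar> / f x = (\<alpha> * \<bar>\<beta>\<bar>) * (k x * f x powr (- 1)) * \<bar>dL x\<bar>"
   using \<alpha> kpos[OF x] f0 by (simp add: dk_def abs_mult powr_minus field_simps)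
  have "(\<bar>dk x\<bar> / f x) powr p = (\<alpha> * \<bar>\<beta>\<bar>) powr p * (k x powr p * f x powr (- p)) * \<bar>dL x\<bar> powr p"
   unfolding dkf powr_mult powr_powr by simp
  moreover have "k x powr p * f x powr (- p) * f x = f x powr (1 + p * (\<beta> * \<alpha> - 1)) * h x powr (- (\<beta> * \<alpha>) * p)"
  proof -
   have "k x powr p * f x powr (- p) * f x = f x powr (\<alpha> * \<beta> * p) * f x powr (- p) * f x powr 1 * h x powr (- (\<alpha> * \<beta> * p))"
    unfolding k_def powr_powr unfolding fh using f0 by simp
   also have "\<dots> = f x powr (\<alpha> * \<beta> * p + - p + 1) * h x powr (- (\<alpha> * \<beta> * p))" by (simp only: powr_add)
   also have "\<alpha> * \<beta> * p + - p + 1 = 1 + p * (\<beta> * \<alpha> - 1)" by (simp add: algebra_simps)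
   also have "- (\<alpha> * \<beta> * p) = - (\<beta> * \<alpha>) * p" by (simp add: algebra_simps)
   finally show ?thesis .
  qed
  ultimately show ?thesis unfolding \<phi>_def by (metis mult.assoc mult.commute)
 qed
 have m: "(\<lambda>x. indicator (ivl a b) x * dL x) \<in> borelfun"
  by (rule borel_measurable_deriv_einterval(2)[OF has_deriv(1)])
 have F: "F = (NN x:ivl a b. ennreal (\<phi> x))" unfolding F_def rel_fisher_div_def \<phi>_def dL_def ..
 have "(NN x:ivl a b. ennreal ((\<bar>dk x\<bar> / f x) powr p * f x)) =
  (NN x. ennreal ((\<alpha> * \<bar>\<beta>\<bar>) powr p) * (ennreal (\<phi> x) * indicator (ivl a b) x))"
 proof (intro nn_integral_cong)
  fix x
  show "ennreal ((\<bar>dk x\<bar> / f x) powr p * f x) * indicator (ivl a b) x = ennreal ((\<alpha> * \<bar>\<beta>\<bar>) powr p) * (ennreal (\<phi> x) * indicator (ivl a b) x)"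
  proof (cases "x \<in> ivl a b")
   case True
   have "ennreal ((\<alpha> * \<bar>\<beta>\<bar>) powr p * \<phi> x) = ennreal ((\<alpha> * \<bar>\<beta>\<bar>) powr p) * ennreal (\<phi> x)"
    by (rule ennreal_mult') simp
   then show ?thesis unfolding eq[OF True] using True by simp
  qed simp
 qed
 also have "\<dots> = ennreal ((\<alpha> * \<bar>\<beta>\<bar>) powr p) * F" unfolding F
 proof (rule nn_integral_cmult)
  have "(\<lambda>x. ennreal (f x powr (1 + p * (\<beta> * \<alpha> - 1)) * h x powr (- (\<beta> * \<alpha>) * p) * \<bar>indicator (ivl a b) x * dL x\<bar> powr p) * indicator (ivl a b) x) \<in> borelfun"
   using m by measurable
  also have "(\<lambda>x. ennreal (f x powr (1 + p * (\<beta> * \<alpha> - 1)) * h x powr (- (\<beta> * \<alpha>) * p) * \<bar>indicator (ivl a b) x * dL x\<bar> powr p) * indicator (ivl a b) x)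
    = (\<lambda>x. ennreal (\<phi> x) * indicator (ivl a b) x)" by (auto simp: \<phi>_def indicator_def)
  finally show "\<dots> \<in> borel_measurable lborel" by simp
 qed
 finally show ?thesis .
qed

text \<open>From z \<le> 1 + z^p with z = |k'| / f, integrated against the probability measure f
  dx.\<close>

lemma dk_integrable:
 assumes "F < \<infinity>"
 shows "(NN x:ivl a b. ennreal \<bar>dk x\<bar>) < \<infinity>"
proof -
 define d where "d x = indicator (ivl a b) x * dk x" for x
 have [measurable]: "d \<in> borelfun" using k_der_meas(2) unfolding d_def[abs_def] .
 have le: "\<bar>dk x\<bar> \<le> f x + (\<bar>dk x\<bar> / f x) powr p * f x" if x: "x \<in> ivl a b" for x proof -
  have f0: "0 < f x" using fpos[OF x] .
  have "z \<le> 1 + z powr p" if "0 \<le> z" for z :: real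
  proof (cases "z \<le> 1")
   case True
   then show ?thesis using powr_ge_zero[of z p] by linarith
  next
   case False
   then have "z powr 1 \<le> z powr p" using p by (intro powr_mono) auto
   then show ?thesis using False by simp
  qed
  from this[of "\<bar>dk x\<bar> / f x"] have "\<bar>dk x\<bar> / f x * f x \<le> (1 + (\<bar>dk x\<bar> / f x) powr p) * f x"
   using f0 by (intro mult_right_mono) auto
  then show ?thesis using f0 by (simp add: algebra_simps)
 qed
 have "(NN x:ivl a b. ennreal \<bar>dk x\<bar>) \<le> (NN x. ennreal (f x) * indicator (ivl a b) x + ennreal ((\<bar>d x\<bar> / f x) powr p * f x) * indicator (ivl a b) x)"
 proof (intro nn_integral_mono)
  fix x
  show "ennreal \<bar>dk x\<bar> * indicator (ivl a b) x \<le> ennreal (f x) * indicator (ivl a b) x + ennreal ((\<bar>d x\<bar> / f x) powr p * f x) * indicator (ivl a b) x"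
  proof (cases "x \<in> ivl a b")
   case True
   then show ?thesis using le[OF True] fpos[OF True]
    by (simp add: d_def ennreal_leI ennreal_plus[symmetric] del: ennreal_plus)
  qed simp
 qed
 also have "\<dots> = 1 + (NN x:ivl a b. ennreal ((\<bar>d x\<bar> / f x) powr p * f x))"
  by (subst nn_integral_add) (simp_all add: prob_density_onD(4)[OF f])
 also have "(NN x:ivl a b. ennreal ((\<bar>d x\<bar> / f x) powr p * f x)) = ennreal ((\<alpha> * \<bar>\<beta>\<bar>) powr p) * F"
  unfolding F_eq[symmetric] by (intro nn_integral_cong) (auto simp: d_def indicator_def)
 also have "1 + \<dots> < \<infinity>" using assms by (simp add: ennreal_mult_less_top)
 finally show ?thesis .
qed

text \<open>If \<open>k\<close> stayed above \<open>e\<close> towards an end, it would also be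
  bounded, its variation being finite. Then y' = f k^(-1/\<beta>) is at most a multiple of
  \<open>f\<close>, so \<open>y\<close> stays bounded and its range has a finite end point there.
  Near that point R^\<theta> = k^(1/l) has to become small, a contradiction. This covers bounded and
  unbounded ranges at once.\<close>

lemma k_small:
 assumes y: "escort_coord \<alpha> (ivl a b) f h y"
  and reg: "stam_regular \<theta> (y ` ivl a b) (rel_escort \<alpha> (ivl a b) f h y)"
  and fin: "(NN x:ivl a b. ennreal \<bar>dk x\<bar>) < \<infinity>"
  and e: "0 < e" and x: "x \<in> ivl a b"
 shows "\<exists>t\<in>ivl a b. x < t \<and> k t < e" "\<exists>t\<in>ivl a b. t < x \<and> k t < e"
proof -
 interpret coordinate a b "\<lambda>x. f x powr (1 - \<alpha>) * h x powr \<alpha>" y by (rule escort_coordinate[OF ab f h y])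
 define R where "R = rel_escort \<alpha> (ivl a b) f h y"
 define J where "J = y ` ivl a b"
 define r where "r v = (if v \<in> J then R v powr \<theta> else 0)" for v
 have R0: "R v = 0" if "v \<notin> J" for v using that by (simp add: R_def rel_escort_def J_def)
 have Rnn: "0 \<le> R v" for v by (simp add: R_def rel_escort_def)
 \<comment> \<open>For either sign of \<theta> the regularity condition amounts here to continuity
   on the whole line of R^\<theta>, set to 0 outside \<open>J\<close>.\<close>
 have cont: "continuous_on UNIV r"
 proof (cases "0 < \<theta>")
  case True
  then have "loc_abs_cont UNIV R" using reg by (simp add: stam_regular_def R_def)
  then have "continuous_on UNIV R" by (rule loc_abs_cont_continuous)
  then have "continuous_on UNIV (\<lambda>v. R v powr \<theta>)"
   using True Rnn by (intro continuous_on_powr' continuous_intros) auto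
  moreover have "(\<lambda>v. R v powr \<theta>) = r" using R0 True by (auto simp: r_def)
  ultimately show ?thesis by metis
 next
  case False
  then show ?thesis using reg unfolding stam_regular_def r_def[abs_def] unfolding R_def J_def by metis
 qed
 have ry: "r (y t) = k t powr (1 / l)" if t: "t \<in> ivl a b" for t proof -
  have "r (y t) = ((f t / h t) powr \<alpha>) powr \<theta>"
   using t by (simp add: r_def J_def R_def rel_escort_def inv_image)
  then show ?thesis using k_powr(3)[OF t] by simp
 qed
 define e' where "e' = e powr (1 / l)"
 have e': "0 < e'" using e by (simp add: e'_def)
 have small: "k t < e" if "t \<in> ivl a b" "\<bar>r (y t)\<bar> < e'" for t
 proof (rule ccontr)
  assume "\<not> k t < e"
  then have "e' \<le> k t powr (1 / l)" unfolding e'_def using e l_pos by (intro powr_mono2) auto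
  then show False using that ry[OF that(1)] by simp
 qed
 obtain D where D: "(NN x:ivl a b. ennreal \<bar>dk x\<bar>) = ennreal D" "0 \<le> D"
  using fin by (cases "NN x:ivl a b. ennreal \<bar>dk x\<bar>") auto
 have kD: "\<bar>k t - k s\<bar> \<le> D" if st: "s \<in> ivl a b" "t \<in> ivl a b" "s \<le> t" for s t proof -
  have "ennreal \<bar>k t - k s\<bar> \<le> (NN x:{s..t}. ennreal \<bar>dk x\<bar>)"
   by (rule nn_integral_deriv_ge[OF has_deriv(2) st])
  also have "\<dots> \<le> (NN x:ivl a b. ennreal \<bar>dk x\<bar>)"
   using einterval_Icc_subset[OF st(1,2)] by (intro nn_integral_mono) (auto simp: indicator_def)
  finally show ?thesis using D by simp
 qed
 define U where "U = k x + D"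
 have U: "0 < U" using kpos[OF x] D by (simp add: U_def)
 \<comment> \<open>Bounds k^(-1/\<beta>) for \<open>k\<close> between \<open>e\<close> and
   \<open>U\<close>; the sign of \<beta> decides which of the two values counts.\<close>
 define C where "C = max (e powr (- (1 / \<beta>))) (U powr (- (1 / \<beta>)))"
 have C0: "0 < C" using e by (simp add: C_def less_max_iff_disj)
 have bound: "k t powr (- (1 / \<beta>)) \<le> C" if "e \<le> k t" "k t \<le> U" for t
 proof (cases "0 < \<beta>")
  case True
  then have "k t powr (- (1 / \<beta>)) \<le> e powr (- (1 / \<beta>))" using that e by (intro powr_mono2') auto
  then show ?thesis by (simp add: C_def)
 next
  case False
  then have "0 \<le> - (1 / \<beta>)" by (simp add: divide_nonneg_neg)
  then have "k t powr (- (1 / \<beta>)) \<le> U powr (- (1 / \<beta>))" using that e by (intro powr_mono2) auto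
  then show ?thesis by (simp add: C_def)
 qed
 have ybound: "y t - y s \<le> C" if st: "s \<in> ivl a b" "t \<in> ivl a b" "s \<le> t" and kb: "\<And>u. u \<in> {s<..<t} \<Longrightarrow> e \<le> k u \<and> k u \<le> U" for s t
 proof -
  note sub = einterval_Icc_subset[OF st(1,2)]
  have "ennreal (y t - y s) = (NN u:{s..t}. ennreal (f u powr (1 - \<alpha>) * h u powr \<alpha>))"
   using integral_eq[OF st] by simp
  also have "\<dots> \<le> (NN u. ennreal C * (ennreal (f u) * indicator (ivl a b) u))"
  proof (rule nn_integral_mono_AE)
   show "AE u in lborel. ennreal (f u powr (1 - \<alpha>) * h u powr \<alpha>) * indicator {s..t} u \<le> ennreal C * (ennreal (f u) * indicator (ivl a b) u)"
    using AE_lborel_singleton[of s] AE_lborel_singleton[of t]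
   proof eventually_elim
    case (elim u)
    show ?case
    proof (cases "u \<in> {s..t}")
     case True
     then have u: "u \<in> ivl a b" "u \<in> {s<..<t}" using sub elim by auto
     have "f u * k u powr (- (1 / \<beta>)) \<le> C * f u"
      using bound[of u] kb[OF u(2)] fpos[OF u(1)] by (simp add: mult.commute mult_right_mono)
     then show ?thesis using True u fpos[OF u(1)] C0
      by (simp add: k_powr(2)[OF u(1)] ennreal_mult[symmetric] ennreal_leI)
    qed simp
   qed
  qed
  also have "\<dots> = ennreal C" by (simp add: nn_integral_cmult prob_density_onD(4)[OF f])
  finally show ?thesis using C0 by (simp add: ennreal_le_iff)
 qed
 show "\<exists>t\<in>ivl a b. x < t \<and> k t < e"
 proof (rule ccontr)
  assume contr: "\<not> ?thesis"
  have "y t \<le> y x + C" if t: "t \<in> ivl a b" "x < t" for t proof -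
   have "e \<le> k u \<and> k u \<le> U" if "u \<in> {x<..<t}" for u proof -
    have "u \<in> ivl a b" using einterval_Icc_subset[OF x t(1)] that by auto
    then show ?thesis using contr kD[OF x, of u] that by (auto simp: U_def not_less)
   qed
   then show ?thesis using ybound[OF x t(1)] t by fastforce
  qed
  then obtain t where "t \<in> ivl a b" "x < t" "\<bar>r (y t)\<bar> < e'"
   using vanishing_at_ends(1)[OF cont _ e' x, of "y x + C"] by (auto simp: r_def J_def)
  then show False using contr small by blast
 qed
 show "\<exists>t\<in>ivl a b. t < x \<and> k t < e"
 proof (rule ccontr)
  assume contr: "\<not> ?thesis"
  have "y x - C \<le> y t" if t: "t \<in> ivl a b" "t < x" for t proof -
   have "e \<le> k u \<and> k u \<le> U" if "u \<in> {t<..<x}" for u proof -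
    have "u \<in> ivl a b" using einterval_Icc_subset[OF t(1) x] that by auto
    then show ?thesis using contr kD[OF _ x, of u] that by (auto simp: U_def not_less)
   qed
   then show ?thesis using ybound[OF t(1) x] t by fastforce
  qed
  then obtain t where "t \<in> ivl a b" "t < x" "\<bar>r (y t)\<bar> < e'"
   using vanishing_at_ends(2)[OF cont _ e' x, of "y x - C"] by (auto simp: r_def J_def)
  then show False using contr small by blast
 qed
qed

section \<open>Transport of \<open>f\<close> to the stretched Gaussian\<close>

lemma transport_G:
 obtains T where "coordinate a b (\<lambda>x. if x \<in> ivl a b then f x / G (T x) else 1) T" "T ` ivl a b = S"
proof -
 obtain \<rho> where \<rho>: "0 < \<rho>" "- \<rho> < \<rho>" "S = ivl (- \<rho>) \<rho>" "0 \<in> ivl (- \<rho>) \<rho>" using S_einterval .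
 show thesis by (rule transport[OF ab f_meas fpos prob_density_onD(4)[OF f] \<rho>(2) G_meas])
   (use that G_pos G_integral(2) \<rho> in auto)
qed

context
 fixes T :: "real \<Rightarrow> real"
 assumes T: "coordinate a b (\<lambda>x. if x \<in> ivl a b then f x / G (T x) else 1) T" and TS: "T ` ivl a b = S"
begin

lemma T_in_S: "x \<in> ivl a b \<Longrightarrow> T x \<in> S"
 using TS by auto

lemma T_pushforward:
 fixes \<phi> :: "real \<Rightarrow> ennreal"
 assumes "\<phi> \<in> borelfun"
 shows "(NN x:ivl a b. \<phi> (T x) * ennreal (f x)) = (NN v:S. \<phi> v * ennreal (G v))"
 unfolding TS[symmetric] by (rule coordinate.pushforward_density[OF T assms G_meas]) (use G_pos T_in_S in auto)

text \<open>Hoelder's inequality for |k'| / f and |T| with respect to f dx. As \<open>T\<close>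
  transports \<open>f\<close> to \<open>G\<close>, its moment is that of \<open>G\<close>, hence the
  factor \<open>sig\<close>. For p = 1 this degenerates to |T| \<le> 1.\<close>

lemma T_bound:
 assumes F: "F = ennreal \<Phi>" "0 < \<Phi>"
 shows "(NN x:ivl a b. ennreal (\<bar>dk x\<bar> * \<bar>T x\<bar>)) \<le> ennreal (\<alpha> * \<bar>\<beta>\<bar> * sig * \<Phi> powr (1 / p))"
proof (cases "p = 1")
 case True
 have sig1: "sig = 1" unfolding sig_def gaussian_sigma_def unfolding True hconj_def using gaussian_sup_moment(1)[OF l_pos] by simp
 have G1: "G = (\<lambda>x. if \<bar>x\<bar> < 1 then 1 / 2 else 0)" unfolding G_def unfolding True by (rule gaussian_sup_moment(2)[OF l_pos])
 have Tle: "\<bar>T x\<bar> \<le> 1" if "x \<in> ivl a b" for x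
  using T_in_S[OF that] by (auto simp: S_def support_def G1 split: if_splits)
 have "(NN x:ivl a b. ennreal (\<bar>dk x\<bar> * \<bar>T x\<bar>)) \<le> (NN x:ivl a b. ennreal ((\<bar>dk x\<bar> / f x) powr p * f x))"
 proof (rule nn_set_mono)
  fix x assume xA: "x \<in> ivl a b"
  show "ennreal (\<bar>dk x\<bar> * \<bar>T x\<bar>) \<le> ennreal ((\<bar>dk x\<bar> / f x) powr p * f x)"
   using xA Tle[of x] fpos[of x] True by (auto intro!: ennreal_leI mult_left_le)
 qed
 also have "\<dots> = ennreal (\<alpha> * \<bar>\<beta>\<bar> * sig * \<Phi> powr (1 / p))"
  unfolding F_eq F sig1 using True \<alpha> F(2) by (simp add: ennreal_mult[symmetric])
 finally show ?thesis .
next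
 case False
 define q where "q = p / (p - 1)"
 have p1: "1 < p" using p False by simp
 have q: "1 < q" "0 < q" using p1 by (auto simp: q_def field_simps)
 have pq: "1 / p + 1 / q = 1" using p1 by (simp add: q_def field_simps)
 obtain \<mu> where \<mu>: "0 < \<mu>" "has_bochner_integral lborel (\<lambda>x. stretched_gaussian p l x * \<bar>x\<bar> powr q) \<mu>"
  "sigma (hconj p) (stretched_gaussian p l) = ennreal (\<mu> powr (1 / q))"
  using gaussian_powr_moment[OF range _ False q_def q(2)] p1 by (metis not_one_less_zero)
 have sig: "sig = \<mu> powr (1 / q)" using \<mu> by (simp add: sig_def gaussian_sigma_def)
 interpret coordinate a b "\<lambda>x. if x \<in> ivl a b then f x / G (T x) else 1" T by (rule T)
 define d where "d x = indicator (ivl a b) x * dk x" for x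
 define t where "t x = indicator (ivl a b) x * T x" for x
 have [measurable]: "d \<in> borelfun" using k_der_meas(2) unfolding d_def[abs_def] .
 have [measurable]: "t \<in> borelfun" using borel_measurable_indicator unfolding t_def[abs_def] .
 define M where "M = density lborel (\<lambda>x. ennreal (f x) * indicator (ivl a b) x)"
 define A where "A = (\<alpha> * \<bar>\<beta>\<bar>) powr p * \<Phi>"
 have A: "0 < A" using \<alpha> beta F by (simp add: A_def)
 have spM: "space M = UNIV" by (simp add: M_def)
 have fnn: "0 \<le> f x" for x by (rule prob_density_onD(2)[OF f])
 have nnM: "(\<integral>\<^sup>+x. ennreal (u x) \<partial>M) = (NN x:ivl a b. ennreal (u x * f x))" if [measurable]: "u \<in> borelfun" for u
 proof -
  have "(\<integral>\<^sup>+x. ennreal (u x) \<partial>M) = (NN x. ennreal (f x) * indicator (ivl a b) x * ennreal (u x))"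
   unfolding M_def by (subst nn_integral_density) simp_all
  also have "\<dots> = (NN x:ivl a b. ennreal (u x * f x))"
  proof (intro nn_integral_cong)
   fix x
   have "ennreal (u x * f x) = ennreal (u x) * ennreal (f x)" using fnn by (rule ennreal_mult'')
   then show "ennreal (f x) * indicator (ivl a b) x * ennreal (u x) = ennreal (u x * f x) * indicator (ivl a b) x"
    by (simp add: mult_ac)
  qed
  finally show ?thesis .
 qed
 have "(NN x:ivl a b. ennreal (\<bar>dk x\<bar> * \<bar>T x\<bar>)) = (\<integral>\<^sup>+x. ennreal ((\<bar>d x\<bar> / f x) * \<bar>t x\<bar>) \<partial>M)"
 proof (subst nnM)
  show "(NN x:ivl a b. ennreal (\<bar>dk x\<bar> * \<bar>T x\<bar>)) = (NN x:ivl a b. ennreal (\<bar>d x\<bar> / f x * \<bar>t x\<bar> * f x))"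
  proof (rule nn_set_cong)
   fix x assume xA: "x \<in> ivl a b"
   show "ennreal (\<bar>dk x\<bar> * \<bar>T x\<bar>) = ennreal (\<bar>d x\<bar> / f x * \<bar>t x\<bar> * f x)"
    using xA fpos[of x] by (auto simp: d_def t_def)
  qed
 qed measurable
 also have "\<dots> \<le> ennreal (A powr (1 / p) * \<mu> powr (1 / q))"
 proof (rule nn_integral_Holder[OF _ _ _ _ p1 q(1) pq])
  have "(\<integral>\<^sup>+x. ennreal ((\<bar>d x\<bar> / f x) powr p) \<partial>M) = (NN x:ivl a b. ennreal ((\<bar>dk x\<bar> / f x) powr p * f x))"
  proof (subst nnM)
   show "(NN x:ivl a b. ennreal ((\<bar>d x\<bar> / f x) powr p * f x)) = (NN x:ivl a b. ennreal ((\<bar>dk x\<bar> / f x) powr p * f x))"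
    by (intro nn_integral_cong) (auto simp: d_def indicator_def)
  qed measurable
  then show "(\<integral>\<^sup>+x. ennreal ((\<bar>d x\<bar> / f x) powr p) \<partial>M) = ennreal A"
   unfolding F_eq F using F \<alpha> by (simp add: A_def ennreal_mult[symmetric])
  have "(\<integral>\<^sup>+x. ennreal (\<bar>t x\<bar> powr q) \<partial>M) = (NN x:ivl a b. ennreal (\<bar>T x\<bar> powr q) * ennreal (f x))"
  proof (subst nnM)
   show "(NN x:ivl a b. ennreal (\<bar>t x\<bar> powr q * f x)) = (NN x:ivl a b. ennreal (\<bar>T x\<bar> powr q) * ennreal (f x))"
   proof (rule nn_set_cong)
    fix x assume xA: "x \<in> ivl a b"
    have "ennreal (\<bar>T x\<bar> powr q * f x) = ennreal (\<bar>T x\<bar> powr q) * ennreal (f x)" using fnn by (rule ennreal_mult'')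
    then show "ennreal (\<bar>t x\<bar> powr q * f x) = ennreal (\<bar>T x\<bar> powr q) * ennreal (f x)"
     using xA by (auto simp: t_def)
   qed
  qed measurable
  also have "\<dots> = (NN v:S. ennreal (\<bar>v\<bar> powr q) * ennreal (G v))" by (rule T_pushforward) measurable
  also have "\<dots> = (NN v. ennreal (G v * \<bar>v\<bar> powr q))"
   using G_nonneg G_off by (intro nn_integral_cong) (auto simp: indicator_def ennreal_mult'' mult.commute)
  also have "\<dots> = ennreal \<mu>"
   using \<mu>(2) G_nonneg by (subst nn_integral_eq_integral) (auto simp: has_bochner_integral_iff G_def)
  finally show "(\<integral>\<^sup>+x. ennreal (\<bar>t x\<bar> powr q) \<partial>M) = ennreal \<mu>" .
 qed (use A \<mu> fnn in \<open>auto simp: M_def\<close>)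
 also have "A powr (1 / p) * \<mu> powr (1 / q) = \<alpha> * \<bar>\<beta>\<bar> * sig * \<Phi> powr (1 / p)"
  unfolding A_def sig using \<alpha> F p1 by (simp add: powr_mult powr_powr)
 finally show ?thesis .
qed

text \<open>\<open>stam_core\<close> with u = G(T), the weight w = f/G(T) and for \<open>X\<close>
  the Hoelder bound of the integral of |k'| |T|. Since G(T) w = f, the quantity \<open>N\<close>
  there is the Renyi integral \<open>I\<close>.\<close>

lemma stam_core_application:
 assumes F: "F < \<infinity>"
  and right: "\<And>e x. 0 < e \<Longrightarrow> x \<in> ivl a b \<Longrightarrow> \<exists>t\<in>ivl a b. x < t \<and> k t < e"
  and left: "\<And>e x. 0 < e \<Longrightarrow> x \<in> ivl a b \<Longrightarrow> \<exists>t\<in>ivl a b. t < x \<and> k t < e"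
 obtains \<Phi> where "F = ennreal \<Phi>" "0 < \<Phi>" "1 < l \<Longrightarrow> I < \<infinity>"
  "\<And>\<mu>. I = ennreal \<mu> \<Longrightarrow> 0 < \<mu> \<Longrightarrow> l < 1 \<Longrightarrow> m \<le> \<mu> powr l * (\<alpha> * \<bar>\<beta>\<bar> * sig * \<Phi> powr (1 / p)) powr (1 - l)"
  "\<And>\<mu>. I = ennreal \<mu> \<Longrightarrow> 0 < \<mu> \<Longrightarrow> 1 < l \<Longrightarrow> \<mu> powr l * (\<alpha> * \<bar>\<beta>\<bar> * sig * \<Phi> powr (1 / p)) powr (1 - l) \<le> m"
  "\<And>\<mu>. I = ennreal \<mu> \<Longrightarrow> 0 < \<mu> \<Longrightarrow> m = \<mu> powr l * (\<alpha> * \<bar>\<beta>\<bar> * sig * \<Phi> powr (1 / p)) powr (1 - l) \<Longrightarrow>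
   \<exists>c>0. AE x\<in>ivl a b in lborel. k x = c * G (T x) powr l" proof -
 define w where "w x = (if x \<in> ivl a b then f x / G (T x) else 1)" for x
 interpret coordinate a b w T using T unfolding w_def[abs_def] .
 obtain \<rho> where \<rho>: "S = ivl (- \<rho>) \<rho>" "0 \<in> ivl (- \<rho>) \<rho>" using S_einterval by metis
 then obtain x0 where x0: "x0 \<in> ivl a b" "T x0 = 0" using TS by (metis imageE)
 have Gpos: "0 < G (T x)" if "x \<in> ivl a b" for x using G_pos[OF T_in_S[OF that]] .
 \<comment> \<open>The integration by parts: \<open>k\<close> is bounded by its outward variation,
   and Tonelli's theorem exchanges this with the integral of T'.\<close>
 have kw: "(NN x:ivl a b. ennreal (k x * w x)) \<le> (NN x:ivl a b. ennreal (\<bar>dk x\<bar> * \<bar>T x\<bar>))"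
 proof -
  have "(NN x:ivl a b. ennreal (k x * w x)) \<le> (NN x:ivl a b. (NN s:outward a b x0 x. ennreal \<bar>dk s\<bar>) * ennreal (w x))"
  proof (rule nn_set_mono)
   fix x assume True: "x \<in> ivl a b"
   have "ennreal (k x) \<le> (NN s:outward a b x0 x. ennreal \<bar>dk s\<bar>)"
    by (rule outward_bound[OF has_deriv(2) right left True])
   then have "ennreal (k x) * ennreal (w x) \<le> (NN s:outward a b x0 x. ennreal \<bar>dk s\<bar>) * ennreal (w x)"
    by (rule mult_right_mono) simp
   then show "ennreal (k x * w x) \<le> (NN s:outward a b x0 x. ennreal \<bar>dk s\<bar>) * ennreal (w x)" using True w_pos[OF True] by (simp add: ennreal_mult'')
  qed
  also have "\<dots> = (NN x:ivl a b. ennreal (\<bar>dk x\<bar> * \<bar>T x\<bar>))"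
   by (rule outward_tonelli[OF k_der_meas(2) x0])
  finally show ?thesis .
 qed
 define M where "M = restrict_space lborel (ivl a b)"
 have spM: "space M = ivl a b" by (simp add: M_def)
 have nnM: "(\<integral>\<^sup>+x. u x \<partial>M) = (NN x:ivl a b. u x)" for u
  unfolding M_def by (subst nn_integral_restrict_space) simp_all
 have measM: "u \<in> borel_measurable M" if "(\<lambda>x. indicator (ivl a b) x * u x) \<in> borelfun" for u :: "real \<Rightarrow> real"
  unfolding M_def using that by (subst borel_measurable_restrict_space_iff) simp_all
 have um: "(\<lambda>x. G (T x)) \<in> borel_measurable M"
 proof (rule measM)
  have "(\<lambda>x. indicator (ivl a b) x * G (indicator (ivl a b) x * T x)) \<in> borelfun" by measurable
  also have "(\<lambda>x. indicator (ivl a b) x * G (indicator (ivl a b) x * T x)) = (\<lambda>x. indicator (ivl a b) x * G (T x))"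
   by (auto simp: indicator_def)
  finally show "\<dots> \<in> borelfun" .
 qed
 have km: "k \<in> borel_measurable M" by (rule measM[OF k_der_meas(1)])
 have wm: "w \<in> borel_measurable M" by (rule measM) measurable
 have pos: "\<And>x. x \<in> space M \<Longrightarrow> 0 < G (T x)" "\<And>x. x \<in> space M \<Longrightarrow> 0 < k x" "\<And>x. x \<in> space M \<Longrightarrow> 0 < w x"
  unfolding spM using Gpos kpos w_pos by auto
 have mass: "(\<integral>\<^sup>+x. ennreal (G (T x) powr l * w x) \<partial>M) = ennreal m" proof -
  have "(\<integral>\<^sup>+x. ennreal (G (T x) powr l * w x) \<partial>M) = (NN x:ivl a b. ennreal (G (T x) powr l) * ennreal (w x))"
   unfolding nnM by (intro nn_integral_cong) (simp add: ennreal_mult')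
  also have "\<dots> = (NN v:S. ennreal (G v powr l))" unfolding TS[symmetric] by (rule pushforward) measurable
  also have "\<dots> = ennreal m" unfolding S_def G_def m_def by (rule gaussian_mass_nn_integral(2)[OF range])
  finally show ?thesis .
 qed
 have IM: "(\<integral>\<^sup>+x. ennreal (k x powr (1 - 1 / l) * (G (T x) * w x)) \<partial>M) = I" unfolding nnM I_eq
 proof (rule nn_set_cong)
  fix x assume xA: "x \<in> ivl a b"
  show "ennreal (k x powr (1 - 1 / l) * (G (T x) * w x)) = ennreal (k x powr (1 - 1 / l) * f x)"
   using xA Gpos[of x] by (auto simp: w_def)
 qed
 obtain \<Phi> where \<Phi>: "F = ennreal \<Phi>" "0 \<le> \<Phi>" using F by (cases F) auto
 \<comment> \<open>A zero divergence would make the integral of k w vanish, although both factors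
   are positive.\<close>
 have "\<Phi> \<noteq> 0"
 proof
  assume "\<Phi> = 0"
  define d where "d x = indicator (ivl a b) x * dk x" for x
  have [measurable]: "d \<in> borelfun" using k_der_meas(2) unfolding d_def[abs_def] .
  have "(NN x:ivl a b. ennreal ((\<bar>dk x\<bar> / f x) powr p * f x)) = 0"
   unfolding F_eq \<Phi> using \<open>\<Phi> = 0\<close> by simp
  then have "(NN x:ivl a b. ennreal ((\<bar>d x\<bar> / f x) powr p * f x)) = 0"
   by (subst (asm) nn_integral_cong[of _ _ "\<lambda>x. ennreal ((\<bar>d x\<bar> / f x) powr p * f x) * indicator (ivl a b) x"]) (auto simp: d_def indicator_def)
  then have "AE x in lborel. ennreal ((\<bar>d x\<bar> / f x) powr p * f x) * indicator (ivl a b) x = 0"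
   by (subst (asm) nn_integral_0_iff_AE) auto
  then have "AE x in lborel. ennreal (\<bar>dk x\<bar> * \<bar>T x\<bar>) * indicator (ivl a b) x = 0"
  proof eventually_elim
   case (elim x)
   show ?case
   proof (cases "x \<in> ivl a b")
    case True
    then have "(\<bar>dk x\<bar> / f x) powr p * f x \<le> 0" using elim by (simp add: d_def ennreal_eq_0_iff)
    then have "(\<bar>dk x\<bar> / f x) powr p = 0" using fpos[OF True] by (metis mult_le_0_iff not_less powr_ge_zero order_antisym)
    then have "dk x = 0" using fpos[OF True] by simp
    then show ?thesis by simp
   qed simp
  qed
  then have "(NN x:ivl a b. ennreal (\<bar>dk x\<bar> * \<bar>T x\<bar>)) = (\<integral>\<^sup>+x. 0 \<partial>(lborel :: real measure))" by (rule nn_integral_cong_AE)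
  then have "(\<integral>\<^sup>+x. ennreal (k x * w x) \<partial>M) = 0" using kw unfolding nnM by simp
  then have "AE x in M. ennreal (k x * w x) = 0" using km wm by (subst (asm) nn_integral_0_iff_AE) auto
  then have "AE x in M. False" using AE_space
  proof eventually_elim
   case (elim x)
   then show ?case using pos(2,3)[OF elim(2)] by (auto simp: ennreal_eq_0_iff mult_le_0_iff)
  qed
  then have "AE x in lborel. x \<notin> ivl a b" unfolding M_def by (subst (asm) AE_restrict_space_iff) auto
  then have "(NN x:ivl a b. ennreal (f x)) = 0" by (subst nn_integral_0_iff_AE) (auto elim!: eventually_mono)
  then show False using prob_density_onD(4)[OF f] by simp
 qed
 then have \<Phi>0: "0 < \<Phi>" using \<Phi> by simp
 define X where "X = \<alpha> * \<bar>\<beta>\<bar> * sig * \<Phi> powr (1 / p)"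
 have X: "0 < X" using \<alpha> beta sig_pos \<Phi>0 by (simp add: X_def)
 have kX: "(\<integral>\<^sup>+x. ennreal (k x * w x) \<partial>M) \<le> ennreal X"
  unfolding nnM X_def using kw T_bound[OF \<Phi>(1) \<Phi>0] by (rule order.trans)
 note core = stam_core[OF um km wm pos l_pos m_pos X mass kX, unfolded IM]
 show thesis
 proof (rule that[OF \<Phi>(1) \<Phi>0, folded X_def])
  show "1 < l \<Longrightarrow> I < \<infinity>" by (rule core(1))
  show "m \<le> \<mu> powr l * X powr (1 - l)" if "I = ennreal \<mu>" "0 < \<mu>" "l < 1" for \<mu> by (rule core(2)[OF _ _ _ that]) auto
  show "\<mu> powr l * X powr (1 - l) \<le> m" if "I = ennreal \<mu>" "0 < \<mu>" "1 < l" for \<mu> by (rule core(3)[OF _ _ _ that]) auto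
  show "\<exists>c>0. AE x\<in>ivl a b in lborel. k x = c * G (T x) powr l"
   if eq: "I = ennreal \<mu>" "0 < \<mu>" "m = \<mu> powr l * X powr (1 - l)" for \<mu> proof -
   obtain c where "0 < c" "AE x in M. k x = c * G (T x) powr l" using core(4)[OF _ _ _ eq] by auto
   then show ?thesis unfolding M_def by (subst (asm) AE_restrict_space_iff) auto
  qed
 qed
qed

end

text \<open>The factor that both sides of (ii) have in common. Its power of \<alpha> is the explicit
  constant of (ii); its power of |\<beta>| \<open>sig\<close> stems from the Fisher information of
  the extremal density.\<close>

definition "\<kappa> = (\<alpha> * \<bar>\<beta>\<bar> * sig) powr (- (1 / (l * \<alpha>)))"

lemma admissibleI:
 assumes "I = ennreal \<mu>" "0 < \<mu>" "F = ennreal \<Phi>" "0 < \<Phi>" and y: "escort_coord \<alpha> (ivl a b) f h y"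
  "stam_regular \<theta> (y ` ivl a b) (rel_escort \<alpha> (ivl a b) f h y)"
 shows "stam_admissible p \<alpha> \<beta> lam (ivl a b) f h"
proof -
 have "mult_defined (eexp (- renyi_div (rel_order lam \<alpha>) (ivl a b) f h)) (rel_phi p (\<beta> * \<alpha>) (ivl a b) f h)"
  unfolding renyi_div_epowr(2)[OF beta(5) \<alpha>] rel_phi_def F_def[symmetric] I_def[symmetric] assms(1,3)
  using assms(2,4) by (simp add: mult_defined_def epowr_ennreal)
 moreover have "renyi_div_defined (rel_order lam \<alpha>) (ivl a b) f h"
  unfolding renyi_div_defined_def I_def[symmetric] assms(1) by simp
 ultimately show ?thesis unfolding stam_admissible_def theta(1)[symmetric] using f f_diff y by blast
qed

lemma stam_rhs_value: "stam_rhs p \<alpha> \<beta> lam = ennreal (\<kappa> * (m powr (1 / (l * (1 - l)))) powr (1 / \<alpha>))"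
proof -
 have e: "(lam - \<beta> - 1) / (\<alpha> * \<beta>) = - (1 / (l * \<alpha>))" proof -
  have "lam - \<beta> - 1 = - \<theta>" using theta(1) by simp
  then show ?thesis using beta(1) theta(2) l_pos by simp
 qed
 have e2: "1 / l + 1 / (1 - l) = 1 / (l * (1 - l))" using l_pos by (simp add: field_simps)
 have "(m / (\<bar>\<beta>\<bar> * sig)) powr (1 / l) * m powr (1 / (1 - l)) = (\<bar>\<beta>\<bar> * sig) powr (- (1 / l)) * (m powr (1 / l) * m powr (1 / (1 - l)))"
  using m_pos sig_pos beta(2) by (subst powr_divide) (simp_all add: powr_minus field_simps)
 also have "m powr (1 / l) * m powr (1 / (1 - l)) = m powr (1 / (l * (1 - l)))" unfolding e2[symmetric] powr_add ..
 finally have "((m / (\<bar>\<beta>\<bar> * sig)) powr (1 / l) * m powr (1 / (1 - l))) powr (1 / \<alpha>) = (\<bar>\<beta>\<bar> * sig) powr (- (1 / (l * \<alpha>))) * (m powr (1 / (l * (1 - l)))) powr (1 / \<alpha>)"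
  using m_pos sig_pos beta(2) by (simp add: powr_mult powr_powr)
 moreover have "\<kappa> = \<alpha> powr (- (1 / (l * \<alpha>))) * (\<bar>\<beta>\<bar> * sig) powr (- (1 / (l * \<alpha>)))"
  using \<alpha> sig_pos unfolding \<kappa>_def mult.assoc[of \<alpha>] by (subst powr_mult) auto
 ultimately show ?thesis
  unfolding stam_rhs_def epowr_K1[OF \<alpha>] e by (simp add: ennreal_mult[symmetric] mult.assoc)
qed

lemma stam_lhs_eq: "stam_lhs p \<alpha> \<beta> lam (ivl a b) f h = epowr (epowr I (1 / (\<alpha> * (1 - lam))) * epowr F (1 / (p * (\<beta> * \<alpha>)))) \<theta>"
 unfolding stam_lhs_def renyi_div_epowr(2)[OF beta(5) \<alpha>] rel_phi_def F_def I_def theta(1) ..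

text \<open>The shape is that of \<open>stam_rhs_value\<close>, with \<open>m\<close> replaced by
  the product which \<open>stam_core\<close> compares with \<open>m\<close>.\<close>

lemma stam_lhs_value:
 assumes "I = ennreal \<mu>" "0 < \<mu>" "F = ennreal \<Phi>" "0 < \<Phi>"
 shows "stam_lhs p \<alpha> \<beta> lam (ivl a b) f h =
  ennreal (\<kappa> * ((\<mu> powr l * (\<alpha> * \<bar>\<beta>\<bar> * sig * \<Phi> powr (1 / p)) powr (1 - l)) powr (1 / (l * (1 - l)))) powr (1 / \<alpha>))"
proof -
 have e1: "1 / (\<alpha> * (1 - lam)) * \<theta> = 1 / (1 - l) * (1 / \<alpha>)" unfolding beta(4) using theta(2) by simp
 have e2: "1 / (p * (\<beta> * \<alpha>)) * \<theta> = 1 / p * (1 / (l * \<alpha>))" using beta(1,2) theta(2) by (simp add: field_simps)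
 have e3: "l * (1 / (l * (1 - l))) = 1 / (1 - l)" "(1 - l) * (1 / (l * (1 - l))) = 1 / l" using l_pos by auto
 have "stam_lhs p \<alpha> \<beta> lam (ivl a b) f h = ennreal ((\<mu> powr (1 / (\<alpha> * (1 - lam))) * \<Phi> powr (1 / (p * (\<beta> * \<alpha>)))) powr \<theta>)"
  unfolding stam_lhs_eq using assms by (simp add: epowr_ennreal ennreal_mult[symmetric])
 also have "(\<mu> powr (1 / (\<alpha> * (1 - lam))) * \<Phi> powr (1 / (p * (\<beta> * \<alpha>)))) powr \<theta> = \<mu> powr (1 / (1 - l) * (1 / \<alpha>)) * \<Phi> powr (1 / p * (1 / (l * \<alpha>)))"
  using assms by (simp only: powr_mult powr_powr e1 e2)
 also have "\<dots> = \<kappa> * ((\<mu> powr l * (\<alpha> * \<bar>\<beta>\<bar> * sig * \<Phi> powr (1 / p)) powr (1 - l)) powr (1 / (l * (1 - l)))) powr (1 / \<alpha>)"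
 proof -
  define X where "X = \<alpha> * \<bar>\<beta>\<bar> * sig"
  have X: "0 < X" using \<alpha> beta(2) sig_pos by (simp add: X_def)
  have "((\<mu> powr l * (X * \<Phi> powr (1 / p)) powr (1 - l)) powr (1 / (l * (1 - l)))) = \<mu> powr (1 / (1 - l)) * (X * \<Phi> powr (1 / p)) powr (1 / l)"
   by (simp only: powr_mult powr_powr mult.assoc e3)
  also have "\<dots> powr (1 / \<alpha>) = \<mu> powr (1 / (1 - l) * (1 / \<alpha>)) * (X powr (1 / (l * \<alpha>)) * \<Phi> powr (1 / p * (1 / (l * \<alpha>))))"
   by (simp only: powr_mult powr_powr divide_divide_eq_left times_divide_eq_right mult_1_right mult.assoc times_divide_eq_left mult_1_left)
  finally show ?thesis unfolding \<kappa>_def X_def[symmetric] using X by (simp add: powr_minus field_simps)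
 qed
 finally show ?thesis .
qed

lemma stam_inequality:
 assumes adm: "stam_admissible p \<alpha> \<beta> lam (ivl a b) f h"
 shows "stam_rhs p \<alpha> \<beta> lam \<le> stam_lhs p \<alpha> \<beta> lam (ivl a b) f h" (is "?R \<le> ?L")
  and "stam_lhs p \<alpha> \<beta> lam (ivl a b) f h = stam_rhs p \<alpha> \<beta> lam \<Longrightarrow>
   coordinate a b (\<lambda>x. if x \<in> ivl a b then f x / G (T x) else 1) T \<Longrightarrow> T ` ivl a b = S \<Longrightarrow>
   \<exists>c>0. AE x\<in>ivl a b in lborel. k x = c * G (T x) powr l" proof -
 define e1 where "e1 = 1 / (\<alpha> * (1 - lam))"
 define e2 where "e2 = 1 / (p * (\<beta> * \<alpha>))"
 have e1: "e1 = 1 / (\<alpha> * \<theta> * (1 - l))" unfolding e1_def beta(4) by simp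
 have md: "\<not> (epowr I e1 = 0 \<and> epowr F e2 = \<infinity>)" "\<not> (epowr I e1 = \<infinity> \<and> epowr F e2 = 0)"
  using adm unfolding stam_admissible_def mult_defined_def renyi_div_epowr(2)[OF beta(5) \<alpha>] rel_phi_def F_def[symmetric] I_def[symmetric] e1_def e2_def
  by auto
 obtain y where y: "escort_coord \<alpha> (ivl a b) f h y" "stam_regular \<theta> (y ` ivl a b) (rel_escort \<alpha> (ivl a b) f h y)"
  using adm unfolding stam_admissible_def theta(1) by auto
 have I0: "0 < I" unfolding I_def by (rule renyi_integral_pos[OF ab f h])
 have lhs: "?L = epowr (epowr I e1 * epowr F e2) \<theta>"
  unfolding stam_lhs_eq e1_def e2_def ..
 have e20: "0 < e2 \<longleftrightarrow> 0 < \<theta>" "e2 \<noteq> 0" using p \<alpha> beta(2,3) by (auto simp: e2_def zero_less_mult_iff zero_less_divide_iff)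
 \<comment> \<open>For negative \<theta> it is the value 0 of the product that makes its power
   infinite.\<close>
 have top: "epowr (epowr I e1 * epowr F e2) \<theta> = \<infinity>"
  if "0 < \<theta> \<Longrightarrow> epowr I e1 * epowr F e2 = \<infinity>" "\<theta> < 0 \<Longrightarrow> epowr I e1 * epowr F e2 = 0"
  using that theta(2) by (cases "0 < \<theta>") auto
 have main: "?R \<le> ?L \<and> (?L = ?R \<longrightarrow>
   (\<exists>c>0. AE x\<in>ivl a b in lborel. k x = c * G (T x) powr l))"
  if T: "coordinate a b (\<lambda>x. if x \<in> ivl a b then f x / G (T x) else 1) T" "T ` ivl a b = S" for T
 proof (cases "F = \<infinity>")
  case True
  have "?L = \<infinity>" unfolding lhs
  proof (rule top)
   assume "0 < \<theta>"
   then have "epowr F e2 = \<infinity>" using True e20 by simp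
   then show "epowr I e1 * epowr F e2 = \<infinity>" using md by (simp add: ennreal_mult_top)
  next
   assume "\<theta> < 0"
   then have "e2 < 0" using e20 by linarith
   then show "epowr I e1 * epowr F e2 = 0" using True by simp
  qed
  then show ?thesis by (simp add: stam_rhs_value)
 next
  case False
  then have Ffin: "F < \<infinity>" by (simp add: top.not_eq_extremum)
  note small = k_small[OF y dk_integrable[OF Ffin]]
  obtain \<Phi> where \<Phi>: "F = ennreal \<Phi>" "0 < \<Phi>" "1 < l \<Longrightarrow> I < \<infinity>"
   and core: "\<And>\<mu>. I = ennreal \<mu> \<Longrightarrow> 0 < \<mu> \<Longrightarrow> l < 1 \<Longrightarrow> m \<le> \<mu> powr l * (\<alpha> * \<bar>\<beta>\<bar> * sig * \<Phi> powr (1 / p)) powr (1 - l)"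
  "\<And>\<mu>. I = ennreal \<mu> \<Longrightarrow> 0 < \<mu> \<Longrightarrow> 1 < l \<Longrightarrow> \<mu> powr l * (\<alpha> * \<bar>\<beta>\<bar> * sig * \<Phi> powr (1 / p)) powr (1 - l) \<le> m"
  "\<And>\<mu>. I = ennreal \<mu> \<Longrightarrow> 0 < \<mu> \<Longrightarrow> m = \<mu> powr l * (\<alpha> * \<bar>\<beta>\<bar> * sig * \<Phi> powr (1 / p)) powr (1 - l) \<Longrightarrow>
   \<exists>c>0. AE x\<in>ivl a b in lborel. k x = c * G (T x) powr l"
   by (rule stam_core_application[OF T Ffin small]) blast+
  show ?thesis
  proof (cases I rule: ennreal_cases_pos)
   case 1
   then show ?thesis using I0 by simp
  next
   case 2
   \<comment> \<open>For l > 1 the Renyi integral is finite, so \<open>I\<close> is infinite only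
     for l < 1; then \<open>e1\<close> has the sign of \<theta>, and the left side is infinite in
     both cases.\<close>
   then have l1: "l < 1" using \<Phi>(3) l_pos by fastforce
   have "?L = \<infinity>" unfolding lhs
   proof (rule top)
    assume "0 < \<theta>"
    then have "0 < e1" unfolding e1 using \<alpha> l1 by simp
    then show "epowr I e1 * epowr F e2 = \<infinity>" using 2 \<Phi> by (simp add: epowr_ennreal ennreal_top_mult)
   next
    assume "\<theta> < 0"
    then have "e1 < 0" unfolding e1 using \<alpha> l1 by (simp add: divide_less_0_iff mult_less_0_iff)
    then show "epowr I e1 * epowr F e2 = 0" using 2 by simp
   qed
   then show ?thesis by (simp add: stam_rhs_value)
  next
   case (3 \<mu>)
   define Q where "Q = \<mu> powr l * (\<alpha> * \<bar>\<beta>\<bar> * sig * \<Phi> powr (1 / p)) powr (1 - l)"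
   have Q: "0 < Q" using 3 \<alpha> beta(2) sig_pos \<Phi> by (simp add: Q_def)
   have \<kappa>: "0 < \<kappa>" using \<alpha> beta(2) sig_pos by (simp add: \<kappa>_def)
   have v: "?L = ennreal (\<kappa> * (Q powr (1 / (l * (1 - l)))) powr (1 / \<alpha>))"
    unfolding Q_def by (rule stam_lhs_value[OF 3 \<Phi>(1,2)])
   \<comment> \<open>The exponent 1/(l (1 - l)) is negative for l > 1, which undoes the reversal of
     the inequality in \<open>core\<close>.\<close>
   have "m powr (1 / (l * (1 - l))) \<le> Q powr (1 / (l * (1 - l)))"
   proof (cases "l < 1")
    case True
    then show ?thesis using core(1)[OF 3 True] m_pos l_pos unfolding Q_def by (intro powr_mono2) auto
   next
    case False
    then have "1 < l" using l_pos by simp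
    then show ?thesis using core(2)[OF 3 \<open>1 < l\<close>] Q unfolding Q_def
     by (intro powr_mono2') (auto simp: divide_le_0_iff mult_le_0_iff)
   qed
   then have le: "(m powr (1 / (l * (1 - l)))) powr (1 / \<alpha>) \<le> (Q powr (1 / (l * (1 - l)))) powr (1 / \<alpha>)"
    by (rule powr_mono2[rotated 2]) (use \<alpha> in auto)
   have "\<exists>c>0. AE x\<in>ivl a b in lborel. k x = c * G (T x) powr l"
    if "?L = ?R"
   proof (rule core(3)[OF 3])
    have "(Q powr (1 / (l * (1 - l)))) powr (1 / \<alpha>) = (m powr (1 / (l * (1 - l)))) powr (1 / \<alpha>)"
     using that \<kappa> unfolding v stam_rhs_value by (subst (asm) ennreal_inj) auto
    then have "((Q powr (1 / (l * (1 - l)))) powr (1 / \<alpha>)) powr (\<alpha> * (l * (1 - l))) = ((m powr (1 / (l * (1 - l)))) powr (1 / \<alpha>)) powr (\<alpha> * (l * (1 - l)))"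
     by simp
    then have "Q = m" using Q m_pos \<alpha> l_pos by (simp add: powr_powr)
    then show "m = \<mu> powr l * (\<alpha> * \<bar>\<beta>\<bar> * sig * \<Phi> powr (1 / p)) powr (1 - l)" by (simp add: Q_def)
   qed
   then show ?thesis using le \<kappa> unfolding v stam_rhs_value by (auto intro!: ennreal_leI mult_left_mono)
  qed
 qed
 obtain T where T: "coordinate a b (\<lambda>x. if x \<in> ivl a b then f x / G (T x) else 1) T" "T ` ivl a b = S"
  using transport_G .
 show "?R \<le> ?L" using main[OF T] by simp
 show "\<exists>c>0. AE x\<in>ivl a b in lborel. k x = c * G (T x) powr l"
  if "?L = ?R"
   "coordinate a b (\<lambda>x. if x \<in> ivl a b then f x / G (T x) else 1) T" "T ` ivl a b = S" for T
  using main[OF that(2,3)] that(1) by simp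
qed

end

section \<open>Absolute continuity of unimodal densities\<close>

lemma sum_indicator_disjoint_le:
 assumes "finite D" "pairwise (\<lambda>I J. S I \<inter> S J = {}) D"
 shows "(\<Sum>I\<in>D. indicator (S I) v :: ennreal) \<le> 1"
proof (cases "\<exists>I\<in>D. v \<in> S I")
 case True
 then obtain I where I: "I \<in> D" "v \<in> S I" by blast
 have "(\<Sum>J\<in>D - {I}. indicator (S J) v :: ennreal) = 0"
 proof (rule sum.neutral, rule ballI)
  fix J assume "J \<in> D - {I}"
  then have "S I \<inter> S J = {}" using assms(2) I(1) unfolding pairwise_def by fastforce
  then show "(indicator (S J) v :: ennreal) = 0" using I(2) by (auto simp: indicator_def)
 qed
 then show ?thesis using sum.remove[OF assms(1) I(1), of "\<lambda>I. indicator (S I) v :: ennreal"] I by simp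
next
 case False
 then have "(\<Sum>I\<in>D. indicator (S I) v :: ennreal) = (\<Sum>I\<in>D. 0)"
  by (intro sum.cong) (auto simp: indicator_def)
 then show ?thesis by simp
qed

text \<open>Splits an integrable function into a bounded part and a part of small integral, by
  monotone convergence of its truncations.\<close>

lemma nn_integral_truncation:
 fixes u :: "'a \<Rightarrow> ennreal"
 assumes [measurable]: "u \<in> borel_measurable M" and fin: "(\<integral>\<^sup>+x. u x \<partial>M) < \<infinity>" and e: "0 < (e :: real)"
 obtains v and n :: nat where "v \<in> borel_measurable M" "\<And>x. u x \<le> v x + of_nat n" "(\<integral>\<^sup>+x. v x \<partial>M) < ennreal e"
proof -
 define c where "c n x = inf (u x) (of_nat n)" for n x
 have [measurable]: "c n \<in> borel_measurable M" for n unfolding c_def by measurable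
 have "(SUP n. c n x) = u x" for x unfolding c_def inf_SUP[symmetric] by (simp add: ennreal_SUP_of_nat_eq_top)
 then have "(\<integral>\<^sup>+x. u x \<partial>M) = (\<integral>\<^sup>+x. (SUP n. c n x) \<partial>M)" by simp
 also have "\<dots> = (SUP n. \<integral>\<^sup>+x. c n x \<partial>M)"
 proof (rule nn_integral_monotone_convergence_SUP)
  show "incseq c" unfolding c_def incseq_def le_fun_def by (meson inf_mono of_nat_mono order_refl)
 qed measurable
 finally have S: "(\<integral>\<^sup>+x. u x \<partial>M) = (SUP n. \<integral>\<^sup>+x. c n x \<partial>M)" .
 have "\<exists>n\<in>UNIV. (\<integral>\<^sup>+x. u x \<partial>M) < (\<integral>\<^sup>+x. c n x \<partial>M) + ennreal e"
  by (rule SUP_approx_ennreal[OF e _ S]) (use fin in auto)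
 then obtain n where n: "(\<integral>\<^sup>+x. u x \<partial>M) < (\<integral>\<^sup>+x. c n x \<partial>M) + ennreal e" by blast
 have le: "c n x \<le> u x" "c n x \<le> of_nat n" for x by (simp_all add: c_def)
 have cn: "(\<integral>\<^sup>+x. c n x \<partial>M) < \<infinity>" using le(1) fin by (meson nn_integral_mono le_less_trans)
 show thesis
 proof (rule that[of "\<lambda>x. u x - c n x" n])
  show "u x \<le> u x - c n x + of_nat n" for x proof -
   have "u x = u x - c n x + c n x" using le(1)[of x] by (simp add: diff_add_cancel_ennreal)
   also have "\<dots> \<le> u x - c n x + of_nat n" by (intro add_left_mono le)
   finally show ?thesis .
  qed
  have "(\<integral>\<^sup>+x. u x - c n x \<partial>M) = (\<integral>\<^sup>+x. u x \<partial>M) - (\<integral>\<^sup>+x. c n x \<partial>M)"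
   using cn le(1) by (intro nn_integral_diff) auto
  also have "\<dots> < ennreal e" proof -
   obtain A where A: "(\<integral>\<^sup>+x. u x \<partial>M) = ennreal A" "0 \<le> A" using fin by (cases "\<integral>\<^sup>+x. u x \<partial>M") auto
   obtain C where C: "(\<integral>\<^sup>+x. c n x \<partial>M) = ennreal C" "0 \<le> C" using cn by (cases "\<integral>\<^sup>+x. c n x \<partial>M") auto
   have "A < C + e" using n e A(2) C(2) unfolding A C by (simp add: ennreal_less_iff flip: ennreal_plus)
   then show ?thesis unfolding A C using C e by (simp add: ennreal_minus ennreal_lessI)
  qed
  finally show "(\<integral>\<^sup>+x. u x - c n x \<partial>M) < ennreal e" .
 qed measurable
qed

text \<open>Absolute continuity of the integral of \<open>D\<close>: over disjoint intervals the
  unbounded part of \<open>D\<close> contributes less than \<epsilon>/2 in total, and the part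
  bounded by \<open>n\<close> at most \<open>n\<close> times the total length.\<close>

lemma abs_cont_on_IccI:
 fixes D :: "real \<Rightarrow> ennreal"
 assumes [measurable]: "D \<in> borelfun" and fin: "(NN v:{A..B}. D v) < \<infinity>"
  and le: "\<And>s t. A \<le> s \<Longrightarrow> s \<le> t \<Longrightarrow> t \<le> B \<Longrightarrow> ennreal \<bar>u t - u s\<bar> \<le> (NN v:{s..t}. D v)"
 shows "abs_cont_on_Icc A B u"
 unfolding abs_cont_on_Icc_def
proof (intro allI impI)
 fix \<epsilon> :: real assume \<epsilon>: "0 < \<epsilon>"
 define d where "d v = D v * indicator {A..B} v" for v
 have [measurable]: "d \<in> borel_measurable lborel" unfolding d_def by measurable
 obtain v and n :: nat where v [measurable]: "v \<in> borel_measurable lborel" and dv: "\<And>x. d x \<le> v x + of_nat n"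
  and vI: "(NN x. v x) < ennreal (\<epsilon> / 2)"
  by (rule nn_integral_truncation[of d lborel "\<epsilon> / 2"]) (use fin \<epsilon> in \<open>auto simp: d_def\<close>)
 \<comment> \<open>Makes n \<delta> \<le> \<epsilon>/2, also for n = 0.\<close>
 define \<delta> where "\<delta> = \<epsilon> / (2 * (real n + 1))"
 have \<delta>: "0 < \<delta>" "real n * \<delta> \<le> \<epsilon> / 2" using \<epsilon> by (auto simp: \<delta>_def field_simps)
 show "\<exists>\<delta>>0. \<forall>P. finite P \<and> (\<forall>(s, t)\<in>P. A \<le> s \<and> s \<le> t \<and> t \<le> B) \<and>
   pairwise (\<lambda>I J. {fst I<..<snd I} \<inter> {fst J<..<snd J} = {}) P \<and> (\<Sum>(s, t)\<in>P. t - s) < \<delta> \<longrightarrow>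
   (\<Sum>(s, t)\<in>P. \<bar>u t - u s\<bar>) < \<epsilon>"
 proof (intro exI[of _ \<delta>] conjI allI impI \<delta>(1), elim conjE)
  fix P :: "(real \<times> real) set"
  assume fP: "finite P" and ord: "\<forall>(s, t)\<in>P. A \<le> s \<and> s \<le> t \<and> t \<le> B"
   and disj: "pairwise (\<lambda>I J. {fst I<..<snd I} \<inter> {fst J<..<snd J} = {}) P"
   and sum: "(\<Sum>(s, t)\<in>P. t - s) < \<delta>"
  have ord': "A \<le> fst I" "fst I \<le> snd I" "snd I \<le> B" if "I \<in> P" for I
   using ord that by (auto simp: split_beta)
  have one: "ennreal \<bar>u (snd I) - u (fst I)\<bar> \<le> (NN x. v x * indicator {fst I<..<snd I} x) + ennreal (real n * (snd I - fst I))"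
   if I: "I \<in> P" for I proof -
   have "ennreal \<bar>u (snd I) - u (fst I)\<bar> \<le> (NN x:{fst I..snd I}. D x)" by (rule le[OF ord'[OF I]])
   also have "\<dots> \<le> (NN x. v x * indicator {fst I<..<snd I} x + of_nat n * indicator {fst I<..<snd I} x)"
   proof (rule nn_integral_mono_AE)
    show "AE x in lborel. D x * indicator {fst I..snd I} x \<le> v x * indicator {fst I<..<snd I} x + of_nat n * indicator {fst I<..<snd I} x"
     using AE_lborel_singleton[of "fst I"] AE_lborel_singleton[of "snd I"]
    proof eventually_elim
     case (elim x)
     show ?case
     proof (cases "x \<in> {fst I..snd I}")
      case True
      then have "x \<in> {fst I<..<snd I}" "x \<in> {A..B}" using elim ord'[OF I] by auto
      then show ?thesis using True dv[of x] by (simp add: d_def)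
     qed simp
    qed
   qed
   also have "\<dots> = (NN x. v x * indicator {fst I<..<snd I} x) + of_nat n * ennreal (snd I - fst I)"
    using ord'[OF I] by (subst nn_integral_add) (simp_all add: nn_integral_cmult)
   also have "of_nat n * ennreal (snd I - fst I) = ennreal (real n * (snd I - fst I))"
    using ord'[OF I] by (simp add: ennreal_mult ennreal_of_nat_eq_real_of_nat)
   finally show ?thesis .
  qed
  have "ennreal (\<Sum>I\<in>P. \<bar>u (snd I) - u (fst I)\<bar>) = (\<Sum>I\<in>P. ennreal \<bar>u (snd I) - u (fst I)\<bar>)"
   by (rule sum_ennreal[symmetric]) simp
  also have "\<dots> \<le> (\<Sum>I\<in>P. (NN x. v x * indicator {fst I<..<snd I} x) + ennreal (real n * (snd I - fst I)))"
   by (rule sum_mono) (rule one)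
  also have "\<dots> = (NN x. (\<Sum>I\<in>P. v x * indicator {fst I<..<snd I} x)) + ennreal (real n * (\<Sum>I\<in>P. snd I - fst I))"
  proof -
   have "(\<Sum>I\<in>P. ennreal (real n * (snd I - fst I))) = ennreal (\<Sum>I\<in>P. real n * (snd I - fst I))"
    using ord' by (intro sum_ennreal) auto
   then show ?thesis by (simp add: sum.distrib nn_integral_sum sum_distrib_left)
  qed
  also have "\<dots> \<le> (NN x. v x) + ennreal (\<epsilon> / 2)"
  proof (intro add_mono nn_integral_mono)
   show "(\<Sum>I\<in>P. v x * indicator {fst I<..<snd I} x) \<le> v x" for x
    using mult_left_mono[OF sum_indicator_disjoint_le[OF fP disj, of x], of "v x"] by (simp add: sum_distrib_left)
   have "real n * (\<Sum>I\<in>P. snd I - fst I) \<le> real n * \<delta>"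
    using sum by (intro mult_left_mono) (auto simp: split_beta)
   then show "ennreal (real n * (\<Sum>I\<in>P. snd I - fst I)) \<le> ennreal (\<epsilon> / 2)" using \<delta> by (intro ennreal_leI) simp
  qed
  also have "\<dots> < ennreal (\<epsilon> / 2) + ennreal (\<epsilon> / 2)" using vI by (simp add: ennreal_add_left_cancel_less add.commute)
  also have "\<dots> = ennreal \<epsilon>" using \<epsilon> by (simp flip: ennreal_plus)
  finally show "(\<Sum>(s, t)\<in>P. \<bar>u t - u s\<bar>) < \<epsilon>"
   using \<epsilon> by (simp add: split_beta ennreal_less_iff sum_nonneg)
 qed
qed

context coordinate
begin

text \<open>\<open>R\<close> is \<open>u\<close> expressed in the coordinate v = y(x) and extended
  by 0. \<open>D\<close> plays the role of |dR/dv|: by substitution its integral over an interval of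
  \<open>v\<close> is the integral of |du| over the corresponding interval of
  \<open>x\<close>.\<close>

context
 fixes u du R :: "real \<Rightarrow> real" and D :: "real \<Rightarrow> ennreal"
 assumes der: "\<And>x. x \<in> ivl a b \<Longrightarrow> (u has_real_derivative du x) (at x)"
 defines "R \<equiv> \<lambda>v. if v \<in> y ` ivl a b then u (inv_into (ivl a b) y v) else 0"
  and "D \<equiv> \<lambda>v. ennreal (\<bar>du (inv_into (ivl a b) y v)\<bar> / w (inv_into (ivl a b) y v)) * indicator (y ` ivl a b) v"
begin

lemma derivative_density_measurable [measurable]: "D \<in> borelfun"
proof -
 define d where "d x = indicator (ivl a b) x * du x" for x
 define X where "X v = indicator (y ` ivl a b) v * inv_into (ivl a b) y v" for v
 have [measurable]: "d \<in> borelfun" unfolding d_def[abs_def] by (rule borel_measurable_deriv_einterval(2)[OF der])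
 have [measurable]: "X \<in> borelfun" unfolding X_def[abs_def] by (rule borel_measurable_inv)
 have "(\<lambda>v. ennreal (\<bar>d (X v)\<bar> / w (X v)) * indicator (y ` ivl a b) v) \<in> borelfun" by measurable
 also have "(\<lambda>v. ennreal (\<bar>d (X v)\<bar> / w (X v)) * indicator (y ` ivl a b) v) = D"
  using inv_image(1) by (auto simp: D_def d_def X_def indicator_def)
 finally show ?thesis .
qed

lemma derivative_density_integral:
 shows "s \<in> ivl a b \<Longrightarrow> t \<in> ivl a b \<Longrightarrow> s \<le> t \<Longrightarrow>
   (NN v:{y s..y t}. D v) = (NN x:{s..t}. ennreal \<bar>du x\<bar>)"
  and "(NN v. D v) = (NN x:ivl a b. ennreal \<bar>du x\<bar>)"
proof -
 have Dw: "D (y x) * ennreal (w x) = ennreal \<bar>du x\<bar>" if "x \<in> ivl a b" for x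
  using that w_pos[OF that] by (simp add: D_def inv_image(3) ennreal_mult[symmetric])
 show "(NN v:{y s..y t}. D v) = (NN x:{s..t}. ennreal \<bar>du x\<bar>)"
  if st: "s \<in> ivl a b" "t \<in> ivl a b" "s \<le> t" for s t
  unfolding pushforward_Icc[OF st derivative_density_measurable, symmetric]
  using einterval_Icc_subset[OF st(1,2)] Dw by (intro nn_integral_cong) (auto simp: indicator_def)
 have "(NN v. D v) = (NN v:y ` ivl a b. D v)" by (intro nn_integral_cong) (auto simp: D_def indicator_def)
 also have "\<dots> = (NN x:ivl a b. ennreal \<bar>du x\<bar>)"
  unfolding pushforward[OF derivative_density_measurable, symmetric]
  using Dw by (intro nn_integral_cong) (auto simp: indicator_def)
 finally show "(NN v. D v) = (NN x:ivl a b. ennreal \<bar>du x\<bar>)" .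
qed

lemma derivative_density_bound:
 assumes "s \<in> ivl a b" "t \<in> ivl a b" "s \<le> t"
 shows "ennreal \<bar>u t - u s\<bar> \<le> (NN v:{y s..y t}. D v)"
 using nn_integral_deriv_ge[OF der assms] derivative_density_integral(1)[OF assms] by simp

text \<open>For functions that may blow up at the ends: only compact pieces of the image occur, so
  local integrability of the derivative is enough.\<close>

lemma loc_abs_cont_image:
 assumes fin: "\<And>s t. s \<in> ivl a b \<Longrightarrow> t \<in> ivl a b \<Longrightarrow> s \<le> t \<Longrightarrow> (NN x:{s..t}. ennreal \<bar>du x\<bar>) < \<infinity>"
 shows "loc_abs_cont (y ` ivl a b) R"
 unfolding loc_abs_cont_def
proof (intro allI impI)
 fix A B assume sub: "{A..B} \<subseteq> y ` ivl a b"
 show "abs_cont_on_Icc A B R"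
 proof (rule abs_cont_on_IccI[OF derivative_density_measurable])
  show "(NN v:{A..B}. D v) < \<infinity>"
  proof (cases "A \<le> B")
   case True
   then obtain s t where "s \<in> ivl a b" "t \<in> ivl a b" "A = y s" "B = y t"
    using sub[THEN subsetD, of A] sub[THEN subsetD, of B] by auto
   then show ?thesis using fin[of s t] True derivative_density_integral(1)[of s t] by (simp add: mono)
  qed simp
  fix s t assume st: "A \<le> s" "s \<le> t" "t \<le> B"
  then obtain s' t' where "s' \<in> ivl a b" "t' \<in> ivl a b" "s = y s'" "t = y t'"
   using sub[THEN subsetD, of s] sub[THEN subsetD, of t] by auto
  then show "ennreal \<bar>R t - R s\<bar> \<le> (NN v:{s..t}. D v)"
   using derivative_density_bound[of s' t'] st by (simp add: R_def inv_image(3) mono)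
 qed
qed

text \<open>An interval that crosses an end of the image sees no jump: \<open>u\<close> takes
  arbitrarily small values towards that end, so |u| at an inner point is bounded by the variation
  from there to the end.\<close>

lemma loc_abs_cont_zero_extension:
 assumes fin: "(NN x:ivl a b. ennreal \<bar>du x\<bar>) < \<infinity>"
  and right: "\<And>e x. 0 < e \<Longrightarrow> x \<in> ivl a b \<Longrightarrow> \<exists>t\<in>ivl a b. x < t \<and> \<bar>u t\<bar> < e"
  and left: "\<And>e x. 0 < e \<Longrightarrow> x \<in> ivl a b \<Longrightarrow> \<exists>t\<in>ivl a b. t < x \<and> \<bar>u t\<bar> < e"
 shows "loc_abs_cont UNIV R"
 unfolding loc_abs_cont_def
proof (intro allI impI)
 fix A B :: real
 show "abs_cont_on_Icc A B R"
 proof (rule abs_cont_on_IccI[OF derivative_density_measurable])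
  have "(NN v:{A..B}. D v) \<le> (NN v. D v)" by (intro nn_integral_mono) (simp add: indicator_def)
  then show "(NN v:{A..B}. D v) < \<infinity>" using fin derivative_density_integral(2) by simp
  \<comment> \<open>Comparison with a point where |u| < e, and then e to 0.\<close>
  have ext: "ennreal \<bar>u x\<bar> \<le> C"
   if x: "x \<in> ivl a b" and ex: "\<And>e. 0 < e \<Longrightarrow> \<exists>t\<in>ivl a b. \<bar>u t\<bar> < e \<and> ennreal \<bar>u x - u t\<bar> \<le> C" for x C
  proof (rule ennreal_le_epsilon)
   fix e :: real assume "0 < e"
   then obtain t where t: "\<bar>u t\<bar> < e" "ennreal \<bar>u x - u t\<bar> \<le> C" using ex by blast
   have "ennreal \<bar>u x\<bar> \<le> ennreal \<bar>u x - u t\<bar> + ennreal e"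
    using t(1) \<open>0 < e\<close> by (simp flip: ennreal_plus) 
   also have "\<dots> \<le> C + ennreal e" by (intro add_right_mono t)
   finally show "ennreal \<bar>u x\<bar> \<le> C + ennreal e" .
  qed
  fix s t :: real assume "s \<le> t"
  define C where "C = (NN v:{s..t}. D v)"
  have sub: "(NN v:{s'..t'}. D v) \<le> C" if "s \<le> s'" "t' \<le> t" for s' t'
   unfolding C_def using that by (intro nn_integral_mono) (auto simp: indicator_def)
  have Ry: "R (y x) = u x" if "x \<in> ivl a b" for x using that by (simp add: R_def inv_image(3))
  have R0: "R v = 0" if "v \<notin> y ` ivl a b" for v using that by (simp add: R_def)
  have "ennreal \<bar>R t - R s\<bar> \<le> C"
  proof (cases "s \<in> y ` ivl a b")
   case True
   then obtain s' where s': "s' \<in> ivl a b" "s = y s'" by blast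
   show ?thesis
   proof (cases "t \<in> y ` ivl a b")
    case True
    then obtain t' where t': "t' \<in> ivl a b" "t = y t'" by blast
    then show ?thesis using derivative_density_bound[of s' t'] s' \<open>s \<le> t\<close> by (simp add: Ry mono C_def)
   next
    case False
    have "ennreal \<bar>u s'\<bar> \<le> C"
    proof (rule ext[OF s'(1)])
     fix e :: real assume "0 < e"
     then obtain x where x: "x \<in> ivl a b" "s' < x" "\<bar>u x\<bar> < e" using right s' by blast
     \<comment> \<open>The image is an interval that does not contain \<open>t\<close>, so no point
       of it beyond \<open>y s'\<close> can pass \<open>t\<close>.\<close>
     have "y x < t"
     proof (rule ccontr)
      assume "\<not> y x < t"
      then have "t \<in> {y s'..y x}" using s' \<open>s \<le> t\<close> by simp
      then show False using image_interval[of "y s'" "y x"] s' x False by blast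
     qed
     then show "\<exists>t\<in>ivl a b. \<bar>u t\<bar> < e \<and> ennreal \<bar>u s' - u t\<bar> \<le> C"
      using x derivative_density_bound[of s' x] s' sub[of "y s'" "y x"]
      by (intro bexI[of _ x]) (auto simp: abs_minus_commute intro: order.trans)
    qed
    then show ?thesis using s' False by (simp add: Ry R0)
   qed
  next
   case False
   show ?thesis
   proof (cases "t \<in> y ` ivl a b")
    case True
    then obtain t' where t': "t' \<in> ivl a b" "t = y t'" by blast
    have "ennreal \<bar>u t'\<bar> \<le> C"
    proof (rule ext[OF t'(1)])
     fix e :: real assume "0 < e"
     then obtain x where x: "x \<in> ivl a b" "x < t'" "\<bar>u x\<bar> < e" using left t' by blast
     have "s < y x"
     proof (rule ccontr)
      assume "\<not> s < y x"
      then have "s \<in> {y x..y t'}" using t' \<open>s \<le> t\<close> by simp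
      then show False using image_interval[of "y x" "y t'"] t' x False by blast
     qed
     then show "\<exists>t\<in>ivl a b. \<bar>u t\<bar> < e \<and> ennreal \<bar>u t' - u t\<bar> \<le> C"
      using x derivative_density_bound[of x t'] t' sub[of "y x" "y t'"]
      by (intro bexI[of _ x]) (auto intro: order.trans)
    qed
    then show ?thesis using t' False by (simp add: Ry R0)
   qed (simp add: R0 False)
  qed
  then show "ennreal \<bar>R t - R s\<bar> \<le> (NN v:{s..t}. D v)" by (simp add: C_def)
 qed
qed

end

end

context stam_setting
begin

text \<open>In terms of \<open>k\<close> the density R is k^(1/\<beta>) and R^\<theta> is k^(1/l).
  For \<theta> > 0 both exponents are positive and R itself extends by 0. For \<theta> < 0 the
  density grows beyond all bounds towards the ends, and only R^\<theta> extends; R is absolutely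
  continuous on compact pieces because it is monotone on either side of the peak of
  \<open>k\<close>.\<close>

lemma unimodal_regular:
 assumes y: "escort_coord \<alpha> (ivl a b) f h y" and x0: "x0 \<in> ivl a b"
  and sgn: "\<And>x. x \<in> ivl a b \<Longrightarrow> x \<le> x0 \<Longrightarrow> 0 \<le> dk x" "\<And>x. x \<in> ivl a b \<Longrightarrow> x0 \<le> x \<Longrightarrow> dk x \<le> 0"
  and right: "\<And>e x. 0 < e \<Longrightarrow> x \<in> ivl a b \<Longrightarrow> \<exists>t\<in>ivl a b. x < t \<and> k t < e"
  and left: "\<And>e x. 0 < e \<Longrightarrow> x \<in> ivl a b \<Longrightarrow> \<exists>t\<in>ivl a b. t < x \<and> k t < e"
 shows "stam_regular \<theta> (y ` ivl a b) (rel_escort \<alpha> (ivl a b) f h y)"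
proof -
 interpret coordinate a b "\<lambda>x. f x powr (1 - \<alpha>) * h x powr \<alpha>" y by (rule escort_coordinate[OF ab f h y])
 define du where "du e x = e * k x powr (e - 1) * dk x" for e x
 have der: "((\<lambda>x. k x powr e) has_real_derivative du e x) (at x)" if x: "x \<in> ivl a b" for e x
  using DERIV_fun_powr[OF has_deriv(2)[OF x] kpos[OF x], of e] by (simp add: du_def)
 have small: "k t powr e < c" if "0 < e" "0 < c" "t \<in> ivl a b" "k t < c powr (1 / e)" for e c t proof -
  have "k t powr e < (c powr (1 / e)) powr e" using that kpos[of t] by (intro powr_less_mono2) auto
  then show ?thesis using that by (simp add: powr_powr)
 qed
 \<comment> \<open>Any positive power of \<open>k\<close> is unimodal and has finite variation; the
   exponents 1/\<beta> and 1/l are the ones used below.\<close>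
 have ext: "loc_abs_cont UNIV (\<lambda>v. if v \<in> y ` ivl a b then k (inv_into (ivl a b) y v) powr e else 0)" if e: "0 < e" for e
 proof (rule loc_abs_cont_zero_extension[OF der])
  have "(NN x:ivl a b. ennreal \<bar>du e x\<bar>) \<le> ennreal (2 * k x0 powr e)"
   by (rule unimodal_variation(2)[OF ab der _ x0])
    (use e sgn in \<open>auto simp: du_def mult_nonneg_nonneg mult_nonneg_nonpos\<close>)
  then show "(NN x:ivl a b. ennreal \<bar>du e x\<bar>) < \<infinity>" by (rule le_less_trans) simp
  fix c x :: real assume c: "0 < c" and x: "x \<in> ivl a b"
  have c': "0 < c powr (1 / e)" using c by simp
  show "\<exists>t\<in>ivl a b. x < t \<and> \<bar>k t powr e\<bar> < c" "\<exists>t\<in>ivl a b. t < x \<and> \<bar>k t powr e\<bar> < c"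
   using right[OF c' x] left[OF c' x] small[OF e c] by auto
 qed
 have R: "rel_escort \<alpha> (ivl a b) f h y = (\<lambda>v. if v \<in> y ` ivl a b then k (inv_into (ivl a b) y v) powr (1 / \<beta>) else 0)"
  using beta(2) by (auto simp: rel_escort_def k_def powr_powr fun_eq_iff)
 show ?thesis
 proof (cases "0 < \<theta>")
  case True
  then show ?thesis using ext[of "1 / \<beta>"] beta(3) unfolding stam_regular_def R by simp
 next
  case False
  have "loc_abs_cont (y ` ivl a b) (rel_escort \<alpha> (ivl a b) f h y)" unfolding R
  proof (rule loc_abs_cont_image[OF der])
   fix s t assume st: "s \<in> ivl a b" "t \<in> ivl a b" "s \<le> t"
   define e where "e = 1 / \<beta>"
   define D where "D x = indicator (ivl a b) x * du e x" for x
   have [measurable]: "D \<in> borelfun"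
    using borel_measurable_deriv_einterval(2)[OF der, of a b e] unfolding D_def[abs_def] .
   have e: "e < 0" using False beta(2,3) by (simp add: e_def)
   \<comment> \<open>Enlarge {s..t} so that it contains the peak and split there; on each half the
     derivative has a constant sign.\<close>
   have "(NN x:{s..t}. ennreal \<bar>du e x\<bar>) \<le>
    (NN x. ennreal \<bar>D x\<bar> * indicator {min s x0..x0} x + ennreal \<bar>D x\<bar> * indicator {x0..max t x0} x)"
    using einterval_Icc_subset[OF st(1,2)] by (intro nn_integral_mono) (auto simp: indicator_def D_def)
   also have "\<dots> = (NN x:{min s x0..x0}. ennreal \<bar>D x\<bar>) + (NN x:{x0..max t x0}. ennreal \<bar>D x\<bar>)"
    by (rule nn_integral_add) measurable
   also have "(NN x:{min s x0..x0}. ennreal \<bar>D x\<bar>) = ennreal \<bar>k x0 powr e - k (min s x0) powr e\<bar>"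
   proof (rule nn_integral_deriv_eq)
    have "min s x0 \<in> ivl a b" using st x0 by (simp add: min_def)
    from einterval_Icc_subset[OF this x0] have sub: "x \<in> ivl a b" if "x \<in> {min s x0..x0}" for x using that by auto
    show "((\<lambda>x. k x powr e) has_real_derivative D x) (at x)" if "x \<in> {min s x0..x0}" for x
     using der[OF sub[OF that], of e] sub[OF that] by (simp add: D_def)
    show "(\<forall>x\<in>{min s x0..x0}. 0 \<le> D x) \<or> (\<forall>x\<in>{min s x0..x0}. D x \<le> 0)"
     using sub sgn(1) e by (intro disjI2) (auto simp: D_def du_def mult_le_0_iff zero_le_mult_iff)
   qed simp
   also have "(NN x:{x0..max t x0}. ennreal \<bar>D x\<bar>) = ennreal \<bar>k (max t x0) powr e - k x0 powr e\<bar>"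
   proof (rule nn_integral_deriv_eq)
    have "max t x0 \<in> ivl a b" using st x0 by (simp add: max_def)
    from einterval_Icc_subset[OF x0 this] have sub: "x \<in> ivl a b" if "x \<in> {x0..max t x0}" for x using that by auto
    show "((\<lambda>x. k x powr e) has_real_derivative D x) (at x)" if "x \<in> {x0..max t x0}" for x
     using der[OF sub[OF that], of e] sub[OF that] by (simp add: D_def)
    show "(\<forall>x\<in>{x0..max t x0}. 0 \<le> D x) \<or> (\<forall>x\<in>{x0..max t x0}. D x \<le> 0)"
     using sub sgn(2) e by (intro disjI1) (auto simp: D_def du_def mult_le_0_iff zero_le_mult_iff)
   qed simp
   finally show "(NN x:{s..t}. ennreal \<bar>du (1 / \<beta>) x\<bar>) < \<infinity>"
    unfolding e_def by (rule le_less_trans) simp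
  qed
  moreover have "continuous_on UNIV (\<lambda>v. if v \<in> y ` ivl a b then rel_escort \<alpha> (ivl a b) f h y v powr \<theta> else 0)"
  proof -
   have "1 / \<beta> * \<theta> = 1 / l" using beta by simp
   then have eq: "(\<lambda>v. if v \<in> y ` ivl a b then rel_escort \<alpha> (ivl a b) f h y v powr \<theta> else 0) =
    (\<lambda>v. if v \<in> y ` ivl a b then k (inv_into (ivl a b) y v) powr (1 / l) else 0)"
    unfolding R by (auto simp: powr_powr)
   have "0 < 1 / l" using l_pos by simp
   then show ?thesis unfolding eq by (intro loc_abs_cont_continuous ext)
  qed
  ultimately show ?thesis using False by (simp add: stam_regular_def)
 qed
qed

end

section \<open>Minimizers of the Stam inequality\<close>

text \<open>The set where the functions differ is open and negligible, hence empty.\<close>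

lemma continuous_AE_eqD:
 fixes u v :: "real \<Rightarrow> real"
 assumes A: "open A" and cont: "continuous_on A u" "continuous_on A v"
  and AE: "AE x in lborel. x \<in> A \<longrightarrow> u x = v x" and x: "x \<in> A"
 shows "u x = v x"
proof -
 define N where "N = {x \<in> A. u x - v x \<in> - {0}}"
 have "open N" unfolding N_def using A cont
  by (intro continuous_open_preimage[of A "\<lambda>x. u x - v x", unfolded vimage_def Int_def, simplified] continuous_on_diff)
   (auto intro: open_Compl)
 moreover have "negligible N" proof -
  have "AE x in lborel. x \<notin> N" using AE by eventually_elim (auto simp: N_def)
  moreover have "N \<in> sets lborel" using \<open>open N\<close> by simp
  ultimately have "N \<in> null_sets lborel" by (simp add: AE_iff_null_sets)
  then show ?thesis by (simp add: negligible_iff_null_sets null_sets_completionI)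
 qed
 ultimately have "N = {}" using open_not_negligible by blast
 then show ?thesis using x by (auto simp: N_def)
qed

context stam_params
begin

text \<open>The map obtained from \<open>r y\<close> by the inverse of \<open>Y\<close> transports
  \<open>f\<close> to \<open>G\<close>, and k = r^\<beta> G(T)^l. So \<open>k\<close> has the
  equality form of Young's inequality, and |k'| / f is proportional to |T|^(q-1), the equality form
  of Hoelder's inequality. The integrals \<open>I\<close> and \<open>F\<close> are then
  explicit.\<close>

lemma stam_minimizer:
 fixes a b :: ereal and h y :: "real \<Rightarrow> real"
 assumes p1: "p \<noteq> 1" and ab: "a < b" and h: "prob_density_on (ivl a b) h"
  and h_diff: "h differentiable_on ivl a b" and \<alpha>: "0 < \<alpha>"
  and fin: "renyi_power ((\<alpha> - 1) / \<alpha>) g < \<infinity>" and y: "inv_coord \<alpha> (ivl a b) h g y"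
  and f_def: "f = inv_transform \<alpha> (ivl a b) h g y"
 shows "stam_admissible p \<alpha> \<beta> lam (ivl a b) f h"
  and "stam_lhs p \<alpha> \<beta> lam (ivl a b) f h = stam_rhs p \<alpha> \<beta> lam"
proof -
 obtain c d where cd: "c < d" "support g = ivl c d" using g_support_einterval .
 note ctx = ab h g_meas g_nonneg cd(2,1) \<alpha> fin
 note ctxy = ctx y
 define r where "r = inv_radius \<alpha> g"
 have r: "0 < r" unfolding r_def by (rule inv_radius_props(1)[OF ctx])
 have f: "prob_density_on (ivl a b) f" unfolding f_def by (rule inv_transform_prob_density[OF ctxy g_integral])
 have esc: "escort_coord \<alpha> (ivl a b) f h y" unfolding f_def by (rule inv_transform_escort_coord[OF ctxy])
 have ratio: "(f x / h x) powr \<alpha> = r * g (r * y x)" if "x \<in> ivl a b" for x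
  using inv_transform_ratio[OF ctxy that] by (simp add: f_def r_def)
 have f_eq: "f x = (r * g (r * y x)) powr (1 / \<alpha>) * h x" if "x \<in> ivl a b" for x
  using that by (simp add: f_def inv_transform_def r_def)
 obtain \<rho> where \<rho>: "0 < \<rho>" "- \<rho> < \<rho>" "S = ivl (- \<rho>) \<rho>" "0 \<in> ivl (- \<rho>) \<rho>" using S_einterval .
 interpret Yc: coordinate "- \<rho>" \<rho> wY Y by (rule coordinate_Y[OF \<rho>])
 interpret yc: coordinate a b "\<lambda>x. f x powr (1 - \<alpha>) * h x powr \<alpha>" y by (rule escort_coordinate[OF ab f h esc])
 define w where "w x = f x powr (1 - \<alpha>) * h x powr \<alpha>" for x
 define T where "T x = inv_into S Y (r * y x)" for x
 have in_supp: "r * y x \<in> support g" if "x \<in> ivl a b" for x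
  using inv_coord_pos(2)[OF ctxy that] by (simp add: r_def)
 have T: "T x \<in> S" "Y (T x) = r * y x" if "x \<in> ivl a b" for x
  using Yc.inv_image(1,2)[of "r * y x"] in_supp[OF that] unfolding T_def support_g[OF \<rho>] \<rho>(3) by auto
 have gT: "g (r * y x) = G (T x) powr (1 / \<theta>)" if "x \<in> ivl a b" for x
  using g_Y[OF \<rho> T(1)[OF that]] T(2)[OF that] by simp
 have g_der: "(g has_real_derivative - (1 / \<theta>) * sgn (T x) * gaussian_slope p l (T x) * G (T x) powr (2 / \<theta> - l)) (at (r * y x))"
  if "x \<in> ivl a b" for x using g_has_derivative[OF \<rho> T(1)[OF that]] T(2)[OF that] by simp
 have gpos: "0 < g (r * y x)" if "x \<in> ivl a b" for x using in_supp[OF that] by (simp add: support_def)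
 have fpos: "0 < f x" and hpos: "0 < h x" if "x \<in> ivl a b" for x
  using prob_density_onD(3)[OF f that] prob_density_onD(3)[OF h that] .
 have cont_g: "continuous_on (ivl a b) (\<lambda>x. g (r * y x))"
 proof (rule continuous_on_compose2[of "support g" g])
  show "continuous_on (support g) g"
  proof (rule continuous_at_imp_continuous_on, rule ballI)
   fix v assume "v \<in> support g"
   then obtain x where "x \<in> S" "v = Y x" unfolding support_g[OF \<rho>] by blast
   then show "isCont g v" using g_has_derivative[OF \<rho>] by (auto intro: DERIV_isCont)
  qed
  show "continuous_on (ivl a b) (\<lambda>x. r * y x)" by (intro continuous_intros yc.continuous)
 qed (use in_supp in auto)
 have cont_h: "continuous_on (ivl a b) h" by (rule differentiable_imp_continuous_on[OF h_diff])
 have "continuous_on (ivl a b) (\<lambda>x. (r * g (r * y x)) powr (1 / \<alpha>) * h x)"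
  using r gpos by (intro continuous_intros cont_g cont_h) fastforce
 then have cont_f: "continuous_on (ivl a b) f" by (simp add: f_eq cong: continuous_on_cong)
 have cont_w: "continuous_on (ivl a b) (\<lambda>x. f x powr (1 - \<alpha>) * h x powr \<alpha>)"
  using fpos hpos by (intro continuous_intros cont_f cont_h) fastforce+
 have y_der: "((\<lambda>x. r * y x) has_real_derivative r * w x) (at x)" if "x \<in> ivl a b" for x
  unfolding w_def by (intro DERIV_cmult yc.has_derivative[OF cont_w that])
 have f_diff: "f differentiable_on ivl a b" unfolding differentiable_on_eq_differentiable_at[OF open_einterval]
 proof
  fix x assume x: "x \<in> ivl a b"
  obtain h' where h': "(h has_real_derivative h') (at x)"
   using h_diff x by (auto simp: differentiable_on_eq_differentiable_at real_differentiable_def)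
  obtain g' where g': "((\<lambda>x. g (r * y x)) has_real_derivative g') (at x)"
   using DERIV_chain2[OF g_der[OF x] y_der[OF x]] by blast
  have "0 < r * g (r * y x)" using r gpos[OF x] by simp
  then have "((\<lambda>x. (r * g (r * y x)) powr (1 / \<alpha>) * h x) has_real_derivative
   (1 / \<alpha> * (r * g (r * y x)) powr (1 / \<alpha> - real_of_nat 1) * (r * g')) * h x + h' * (r * g (r * y x)) powr (1 / \<alpha>)) (at x)"
   by (intro DERIV_mult DERIV_fun_powr DERIV_cmult g' h')
  then have "(f has_real_derivative
   (1 / \<alpha> * (r * g (r * y x)) powr (1 / \<alpha> - real_of_nat 1) * (r * g')) * h x + h' * (r * g (r * y x)) powr (1 / \<alpha>)) (at x)"
   by (rule has_field_derivative_transform_within_open[OF _ open_einterval x]) (simp add: f_eq)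
  then show "f differentiable at x" by (auto simp: real_differentiable_def)
 qed
 interpret stam_setting p \<beta> lam \<theta> l a b \<alpha> f h
  by unfold_locales (use ab f h f_diff h_diff \<alpha> in auto)
 have T_der: "(T has_real_derivative f x / G (T x)) (at x)" if x: "x \<in> ivl a b" for x proof -
  have "(inv_into S Y has_real_derivative inverse (wY (T x))) (at (r * y x))"
   using Yc.inv_has_derivative[of "T x"] wY_continuous T[OF x] unfolding \<rho>(3)[symmetric] by simp
  from DERIV_chain2[OF this y_der[OF x]]
  have "(T has_real_derivative inverse (wY (T x)) * (r * w x)) (at x)" unfolding T_def[abs_def] .
  moreover have "inverse (wY (T x)) * (r * w x) = f x / G (T x)" proof -
   have fx: "f x = G (T x) powr (1 / \<theta>) * (r * w x)"
    using escort_identities(1)[OF fpos[OF x] hpos[OF x], of \<alpha>] unfolding ratio[OF x] gT[OF x] by (simp add: w_def mult_ac)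
   have "G (T x) powr (1 / \<theta>) * wY (T x) = G (T x) powr 1" using T(1)[OF x] by (simp add: wY_def flip: powr_add)
   then have GT: "G (T x) = G (T x) powr (1 / \<theta>) * wY (T x)" using G_nonneg by simp
   have "f x / G (T x) = (G (T x) powr (1 / \<theta>) * (r * w x)) / (G (T x) powr (1 / \<theta>) * wY (T x))"
    using fx GT by metis
   also have "\<dots> = (r * w x) / wY (T x)" using G_neq[OF T(1)[OF x]] by simp
   finally show ?thesis by (simp add: field_simps)
  qed
  ultimately show ?thesis by simp
 qed
 have k_eq: "k x = r powr \<beta> * G (T x) powr l" if x: "x \<in> ivl a b" for x proof -
  have "1 / \<theta> * \<beta> = l" using l by simp
  then show ?thesis unfolding k_def powr_powr[symmetric] ratio[OF x] gT[OF x] powr_mult by (simp add: powr_powr)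
 qed
 have dk_eq: "dk x = - (r powr \<beta> * l * gaussian_slope p l (T x) * f x) * sgn (T x)" if x: "x \<in> ivl a b" for x
 proof (rule DERIV_unique[OF has_deriv(2)[OF x]])
  have "((\<lambda>v. G v powr l) has_real_derivative - l * sgn (T x) * gaussian_slope p l (T x) * G (T x)) (at (T x))"
   using stretched_gaussian_powr_deriv[OF p range, of "T x" l] T(1)[OF x] G_nonneg[of "T x"] by (simp add: G_def S_def)
  from DERIV_cmult[OF DERIV_chain2[OF this T_der[OF x]], of "r powr \<beta>"]
  have "((\<lambda>x. r powr \<beta> * G (T x) powr l) has_real_derivative - (r powr \<beta> * l * gaussian_slope p l (T x) * f x) * sgn (T x)) (at x)"
   using G_neq[OF T(1)[OF x]] by (simp add: mult_ac)
  then show "(k has_real_derivative - (r powr \<beta> * l * gaussian_slope p l (T x) * f x) * sgn (T x)) (at x)"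
   by (rule has_field_derivative_transform_within_open[OF _ open_einterval x]) (simp add: k_eq)
 qed
 have Tc: "coordinate a b (\<lambda>x. if x \<in> ivl a b then f x / G (T x) else 1) T"
 proof (rule coordinate_of_derivative[OF ab])
  define t where "t x = indicator (ivl a b) x * T x" for x
  have [measurable]: "t \<in> borelfun"
   unfolding t_def[abs_def] by (rule borel_measurable_deriv_einterval(1)[OF T_der])
  have "(\<lambda>x. if x \<in> ivl a b then f x / G (t x) else 1) \<in> borelfun" by measurable
  also have "(\<lambda>x. if x \<in> ivl a b then f x / G (t x) else 1) = (\<lambda>x. if x \<in> ivl a b then f x / G (T x) else 1)"
   by (auto simp: t_def)
  finally show "\<dots> \<in> borelfun" .
 qed (use fpos G_pos T T_der in auto)
 interpret Tc: coordinate a b "\<lambda>x. if x \<in> ivl a b then f x / G (T x) else 1" T by (rule Tc)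
 have TS: "T ` ivl a b = S"
 proof
  show "S \<subseteq> T ` ivl a b"
  proof
   fix v assume v: "v \<in> S"
   then have "r * (Y v / r) \<in> support g" unfolding support_g[OF \<rho>] using r by simp
   then have "Y v / r \<in> y ` ivl a b" unfolding inv_coord_image[OF ctxy] r_def by simp
   then obtain x where x: "x \<in> ivl a b" "y x = Y v / r" by auto
   then have "T x = v" using Yc.inv_image(3)[of v] v r \<rho>(3) by (simp add: T_def)
   then show "v \<in> T ` ivl a b" using x by blast
  qed
 qed (use T in auto)
 have rb: "0 < r powr \<beta>" using r by simp
 have G_even: "G (- v) = G v" for v unfolding G_def by (rule stretched_gaussian_even)
 have S_even: "- v \<in> S \<longleftrightarrow> v \<in> S" for v by (simp add: S_def support_def G_even)
 have right: "\<exists>t\<in>ivl a b. x < t \<and> k t < e" if e: "0 < e" and x: "x \<in> ivl a b" for e x proof -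
  obtain t where t: "t \<in> S" "T x < t" "G t powr l < e / r powr \<beta>"
   using stretched_gaussian_small[OF p range p1, of "e / r powr \<beta>" "T x"] e rb T(1)[OF x] unfolding S_def G_def by auto
  obtain x' where x': "x' \<in> ivl a b" "t = T x'" using t(1) TS by auto
  then show ?thesis using t Tc.mono(2)[OF x x'(1)] rb by (intro bexI[of _ x']) (auto simp: k_eq field_simps)
 qed
 have left: "\<exists>t\<in>ivl a b. t < x \<and> k t < e" if e: "0 < e" and x: "x \<in> ivl a b" for e x proof -
  have "- T x \<in> S" using T(1)[OF x] S_even by simp
  then obtain t where t: "t \<in> S" "- T x < t" "G t powr l < e / r powr \<beta>"
   using stretched_gaussian_small[OF p range p1, of "e / r powr \<beta>" "- T x"] e rb unfolding S_def G_def by auto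
  have "- t \<in> S" using t(1) S_even by simp
  then obtain x' where x': "x' \<in> ivl a b" "- t = T x'" using TS by auto
  then have "G (T x') = G t" using G_even[of t] by simp
  then show ?thesis using t Tc.mono(2)[OF x'(1) x] x' rb by (intro bexI[of _ x']) (auto simp: k_eq field_simps)
 qed
 obtain x0 where x0: "x0 \<in> ivl a b" "T x0 = 0" using \<rho>(3,4) TS by (metis imageE)
 have slope: "0 \<le> r powr \<beta> * l * gaussian_slope p l v" for v
  using rb l_pos gaussian_slope_nonneg[OF p range, of v] by simp
 have reg: "stam_regular \<theta> (y ` ivl a b) (rel_escort \<alpha> (ivl a b) f h y)"
 proof (rule unimodal_regular[OF esc x0(1) _ _ right left])
  fix x assume x: "x \<in> ivl a b"
  have nn: "0 \<le> r powr \<beta> * l * gaussian_slope p l (T x) * f x" using slope fpos[OF x] by simp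
  show "0 \<le> dk x" if "x \<le> x0" proof -
   have "sgn (T x) \<le> 0" using Tc.mono(1)[OF x x0(1)] x0 that by simp
   then show ?thesis unfolding dk_eq[OF x] using nn by (simp add: mult_nonneg_nonpos)
  qed
  show "dk x \<le> 0" if "x0 \<le> x" proof -
   have "0 \<le> sgn (T x)" using Tc.mono(1)[OF x0(1) x] x0 that by simp
   then show ?thesis unfolding dk_eq[OF x] using nn by (simp add: mult_nonneg_nonneg)
  qed
 qed
 define q where "q = p / (p - 1)"
 have p1': "1 < p" using p p1 by simp
 have q: "1 < q" "(q - 1) * p = q" "0 < q" using p1' by (auto simp: q_def field_simps)
 define C where "C = (1 / (LINT t|lborel. stretched_profile p l t)) powr (l - 1)"
 have C: "0 < C" using profile_integral_pos[OF range] by (simp add: C_def)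
 obtain \<mu> where \<mu>: "0 < \<mu>" "has_bochner_integral lborel (\<lambda>x. stretched_gaussian p l x * \<bar>x\<bar> powr q) \<mu>"
  "sigma (hconj p) (stretched_gaussian p l) = ennreal (\<mu> powr (1 / q))"
  using gaussian_powr_moment[OF range _ p1 q_def q(3)] p1' by (metis not_one_less_zero)
 have sig: "sig = \<mu> powr (1 / q)" using \<mu> by (simp add: sig_def gaussian_sigma_def)
 have mass: "m = l * (C * q) * \<mu>"
  unfolding m_def C_def by (rule gaussian_mass_moment[OF p range p1 q_def \<mu>(2)])
 \<comment> \<open>The constant in |k'| / f = A |T|^(q-1); since (q - 1) p = q, the Fisher integral
   is A^p times the q-th moment of \<open>G\<close>.\<close>
 define A where "A = r powr \<beta> * l * (C * q)"
 have A: "0 < A" using rb l_pos C q by (simp add: A_def)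
 have "ennreal ((\<alpha> * \<bar>\<beta>\<bar>) powr p) * F = (NN x:ivl a b. ennreal ((\<bar>dk x\<bar> / f x) powr p * f x))"
  by (rule F_eq[symmetric])
 also have "\<dots> = (NN x:ivl a b. ennreal (A powr p * \<bar>T x\<bar> powr q) * ennreal (f x))"
 proof (rule nn_set_cong)
  fix x assume True: "x \<in> ivl a b"
  have "\<bar>dk x\<bar> / f x = r powr \<beta> * l * gaussian_slope p l (T x) * \<bar>sgn (T x)\<bar>"
   unfolding dk_eq[OF True] abs_mult abs_minus_cancel abs_of_nonneg[OF slope[of "T x"], unfolded abs_mult] using fpos[OF True] by simp
  also have "\<dots> = A * \<bar>T x\<bar> powr (q - 1)"
   using p1 by (cases "T x = 0") (auto simp: gaussian_slope_def A_def C_def q_def abs_sgn_eq)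
  finally have "(\<bar>dk x\<bar> / f x) powr p = A powr p * \<bar>T x\<bar> powr q"
   by (simp only: powr_mult powr_powr q(2))
  then show "ennreal ((\<bar>dk x\<bar> / f x) powr p * f x) = ennreal (A powr p * \<bar>T x\<bar> powr q) * ennreal (f x)" using less_imp_le[OF fpos[OF True]] by (simp add: ennreal_mult'')
 qed
 also have "\<dots> = (NN v:S. ennreal (A powr p * \<bar>v\<bar> powr q) * ennreal (G v))"
  by (rule T_pushforward[OF Tc TS]) measurable
 also have "\<dots> = (NN v. ennreal (A powr p * (G v * \<bar>v\<bar> powr q)))"
 proof (intro nn_integral_cong)
  fix v
  have "A powr p * (G v * \<bar>v\<bar> powr q) = A powr p * \<bar>v\<bar> powr q * G v" by simp
  then have "ennreal (A powr p * (G v * \<bar>v\<bar> powr q)) = ennreal (A powr p * \<bar>v\<bar> powr q) * ennreal (G v)"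
   using G_nonneg by (simp only: ennreal_mult'')
  then show "ennreal (A powr p * \<bar>v\<bar> powr q) * ennreal (G v) * indicator S v = ennreal (A powr p * (G v * \<bar>v\<bar> powr q))"
   using G_off[of v] by (cases "v \<in> S") auto
 qed
 also have "\<dots> = ennreal (A powr p * \<mu>)" using \<mu>(2) G_nonneg
  by (subst nn_integral_eq_integral) (auto simp: has_bochner_integral_iff G_def)
 finally have Feq: "ennreal ((\<alpha> * \<bar>\<beta>\<bar>) powr p) * F = ennreal (A powr p * \<mu>)" .
 have ab0: "0 < \<alpha> * \<bar>\<beta>\<bar>" using \<alpha> beta(2) by simp
 obtain \<Phi> where \<Phi>: "F = ennreal \<Phi>" "0 \<le> \<Phi>"
  using Feq ab0 by (cases F) (auto simp: ennreal_mult_top split: if_splits)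
 have \<Phi>eq: "(\<alpha> * \<bar>\<beta>\<bar>) powr p * \<Phi> = A powr p * \<mu>"
  using Feq \<Phi> \<mu>(1) unfolding \<Phi>(1) by (simp add: ennreal_mult[symmetric])
 have \<Phi>0: "0 < \<Phi>" proof -
  have "0 < (\<alpha> * \<bar>\<beta>\<bar>) powr p * \<Phi>" unfolding \<Phi>eq using A \<mu>(1) by simp
  then show ?thesis by (metis zero_less_mult_pos ab0 powr_gt_zero less_imp_neq)
 qed
 have X: "\<alpha> * \<bar>\<beta>\<bar> * sig * \<Phi> powr (1 / p) = r powr \<beta> * m" proof -
  have "\<alpha> * \<bar>\<beta>\<bar> * \<Phi> powr (1 / p) = ((\<alpha> * \<bar>\<beta>\<bar>) powr p * \<Phi>) powr (1 / p)"
   unfolding powr_mult[of "(\<alpha> * \<bar>\<beta>\<bar>) powr p"] powr_powr using ab0 p1' by simp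
  also have "\<dots> = A * \<mu> powr (1 / p)" unfolding \<Phi>eq using A p1' by (simp add: powr_mult powr_powr)
  finally have "\<alpha> * \<bar>\<beta>\<bar> * sig * \<Phi> powr (1 / p) = A * (\<mu> powr (1 / p) * \<mu> powr (1 / q))"
   unfolding sig by (simp add: mult_ac)
  also have "\<mu> powr (1 / p) * \<mu> powr (1 / q) = \<mu>" proof -
   have "1 / p + 1 / q = 1" using p1' by (simp add: q_def field_simps)
   then show ?thesis using \<mu>(1) by (simp flip: powr_add)
  qed
  finally show ?thesis unfolding mass A_def by simp
 qed
 have I: "I = ennreal (r powr (lam - 1) * m)"
 proof -
  have "(NN v. ennreal (g v powr lam)) = ennreal m"
   unfolding g_powr_integral'(1)[OF \<rho>, symmetric] using g_nonneg
   by (intro nn_integral_cong) (auto simp: indicator_def support_def not_less dest: antisym)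
  then show ?thesis
   unfolding I_def using inv_transform_renyi[OF ctxy, of lam, folded f_def] by (simp add: r_def ennreal_mult')
 qed
 have I0: "0 < r powr (lam - 1) * m" using r m_pos by simp
 have Q: "(r powr (lam - 1) * m) powr l * (\<alpha> * \<bar>\<beta>\<bar> * sig * \<Phi> powr (1 / p)) powr (1 - l) = m"
 proof -
  \<comment> \<open>The total exponent of the scale \<open>r\<close>, so that the value does not
    depend on \<open>r\<close>.\<close>
  have e: "(lam - 1) * l + \<beta> * (1 - l) = 0" proof -
   have "lam - 1 = - (\<theta> * (1 - l))" using beta(4) by simp
   then show ?thesis unfolding beta(1) by (simp only:) (simp add: algebra_simps)
  qed
  have "(r powr (lam - 1) * m) powr l * (r powr \<beta> * m) powr (1 - l) =
   r powr ((lam - 1) * l + \<beta> * (1 - l)) * m powr (l + (1 - l))"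
   by (simp only: powr_mult powr_powr powr_add mult_ac)
  then show ?thesis unfolding X e using r m_pos by simp
 qed
 show "stam_lhs p \<alpha> \<beta> lam (ivl a b) f h = stam_rhs p \<alpha> \<beta> lam"
  unfolding stam_lhs_value[OF I I0 \<Phi>(1) \<Phi>0] Q stam_rhs_value ..
 show "stam_admissible p \<alpha> \<beta> lam (ivl a b) f h" by (rule admissibleI[OF I I0 \<Phi>(1) \<Phi>0 esc reg])
qed

end

context stam_setting
begin

text \<open>Equality gives k = c G(T)^l almost everywhere, and at every point by continuity. Taking
  the power 1/\<beta> turns this into (f/h)^\<alpha> = C g(C y), the equation that characterizes the
  inverse transformation with radius \<open>C\<close>.\<close>

lemma stam_minimizer_unique:
 assumes adm: "stam_admissible p \<alpha> \<beta> lam (ivl a b) f h"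
  and eq: "stam_lhs p \<alpha> \<beta> lam (ivl a b) f h = stam_rhs p \<alpha> \<beta> lam"
 shows "\<exists>y. inv_coord \<alpha> (ivl a b) h g y \<and> (\<forall>x\<in>ivl a b. f x = inv_transform \<alpha> (ivl a b) h g y x)"
proof -
 obtain T where Tc: "coordinate a b (\<lambda>x. if x \<in> ivl a b then f x / G (T x) else 1) T" and TS: "T ` ivl a b = S"
  using transport_G .
 interpret Tc: coordinate a b "\<lambda>x. if x \<in> ivl a b then f x / G (T x) else 1" T by (rule Tc)
 obtain c where c: "0 < c" and AE: "AE x\<in>ivl a b in lborel. k x = c * G (T x) powr l"
  using stam_inequality(2)[OF adm eq Tc TS] by blast
 obtain \<rho> where \<rho>: "0 < \<rho>" "- \<rho> < \<rho>" "S = ivl (- \<rho>) \<rho>" "0 \<in> ivl (- \<rho>) \<rho>" using S_einterval .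
 interpret Yc: coordinate "- \<rho>" \<rho> wY Y by (rule coordinate_Y[OF \<rho>])
 note TinS = T_in_S[OF Tc TS]
 have cont_GT: "continuous_on (ivl a b) (\<lambda>x. G (T x))"
  by (rule continuous_on_compose2[OF G_continuous Tc.continuous]) (use TS in simp)
 have k_eq: "k x = c * G (T x) powr l" if x: "x \<in> ivl a b" for x
 proof (rule continuous_AE_eqD[OF open_einterval _ _ AE x])
  show "continuous_on (ivl a b) k"
   using has_deriv(2) by (intro continuous_at_imp_continuous_on) (auto intro: DERIV_isCont)
  show "continuous_on (ivl a b) (\<lambda>x. c * G (T x) powr l)"
   using G_neq[OF TinS] by (intro continuous_intros cont_GT) auto
 qed
 \<comment> \<open>The 1/\<beta>-th power of k = c G(T)^l is (f/h)^\<alpha> = C G(T)^(1/\<theta>) =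
   C g(Y(T)); dividing Y(T) by \<open>C\<close> then produces a coordinate with y' = f^(1-\<alpha>)
   h^\<alpha>.\<close>
 define C where "C = c powr (1 / \<beta>)"
 have C: "0 < C" using c by (simp add: C_def)
 define y where "y x = Y (T x) / C" for x
 have ratio: "(f x / h x) powr \<alpha> = C * g (Y (T x))" if x: "x \<in> ivl a b" for x proof -
  have e: "\<alpha> * \<beta> * (1 / \<beta>) = \<alpha>" "l * (1 / \<beta>) = 1 / \<theta>" using beta(1,2) l_pos by auto
  have "(f x / h x) powr \<alpha> = k x powr (1 / \<beta>)" unfolding k_def powr_powr e ..
  also have "\<dots> = C * G (T x) powr (1 / \<theta>)" unfolding k_eq[OF x] powr_mult powr_powr e C_def ..
  finally show ?thesis using g_Y[OF \<rho> TinS[OF x]] by simp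
 qed
 have T_der: "(T has_real_derivative f x / G (T x)) (at x)" if x: "x \<in> ivl a b" for x proof -
  have "continuous_on (ivl a b) (\<lambda>x. f x / G (T x))"
   using G_neq[OF TinS] by (intro continuous_intros f_cont cont_GT) auto
  then have "continuous_on (ivl a b) (\<lambda>x. if x \<in> ivl a b then f x / G (T x) else 1)"
   by (simp cong: continuous_on_cong)
  from Tc.has_derivative[OF this x] show ?thesis using x by simp
 qed
 have "coordinate a b (\<lambda>x. f x powr (1 - \<alpha>) * h x powr \<alpha>) y"
 proof (rule coordinate_of_derivative[OF ab])
  fix x assume x: "x \<in> ivl a b"
  show "0 < f x powr (1 - \<alpha>) * h x powr \<alpha>" using fpos[OF x] hpos[OF x] by simp
  have "T x \<in> ivl (- \<rho>) \<rho>" using TinS[OF x] \<rho>(3) by simp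
  from Yc.has_derivative[OF _ this] have "(Y has_real_derivative wY (T x)) (at (T x))" using wY_continuous \<rho>(3) by simp
  from DERIV_cdivide[OF DERIV_chain2[OF this T_der[OF x]], of C]
  have d: "(y has_real_derivative wY (T x) * (f x / G (T x)) / C) (at x)" unfolding y_def[abs_def] .
  have "G (T x) powr (1 / \<theta>) * wY (T x) = G (T x) powr 1" using TinS[OF x] by (simp add: wY_def flip: powr_add)
  then have GT: "G (T x) = G (T x) powr (1 / \<theta>) * wY (T x)" using G_nonneg by simp
  have "wY (T x) * (f x / G (T x)) / C = wY (T x) * (f x / (G (T x) powr (1 / \<theta>) * wY (T x))) / C"
   using GT by metis
  also have "\<dots> = f x / (C * G (T x) powr (1 / \<theta>))" using wY_pos[of "T x"] by simp
  also have "\<dots> = f x / (f x / h x) powr \<alpha>" unfolding ratio[OF x] g_Y[OF \<rho> TinS[OF x]] ..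
  also have "\<dots> = f x powr (1 - \<alpha>) * h x powr \<alpha>" proof -
   have "(f x / h x) powr \<alpha> \<noteq> 0" using fpos[OF x] hpos[OF x] by simp
   then show ?thesis using escort_identities(1)[OF fpos[OF x] hpos[OF x], of \<alpha>] by (simp add: nonzero_divide_eq_eq mult.commute)
  qed
  finally show "(y has_real_derivative f x powr (1 - \<alpha>) * h x powr \<alpha>) (at x)" using d by simp
 qed measurable
 then interpret yc: coordinate a b "\<lambda>x. f x powr (1 - \<alpha>) * h x powr \<alpha>" y .
 have esc: "escort_coord \<alpha> (ivl a b) f h y" unfolding escort_coord_def using yc.integral_eq by blast
 obtain c' d' where supp: "support g = einterval c' d'" using g_support_einterval by metis
 have "AE x\<in>ivl a b in lborel. (f x / h x) powr \<alpha> = g (y x / (1 / C)) / (1 / C)"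
  using C by (simp add: ratio y_def mult.commute)
 note inv = inv_coord_of_ratio[OF ab f h \<alpha> esc g_meas g_nonneg supp g_integral _ this]
 have "inv_coord \<alpha> (ivl a b) h g y" "inv_radius \<alpha> g = C" using inv(1,3) C by auto
 moreover have "f x = inv_transform \<alpha> (ivl a b) h g y x" if x: "x \<in> ivl a b" for x proof -
  have "inv_transform \<alpha> (ivl a b) h g y x = ((f x / h x) powr \<alpha>) powr (1 / \<alpha>) * h x"
   unfolding inv_transform_def \<open>inv_radius \<alpha> g = C\<close> ratio[OF x] using x C by (simp add: y_def)
  also have "\<dots> = f x" using \<alpha> fpos[OF x] hpos[OF x] by (simp add: powr_powr)
  finally show ?thesis by simp
 qed
 ultimately show ?thesis by blast
qed

end

section \<open>The infimum for \<open>p = 1\<close>\<close>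

text \<open>The Beta function at (1 + e, 1 + e), that is, the integral of (u (1 - u))^e over (0,
  1).\<close>

definition beta_mass :: "real \<Rightarrow> real" where
 "beta_mass e = Gamma (1 + e) * Gamma (1 + e) / Gamma (2 + 2 * e)"

lemma beta_mass:
 assumes "-1 < e"
 shows "0 < beta_mass e" "(NN u:{0<..<1}. ennreal ((u * (1 - u)) powr e)) = ennreal (beta_mass e)"
proof -
 show "0 < beta_mass e" unfolding beta_mass_def using assms by (intro divide_pos_pos mult_pos_pos Gamma_real_pos) auto
 have "((\<lambda>u. u powr ((1 + e) - 1) * (1 - u) powr ((1 + e) - 1)) has_integral Beta (1 + e) (1 + e)) {0<..<1}"
  using has_integral_Beta_real[of "1 + e" "1 + e"] assms by (simp add: has_integral_Icc_iff_Ioo)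
 moreover have "1 + e + (1 + e) = 2 + 2 * e" by simp
 ultimately have "((\<lambda>u. (u * (1 - u)) powr e) has_integral beta_mass e) {0<..<1}"
  by (simp add: powr_mult Beta_def beta_mass_def)
 then show "(NN u:{0<..<1}. ennreal ((u * (1 - u)) powr e)) = ennreal (beta_mass e)"
  by (intro nn_integral_has_integral_lebesgue') auto
qed

lemma tendsto_beta_mass:
 assumes "(e \<longlongrightarrow> 0) F"
 shows "((\<lambda>n. beta_mass (e n)) \<longlongrightarrow> 1) F"
proof -
 have "((\<lambda>n. Gamma (1 + e n) * Gamma (1 + e n) / Gamma (2 + 2 * e n)) \<longlongrightarrow> Gamma (1 + 0) * Gamma (1 + 0) / Gamma (2 + 2 * 0)) F"
  by (intro tendsto_intros assms) (auto simp: Gamma_eq_zero_iff elim!: nonpos_Ints_cases)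
 moreover have "Gamma 2 = (1 :: real)" using Gamma_fact[of 1, where ?'a = real] by simp
 ultimately show ?thesis by (simp add: beta_mass_def)
qed

context stam_params
begin

text \<open>
 With \<open>H\<close> the distribution function of \<open>h\<close>, the densities proportional to \<open>h (H (1 - H))^\<delta>\<close> approach the
 infimum as \<open>\<delta> \<rightarrow> 0\<close>; the sign of \<open>\<delta>\<close> makes \<open>k\<close> vanish at both ends.
\<close>

lemma stam_near_minimizer:
 fixes a b :: ereal and h :: "real \<Rightarrow> real"
 assumes p1: "p = 1" and ab: "a < b" and h: "prob_density_on (ivl a b) h"
  and h_diff: "h differentiable_on ivl a b" and \<alpha>: "0 < \<alpha>"
  and \<delta>: "0 < \<delta> * \<beta>" "-1 < \<delta>" "-1 < \<delta> * rel_order lam \<alpha>"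
 obtains f where "stam_admissible p \<alpha> \<beta> lam (ivl a b) f h"
  "stam_lhs p \<alpha> \<beta> lam (ivl a b) f h \<le> ennreal ((\<alpha> * \<bar>\<beta>\<bar>) powr (- (1 / (l * \<alpha>))) *
   ((beta_mass (\<delta> * rel_order lam \<alpha>) / beta_mass \<delta> powr rel_order lam \<alpha>) powr (1 / (1 - l)) *
    (2 * ((1 / 4) powr (\<delta> * (\<alpha> * \<beta>)) * beta_mass \<delta> powr (- (\<alpha> * \<beta>)))) powr (1 / l)) powr (1 / \<alpha>))"
proof -
 note [measurable] = prob_density_onD(1)[OF h]
 note hpos = prob_density_onD(3)[OF h]
 have cont_h: "continuous_on (ivl a b) h" by (rule differentiable_imp_continuous_on[OF h_diff])
 obtain H where Hc: "coordinate a b h H" and HI: "H ` ivl a b = {0<..<1}"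
  by (rule density_cdf[OF ab prob_density_onD(1)[OF h] hpos prob_density_onD(4)[OF h]])
 interpret Hc: coordinate a b h H by (rule Hc)
 have H01: "0 < H x" "H x < 1" if "x \<in> ivl a b" for x using HI that by auto
 have H_der: "(H has_real_derivative h x) (at x)" if "x \<in> ivl a b" for x
  by (rule Hc.has_derivative[OF cont_h that])
 define s where "s x = H x * (1 - H x)" for x
 have spos: "0 < s x" if "x \<in> ivl a b" for x using H01[OF that] by (simp add: s_def)
 have s_der: "(s has_real_derivative h x * (1 - 2 * H x)) (at x)" if x: "x \<in> ivl a b" for x
  unfolding s_def[abs_def] using H_der[OF x] by (auto intro!: derivative_eq_intros simp: algebra_simps)
 have s_int: "(NN x:ivl a b. ennreal (s x powr e) * ennreal (h x)) = ennreal (beta_mass e)" if "-1 < e" for e proof -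
  have "(NN x:ivl a b. ennreal ((H x * (1 - H x)) powr e) * ennreal (h x)) = (NN u:{0<..<1}. ennreal ((u * (1 - u)) powr e))"
   unfolding HI[symmetric] by (rule Hc.pushforward) measurable
  then show ?thesis using beta_mass(2)[OF that] by (simp add: s_def)
 qed
 define Z where "Z = beta_mass \<delta>"
 have Z: "0 < Z" unfolding Z_def by (rule beta_mass(1)[OF \<delta>(2)])
 define f where "f x = (if x \<in> ivl a b then h x * s x powr \<delta> / Z else 0)" for x
 have f_eq: "f x = h x * s x powr \<delta> / Z" if "x \<in> ivl a b" for x using that by (simp add: f_def)
 have f: "prob_density_on (ivl a b) f"
 proof (rule prob_density_onI)
  define H' where "H' x = indicator (ivl a b) x * H x" for x
  have [measurable]: "H' \<in> borelfun" unfolding H'_def[abs_def] by (rule Hc.borel_measurable_indicator)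
  have "(\<lambda>x. if x \<in> ivl a b then h x * (H' x * (1 - H' x)) powr \<delta> / Z else 0) \<in> borelfun" by measurable
  also have "(\<lambda>x. if x \<in> ivl a b then h x * (H' x * (1 - H' x)) powr \<delta> / Z else 0) = f"
   by (auto simp: f_def H'_def s_def)
  finally show "f \<in> borelfun" .
  show "0 < f x" if "x \<in> ivl a b" for x using that hpos[OF that] spos[OF that] Z by (simp add: f_def)
  have "(NN x:ivl a b. ennreal (f x)) = (NN x. ennreal (1 / Z) * (ennreal (s x powr \<delta>) * ennreal (h x) * indicator (ivl a b) x))"
  proof (intro nn_integral_cong)
   fix x
   show "ennreal (f x) * indicator (ivl a b) x = ennreal (1 / Z) * (ennreal (s x powr \<delta>) * ennreal (h x) * indicator (ivl a b) x)"
    using less_imp_le[OF hpos[of x]] Z by (cases "x \<in> ivl a b") (simp_all add: f_def ennreal_mult[symmetric] mult_ac)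
  qed
  also have "\<dots> = ennreal (1 / Z) * (NN x:ivl a b. ennreal (s x powr \<delta>) * ennreal (h x))"
  proof (rule nn_integral_cmult)
   have "(\<lambda>x. ennreal ((H' x * (1 - H' x)) powr \<delta>) * ennreal (h x) * indicator (ivl a b) x) \<in> borel_measurable lborel" by measurable
   also have "(\<lambda>x. ennreal ((H' x * (1 - H' x)) powr \<delta>) * ennreal (h x) * indicator (ivl a b) x) = (\<lambda>x. ennreal (s x powr \<delta>) * ennreal (h x) * indicator (ivl a b) x)"
    by (auto simp: H'_def s_def indicator_def)
   finally show "\<dots> \<in> borel_measurable lborel" .
  qed
  also have "\<dots> = 1" unfolding s_int[OF \<delta>(2)] Z_def[symmetric] using Z by (simp add: ennreal_mult[symmetric])
  finally show "(NN x:ivl a b. ennreal (f x)) = 1" .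
 qed (simp add: f_def)
 have fpos: "0 < f x" if "x \<in> ivl a b" for x by (rule prob_density_onD(3)[OF f that])
 have f_diff: "f differentiable_on ivl a b" unfolding differentiable_on_eq_differentiable_at[OF open_einterval]
 proof
  fix x assume x: "x \<in> ivl a b"
  obtain h' where h': "(h has_real_derivative h') (at x)"
   using h_diff x by (auto simp: differentiable_on_eq_differentiable_at real_differentiable_def)
  have "((\<lambda>x. h x * s x powr \<delta> / Z) has_real_derivative (h x * (\<delta> * s x powr (\<delta> - real_of_nat 1) * (h x * (1 - 2 * H x))) + h' * s x powr \<delta>) / Z) (at x)"
   using DERIV_cdivide[OF DERIV_mult[OF h' DERIV_fun_powr[OF s_der[OF x] spos[OF x], of \<delta>]], of Z] by (simp add: algebra_simps)
  then have "(f has_real_derivative (h x * (\<delta> * s x powr (\<delta> - real_of_nat 1) * (h x * (1 - 2 * H x))) + h' * s x powr \<delta>) / Z) (at x)"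
   by (rule has_field_derivative_transform_within_open[OF _ open_einterval x]) (simp add: f_eq)
  then show "f differentiable at x" by (auto simp: real_differentiable_def)
 qed
 interpret stam_setting p \<beta> lam \<theta> l a b \<alpha> f h
  by unfold_locales (use ab f h f_diff h_diff \<alpha> in auto)
 define \<epsilon> where "\<epsilon> = \<delta> * (\<alpha> * \<beta>)"
 have "\<epsilon> = \<alpha> * (\<delta> * \<beta>)" by (simp add: \<epsilon>_def)
 then have \<epsilon>: "0 < \<epsilon>" using mult_pos_pos[OF \<alpha> \<delta>(1)] by simp
 define W where "W = Z powr (- (\<alpha> * \<beta>))"
 have W: "0 < W" using Z by (simp add: W_def)
 have ratio: "f x / h x = s x powr \<delta> / Z" if "x \<in> ivl a b" for x
  using hpos[OF that] by (simp add: f_eq[OF that])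
 have k_eq: "k x = s x powr \<epsilon> * W" if x: "x \<in> ivl a b" for x
  unfolding k_def ratio[OF x] W_def \<epsilon>_def using Z by (subst powr_divide) (simp_all add: powr_powr powr_minus divide_inverse)
 have dk_eq: "dk x = \<epsilon> * s x powr (\<epsilon> - 1) * h x * W * (1 - 2 * H x)" if x: "x \<in> ivl a b" for x
 proof (rule DERIV_unique[OF has_deriv(2)[OF x]])
  have "((\<lambda>x. s x powr \<epsilon> * W) has_real_derivative \<epsilon> * s x powr (\<epsilon> - real_of_nat 1) * (h x * (1 - 2 * H x)) * W) (at x)"
   by (rule DERIV_cmult_right[OF DERIV_fun_powr[OF s_der[OF x] spos[OF x]]])
  then have "(k has_real_derivative \<epsilon> * s x powr (\<epsilon> - real_of_nat 1) * (h x * (1 - 2 * H x)) * W) (at x)"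
   by (rule has_field_derivative_transform_within_open[OF _ open_einterval x]) (simp add: k_eq)
  then show "(k has_real_derivative \<epsilon> * s x powr (\<epsilon> - 1) * h x * W * (1 - 2 * H x)) (at x)" by (simp add: mult_ac)
 qed
 have "1 / 2 \<in> H ` ivl a b" unfolding HI by simp
 then obtain x0 where x0: "x0 \<in> ivl a b" "H x0 = 1 / 2" by force
 have nn: "0 \<le> \<epsilon> * s x powr (\<epsilon> - 1) * h x * W" if "x \<in> ivl a b" for x
  using \<epsilon> W hpos[OF that] by simp
 have sgn: "x \<le> x0 \<Longrightarrow> 0 \<le> dk x" "x0 \<le> x \<Longrightarrow> dk x \<le> 0" if x: "x \<in> ivl a b" for x
 proof -
  show "0 \<le> dk x" if "x \<le> x0"
   unfolding dk_eq[OF x] using Hc.mono(1)[OF x x0(1)] that x0(2) by (intro mult_nonneg_nonneg[OF nn[OF x]]) auto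
  show "dk x \<le> 0" if "x0 \<le> x"
   unfolding dk_eq[OF x] using Hc.mono(1)[OF x0(1) x] that x0(2) by (intro mult_nonneg_nonpos[OF nn[OF x]]) auto
 qed
 have small: "k x < e" if e: "0 < e" and x: "x \<in> ivl a b" and sx: "s x < (e / W) powr (1 / \<epsilon>)" for e x
 proof -
  have "s x powr \<epsilon> < ((e / W) powr (1 / \<epsilon>)) powr \<epsilon>" using \<epsilon> spos[OF x] sx by (intro powr_less_mono2) auto
  then have "s x powr \<epsilon> < e / W" using \<epsilon> e W by (simp add: powr_powr)
  then show ?thesis unfolding k_eq[OF x] using W by (simp add: field_simps)
 qed
 have right: "\<exists>t\<in>ivl a b. x < t \<and> k t < e" if e: "0 < e" and x: "x \<in> ivl a b" for e x proof -
  define \<eta> where "\<eta> = (e / W) powr (1 / \<epsilon>)"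
  have \<eta>: "0 < \<eta>" using e W by (simp add: \<eta>_def)
  obtain v where v: "max (H x) (1 - \<eta>) < v" "v < 1" using dense[of "max (H x) (1 - \<eta>)" 1] H01[OF x] \<eta> by auto
  then have "v \<in> H ` ivl a b" unfolding HI using H01[OF x] by auto
  then obtain t where t: "t \<in> ivl a b" "v = H t" by blast
  have "H t * (1 - H t) \<le> 1 * (1 - H t)" using H01[OF t(1)] by (intro mult_right_mono) auto
  also have "1 * (1 - H t) < \<eta>" using v t by simp
  finally have "s t < \<eta>" by (simp only: s_def)
  then show ?thesis using t v Hc.mono(2)[OF x t(1)] small[OF e t(1)] by (auto simp: \<eta>_def)
 qed
 have left: "\<exists>t\<in>ivl a b. t < x \<and> k t < e" if e: "0 < e" and x: "x \<in> ivl a b" for e x proof -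
  define \<eta> where "\<eta> = (e / W) powr (1 / \<epsilon>)"
  have \<eta>: "0 < \<eta>" using e W by (simp add: \<eta>_def)
  obtain v where v: "0 < v" "v < min (H x) \<eta>" using dense[of 0 "min (H x) \<eta>"] H01[OF x] \<eta> by auto
  then have "v \<in> H ` ivl a b" unfolding HI using H01[OF x] by auto
  then obtain t where t: "t \<in> ivl a b" "v = H t" by blast
  have "H t * (1 - H t) \<le> H t * 1" using H01[OF t(1)] by (intro mult_left_mono) auto
  also have "H t * 1 < \<eta>" using v t by simp
  finally have "s t < \<eta>" by (simp only: s_def)
  then show ?thesis using t v Hc.mono(2)[OF t(1) x] small[OF e t(1)] by (auto simp: \<eta>_def)
 qed
 obtain y where esc: "escort_coord \<alpha> (ivl a b) f h y" proof -
  have cont: "continuous_on (ivl a b) (\<lambda>x. f x powr (1 - \<alpha>) * h x powr \<alpha>)"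
   using fpos hpos by (intro continuous_intros differentiable_imp_continuous_on[OF f_diff] cont_h) fastforce+
  have "\<exists>y. \<forall>x. a < ereal x \<longrightarrow> ereal x < b \<longrightarrow> (y has_vector_derivative f x powr (1 - \<alpha>) * h x powr \<alpha>) (at x)"
  proof (rule einterval_antiderivative[OF ab])
   fix x assume "a < ereal x" "ereal x < b"
   then have "x \<in> ivl a b" by (simp add: einterval_iff)
   then show "isCont (\<lambda>x. f x powr (1 - \<alpha>) * h x powr \<alpha>) x"
    using cont by (simp add: continuous_on_eq_continuous_at)
  qed
  then obtain y where y: "\<And>x. x \<in> ivl a b \<Longrightarrow> (y has_real_derivative f x powr (1 - \<alpha>) * h x powr \<alpha>) (at x)"
   by (auto simp: einterval_iff has_real_derivative_iff_has_vector_derivative)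
  interpret yc: coordinate a b "\<lambda>x. f x powr (1 - \<alpha>) * h x powr \<alpha>" y
  proof (rule coordinate_of_derivative[OF ab _ _ y])
   show "0 < f x powr (1 - \<alpha>) * h x powr \<alpha>" if "x \<in> ivl a b" for x
    using fpos[OF that] hpos[OF that] by simp
  qed measurable
  show thesis by (rule that[of y]) (use yc.integral_eq in \<open>auto simp: escort_coord_def\<close>)
 qed
 have reg: "stam_regular \<theta> (y ` ivl a b) (rel_escort \<alpha> (ivl a b) f h y)"
  by (rule unimodal_regular[OF esc x0(1) sgn right left])
 have sig1: "sig = 1"
  unfolding sig_def gaussian_sigma_def unfolding p1 hconj_def using gaussian_sup_moment(1)[OF l_pos] by simp
 \<comment> \<open>Twice the maximum of \<open>k\<close>, attained at the median of
   \<open>h\<close>, where H = 1/2 and s = 1/4; by unimodality it bounds the variation.\<close>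
 define Xb where "Xb = 2 * ((1 / 4) powr \<epsilon> * W)"
 have Xb: "0 < Xb" using W by (simp add: Xb_def)
 have "ennreal (\<alpha> * \<bar>\<beta>\<bar>) * F = (NN x:ivl a b. ennreal ((\<bar>dk x\<bar> / f x) powr p * f x))"
  unfolding F_eq using p1 \<alpha> by simp
 also have "\<dots> = (NN x:ivl a b. ennreal \<bar>dk x\<bar>)"
 proof (rule nn_set_cong)
  fix x assume xA: "x \<in> ivl a b"
  show "ennreal ((\<bar>dk x\<bar> / f x) powr p * f x) = ennreal \<bar>dk x\<bar>"
   using xA fpos[of x] p1 by simp_all
 qed
 also have "\<dots> \<le> ennreal (2 * k x0)"
  by (rule unimodal_variation(2)[OF ab has_deriv(2) less_imp_le[OF kpos] x0(1) sgn])
 also have "2 * k x0 = Xb" unfolding k_eq[OF x0(1)] s_def x0(2) Xb_def by simp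
 finally have FX: "ennreal (\<alpha> * \<bar>\<beta>\<bar>) * F \<le> ennreal Xb" .
 have ab0: "0 < \<alpha> * \<bar>\<beta>\<bar>" using \<alpha> beta(2) by simp
 have "F \<noteq> \<infinity>"
 proof
  assume "F = \<infinity>"
  then have "ennreal (\<alpha> * \<bar>\<beta>\<bar>) * F = \<infinity>" using \<alpha> beta(2) by (simp add: ennreal_mult_top)
  then show False using FX by (simp add: top_unique)
 qed
 then have Ffin: "F < \<infinity>" by (simp add: top.not_eq_extremum)
 obtain T where T: "coordinate a b (\<lambda>x. if x \<in> ivl a b then f x / G (T x) else 1) T" "T ` ivl a b = S"
  using transport_G .
 \<comment> \<open>Invoked here for the positivity of the divergence.\<close>
 obtain \<Phi> where \<Phi>: "F = ennreal \<Phi>" "0 < \<Phi>"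
  by (rule stam_core_application[OF T Ffin right left]) (assumption | rule that)+
 have XX: "\<alpha> * \<bar>\<beta>\<bar> * sig * \<Phi> powr (1 / p) \<le> Xb"
  using FX Xb ab0 \<Phi> p1 sig1 unfolding \<Phi>(1) by (simp add: ennreal_mult[symmetric])
 define \<xi> where "\<xi> = rel_order lam \<alpha>"
 define \<mu> where "\<mu> = beta_mass (\<delta> * \<xi>) / Z powr \<xi>"
 have \<mu>: "0 < \<mu>" unfolding \<mu>_def \<xi>_def using beta_mass(1)[OF \<delta>(3)] Z by simp
 have I: "I = ennreal \<mu>" proof -
  have "I = (NN x. ennreal (1 / Z powr \<xi>) * (ennreal (s x powr (\<delta> * \<xi>)) * ennreal (h x) * indicator (ivl a b) x))"
   unfolding I_def renyi_integral_def \<xi>_def[symmetric]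
  proof (intro nn_integral_cong)
   fix x
   show "ennreal (f x powr \<xi> * h x powr (1 - \<xi>)) * indicator (ivl a b) x =
    ennreal (1 / Z powr \<xi>) * (ennreal (s x powr (\<delta> * \<xi>)) * ennreal (h x) * indicator (ivl a b) x)"
   proof (cases "x \<in> ivl a b")
    case True
    have "f x = (s x powr \<delta> / Z) * h x" using f_eq[OF True] by simp
    then have "f x powr \<xi> * h x powr (1 - \<xi>) = (s x powr \<delta> / Z) powr \<xi> * (h x powr \<xi> * h x powr (1 - \<xi>))"
     by (simp only: powr_mult mult.assoc)
    also have "h x powr \<xi> * h x powr (1 - \<xi>) = h x" using hpos[OF True] by (simp flip: powr_add)
    also have "(s x powr \<delta> / Z) powr \<xi> = s x powr (\<delta> * \<xi>) / Z powr \<xi>"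
     using Z by (subst powr_divide) (simp_all add: powr_powr)
    finally show ?thesis using True less_imp_le[OF hpos[OF True]] by (simp add: ennreal_mult[symmetric])
   qed simp
  qed
  also have "\<dots> = ennreal (1 / Z powr \<xi>) * (NN x:ivl a b. ennreal (s x powr (\<delta> * \<xi>)) * ennreal (h x))"
  proof (rule nn_integral_cmult)
   define H' where "H' x = indicator (ivl a b) x * H x" for x
   have [measurable]: "H' \<in> borelfun" unfolding H'_def[abs_def] by (rule Hc.borel_measurable_indicator)
   have "(\<lambda>x. ennreal ((H' x * (1 - H' x)) powr (\<delta> * \<xi>)) * ennreal (h x) * indicator (ivl a b) x) \<in> borel_measurable lborel" by measurable
   also have "(\<lambda>x. ennreal ((H' x * (1 - H' x)) powr (\<delta> * \<xi>)) * ennreal (h x) * indicator (ivl a b) x) = (\<lambda>x. ennreal (s x powr (\<delta> * \<xi>)) * ennreal (h x) * indicator (ivl a b) x)"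
    by (auto simp: H'_def s_def indicator_def)
   finally show "\<dots> \<in> borel_measurable lborel" .
  qed
  also have "\<dots> = ennreal \<mu>"
   unfolding \<xi>_def s_int[OF \<delta>(3)] \<mu>_def using beta_mass(1)[OF \<delta>(3)] by (simp add: ennreal_mult[symmetric])
  finally show ?thesis .
 qed
 show thesis
 proof (rule that)
  show "stam_admissible p \<alpha> \<beta> lam (ivl a b) f h" by (rule admissibleI[OF I \<mu> \<Phi> esc reg])
  define X where "X = \<alpha> * \<bar>\<beta>\<bar> * sig * \<Phi> powr (1 / p)"
  have e3: "l * (1 / (l * (1 - l))) = 1 / (1 - l)" "(1 - l) * (1 / (l * (1 - l))) = 1 / l" using l_pos by auto
  have "stam_lhs p \<alpha> \<beta> lam (ivl a b) f h = ennreal (\<kappa> * (\<mu> powr (1 / (1 - l)) * X powr (1 / l)) powr (1 / \<alpha>))"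
   unfolding stam_lhs_value[OF I \<mu> \<Phi>] X_def[symmetric] powr_mult powr_powr e3 ..
  also have "\<dots> \<le> ennreal (\<kappa> * (\<mu> powr (1 / (1 - l)) * Xb powr (1 / l)) powr (1 / \<alpha>))"
  proof (intro ennreal_leI mult_left_mono powr_mono2)
   show "X \<le> Xb" using XX by (simp add: X_def)
   show "0 \<le> X" unfolding X_def using ab0 sig_pos by simp
  qed (use \<alpha> l_pos in \<open>auto simp: \<kappa>_def\<close>)
  also have "\<kappa> = (\<alpha> * \<bar>\<beta>\<bar>) powr (- (1 / (l * \<alpha>)))" by (simp add: \<kappa>_def sig1)
  finally show "stam_lhs p \<alpha> \<beta> lam (ivl a b) f h \<le> ennreal ((\<alpha> * \<bar>\<beta>\<bar>) powr (- (1 / (l * \<alpha>))) *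
   ((beta_mass (\<delta> * rel_order lam \<alpha>) / beta_mass \<delta> powr rel_order lam \<alpha>) powr (1 / (1 - l)) *
    (2 * ((1 / 4) powr (\<delta> * (\<alpha> * \<beta>)) * beta_mass \<delta> powr (- (\<alpha> * \<beta>)))) powr (1 / l)) powr (1 / \<alpha>))"
   unfolding \<mu>_def Xb_def W_def Z_def \<epsilon>_def \<xi>_def .
 qed
qed

text \<open>As \<delta> tends to 0, both Beta integrals and the power of 1/4 tend to 1, and the
  bounds of \<open>stam_near_minimizer\<close> converge to the right side of (ii).\<close>

lemma stam_infimum_le:
 fixes a b :: ereal and h :: "real \<Rightarrow> real"
 assumes p1: "p = 1" and ab: "a < b" and h: "prob_density_on (ivl a b) h"
  and h_diff: "h differentiable_on ivl a b" and \<alpha>: "0 < \<alpha>"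
 shows "(INF f\<in>{f. stam_admissible p \<alpha> \<beta> lam (ivl a b) f h}. stam_lhs p \<alpha> \<beta> lam (ivl a b) f h)
  \<le> stam_rhs p \<alpha> \<beta> lam" proof -
 \<comment> \<open>With f = h, to have \<open>\<kappa>\<close> and \<open>stam_rhs_value\<close>
   available.\<close>
 interpret stam_setting p \<beta> lam \<theta> l a b \<alpha> h h by unfold_locales (use ab h h_diff \<alpha> in auto)
 define J where "J = (INF f\<in>{f. stam_admissible p \<alpha> \<beta> lam (ivl a b) f h}. stam_lhs p \<alpha> \<beta> lam (ivl a b) f h)"
 define B where "B \<delta> = (\<alpha> * \<bar>\<beta>\<bar>) powr (- (1 / (l * \<alpha>))) *
   ((beta_mass (\<delta> * rel_order lam \<alpha>) / beta_mass \<delta> powr rel_order lam \<alpha>) powr (1 / (1 - l)) *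
    (2 * ((1 / 4) powr (\<delta> * (\<alpha> * \<beta>)) * beta_mass \<delta> powr (- (\<alpha> * \<beta>)))) powr (1 / l)) powr (1 / \<alpha>)" for \<delta>
 define \<delta> where "\<delta> n = sgn \<beta> / real (Suc n)" for n
 have d0: "\<delta> \<longlonglongrightarrow> 0" proof -
  have "(\<lambda>n. sgn \<beta> * (1 / real (Suc n))) \<longlonglongrightarrow> sgn \<beta> * 0"
   by (intro tendsto_intros LIMSEQ_Suc[OF lim_1_over_n])
  then show ?thesis by (simp add: \<delta>_def[abs_def])
 qed
 have d0': "(\<lambda>n. \<delta> n * c) \<longlonglongrightarrow> 0" for c using tendsto_mult_right[OF d0, of c] by (simp add: mult.commute)
 have "(\<lambda>n. B (\<delta> n)) \<longlonglongrightarrow> (\<alpha> * \<bar>\<beta>\<bar>) powr (- (1 / (l * \<alpha>))) *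
   ((1 / 1 powr rel_order lam \<alpha>) powr (1 / (1 - l)) * (2 * ((1 / 4) powr 0 * 1 powr (- (\<alpha> * \<beta>)))) powr (1 / l)) powr (1 / \<alpha>)"
  unfolding B_def by (intro tendsto_intros tendsto_beta_mass d0 d0') auto
 \<comment> \<open>The factor 2 counts the rise and the fall of \<open>k\<close>; it matches m =
   2^(1-l) for the uniform density on (-1, 1).\<close>
 moreover have "(2::real) powr (1 / l) = m powr (1 / (l * (1 - l)))" proof -
  have "m = 2 powr (1 - l)" unfolding m_def unfolding p1 by (rule gaussian_sup_moment(3)[OF l_pos])
  then show ?thesis using l_pos by (simp add: powr_powr)
 qed
 moreover have "sig = 1"
  unfolding sig_def gaussian_sigma_def unfolding p1 hconj_def using gaussian_sup_moment(1)[OF l_pos] by simp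
 ultimately have "(\<lambda>n. B (\<delta> n)) \<longlonglongrightarrow> \<kappa> * (m powr (1 / (l * (1 - l)))) powr (1 / \<alpha>)"
  by (simp add: \<kappa>_def)
 then have lim: "(\<lambda>n. ennreal (B (\<delta> n))) \<longlonglongrightarrow> stam_rhs p \<alpha> \<beta> lam"
  unfolding stam_rhs_value by (rule tendsto_ennrealI)
 have ev: "eventually (\<lambda>n. -1 < \<delta> n) sequentially" "eventually (\<lambda>n. -1 < \<delta> n * rel_order lam \<alpha>) sequentially"
  by (rule order_tendstoD(1)[OF d0], simp, rule order_tendstoD(1)[OF d0'], simp)
 have "J \<le> stam_rhs p \<alpha> \<beta> lam"
 proof (rule tendsto_lowerbound[OF lim _ sequentially_bot])
  show "eventually (\<lambda>n. J \<le> ennreal (B (\<delta> n))) sequentially" using ev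
  proof eventually_elim
   case (elim n)
   have "0 < \<delta> n * \<beta>" using beta(2) by (simp add: \<delta>_def sgn_mult_self_eq[symmetric] sgn_if)
   then obtain f where "stam_admissible p \<alpha> \<beta> lam (ivl a b) f h"
    "stam_lhs p \<alpha> \<beta> lam (ivl a b) f h \<le> ennreal (B (\<delta> n))"
    using stam_near_minimizer[OF p1 ab h h_diff \<alpha> _ elim] unfolding B_def by metis
   then show ?case unfolding J_def by (metis (mono_tags, lifting) INF_lower2 mem_Collect_eq)
  qed
 qed
 then show ?thesis by (simp add: J_def)
qed

end

text \<open>Dividing (1 + q) \<beta> - \<theta> by \<theta> turns equality of the signs into
  \<beta>/\<theta> > 1/(1 + q). For p = 1 the term \<infinity> \<beta> decides the sign unless
  \<beta> = 0, and then the condition would compare \<lambda> - 1 with 1 - \<lambda>.\<close>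

lemma stam_paramsI:
 assumes p: "1 \<le> p" and lam: "lam \<noteq> 1"
  and sgn: "sgn (hconj p * ereal \<beta> + ereal lam - 1) = sgn (ereal (\<beta> + 1 - lam))" "sgn (ereal (\<beta> + 1 - lam)) \<noteq> 0"
 shows "stam_params p \<beta> lam (1 + \<beta> - lam) (\<beta> / (1 + \<beta> - lam))"
proof -
 define \<theta> where "\<theta> = 1 + \<beta> - lam"
 have \<theta>': "\<beta> + 1 - lam = \<theta>" by (simp add: \<theta>_def)
 have \<theta>0: "\<theta> \<noteq> 0" using sgn(2) unfolding \<theta>' by auto
 have ne1: "\<beta> / \<theta> \<noteq> 1" using \<theta>0 lam by (simp add: \<theta>_def)
 have "me_range p (\<beta> / \<theta>)"
 proof (cases "p = 1")
  case True
  have "0 < \<beta> / \<theta>"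
  proof (cases \<beta> "0 :: real" rule: linorder_cases)
   case less
   then have "sgn (hconj p * ereal \<beta> + ereal lam - 1) = -1" using True by (simp add: hconj_def one_ereal_def)
   then have "sgn \<theta> = -1" using sgn(1) unfolding \<theta>' by (simp add: one_ereal_def)
   then show ?thesis using less by (simp add: sgn_1_neg zero_less_divide_iff)
  next
   case equal
   then have "ereal (sgn (lam - 1)) = ereal (sgn \<theta>)"
    using sgn(1) unfolding \<theta>' by (simp add: zero_ereal_def[symmetric] one_ereal_def)
   then have "sgn (lam - 1) = sgn (1 - lam)" using equal by (simp add: \<theta>_def)
   then show ?thesis using lam by (auto simp: sgn_if split: if_splits)
  next
   case greater
   then have "sgn (hconj p * ereal \<beta> + ereal lam - 1) = 1" using True by (simp add: hconj_def)
   then have "sgn \<theta> = 1" using sgn(1) unfolding \<theta>' by simp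
   then show ?thesis using greater by (simp add: sgn_1_pos)
  qed
  then show ?thesis using True ne1 by (simp add: me_range_def hconj_def)
 next
  case False
  define q where "q = p / (p - 1)"
  have q: "0 < q" using p False by (simp add: q_def)
  have hq: "hconj p = ereal q" using False by (simp add: hconj_def q_def)
  have "sgn (q * \<beta> + lam - 1) = sgn \<theta>" using sgn(1) unfolding \<theta>' hq by (simp add: one_ereal_def)
  moreover have "q * \<beta> + lam - 1 = (1 + q) * \<beta> - \<theta>" by (simp add: \<theta>_def algebra_simps)
  ultimately have "sgn ((1 + q) * \<beta> - \<theta>) = sgn \<theta>" by simp
  then have "1 / (1 + q) < \<beta> / \<theta>"
   using q \<theta>0 by (cases "0 < \<theta>") (auto simp: sgn_if field_simps split: if_splits)
  then show ?thesis using q ne1 unfolding me_range_def hq by (simp add: one_ereal_def)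
 qed
 then show ?thesis using p \<theta>0 unfolding stam_params_def \<theta>_def by simp
qed

section \<open>Assembly of the statements on minimizers and sharpness\<close>

context stam_params
begin

lemma stam_theorem:
 fixes a b :: ereal and h :: "real \<Rightarrow> real"
 assumes ab: "a < b" and h: "prob_density_on (ivl a b) h"
  and h_diff: "h differentiable_on ivl a b" and \<alpha>: "0 < \<alpha>"
 defines "D \<equiv> stam_density p \<beta> lam"
 shows "stam_admissible p \<alpha> \<beta> lam (ivl a b) f h \<Longrightarrow>
   stam_rhs p \<alpha> \<beta> lam \<le> stam_lhs p \<alpha> \<beta> lam (ivl a b) f h"
  and "renyi_power ((\<alpha> - 1) / \<alpha>) D < \<infinity> \<Longrightarrow>
   (INF f\<in>{f. stam_admissible p \<alpha> \<beta> lam (ivl a b) f h}. stam_lhs p \<alpha> \<beta> lam (ivl a b) f h)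
    = stam_rhs p \<alpha> \<beta> lam"
  and "renyi_power ((\<alpha> - 1) / \<alpha>) D < \<infinity> \<Longrightarrow> \<exists>y. inv_coord \<alpha> (ivl a b) h D y"
  and "renyi_power ((\<alpha> - 1) / \<alpha>) D < \<infinity> \<Longrightarrow> 1 < p \<Longrightarrow> inv_coord \<alpha> (ivl a b) h D y \<Longrightarrow>
   stam_admissible p \<alpha> \<beta> lam (ivl a b) (inv_transform \<alpha> (ivl a b) h D y) h \<and>
   stam_lhs p \<alpha> \<beta> lam (ivl a b) (inv_transform \<alpha> (ivl a b) h D y) h = stam_rhs p \<alpha> \<beta> lam"
  and "stam_admissible p \<alpha> \<beta> lam (ivl a b) f h \<Longrightarrow>
   stam_lhs p \<alpha> \<beta> lam (ivl a b) f h = stam_rhs p \<alpha> \<beta> lam \<Longrightarrow>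
   \<exists>y. inv_coord \<alpha> (ivl a b) h D y \<and> (\<forall>x\<in>ivl a b. f x = inv_transform \<alpha> (ivl a b) h D y x)"
proof -
 have D: "D = g" by (simp add: D_def g_def)
 have setting: "stam_setting p \<beta> lam \<theta> l a b \<alpha> f h" if "stam_admissible p \<alpha> \<beta> lam (ivl a b) f h" for f
  by unfold_locales (use that ab h h_diff \<alpha> in \<open>auto simp: stam_admissible_def\<close>)
 show le: "stam_rhs p \<alpha> \<beta> lam \<le> stam_lhs p \<alpha> \<beta> lam (ivl a b) f h" if "stam_admissible p \<alpha> \<beta> lam (ivl a b) f h" for f
  by (rule stam_setting.stam_inequality(1)[OF setting[OF that] that])
 show "\<exists>y. inv_coord \<alpha> (ivl a b) h D y \<and> (\<forall>x\<in>ivl a b. f x = inv_transform \<alpha> (ivl a b) h D y x)"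
  if "stam_admissible p \<alpha> \<beta> lam (ivl a b) f h" "stam_lhs p \<alpha> \<beta> lam (ivl a b) f h = stam_rhs p \<alpha> \<beta> lam"
  unfolding D by (rule stam_setting.stam_minimizer_unique[OF setting[OF that(1)] that])
 assume "renyi_power ((\<alpha> - 1) / \<alpha>) D < \<infinity>"
 then have fin: "renyi_power ((\<alpha> - 1) / \<alpha>) g < \<infinity>" unfolding D .
 show min: "stam_admissible p \<alpha> \<beta> lam (ivl a b) (inv_transform \<alpha> (ivl a b) h D y) h \<and>
   stam_lhs p \<alpha> \<beta> lam (ivl a b) (inv_transform \<alpha> (ivl a b) h D y) h = stam_rhs p \<alpha> \<beta> lam"
  if "1 < p" "inv_coord \<alpha> (ivl a b) h D y" for y
  using stam_minimizer[OF _ ab h h_diff \<alpha> fin that(2)[unfolded D] refl] that(1) unfolding D by simp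
 show ex: "\<exists>y. inv_coord \<alpha> (ivl a b) h D y" proof -
  obtain c d where cd: "c < d" "support g = ivl c d" using g_support_einterval .
  show ?thesis unfolding D by (rule inv_coord_exists[OF ab h g_meas g_nonneg cd(2,1) \<alpha> fin])
 qed
 show "(INF f\<in>{f. stam_admissible p \<alpha> \<beta> lam (ivl a b) f h}. stam_lhs p \<alpha> \<beta> lam (ivl a b) f h)
   = stam_rhs p \<alpha> \<beta> lam"
 proof (rule antisym)
  show "(INF f\<in>{f. stam_admissible p \<alpha> \<beta> lam (ivl a b) f h}. stam_lhs p \<alpha> \<beta> lam (ivl a b) f h) \<le> stam_rhs p \<alpha> \<beta> lam"
  proof (cases "p = 1")
   case True
   then show ?thesis by (rule stam_infimum_le[OF _ ab h h_diff \<alpha>])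
  next
   case False
   then have "1 < p" using p by simp
   obtain y where "inv_coord \<alpha> (ivl a b) h D y" using ex by blast
   then show ?thesis
    using min[OF \<open>1 < p\<close>, of y] by (intro INF_lower2[of "inv_transform \<alpha> (ivl a b) h D y"]) auto
  qed
 qed (use le in \<open>auto intro: INF_greatest\<close>)
qed

end

theorem theorem4p1:
  fixes a b :: ereal and \<Omega> :: "real set" and h :: "real \<Rightarrow> real" and p \<alpha> lam :: real
  assumes "a < b" and "\<Omega> = einterval a b"
    and "prob_density_on \<Omega> h"
    and "lam \<noteq> 1" and "0 < \<alpha>"
  shows
    "(0 \<le> hconj p \<and> 1 / (1 + hconj p) < ereal lam \<longrightarrow>
        (\<forall>f. prob_density_on \<Omega> f \<longrightarrow>
           (moment_entropy_defined p \<alpha> lam \<Omega> f h (canonical_coord \<alpha> a f h) \<longrightarrow>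
              epowr (K0 p lam) (1 / \<alpha>)
                \<le> moment_entropy_lhs p \<alpha> lam \<Omega> f h (canonical_coord \<alpha> a f h)) \<and>
           (\<forall>y. escort_coord \<alpha> \<Omega> f h y \<and>
                moment_entropy_defined p \<alpha> lam \<Omega> f h (\<lambda>x. ennreal \<bar>y x\<bar>) \<longrightarrow>
              epowr (K0 p lam) (1 / \<alpha>) \<le> moment_entropy_lhs p \<alpha> lam \<Omega> f h (\<lambda>x. ennreal \<bar>y x\<bar>))) \<and>
        (renyi_power ((\<alpha> - 1) / \<alpha>) (stretched_gaussian p lam) < \<infinity> \<longrightarrow>
           (\<exists>y. inv_coord \<alpha> \<Omega> h (stretched_gaussian p lam) y) \<and>
           (\<forall>y. inv_coord \<alpha> \<Omega> h (stretched_gaussian p lam) y \<longrightarrow>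
              (let f = inv_transform \<alpha> \<Omega> h (stretched_gaussian p lam) y in
                 prob_density_on \<Omega> f \<and> escort_coord \<alpha> \<Omega> f h y \<and>
                 moment_entropy_defined p \<alpha> lam \<Omega> f h (\<lambda>x. ennreal \<bar>y x\<bar>) \<and>
                 moment_entropy_lhs p \<alpha> lam \<Omega> f h (\<lambda>x. ennreal \<bar>y x\<bar>)
                   = epowr (K0 p lam) (1 / \<alpha>))) \<and>
           (\<forall>f y. prob_density_on \<Omega> f \<and> escort_coord \<alpha> \<Omega> f h y \<and>
                  moment_entropy_defined p \<alpha> lam \<Omega> f h (\<lambda>x. ennreal \<bar>y x\<bar>) \<and>
                  moment_entropy_lhs p \<alpha> lam \<Omega> f h (\<lambda>x. ennreal \<bar>y x\<bar>)
                    = epowr (K0 p lam) (1 / \<alpha>) \<longrightarrow>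
              inv_coord \<alpha> \<Omega> h (stretched_gaussian p lam) y \<and>
              (AE x in lborel. x \<in> \<Omega> \<longrightarrow>
                 f x = inv_transform \<alpha> \<Omega> h (stretched_gaussian p lam) y x))))
     \<and>
     (\<forall>\<beta>. 1 \<le> p \<and> h differentiable_on \<Omega> \<and>
          sgn (hconj p * ereal \<beta> + ereal lam - 1) = sgn (ereal (\<beta> + 1 - lam)) \<and>
          sgn (ereal (\<beta> + 1 - lam)) \<noteq> 0 \<longrightarrow>
        (\<forall>f. stam_admissible p \<alpha> \<beta> lam \<Omega> f h \<longrightarrow>
             stam_rhs p \<alpha> \<beta> lam \<le> stam_lhs p \<alpha> \<beta> lam \<Omega> f h) \<and>
        (renyi_power ((\<alpha> - 1) / \<alpha>) (stam_density p \<beta> lam) < \<infinity> \<longrightarrow>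
           (INF f\<in>{f. stam_admissible p \<alpha> \<beta> lam \<Omega> f h}. stam_lhs p \<alpha> \<beta> lam \<Omega> f h)
             = stam_rhs p \<alpha> \<beta> lam \<and>
           (1 < p \<longrightarrow>
              (\<exists>y. inv_coord \<alpha> \<Omega> h (stam_density p \<beta> lam) y) \<and>
              (\<forall>y. inv_coord \<alpha> \<Omega> h (stam_density p \<beta> lam) y \<longrightarrow>
                 (let f = inv_transform \<alpha> \<Omega> h (stam_density p \<beta> lam) y in
                    stam_admissible p \<alpha> \<beta> lam \<Omega> f h \<and>
                    stam_lhs p \<alpha> \<beta> lam \<Omega> f h = stam_rhs p \<alpha> \<beta> lam)) \<and>
              (\<forall>f. stam_admissible p \<alpha> \<beta> lam \<Omega> f h \<and>
                   stam_lhs p \<alpha> \<beta> lam \<Omega> f h = stam_rhs p \<alpha> \<beta> lam \<longrightarrow>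
                 (\<exists>y. inv_coord \<alpha> \<Omega> h (stam_density p \<beta> lam) y \<and>
                      (\<forall>x\<in>\<Omega>. f x = inv_transform \<alpha> \<Omega> h (stam_density p \<beta> lam) y x))))))"
proof -
 note ab = assms(1) and h = assms(3)[unfolded assms(2)] and \<alpha> = assms(5)
 have range: "me_range p lam" if "0 \<le> hconj p \<and> 1 / (1 + hconj p) < ereal lam"
  using that assms(4) by (simp add: me_range_def)
 have params: "stam_params p \<beta> lam (1 + \<beta> - lam) (\<beta> / (1 + \<beta> - lam))"
  if "1 \<le> p \<and> h differentiable_on ivl a b \<and>
   sgn (hconj p * ereal \<beta> + ereal lam - 1) = sgn (ereal (\<beta> + 1 - lam)) \<and> sgn (ereal (\<beta> + 1 - lam)) \<noteq> 0" for \<beta>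
  using that assms(4) by (intro stam_paramsI) auto
 note minimizer = moment_entropy_minimizer(2)[OF ab h range \<alpha> _ _ refl]
 note stam = stam_params.stam_theorem[OF params ab h _ \<alpha>]
 have unique: "inv_coord \<alpha> (ivl a b) h (stretched_gaussian p lam) y"
   "AE x\<in>ivl a b in lborel. f x = inv_transform \<alpha> (ivl a b) h (stretched_gaussian p lam) y x"
  if range: "me_range p lam" and fy: "prob_density_on (ivl a b) f \<and> escort_coord \<alpha> (ivl a b) f h y \<and>
   moment_entropy_defined p \<alpha> lam (ivl a b) f h (\<lambda>x. ennreal \<bar>y x\<bar>) \<and>
   moment_entropy_lhs p \<alpha> lam (ivl a b) f h (\<lambda>x. ennreal \<bar>y x\<bar>) = epowr (K0 p lam) (1 / \<alpha>)" for f y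
 proof -
  obtain t where t: "0 < t"
   "AE x\<in>ivl a b in lborel. (f x / h x) powr \<alpha> = stretched_gaussian p lam (y x / t) / t"
   using moment_entropy_inequality(2)[OF ab _ h range \<alpha>] fy by blast
  obtain \<rho> where "support (stretched_gaussian p lam) = ivl (- \<rho>) \<rho>"
   using stretched_profile_support[OF range] unfolding support_stretched_gaussian[OF range] .
  note inv_coord_of_ratio[OF ab _ h \<alpha> _ stretched_gaussian_measurable stretched_gaussian_nonneg[OF range] this
    stretched_gaussian_nn_integral[OF range] t]
  with fy show "inv_coord \<alpha> (ivl a b) h (stretched_gaussian p lam) y"
   "AE x\<in>ivl a b in lborel. f x = inv_transform \<alpha> (ivl a b) h (stretched_gaussian p lam) y x" by blast+
 qed
 show ?thesis unfolding assms(2) Let_def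
 proof (intro conjI allI impI, goal_cases)
  case (1 f)
  then show ?case using moment_entropy_canonical[OF ab _ h range \<alpha>] by simp
 next
  case (2 f y)
  then show ?case using moment_entropy_inequality(1)[OF ab _ h range \<alpha>] by simp
 next
  case 3
  then show ?case using moment_entropy_minimizer(1)[OF ab h range \<alpha>] by simp
 next
  case (4 y)
  then show ?case using minimizer by simp
 next
  case (5 y)
  then show ?case using minimizer by simp
 next
  case (6 y)
  then show ?case using minimizer by simp
 next
  case (7 y)
  then show ?case using minimizer by simp
 next
  case (8 f y)
  then show ?case using unique(1)[OF range] by simp
 next
  case (9 f y)
  then show ?case using unique(2)[OF range] by simp
 next
  case (10 \<beta> f)
  then show ?case using stam(1)[of \<beta>] by simp
 next
  case (11 \<beta>)
  then show ?case using stam(2)[of \<beta>] by simp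
 next
  case (12 \<beta>)
  then show ?case using stam(3)[of \<beta>] by simp
 next
  case (13 \<beta> y)
  then show ?case using stam(4)[of \<beta>] by simp
 next
  case (14 \<beta> y)
  then show ?case using stam(4)[of \<beta>] by simp
 next
  case (15 \<beta> f)
  then show ?case using stam(5)[of \<beta>] by simp
 qed
qed

end
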